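(* Fix $n\in\mathbb N$. Let $\mathfrak M$ be a countable model of $\mathrm{I}\Sigma_n+\exp$ and $(I_k:k\in\mathbb N)$ a countable family of cuts of $\mathfrak M$. Then there exists a model $\mathfrak N$ of $\mathrm{I}\Sigma_n+\exp+\Sigma_{n+1}\text{-}\mathrm{WPHP}$ which is a $\Sigma_{n+1}$-elementary cofinal extension of $\mathfrak M$ such that for all $k\in\mathbb N$, $\sup_{\mathfrak N} I_k=\inf_{\mathfrak N}(M-I_k)$. Hence $\mathrm{I}\Sigma_n+\exp+\Sigma_{n+1}\text{-}\mathrm{WPHP}\nvdash\mathrm{B}\Sigma_{n+1}$.
   Context: Language of first-order arithmetic $0,1,+,\times,<$. $\exp$ is a $\Pi_2$ sentence asserting totality of $x\mapsto 2^x$; $\mathrm{I}\Sigma_n$ is induction for $\Sigma_n$ formulas (with parameters); $\mathrm{B}\Sigma_{n+1}$ is the collection scheme $\forall u(\forall w<u\exists x\,\psi\to\exists v\forall w<u\exists x<v\,\psi)$ for $\Sigma_{n+1}$ formulas $\psi$ with parameters. Numbers $x$ are identified with $\{v:v<x\}$. $\Sigma_{n+1}\text{-}\mathrm{WPHP}$: for no $x\ge1$ is there an injection from $2x$ into $x$ whose graph is $\Sigma_{n+1}$-definable with parameters. A cut of $\mathfrak M$ is a nonempty initial segment of $M$ closed under successor. $\mathfrak N$ is a cofinal extension of $\mathfrak M$ if $\mathfrak M\subseteq\mathfrak N$ and every element of $N$ is below some element of $M$; $\Sigma_{n+1}$-elementary means $\Sigma_{n+1}$ formulas with parameters from $M$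 have the same truth values in both. For $X\subseteq N$: $\sup_{\mathfrak N}X=\{x\in N:\exists y\in X\,(x\le y)\}$ and $\inf_{\mathfrak N}X=\{x\in N:\forall y\in X\,(x<y)\}$. *)

theory Defs
  imports "HOL-Library.Countable_Set"
begin

datatype trm = V nat | Zr | On | Pl trm trm | Ml trm trm

datatype fm =
    Eqf trm trm | Ltf trm trm | Nt fm | Cj fm fm | Dj fm fm
  | Ex nat fm | Al nat fm | BEx nat trm fm | BAl nat trm fm

record 'a arith_struct =
  carr :: "'a set"
  zr :: 'a
  un :: 'a
  ad :: "'a \<Rightarrow> 'a \<Rightarrow> 'a"
  mu :: "'a \<Rightarrow> 'a \<Rightarrow> 'a"
  ls :: "'a \<Rightarrow> 'a \<Rightarrow> bool"

primrec tval :: "'a arith_struct \<Rightarrow> (nat \<Rightarrow> 'a) \<Rightarrow> trm \<Rightarrow> 'a" where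
  "tval M e (V x) = e x"
| "tval M e Zr = zr M"
| "tval M e On = un M"
| "tval M e (Pl s t) = ad M (tval M e s) (tval M e t)"
| "tval M e (Ml s t) = mu M (tval M e s) (tval M e t)"

primrec sat :: "'a arith_struct \<Rightarrow> (nat \<Rightarrow> 'a) \<Rightarrow> fm \<Rightarrow> bool" where
  "sat M e (Eqf s t) = (tval M e s = tval M e t)"
| "sat M e (Ltf s t) = ls M (tval M e s) (tval M e t)"
| "sat M e (Nt p) = (\<not> sat M e p)"
| "sat M e (Cj p q) = (sat M e p \<and> sat M e q)"
| "sat M e (Dj p q) = (sat M e p \<or> sat M e q)"
| "sat M e (Ex x p) = (\<exists>a\<in>carr M. sat M (e(x := a)) p)"
| "sat M e (Al x p) = (\<forall>a\<in>carr M. sat M (e(x := a)) p)"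
| "sat M e (BEx x t p) = (\<exists>a\<in>carr M. ls M a (tval M e t) \<and> sat M (e(x := a)) p)"
| "sat M e (BAl x t p) = (\<forall>a\<in>carr M. ls M a (tval M e t) \<longrightarrow> sat M (e(x := a)) p)"

definition env_in :: "'a arith_struct \<Rightarrow> (nat \<Rightarrow> 'a) \<Rightarrow> bool" where
  "env_in M e \<longleftrightarrow> (\<forall>v. e v \<in> carr M)"

inductive delta0 :: "fm \<Rightarrow> bool" where
  "delta0 (Eqf s t)"
| "delta0 (Ltf s t)"
| "delta0 p \<Longrightarrow> delta0 (Nt p)"
| "delta0 p \<Longrightarrow> delta0 q \<Longrightarrow> delta0 (Cj p q)"
| "delta0 p \<Longrightarrow> delta0 q \<Longrightarrow> delta0 (Dj p q)"
| "delta0 p \<Longrightarrow> delta0 (BEx x t p)"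
| "delta0 p \<Longrightarrow> delta0 (BAl x t p)"

inductive sigma :: "nat \<Rightarrow> fm \<Rightarrow> bool" and pi :: "nat \<Rightarrow> fm \<Rightarrow> bool" where
  "delta0 p \<Longrightarrow> sigma n p"
| "delta0 p \<Longrightarrow> pi n p"
| "pi n p \<Longrightarrow> sigma (Suc n) p"
| "sigma (Suc n) p \<Longrightarrow> sigma (Suc n) (Ex x p)"
| "sigma n p \<Longrightarrow> pi (Suc n) p"
| "pi (Suc n) p \<Longrightarrow> pi (Suc n) (Al x p)"

text \<open>PA^- (Kaye): the axioms of the nonnegative parts of discretely ordered rings.\<close>
definition PAminus :: "'a arith_struct \<Rightarrow> bool" where
  "PAminus M \<longleftrightarrow>
     zr M \<in> carr M \<and> un M \<in> carr M \<and>
     (\<forall>x\<in>carr M. \<forall>y\<in>carr M. ad M x y \<in> carr M \<and> mu M x y \<in> carr M) \<and>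
     (\<forall>x\<in>carr M. \<forall>y\<in>carr M. \<forall>z\<in>carr M.
        ad M (ad M x y) z = ad M x (ad M y z) \<and> ad M x y = ad M y x \<and>
        mu M (mu M x y) z = mu M x (mu M y z) \<and> mu M x y = mu M y x \<and>
        mu M x (ad M y z) = ad M (mu M x y) (mu M x z) \<and>
        ad M x (zr M) = x \<and> mu M x (zr M) = zr M \<and> mu M x (un M) = x \<and>
        \<not> ls M x x \<and> (ls M x y \<and> ls M y z \<longrightarrow> ls M x z) \<and>
        (ls M x y \<or> x = y \<or> ls M y x) \<and>
        (ls M x y \<longrightarrow> ls M (ad M x z) (ad M y z)) \<and>
        (ls M (zr M) z \<and> ls M x y \<longrightarrow> ls M (mu M x z) (mu M y z)) \<and>
        (ls M x y \<longrightarrow> (\<exists>w\<in>carr M. ad M x w = y)) \<and>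
        ls M (zr M) (un M) \<and>
        (ls M (zr M) x \<longrightarrow> ls M (un M) x \<or> un M = x) \<and>
        (ls M (zr M) x \<or> zr M = x))"

definition ISigma :: "nat \<Rightarrow> 'a arith_struct \<Rightarrow> bool" where
  "ISigma n M \<longleftrightarrow> PAminus M \<and>
     (\<forall>p x e. sigma n p \<longrightarrow> env_in M e \<longrightarrow>
        sat M (e(x := zr M)) p \<longrightarrow>
        (\<forall>a\<in>carr M. sat M (e(x := a)) p \<longrightarrow> sat M (e(x := ad M a (un M))) p) \<longrightarrow>
        (\<forall>a\<in>carr M. sat M (e(x := a)) p))"

definition BSigma :: "nat \<Rightarrow> 'a arith_struct \<Rightarrow> bool" where
  "BSigma k M \<longleftrightarrow>
     (\<forall>p w x e. sigma k p \<longrightarrow> w \<noteq> x \<longrightarrow> env_in M e \<longrightarrow>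
        (\<forall>u\<in>carr M.
          (\<forall>b\<in>carr M. ls M b u \<longrightarrow> (\<exists>c\<in>carr M. sat M (e(w := b, x := c)) p)) \<longrightarrow>
          (\<exists>v\<in>carr M. \<forall>b\<in>carr M. ls M b u \<longrightarrow>
              (\<exists>c\<in>carr M. ls M c v \<and> sat M (e(w := b, x := c)) p))))"

text \<open>The sentence exp: forall x exists y (y = 2^x), where y = 2^x is expressed
  by the existence of a Goedel beta-function code (c,d) of the sequence
  2^0,...,2^x, i.e. beta(c,d,0)=1, beta(c,d,i+1) = 2 beta(c,d,i) for i<x,
  beta(c,d,x) = y, with beta(c,d,i) = c mod (1+(i+1)d).
  Variables: x=0, y=1, c=2, d=3, i=4, q=5, r=6.\<close>
definition bmod :: "trm \<Rightarrow> trm" where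
  "bmod i = Pl On (Ml (Pl i On) (V 3))"

definition rem_is :: "trm \<Rightarrow> trm \<Rightarrow> fm" where
  "rem_is m r = BEx 5 (Pl (V 2) On) (Cj (Eqf (V 2) (Pl (Ml (V 5) m) r)) (Ltf r m))"

definition exp_matrix :: fm where
  "exp_matrix =
     Cj (rem_is (bmod Zr) On)
       (Cj (BAl 4 (V 0) (BEx 6 (Pl (V 2) On)
              (Cj (rem_is (bmod (V 4)) (V 6)) (rem_is (bmod (Pl (V 4) On)) (Pl (V 6) (V 6))))))
           (rem_is (bmod (V 0)) (V 1)))"

definition exp_sentence :: fm where
  "exp_sentence = Al 0 (Ex 1 (Ex 2 (Ex 3 exp_matrix)))"

definition Exp :: "'a arith_struct \<Rightarrow> bool" where
  "Exp M \<longleftrightarrow> (\<forall>e. env_in M e \<longrightarrow> sat M e exp_sentence)"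

definition WPHP :: "nat \<Rightarrow> 'a arith_struct \<Rightarrow> bool" where
  "WPHP k M \<longleftrightarrow>
     (\<forall>p u v e x. sigma k p \<longrightarrow> u \<noteq> v \<longrightarrow> env_in M e \<longrightarrow> x \<in> carr M \<longrightarrow>
        \<not> ls M x (un M) \<longrightarrow>
        (let G = (\<lambda>a b. ls M a (ad M x x) \<and> ls M b x \<and> sat M (e(u := a, v := b)) p) in
         \<not> ((\<forall>a\<in>carr M. ls M a (ad M x x) \<longrightarrow> (\<exists>!b. b \<in> carr M \<and> G a b)) \<and>
            (\<forall>a\<in>carr M. \<forall>a'\<in>carr M. \<forall>b\<in>carr M. G a b \<and> G a' b \<longrightarrow> a = a'))))"

definition is_cut :: "'a arith_struct \<Rightarrow> 'a set \<Rightarrow> bool" where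
  "is_cut M I \<longleftrightarrow> I \<subseteq> carr M \<and> I \<noteq> {} \<and>
     (\<forall>a\<in>I. \<forall>b\<in>carr M. ls M b a \<longrightarrow> b \<in> I) \<and>
     (\<forall>a\<in>I. ad M a (un M) \<in> I)"

definition embedding :: "'a arith_struct \<Rightarrow> 'b arith_struct \<Rightarrow> ('a \<Rightarrow> 'b) \<Rightarrow> bool" where
  "embedding M N h \<longleftrightarrow> h ` carr M \<subseteq> carr N \<and> inj_on h (carr M) \<and>
     h (zr M) = zr N \<and> h (un M) = un N \<and>
     (\<forall>x\<in>carr M. \<forall>y\<in>carr M. h (ad M x y) = ad N (h x) (h y) \<and>
        h (mu M x y) = mu N (h x) (h y) \<and> (ls M x y \<longleftrightarrow> ls N (h x) (h y)))"

definition sigma_elementary :: "nat \<Rightarrow> 'a arith_struct \<Rightarrow> 'b arith_struct \<Rightarrow> ('a \<Rightarrow> 'b) \<Rightarrow> bool" where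
  "sigma_elementary k M N h \<longleftrightarrow> embedding M N h \<and>
     (\<forall>p e. sigma k p \<longrightarrow> env_in M e \<longrightarrow> (sat M e p \<longleftrightarrow> sat N (h \<circ> e) p))"

definition cofinal :: "'a arith_struct \<Rightarrow> 'b arith_struct \<Rightarrow> ('a \<Rightarrow> 'b) \<Rightarrow> bool" where
  "cofinal M N h \<longleftrightarrow> (\<forall>y\<in>carr N. \<exists>x\<in>carr M. ls N y (h x) \<or> y = h x)"

definition supN :: "'b arith_struct \<Rightarrow> ('a \<Rightarrow> 'b) \<Rightarrow> 'a set \<Rightarrow> 'b set" where
  "supN N h X = {x\<in>carr N. \<exists>y\<in>X. ls N x (h y) \<or> x = h y}"

definition infN :: "'b arith_struct \<Rightarrow> ('a \<Rightarrow> 'b) \<Rightarrow> 'a set \<Rightarrow> 'b set" where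
  "infN N h X = {x\<in>carr N. \<forall>y\<in>X. ls N x (h y)}"

end

theory Submission
  imports Defs "HOL-Library.Countable" "HOL-Library.Nat_Bijection" "HOL-Number_Theory.Cong"
begin

text \<open>Extensions are ultrapowers of a countable model restricted to definable functions. For one potential
  injection from \<open>2x\<close> into \<open>x\<close>, the index set is the interval \<open>2x\<close> and the functions have bounded graphs;
  the ultrafilter avoids every definable set on which the injection could be followed (such a set has at
  most \<open>x\<close> elements), so the class of the identity has no image. Given a function and a cut, repeated
  halving of intervals around the cut yields a set of small density off which the function stays away from
  the cut, and so no new element fills a given cut. Iterating along \<open>\<omega>\<close> kills all injections.

  For the failure of collection the starting point is the ultrapower of the standard model over the index
  set \<open>\<nat>\<close>, restricted to functions with \<open>\<Sigma>\<^sub>n\<^sub>+\<^sub>1\<close> graph. A diagonal construction against an enumeration of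
  these functions gives a proper cut such that both the cut and its complement are \<open>\<Sigma>\<^sub>n\<^sub>+\<^sub>1\<close> definable. Since
  the extension does not fill the cut, both definitions survive, and collection would turn the cut into a
  \<open>\<Pi>\<^sub>n\<close> definable one, contradicting induction.\<close>

section \<open>Renaming and substitution\<close>

text \<open>Two facts decide which functions to use. In I Sigma_n with exp, the part of a Sigma_n or
  Pi_n set below a given number is coded by a number; hence on a bounded index set functions with
  bounded graphs already supply least witnesses, and Los holds up to level n. One level higher only
  half of it survives: a Sigma_{n+1} statement true of classes is true at all indices of some
  definable set in the ultrafilter. This half suffices, because an image of the identity would be
  the class of some \<open>g\<close> following the injection on such a set. The constants leave room
  for this: half of the \<open>2x\<close> indices are reserved for the excluded sets, and the l-th
  pair of a function and a cut receives density 2^-(l+2), so that finitely many pairs use up less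
  than the other half. Cuts of the standard model are never proper, so failure of collection needs a
  nonstandard model first. That model is not cofinal over the standard one, hence exp must be
  verified there separately. Its cut starts from the interval [0, 2^i) at index i, as avoiding i
  functions costs at most i halvings. Both of its definitions can fail to be monotone in the
  extension; passing to their closures repairs this.\<close>

instance trm :: countable by countable_datatype
instance fm :: countable by countable_datatype

primrec rnt :: "(nat \<Rightarrow> nat) \<Rightarrow> trm \<Rightarrow> trm" where
  "rnt f (V x) = V (f x)"
| "rnt f Zr = Zr"
| "rnt f On = On"
| "rnt f (Pl s t) = Pl (rnt f s) (rnt f t)"
| "rnt f (Ml s t) = Ml (rnt f s) (rnt f t)"

primrec rn :: "(nat \<Rightarrow> nat) \<Rightarrow> fm \<Rightarrow> fm" where
  "rn f (Eqf s t) = Eqf (rnt f s) (rnt f t)"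
| "rn f (Ltf s t) = Ltf (rnt f s) (rnt f t)"
| "rn f (Nt p) = Nt (rn f p)"
| "rn f (Cj p q) = Cj (rn f p) (rn f q)"
| "rn f (Dj p q) = Dj (rn f p) (rn f q)"
| "rn f (Ex x p) = Ex (f x) (rn f p)"
| "rn f (Al x p) = Al (f x) (rn f p)"
| "rn f (BEx x t p) = BEx (f x) (rnt f t) (rn f p)"
| "rn f (BAl x t p) = BAl (f x) (rnt f t) (rn f p)"

lemma tval_rnt: "tval M e (rnt f t) = tval M (\<lambda>v. e (f v)) t"
  by (induction t) auto

lemma sat_rn:
  assumes "inj f" shows "sat M e (rn f p) = sat M (\<lambda>v. e (f v)) p"
proof -
  have upd: "(\<lambda>v. (e(f x := a)) (f v)) = (\<lambda>v. e (f v))(x := a)" for e :: "nat \<Rightarrow> 'a" and x a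
    using assms by (auto simp: fun_eq_iff inj_eq)
  show ?thesis
    by (induction p arbitrary: e) (simp_all only: rn.simps sat.simps tval_rnt upd)
qed

lemma delta0_rn: "delta0 p \<Longrightarrow> delta0 (rn f p)"
  by (induction rule: delta0.induct) (auto intro: delta0.intros)

lemma sigma_pi_rn: "(sigma k p \<longrightarrow> sigma k (rn f p))" "(pi k p \<longrightarrow> pi k (rn f p))"
proof -
  have "(sigma k p \<longrightarrow> sigma k (rn f p)) \<and> (pi k p \<longrightarrow> pi k (rn f p))" for k p
  proof -
    have "(sigma k1 p1 \<longrightarrow> sigma k1 (rn f p1)) \<and> (pi k2 p2 \<longrightarrow> pi k2 (rn f p2))" for k1 k2 p1 p2
      using sigma_pi.induct[of "\<lambda>k p. sigma k (rn f p)" "\<lambda>k p. pi k (rn f p)" k1 p1 k2 p2]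
      by (auto intro: sigma_pi.intros delta0_rn)
    then show ?thesis by blast
  qed
  then show "(sigma k p \<longrightarrow> sigma k (rn f p))" "(pi k p \<longrightarrow> pi k (rn f p))" by blast+
qed

primrec tbound :: "trm \<Rightarrow> nat" where
  "tbound (V x) = Suc x"
| "tbound Zr = 0"
| "tbound On = 0"
| "tbound (Pl s t) = max (tbound s) (tbound t)"
| "tbound (Ml s t) = max (tbound s) (tbound t)"

text \<open>Quantified variables are counted as well, so a variable at or above this bound is
  neither free nor bound in the formula.\<close>

primrec fbound :: "fm \<Rightarrow> nat" where
  "fbound (Eqf s t) = max (tbound s) (tbound t)"
| "fbound (Ltf s t) = max (tbound s) (tbound t)"
| "fbound (Nt p) = fbound p"
| "fbound (Cj p q) = max (fbound p) (fbound q)"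
| "fbound (Dj p q) = max (fbound p) (fbound q)"
| "fbound (Ex x p) = max (Suc x) (fbound p)"
| "fbound (Al x p) = max (Suc x) (fbound p)"
| "fbound (BEx x t p) = max (max (Suc x) (tbound t)) (fbound p)"
| "fbound (BAl x t p) = max (max (Suc x) (tbound t)) (fbound p)"

lemma tval_cong: "(\<And>v. v < tbound t \<Longrightarrow> e v = e' v) \<Longrightarrow> tval M e t = tval M e' t"
  by (induction t) auto

lemma sat_cong: "(\<And>v. v < fbound p \<Longrightarrow> e v = e' v) \<Longrightarrow> sat M e p = sat M e' p"
proof (induction p arbitrary: e e')
  case (Eqf s t) then show ?case using tval_cong[of s e e' M] tval_cong[of t e e' M] by simp
next
  case (Ltf s t) then show ?case using tval_cong[of s e e' M] tval_cong[of t e e' M] by simp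
next
  case (Nt p) then show ?case by (metis fbound.simps(3) sat.simps(3))
next
  case (Cj p q)
  have "sat M e p = sat M e' p" "sat M e q = sat M e' q"
    by (rule Cj.IH, simp add: Cj.prems)+
  then show ?case by simp
next
  case (Dj p q)
  have "sat M e p = sat M e' p" "sat M e q = sat M e' q"
    by (rule Dj.IH, simp add: Dj.prems)+
  then show ?case by simp
next
  case (Ex x p)
  have "sat M (e(x := a)) p = sat M (e'(x := a)) p" for a
    by (rule Ex.IH) (simp add: Ex.prems)
  then show ?case by simp
next
  case (Al x p)
  have "sat M (e(x := a)) p = sat M (e'(x := a)) p" for a
    by (rule Al.IH) (simp add: Al.prems)
  then show ?case by simp
next
  case (BEx x t p)
  have "sat M (e(x := a)) p = sat M (e'(x := a)) p" for a
    by (rule BEx.IH) (simp add: BEx.prems)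
  moreover have "tval M e t = tval M e' t" by (rule tval_cong) (simp add: BEx.prems)
  ultimately show ?case by simp
next
  case (BAl x t p)
  have "sat M (e(x := a)) p = sat M (e'(x := a)) p" for a
    by (rule BAl.IH) (simp add: BAl.prems)
  moreover have "tval M e t = tval M e' t" by (rule tval_cong) (simp add: BAl.prems)
  ultimately show ?case by simp
qed

primrec subt :: "nat \<Rightarrow> nat \<Rightarrow> trm \<Rightarrow> trm" where
  "subt v w (V x) = V (if x = v then w else x)"
| "subt v w Zr = Zr"
| "subt v w On = On"
| "subt v w (Pl s t) = Pl (subt v w s) (subt v w t)"
| "subt v w (Ml s t) = Ml (subt v w s) (subt v w t)"

primrec sub :: "nat \<Rightarrow> nat \<Rightarrow> fm \<Rightarrow> fm" where
  "sub v w (Eqf s t) = Eqf (subt v w s) (subt v w t)"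
| "sub v w (Ltf s t) = Ltf (subt v w s) (subt v w t)"
| "sub v w (Nt p) = Nt (sub v w p)"
| "sub v w (Cj p q) = Cj (sub v w p) (sub v w q)"
| "sub v w (Dj p q) = Dj (sub v w p) (sub v w q)"
| "sub v w (Ex x p) = Ex x (if x = v then p else sub v w p)"
| "sub v w (Al x p) = Al x (if x = v then p else sub v w p)"
| "sub v w (BEx x t p) = BEx x (subt v w t) (if x = v then p else sub v w p)"
| "sub v w (BAl x t p) = BAl x (subt v w t) (if x = v then p else sub v w p)"

lemma tval_subt: "tval M e (subt v w t) = tval M (e(v := e w)) t"
  by (induction t) auto

text \<open>All bound variables of \<open>p\<close> lie below \<open>w\<close>, so no quantifier
  captures the inserted variable; a binder of \<open>v\<close> itself stops the
  substitution.\<close>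

lemma sat_sub: "fbound p \<le> w \<Longrightarrow> sat M e (sub v w p) = sat M (e(v := e w)) p"
proof (induction p arbitrary: e)
  case (Ex x p)
  have w: "w \<noteq> x" "fbound p \<le> w" using Ex.prems by auto
  have "sat M (e(x := a)) (sub v w p) = sat M ((e(v := e w))(x := a)) p" if "x \<noteq> v" for a
    using Ex.IH[OF w(2), of "e(x := a)"] w(1) that by (simp add: fun_upd_twist fun_upd_other del: fun_upd_apply)
  then show ?case by (cases "x = v") (simp_all del: fun_upd_apply)
next
  case (Al x p)
  have w: "w \<noteq> x" "fbound p \<le> w" using Al.prems by auto
  have "sat M (e(x := a)) (sub v w p) = sat M ((e(v := e w))(x := a)) p" if "x \<noteq> v" for a
    using Al.IH[OF w(2), of "e(x := a)"] w(1) that by (simp add: fun_upd_twist fun_upd_other del: fun_upd_apply)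
  then show ?case by (cases "x = v") (simp_all del: fun_upd_apply)
next
  case (BEx x t p)
  have w: "w \<noteq> x" "fbound p \<le> w" using BEx.prems by auto
  have "sat M (e(x := a)) (sub v w p) = sat M ((e(v := e w))(x := a)) p" if "x \<noteq> v" for a
    using BEx.IH[OF w(2), of "e(x := a)"] w(1) that by (simp add: fun_upd_twist fun_upd_other del: fun_upd_apply)
  then show ?case by (cases "x = v") (simp_all add: tval_subt del: fun_upd_apply)
next
  case (BAl x t p)
  have w: "w \<noteq> x" "fbound p \<le> w" using BAl.prems by auto
  have "sat M (e(x := a)) (sub v w p) = sat M ((e(v := e w))(x := a)) p" if "x \<noteq> v" for a
    using BAl.IH[OF w(2), of "e(x := a)"] w(1) that by (simp add: fun_upd_twist fun_upd_other del: fun_upd_apply)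
  then show ?case by (cases "x = v") (simp_all add: tval_subt del: fun_upd_apply)
qed (auto simp: tval_subt)

lemma delta0_sub: "delta0 p \<Longrightarrow> delta0 (sub v w p)"
  by (induction rule: delta0.induct) (auto intro: delta0.intros)

lemma sigma_pi_sub: "(sigma k p \<longrightarrow> sigma k (sub v w p))" "(pi k p \<longrightarrow> pi k (sub v w p))"
proof -
  have "(sigma k1 p1 \<longrightarrow> sigma k1 (sub v w p1)) \<and> (pi k2 p2 \<longrightarrow> pi k2 (sub v w p2))" for k1 k2 p1 p2
    by (rule sigma_pi.induct[of "\<lambda>k p. sigma k (sub v w p)" "\<lambda>k p. pi k (sub v w p)" k1 p1 k2 p2])
      (auto intro: sigma_pi.intros delta0_sub)
  then show "(sigma k p \<longrightarrow> sigma k (sub v w p))" "(pi k p \<longrightarrow> pi k (sub v w p))" by blast+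
qed

section \<open>Prenex classes: monotonicity and conjunction with a bounded formula\<close>

primrec bvbound :: "fm \<Rightarrow> nat" where
  "bvbound (Eqf s t) = 0"
| "bvbound (Ltf s t) = 0"
| "bvbound (Nt p) = bvbound p"
| "bvbound (Cj p q) = max (bvbound p) (bvbound q)"
| "bvbound (Dj p q) = max (bvbound p) (bvbound q)"
| "bvbound (Ex x p) = max (Suc x) (bvbound p)"
| "bvbound (Al x p) = max (Suc x) (bvbound p)"
| "bvbound (BEx x t p) = max (Suc x) (bvbound p)"
| "bvbound (BAl x t p) = max (Suc x) (bvbound p)"

lemma bvbound_sub: "bvbound (sub v w p) = bvbound p"
  by (induction p) auto

lemma bvbound_le: "bvbound p \<le> fbound p"
  by (induction p) auto

lemma sigma_mono: "(sigma k p \<longrightarrow> sigma (Suc k) p)" "(pi k p \<longrightarrow> pi (Suc k) p)"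
proof -
  have "(sigma k1 p1 \<longrightarrow> sigma (Suc k1) p1) \<and> (pi k2 p2 \<longrightarrow> pi (Suc k2) p2)" for k1 k2 p1 p2
    using sigma_pi.induct[of "\<lambda>k p. sigma (Suc k) p" "\<lambda>k p. pi (Suc k) p" k1 p1 k2 p2]
    by (auto intro: sigma_pi.intros)
  then show "(sigma k p \<longrightarrow> sigma (Suc k) p)" "(pi k p \<longrightarrow> pi (Suc k) p)" by blast+
qed

lemma sigma_le: "sigma k p \<Longrightarrow> k \<le> m \<Longrightarrow> sigma m p" and pi_le: "pi k p \<Longrightarrow> k \<le> m \<Longrightarrow> pi m p"
proof -
  show "sigma k p \<Longrightarrow> k \<le> m \<Longrightarrow> sigma m p"
    by (rotate_tac 1, induction rule: dec_induct) (use sigma_mono in blast)+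
  show "pi k p \<Longrightarrow> k \<le> m \<Longrightarrow> pi m p"
    by (rotate_tac 1, induction rule: dec_induct) (use sigma_mono in blast)+
qed

text \<open>Conjoining a bounded formula whose variables are all fresh stays within the syntactic
  prenex class: it can be pushed through the quantifier prefix.\<close>

lemma sigma_pi_conj:
  assumes d: "delta0 d" and fresh: "\<And>(M :: 'a arith_struct) e e'. (\<And>v. m \<le> v \<Longrightarrow> e v = e' v) \<Longrightarrow> sat M e d = sat M e' d"
  shows "sigma k p \<longrightarrow> bvbound p \<le> m \<longrightarrow>
           (\<exists>q. sigma k q \<and> (\<forall>(M :: 'a arith_struct) e. carr M \<noteq> {} \<longrightarrow> sat M e q = (sat M e p \<and> sat M e d)))"
    and "pi k p \<longrightarrow> bvbound p \<le> m \<longrightarrow>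
           (\<exists>q. pi k q \<and> (\<forall>(M :: 'a arith_struct) e. carr M \<noteq> {} \<longrightarrow> sat M e q = (sat M e p \<and> sat M e d)))"
proof -
  let ?S = "\<lambda>k p. bvbound p \<le> m \<longrightarrow> (\<exists>q. sigma k q \<and> (\<forall>(M :: 'a arith_struct) e. carr M \<noteq> {} \<longrightarrow> sat M e q = (sat M e p \<and> sat M e d)))"
  let ?P = "\<lambda>k p. bvbound p \<le> m \<longrightarrow> (\<exists>q. pi k q \<and> (\<forall>(M :: 'a arith_struct) e. carr M \<noteq> {} \<longrightarrow> sat M e q = (sat M e p \<and> sat M e d)))"
  have upd: "sat M (e(x := a)) d = sat M e d" if "x < m" for M :: "'a arith_struct" and e x a
    by (rule fresh) (use that in auto)
  have dd: "delta0 p \<Longrightarrow> delta0 (Cj p d)" for p using d by (blast intro: delta0.intros)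
  have "(sigma k1 p1 \<longrightarrow> ?S k1 p1) \<and> (pi k2 p2 \<longrightarrow> ?P k2 p2)" for k1 k2 p1 p2
  proof (rule sigma_pi.induct[of ?S ?P])
    fix p n assume "delta0 p"
    then show "?S n p" using dd[of p] by (intro impI exI[of _ "Cj p d"]) (auto intro: sigma_pi.intros)
  next
    fix p n assume "delta0 p"
    then show "?P n p" using dd[of p] by (intro impI exI[of _ "Cj p d"]) (auto intro: sigma_pi.intros)
  next
    fix n p assume "?P n p" then show "?S (Suc n) p" by (meson sigma_pi.intros)
  next
    fix n p assume "?S n p" then show "?P (Suc n) p" by (meson sigma_pi.intros)
  next
    fix n p x assume IH: "?S (Suc n) p"
    show "?S (Suc n) (Ex x p)"
    proof
      assume b: "bvbound (Ex x p) \<le> m"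
      then obtain q where "sigma (Suc n) q" "\<forall>(M :: 'a arith_struct) e. carr M \<noteq> {} \<longrightarrow> sat M e q = (sat M e p \<and> sat M e d)"
        using IH by auto
      then show "\<exists>q. sigma (Suc n) q \<and> (\<forall>(M :: 'a arith_struct) e. carr M \<noteq> {} \<longrightarrow> sat M e q = (sat M e (Ex x p) \<and> sat M e d))"
        using b by (intro exI[of _ "Ex x q"]) (auto intro: sigma_pi.intros simp: upd)
    qed
  next
    fix n p x assume IH: "?P (Suc n) p"
    show "?P (Suc n) (Al x p)"
    proof
      assume b: "bvbound (Al x p) \<le> m"
      then obtain q where "pi (Suc n) q" "\<forall>(M :: 'a arith_struct) e. carr M \<noteq> {} \<longrightarrow> sat M e q = (sat M e p \<and> sat M e d)"
        using IH by auto
      then show "\<exists>q. pi (Suc n) q \<and> (\<forall>(M :: 'a arith_struct) e. carr M \<noteq> {} \<longrightarrow> sat M e q = (sat M e (Al x p) \<and> sat M e d))"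
        using b by (intro exI[of _ "Al x q"]) (auto intro: sigma_pi.intros simp: upd)
    qed
  qed
  then show "sigma k p \<longrightarrow> ?S k p" and "pi k p \<longrightarrow> ?P k p" by blast+
qed

text \<open>Renaming \<open>v\<close> to the fresh \<open>w\<close> leaves \<open>d\<close> with
  fresh variables only, so it can be pushed through the prefix before \<open>w\<close> is
  quantified. This expresses, by one formula of the class, that a value subject to a side condition
  satisfies \<open>p\<close>.\<close>

lemma sigma_ex_conj:
  assumes p: "sigma (Suc k) p" and d: "delta0 d"
    and vars: "\<And>(M :: 'a arith_struct) e e'. e z = e' z \<Longrightarrow> e w = e' w \<Longrightarrow> sat M e d = sat M e' d"
    and fresh: "fbound p \<le> z" "fbound p \<le> w" "v \<noteq> w"
  shows "\<exists>q. sigma (Suc k) q \<and> (\<forall>(M :: 'a arith_struct) e. carr M \<noteq> {} \<longrightarrow>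
           sat M e q = (\<exists>b\<in>carr M. sat M (e(w := b)) d \<and> sat M (e(v := b)) p))"
proof -
  have s: "sigma (Suc k) (sub v w p)" using sigma_pi_sub(1) p by blast
  have fr: "sat M e d = sat M e' d" if "\<And>x. fbound p \<le> x \<Longrightarrow> e x = e' x" for M :: "'a arith_struct" and e e'
    by (rule vars) (use that fresh in auto)
  obtain q where q: "sigma (Suc k) q"
    "\<And>(M :: 'a arith_struct) e. carr M \<noteq> {} \<Longrightarrow> sat M e q = (sat M e (sub v w p) \<and> sat M e d)"
    using sigma_pi_conj(1)[of d "fbound p" "Suc k" "sub v w p", OF d fr] s
    by (auto simp: bvbound_sub bvbound_le)
  have "sat M (e(w := b)) (sub v w p) = sat M (e(v := b)) p" for M :: "'a arith_struct" and e b
    unfolding sat_sub[OF fresh(2)] by (rule sat_cong) (use fresh in auto)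
  then show ?thesis using q by (intro exI[of _ "Ex w q"]) (auto intro: sigma_pi.intros)
qed

section \<open>Semantic classes of predicates\<close>

definition mix :: "(nat \<Rightarrow> 'a) \<Rightarrow> (nat \<Rightarrow> 'a) \<Rightarrow> nat \<Rightarrow> 'a" where
  "mix e c v = (if even v then e (v div 2) else c (v div 2))"

text \<open>Semantic counterparts, with parameters, of terms and of bounded, \<open>\<Sigma>\<^sub>k\<close> and \<open>\<Pi>\<^sub>k\<close> formulas. Quantifiers
  bind position \<open>0\<close> of the environment, as with de Bruijn indices.\<close>

inductive TT :: "'a arith_struct \<Rightarrow> ((nat \<Rightarrow> 'a) \<Rightarrow> 'a) \<Rightarrow> bool" for M where
  TT_var: "TT M (\<lambda>e. e v)"
| TT_const: "TT M (\<lambda>e. c)"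
| TT_ad: "TT M s \<Longrightarrow> TT M t \<Longrightarrow> TT M (\<lambda>e. ad M (s e) (t e))"
| TT_mu: "TT M s \<Longrightarrow> TT M t \<Longrightarrow> TT M (\<lambda>e. mu M (s e) (t e))"

inductive DD :: "'a arith_struct \<Rightarrow> ((nat \<Rightarrow> 'a) \<Rightarrow> bool) \<Rightarrow> bool" for M where
  DD_eq: "TT M s \<Longrightarrow> TT M t \<Longrightarrow> DD M (\<lambda>e. s e = t e)"
| DD_ls: "TT M s \<Longrightarrow> TT M t \<Longrightarrow> DD M (\<lambda>e. ls M (s e) (t e))"
| DD_not: "DD M R \<Longrightarrow> DD M (\<lambda>e. \<not> R e)"
| DD_conj: "DD M R \<Longrightarrow> DD M S \<Longrightarrow> DD M (\<lambda>e. R e \<and> S e)"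
| DD_bex: "TT M t \<Longrightarrow> DD M R \<Longrightarrow> DD M (\<lambda>e. \<exists>a. ls M a (t e) \<and> R (case_nat a e))"

inductive SG :: "'a arith_struct \<Rightarrow> nat \<Rightarrow> ((nat \<Rightarrow> 'a) \<Rightarrow> bool) \<Rightarrow> bool"
  and PG :: "'a arith_struct \<Rightarrow> nat \<Rightarrow> ((nat \<Rightarrow> 'a) \<Rightarrow> bool) \<Rightarrow> bool" for M where
  SG_DD: "DD M R \<Longrightarrow> SG M k R"
| PG_DD: "DD M R \<Longrightarrow> PG M k R"
| SG_PG: "PG M k R \<Longrightarrow> SG M (Suc k) R"
| SG_ex: "SG M (Suc k) R \<Longrightarrow> SG M (Suc k) (\<lambda>e. \<exists>a. R (case_nat a e))"
| PG_SG: "SG M k R \<Longrightarrow> PG M (Suc k) R"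
| PG_all: "PG M (Suc k) R \<Longrightarrow> PG M (Suc k) (\<lambda>e. \<forall>a. R (case_nat a e))"

text \<open>Bridging: every semantic class consists of the predicates defined by formulas of the
  corresponding syntactic class, with the free variables at even and parameters at odd places.\<close>

definition repr :: "'a arith_struct \<Rightarrow> (fm \<Rightarrow> bool) \<Rightarrow> ((nat \<Rightarrow> 'a) \<Rightarrow> bool) \<Rightarrow> bool" where
  "repr M C R \<longleftrightarrow> (\<exists>p c. C p \<and> (\<forall>e. R e = sat M (mix e c) p))"

text \<open>Two parameter lists are interleaved: parameter i of the left operand becomes parameter
  2i of \<open>mix c d\<close>, and that of the right operand, through \<open>rren\<close>,
  parameter 2i+1. The even positions, which hold the free variables, stay.\<close>

definition lren :: "nat \<Rightarrow> nat" where "lren v = (if even v then v else 4 * (v div 2) + 1)"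
definition rren :: "nat \<Rightarrow> nat" where "rren v = (if even v then v else 4 * (v div 2) + 3)"
text \<open>Prepares a quantifier: the de Bruijn variable 0 moves to position 1, a parameter slot
  freed by shifting all parameters by one, and the other variables move down by one.\<close>

definition qren :: "nat \<Rightarrow> nat" where "qren v = (if v = 0 then 1 else if even v then v - 2 else v + 2)"

lemma inj_ren: "inj lren" "inj rren" "inj qren"
proof -
  show "inj lren" unfolding inj_def lren_def by (auto split: if_splits; presburger)
  show "inj rren" unfolding inj_def rren_def by (auto split: if_splits; presburger)
  show "inj qren" unfolding inj_def qren_def by (auto split: if_splits; presburger)
qed

lemma mix_lren: "mix e (mix c d) (lren v) = mix e c v"
proof (cases "even v")
  case False
  then obtain i where v: "v = 2 * i + 1" by (metis oddE)
  have "(4 * i + 1) div 2 = 2 * i" "v div 2 = i" using v by simp_all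
  then show ?thesis using False by (simp add: mix_def lren_def)
qed (simp add: mix_def lren_def)

lemma mix_rren: "mix e (mix c d) (rren v) = mix e d v"
proof (cases "even v")
  case False
  then obtain i where v: "v = 2 * i + 1" by (metis oddE)
  have "(4 * i + 3) div 2 = 2 * i + 1" "v div 2 = i" using v by simp_all
  then show ?thesis using False by (simp add: mix_def rren_def)
qed (simp add: mix_def rren_def)

lemma mix_qren: "((mix e (case_nat z c))(Suc 0 := a)) (qren v) = mix (case_nat a e) c v"
proof -
  consider "v = 0" | "v \<noteq> 0" "even v" | "odd v" by blast
  then show ?thesis
  proof cases
    case 1 then show ?thesis by (simp add: mix_def qren_def)
  next
    case 2
    then obtain i where "v = 2 * Suc i" by (metis dvd_def mult_0_right not0_implies_Suc)
    then show ?thesis by (simp add: mix_def qren_def)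
  next
    case 3
    then obtain i where v: "v = 2 * i + 1" by (metis oddE)
    have "(v + 2) div 2 = Suc i" "v div 2 = i" using v by simp_all
    then show ?thesis using 3 by (auto simp: mix_def qren_def)
  qed
qed

lemma TT_term: "TT M t \<Longrightarrow> \<exists>tm c. \<forall>e. t e = tval M (mix e c) tm"
proof (induction rule: TT.induct)
  case (TT_var v) show ?case by (rule exI[of _ "V (2 * v)"]) (simp add: mix_def)
next
  case (TT_const c) show ?case by (rule exI[of _ "V 1"], rule exI[of _ "\<lambda>_. c"]) (simp add: mix_def)
next
  case (TT_ad s t)
  then obtain tm c tm' c' where "\<And>e. s e = tval M (mix e c) tm" "\<And>e. t e = tval M (mix e c') tm'" by blast
  then show ?case by (intro exI[of _ "Pl (rnt lren tm) (rnt rren tm')"] exI[of _ "mix c c'"])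
      (simp add: tval_rnt mix_lren mix_rren)
next
  case (TT_mu s t)
  then obtain tm c tm' c' where "\<And>e. s e = tval M (mix e c) tm" "\<And>e. t e = tval M (mix e c') tm'" by blast
  then show ?case by (intro exI[of _ "Ml (rnt lren tm) (rnt rren tm')"] exI[of _ "mix c c'"])
      (simp add: tval_rnt mix_lren mix_rren)
qed

lemma sat_qren: "sat M ((mix e (case_nat z c))(Suc 0 := a)) (rn qren p) = sat M (mix (case_nat a e) c) p"
  unfolding sat_rn[OF inj_ren(3)] mix_qren ..

lemma DD_repr: assumes "carr M = UNIV" shows "DD M R \<Longrightarrow> repr M delta0 R"
proof (induction rule: DD.induct)
  case (DD_eq s t)
  obtain tm c tm' c' where "\<And>e. s e = tval M (mix e c) tm" "\<And>e. t e = tval M (mix e c') tm'"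
    using DD_eq TT_term by metis
  then show ?case unfolding repr_def by (intro exI[of _ "Eqf (rnt lren tm) (rnt rren tm')"] exI[of _ "mix c c'"])
      (simp add: tval_rnt mix_lren mix_rren delta0.intros)
next
  case (DD_ls s t)
  obtain tm c tm' c' where "\<And>e. s e = tval M (mix e c) tm" "\<And>e. t e = tval M (mix e c') tm'"
    using DD_ls TT_term by metis
  then show ?case unfolding repr_def by (intro exI[of _ "Ltf (rnt lren tm) (rnt rren tm')"] exI[of _ "mix c c'"])
      (simp add: tval_rnt mix_lren mix_rren delta0.intros)
next
  case (DD_not R)
  then obtain p c where "delta0 p" "\<And>e. R e = sat M (mix e c) p" unfolding repr_def by blast
  then show ?case unfolding repr_def by (intro exI[of _ "Nt p"] exI[of _ c]) (auto intro: delta0.intros)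
next
  case (DD_conj R S)
  then obtain p c q d where "delta0 p" "delta0 q" "\<And>e. R e = sat M (mix e c) p" "\<And>e. S e = sat M (mix e d) q"
    unfolding repr_def by blast
  then show ?case unfolding repr_def by (intro exI[of _ "Cj (rn lren p) (rn rren q)"] exI[of _ "mix c d"])
      (auto intro: delta0.intros delta0_rn simp: sat_rn inj_ren mix_lren mix_rren)
next
  case (DD_bex t R)
  obtain tm d where t: "\<And>e. t e = tval M (mix e d) tm" using DD_bex TT_term by metis
  obtain p c where p: "delta0 p" "\<And>e. R e = sat M (mix e c) p" using DD_bex unfolding repr_def by blast
  \<comment> \<open>The bound variable is named \<open>Suc 0\<close>, which \<open>lren\<close>
    fixes, so slot 0 of the shifted parameter list only carries a dummy value.\<close>
  let ?p = "BEx (Suc 0) (rnt rren tm) (rn lren (rn qren p))"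
  let ?c = "mix (case_nat undefined c) d"
  have eq: "(\<lambda>v. ((mix e ?c)(Suc 0 := a)) (lren v)) = (mix e (case_nat undefined c))(Suc 0 := a)" for e a
  proof
    fix v
    have "lren v = Suc 0 \<longleftrightarrow> v = Suc 0" by (auto simp: lren_def elim!: oddE)
    then show "((mix e ?c)(Suc 0 := a)) (lren v) = ((mix e (case_nat undefined c))(Suc 0 := a)) v"
      by (simp add: mix_lren)
  qed
  have "delta0 ?p" using p(1) by (intro delta0.intros delta0_rn)
  moreover have "(\<exists>a. ls M a (t e) \<and> R (case_nat a e)) = sat M (mix e ?c) ?p" for e
    unfolding sat.simps sat_rn[OF inj_ren(1)] eq sat_qren tval_rnt mix_rren using assms t p(2) by simp
  ultimately show ?case unfolding repr_def by blast
qed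

lemma repr_mono: "repr M C R \<Longrightarrow> (\<And>p. C p \<Longrightarrow> C' p) \<Longrightarrow> repr M C' R"
  unfolding repr_def by blast

lemma SG_PG_repr:
  assumes U: "carr M = UNIV"
  shows "SG M k R \<Longrightarrow> repr M (sigma k) R" "PG M k R \<Longrightarrow> repr M (pi k) R"
proof -
  have "(SG M k1 R1 \<longrightarrow> repr M (sigma k1) R1) \<and> (PG M k2 R2 \<longrightarrow> repr M (pi k2) R2)" for k1 R1 k2 R2
  proof (rule SG_PG.induct[of M "\<lambda>k R. repr M (sigma k) R" "\<lambda>k R. repr M (pi k) R"])
    fix R k assume "DD M R" then have "repr M delta0 R" by (rule DD_repr[OF U])
    then show "repr M (sigma k) R" "repr M (pi k) R" by (auto elim: repr_mono intro: sigma_pi.intros)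
  next
    fix k R assume "repr M (pi k) R" then show "repr M (sigma (Suc k)) R"
      by (auto elim: repr_mono intro: sigma_pi.intros)
  next
    fix k R assume "repr M (sigma k) R" then show "repr M (pi (Suc k)) R"
      by (auto elim: repr_mono intro: sigma_pi.intros)
  next
    fix k R assume "repr M (sigma (Suc k)) R"
    then obtain p c where "sigma (Suc k) p" "\<And>e. R e = sat M (mix e c) p" unfolding repr_def by blast
    then show "repr M (sigma (Suc k)) (\<lambda>e. \<exists>a. R (case_nat a e))"
      unfolding repr_def using sigma_pi_rn U
      by (intro exI[of _ "Ex (Suc 0) (rn qren p)"] exI[of _ "case_nat undefined c"])
         (auto intro: sigma_pi.intros simp: sat_qren simp del: fun_upd_apply)
  next
    fix k R assume "repr M (pi (Suc k)) R"
    then obtain p c where "pi (Suc k) p" "\<And>e. R e = sat M (mix e c) p" unfolding repr_def by blast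
    then show "repr M (pi (Suc k)) (\<lambda>e. \<forall>a. R (case_nat a e))"
      unfolding repr_def using sigma_pi_rn U
      by (intro exI[of _ "Al (Suc 0) (rn qren p)"] exI[of _ "case_nat undefined c"])
         (auto intro: sigma_pi.intros simp: sat_qren simp del: fun_upd_apply)
  qed
  then show "SG M k R \<Longrightarrow> repr M (sigma k) R" "PG M k R \<Longrightarrow> repr M (pi k) R" by blast+
qed

text \<open>Only the positions below \<open>fbound p\<close> influence the truth of
  \<open>p\<close>, so a predicate is determined by a formula and a finite list of
  parameters.\<close>

lemma countable_repr:
  assumes "countable (UNIV :: 'a set)"
  shows "countable {R :: (nat \<Rightarrow> 'a) \<Rightarrow> bool. repr M C R}"
proof -
  let ?f = "\<lambda>(p, l). \<lambda>e. sat M (mix e (\<lambda>v. if v < length l then l ! v else undefined)) p"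
  have "{R. repr M C R} \<subseteq> ?f ` (UNIV :: (fm \<times> 'a list) set)"
  proof
    fix R assume "R \<in> {R. repr M C R}"
    then obtain p c where R: "\<And>e. R e = sat M (mix e c) p" unfolding repr_def by blast
    have "R = ?f (p, map c [0..<fbound p])"
      unfolding fun_eq_iff R prod.case by (intro allI sat_cong) (auto simp: mix_def)
    then show "R \<in> range ?f" by blast
  qed
  moreover have "countable (UNIV :: (fm \<times> 'a list) set)"
  proof -
    have "countable (lists (UNIV :: 'a set))" using assms by blast
    then have "countable (UNIV :: 'a list set)" by simp
    then have "countable ((UNIV :: fm set) \<times> (UNIV :: 'a list set))" by (intro countable_SIGMA) auto
    then show ?thesis by simp
  qed
  ultimately show ?thesis by (meson countable_image countable_subset)
qed

section \<open>Closure of the semantic classes under substitution and Boolean operations\<close>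

lemma TT_Tsub: "TT M t \<Longrightarrow> (\<And>v. TT M (\<lambda>e. \<sigma> e v)) \<Longrightarrow> TT M (\<lambda>e. t (\<sigma> e))"
  by (induction rule: TT.induct) (auto intro: TT.intros)

lemma TT_shift: "TT M t \<Longrightarrow> TT M (\<lambda>e. t (\<lambda>v. e (Suc v)))"
  by (erule TT_Tsub) (rule TT_var)

text \<open>The usual lifting of a de Bruijn substitution under one binder.\<close>

definition lift_sub :: "((nat \<Rightarrow> 'a) \<Rightarrow> nat \<Rightarrow> 'a) \<Rightarrow> (nat \<Rightarrow> 'a) \<Rightarrow> nat \<Rightarrow> 'a" where
  "lift_sub \<sigma> e = case_nat (e 0) (\<sigma> (\<lambda>v. e (Suc v)))"

lemma lift_sub_case [simp]: "lift_sub \<sigma> (case_nat a e) = case_nat a (\<sigma> e)"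
  by (simp add: lift_sub_def)

lemma TT_lift_sub: "(\<And>v. TT M (\<lambda>e. \<sigma> e v)) \<Longrightarrow> TT M (\<lambda>e. lift_sub \<sigma> e v)"
  by (cases v) (auto simp: lift_sub_def intro: TT_var TT_shift)

lemma DD_Tsub: "DD M R \<Longrightarrow> (\<And>v. TT M (\<lambda>e. \<sigma> e v)) \<Longrightarrow> DD M (\<lambda>e. R (\<sigma> e))"
proof (induction arbitrary: \<sigma> rule: DD.induct)
  case (DD_eq s t) show ?case
    by (rule DD.DD_eq[OF TT_Tsub[OF DD_eq.hyps(1) DD_eq.prems] TT_Tsub[OF DD_eq.hyps(2) DD_eq.prems]])
next
  case (DD_ls s t) show ?case
    by (rule DD.DD_ls[OF TT_Tsub[OF DD_ls.hyps(1) DD_ls.prems] TT_Tsub[OF DD_ls.hyps(2) DD_ls.prems]])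
next
  case (DD_not R) show ?case by (rule DD.DD_not) (rule DD_not.IH, rule DD_not.prems)
next
  case (DD_conj R S) show ?case
    by (rule DD.DD_conj) (rule DD_conj.IH, rule DD_conj.prems, rule DD_conj.IH, rule DD_conj.prems)
next
  case (DD_bex t R)
  have "DD M (\<lambda>e. R (lift_sub \<sigma> e))" by (rule DD_bex.IH) (rule TT_lift_sub, rule DD_bex.prems)
  from DD.DD_bex[OF TT_Tsub[OF DD_bex.hyps(1) DD_bex.prems] this] show ?case by simp
qed

lemma DD_iff: "DD M R \<Longrightarrow> (\<And>e. R e = S e) \<Longrightarrow> DD M S"
  by (subgoal_tac "R = S") auto

lemma DD_disj: "DD M R \<Longrightarrow> DD M S \<Longrightarrow> DD M (\<lambda>e. R e \<or> S e)"
  by (rule DD_iff[OF DD_not[OF DD_conj[OF DD_not DD_not]]]) auto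
lemma DD_imp: "DD M R \<Longrightarrow> DD M S \<Longrightarrow> DD M (\<lambda>e. R e \<longrightarrow> S e)"
  by (rule DD_iff[OF DD_disj[OF DD_not]]) auto
lemma DD_equiv: "DD M R \<Longrightarrow> DD M S \<Longrightarrow> DD M (\<lambda>e. R e = S e)"
  by (rule DD_iff[OF DD_conj[OF DD_imp[of M R S] DD_imp[of M S R]]]) auto

lemma DD_Tbex: "TT M t \<Longrightarrow> DD M (\<lambda>e. P (\<lambda>v. e (Suc v)) (e 0)) \<Longrightarrow> DD M (\<lambda>e. \<exists>a. ls M a (t e) \<and> P e a)"
  by (drule (1) DD_bex) simp

lemma DD_triv: "DD M (\<lambda>e. c)"
proof -
  have t: "DD M (\<lambda>e. e 0 = e 0)" by (intro DD.intros TT.intros)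
  show ?thesis by (cases c) (use t DD_not[OF t] in auto)
qed

lemma SG_mono1: "SG M k R \<Longrightarrow> SG M (Suc k) R" and PG_mono1: "PG M k R \<Longrightarrow> PG M (Suc k) R"
proof -
  have "(SG M k1 R1 \<longrightarrow> SG M (Suc k1) R1) \<and> (PG M k2 R2 \<longrightarrow> PG M (Suc k2) R2)" for k1 R1 k2 R2
    by (rule SG_PG.induct[of M "\<lambda>k R. SG M (Suc k) R" "\<lambda>k R. PG M (Suc k) R"]) (auto intro: SG_PG.intros)
  then show "SG M k R \<Longrightarrow> SG M (Suc k) R" "PG M k R \<Longrightarrow> PG M (Suc k) R" by blast+
qed

lemma SG_mono: assumes "SG M j R" "j \<le> k" shows "SG M k R"
  using assms(2) by (induction rule: dec_induct) (auto intro: assms SG_mono1)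

lemma SG_not: "PG M k R \<Longrightarrow> SG M k (\<lambda>e. \<not> R e)" and PG_not: "SG M k R \<Longrightarrow> PG M k (\<lambda>e. \<not> R e)"
proof -
  have "(SG M k1 R1 \<longrightarrow> PG M k1 (\<lambda>e. \<not> R1 e)) \<and> (PG M k2 R2 \<longrightarrow> SG M k2 (\<lambda>e. \<not> R2 e))" for k1 R1 k2 R2
    by (rule SG_PG.induct[of M "\<lambda>k R. PG M k (\<lambda>e. \<not> R e)" "\<lambda>k R. SG M k (\<lambda>e. \<not> R e)"])
      (auto intro: SG_DD PG_DD DD_not SG_PG PG_SG dest: SG_ex PG_all)
  then show "PG M k R \<Longrightarrow> SG M k (\<lambda>e. \<not> R e)" "SG M k R \<Longrightarrow> PG M k (\<lambda>e. \<not> R e)" by blast+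
qed

lemma SG_iff: "SG M k R \<Longrightarrow> (\<And>e. R e = S e) \<Longrightarrow> SG M k S"
  by (subgoal_tac "R = S") auto
lemma PG_iff: "PG M k R \<Longrightarrow> (\<And>e. R e = S e) \<Longrightarrow> PG M k S"
  by (subgoal_tac "R = S") auto

lemma SG_Tsub: fixes M :: "'a arith_struct" shows "SG M k R \<Longrightarrow> (\<And>v. TT M (\<lambda>e. \<sigma> e v)) \<Longrightarrow> SG M k (\<lambda>e. R (\<sigma> e))"
  and PG_Tsub: "PG M k R \<Longrightarrow> (\<And>v. TT M (\<lambda>e. \<sigma> e v)) \<Longrightarrow> PG M k (\<lambda>e. R (\<sigma> e))"
proof -
  let ?S = "\<lambda>k (R :: (nat \<Rightarrow> 'a) \<Rightarrow> bool). \<forall>\<sigma> :: (nat \<Rightarrow> 'a) \<Rightarrow> nat \<Rightarrow> 'a. (\<forall>v. TT M (\<lambda>e. \<sigma> e v)) \<longrightarrow> SG M k (\<lambda>e. R (\<sigma> e))"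
  let ?P = "\<lambda>k (R :: (nat \<Rightarrow> 'a) \<Rightarrow> bool). \<forall>\<sigma> :: (nat \<Rightarrow> 'a) \<Rightarrow> nat \<Rightarrow> 'a. (\<forall>v. TT M (\<lambda>e. \<sigma> e v)) \<longrightarrow> PG M k (\<lambda>e. R (\<sigma> e))"
  have "(SG M k1 R1 \<longrightarrow> ?S k1 R1) \<and> (PG M k2 R2 \<longrightarrow> ?P k2 R2)" for k1 R1 k2 R2
  proof (rule SG_PG.induct[of M ?S ?P])
    fix R k assume "DD M R" then show "?S k R" "?P k R" by (blast intro: SG_DD PG_DD DD_Tsub)+
  next
    fix k R assume "?P k R" then show "?S (Suc k) R" by (blast intro: SG_PG)
  next
    fix k R assume "?S k R" then show "?P (Suc k) R" by (blast intro: PG_SG)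
  next
    fix k R assume IH: "?S (Suc k) R"
    show "?S (Suc k) (\<lambda>e. \<exists>a. R (case_nat a e))"
    proof (intro allI impI)
      fix \<sigma> :: "(nat \<Rightarrow> 'a) \<Rightarrow> nat \<Rightarrow> 'a" assume s: "\<forall>v. TT M (\<lambda>e. \<sigma> e v)"
      have "SG M (Suc k) (\<lambda>e. R (lift_sub \<sigma> e))" using IH s by (blast intro: TT_lift_sub)
      from SG_ex[OF this] show "SG M (Suc k) (\<lambda>e. \<exists>a. R (case_nat a (\<sigma> e)))" by simp
    qed
  next
    fix k R assume IH: "?P (Suc k) R"
    show "?P (Suc k) (\<lambda>e. \<forall>a. R (case_nat a e))"
    proof (intro allI impI)
      fix \<sigma> :: "(nat \<Rightarrow> 'a) \<Rightarrow> nat \<Rightarrow> 'a" assume s: "\<forall>v. TT M (\<lambda>e. \<sigma> e v)"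
      have "PG M (Suc k) (\<lambda>e. R (lift_sub \<sigma> e))" using IH s by (blast intro: TT_lift_sub)
      from PG_all[OF this] show "PG M (Suc k) (\<lambda>e. \<forall>a. R (case_nat a (\<sigma> e)))" by simp
    qed
  qed
  then show "SG M k R \<Longrightarrow> (\<And>v. TT M (\<lambda>e. \<sigma> e v)) \<Longrightarrow> SG M k (\<lambda>e. R (\<sigma> e))"
    "PG M k R \<Longrightarrow> (\<And>v. TT M (\<lambda>e. \<sigma> e v)) \<Longrightarrow> PG M k (\<lambda>e. R (\<sigma> e))" by blast+
qed

lemma SG_shift: "SG M k R \<Longrightarrow> SG M k (\<lambda>e. R (\<lambda>v. e (Suc v)))"
  by (erule SG_Tsub) (rule TT_var)
lemma PG_shift: "PG M k R \<Longrightarrow> PG M k (\<lambda>e. R (\<lambda>v. e (Suc v)))"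
  by (erule PG_Tsub) (rule TT_var)
lemma DD_shift: "DD M R \<Longrightarrow> DD M (\<lambda>e. R (\<lambda>v. e (Suc v)))"
  by (erule DD_Tsub) (rule TT_var)

lemma SG_exI: "SG M (Suc k) (\<lambda>e. P (\<lambda>v. e (Suc v)) (e 0)) \<Longrightarrow> SG M (Suc k) (\<lambda>e. \<exists>a. P e a)"
  by (drule SG_ex) simp
lemma PG_allI: "PG M (Suc k) (\<lambda>e. P (\<lambda>v. e (Suc v)) (e 0)) \<Longrightarrow> PG M (Suc k) (\<lambda>e. \<forall>a. P e a)"
  by (drule PG_all) simp

text \<open>Quantifier prefixes are merged one at a time.\<close>

lemma SG_PG_bool_aux:
  fixes h :: "bool \<Rightarrow> bool \<Rightarrow> bool"
  assumes h: "h = (\<and>) \<or> h = (\<or>)"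
  shows "(\<forall>R S. SG M k R \<longrightarrow> SG M k S \<longrightarrow> SG M k (\<lambda>e. h (R e) (S e))) \<and>
         (\<forall>R S. PG M k R \<longrightarrow> PG M k S \<longrightarrow> PG M k (\<lambda>e. h (R e) (S e)))"
proof (induction k)
  case 0
  have SG0: "SG M 0 R \<Longrightarrow> DD M R" and PG0: "PG M 0 R \<Longrightarrow> DD M R" for R
    by (erule SG.cases; simp) (erule PG.cases; simp)
  have "DD M R \<Longrightarrow> DD M S \<Longrightarrow> DD M (\<lambda>e. h (R e) (S e))" for R S
    using h DD_conj DD_disj by auto
  then show ?case by (meson SG_DD PG_DD SG0 PG0)
next
  case (Suc k)
  have hex: "h (\<exists>a. P a) Q = (\<exists>a. h (P a) Q)" "h Q (\<exists>a. P a) = (\<exists>a. h Q (P a))"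
    "h (\<forall>a. P a) Q = (\<forall>a. h (P a) Q)" "h Q (\<forall>a. P a) = (\<forall>a. h Q (P a))" for P :: "'a \<Rightarrow> bool" and Q
    using h by auto
  text \<open>first with one side from the lower class, then both sides arbitrary\<close>
  have IHS: "SG M k R \<Longrightarrow> SG M k S \<Longrightarrow> SG M k (\<lambda>e. h (R e) (S e))"
    and IHP: "PG M k R \<Longrightarrow> PG M k S \<Longrightarrow> PG M k (\<lambda>e. h (R e) (S e))" for R S
    using Suc by simp_all
  let ?S1 = "\<lambda>j R. j = Suc k \<longrightarrow> (\<forall>S. PG M k S \<longrightarrow> SG M (Suc k) (\<lambda>e. h (R e) (S e)))"
  let ?P1 = "\<lambda>j R. j = Suc k \<longrightarrow> (\<forall>S. SG M k S \<longrightarrow> PG M (Suc k) (\<lambda>e. h (R e) (S e)))"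
  have 1: "(SG M j1 R1 \<longrightarrow> ?S1 j1 R1) \<and> (PG M j2 R2 \<longrightarrow> ?P1 j2 R2)" for j1 R1 j2 R2
  proof (rule SG_PG.induct[of M ?S1 ?P1])
    fix R j assume "DD M R"
    then show "?S1 j R" by (intro impI allI SG_PG IHP) (simp_all add: PG_DD)
  next
    fix R j assume "DD M R"
    then show "?P1 j R" by (intro impI allI PG_SG IHS) (simp_all add: SG_DD)
  next
    fix R j assume "PG M j R" then show "?S1 (Suc j) R" by (intro impI allI SG_PG IHP) simp
  next
    fix R j assume "SG M j R" then show "?P1 (Suc j) R" by (intro impI allI PG_SG IHS) simp
  next
    fix R j assume IH: "?S1 (Suc j) R"
    show "?S1 (Suc j) (\<lambda>e. \<exists>a. R (case_nat a e))"
    proof (intro impI allI)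
      fix S assume j: "Suc j = Suc k" and S: "PG M k S"
      have "SG M (Suc k) (\<lambda>e. h (R e) (S (\<lambda>v. e (Suc v))))" using IH[rule_format, OF j PG_shift[OF S]] .
      from SG_ex[OF this] show "SG M (Suc k) (\<lambda>e. h (\<exists>a. R (case_nat a e)) (S e))" by (simp add: hex)
    qed
  next
    fix R j assume IH: "?P1 (Suc j) R"
    show "?P1 (Suc j) (\<lambda>e. \<forall>a. R (case_nat a e))"
    proof (intro impI allI)
      fix S assume j: "Suc j = Suc k" and S: "SG M k S"
      have "PG M (Suc k) (\<lambda>e. h (R e) (S (\<lambda>v. e (Suc v))))" using IH[rule_format, OF j SG_shift[OF S]] .
      from PG_all[OF this] show "PG M (Suc k) (\<lambda>e. h (\<forall>a. R (case_nat a e)) (S e))" by (simp add: hex)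
    qed
  qed
  have 1: "SG M (Suc k) R \<Longrightarrow> PG M k S \<Longrightarrow> SG M (Suc k) (\<lambda>e. h (R e) (S e))"
    "PG M (Suc k) R \<Longrightarrow> SG M k S \<Longrightarrow> PG M (Suc k) (\<lambda>e. h (R e) (S e))" for R S
    using 1[of "Suc k" R "Suc k" R] by simp_all
  let ?S2 = "\<lambda>j R. j = Suc k \<longrightarrow> (\<forall>S. SG M (Suc k) S \<longrightarrow> SG M (Suc k) (\<lambda>e. h (S e) (R e)))"
  let ?P2 = "\<lambda>j R. j = Suc k \<longrightarrow> (\<forall>S. PG M (Suc k) S \<longrightarrow> PG M (Suc k) (\<lambda>e. h (S e) (R e)))"
  have 2: "(SG M j1 R1 \<longrightarrow> ?S2 j1 R1) \<and> (PG M j2 R2 \<longrightarrow> ?P2 j2 R2)" for j1 R1 j2 R2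
  proof (rule SG_PG.induct[of M ?S2 ?P2])
    fix R j assume "DD M R" then show "?S2 j R" by (intro impI allI 1 PG_DD)
  next
    fix R j assume "DD M R" then show "?P2 j R" by (intro impI allI 1 SG_DD)
  next
    fix R j assume "PG M j R" then show "?S2 (Suc j) R" by (intro impI allI 1) simp_all
  next
    fix R j assume "SG M j R" then show "?P2 (Suc j) R" by (intro impI allI 1) simp_all
  next
    fix R j assume IH: "?S2 (Suc j) R"
    show "?S2 (Suc j) (\<lambda>e. \<exists>a. R (case_nat a e))"
    proof (intro impI allI)
      fix S assume j: "Suc j = Suc k" and S: "SG M (Suc k) S"
      have "SG M (Suc k) (\<lambda>e. h (S (\<lambda>v. e (Suc v))) (R e))" using IH[rule_format, OF j SG_shift[OF S]] .
      from SG_ex[OF this] show "SG M (Suc k) (\<lambda>e. h (S e) (\<exists>a. R (case_nat a e)))" by (simp add: hex)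
    qed
  next
    fix R j assume IH: "?P2 (Suc j) R"
    show "?P2 (Suc j) (\<lambda>e. \<forall>a. R (case_nat a e))"
    proof (intro impI allI)
      fix S assume j: "Suc j = Suc k" and S: "PG M (Suc k) S"
      have "PG M (Suc k) (\<lambda>e. h (S (\<lambda>v. e (Suc v))) (R e))" using IH[rule_format, OF j PG_shift[OF S]] .
      from PG_all[OF this] show "PG M (Suc k) (\<lambda>e. h (S e) (\<forall>a. R (case_nat a e)))" by (simp add: hex)
    qed
  qed
  have "SG M (Suc k) (\<lambda>e. h (R e) (S e))" if "SG M (Suc k) R" "SG M (Suc k) S" for R S
    using 2[of "Suc k" S "Suc k" S] that by simp
  moreover have "PG M (Suc k) (\<lambda>e. h (R e) (S e))" if "PG M (Suc k) R" "PG M (Suc k) S" for R S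
    using 2[of "Suc k" S "Suc k" S] that by simp
  ultimately show ?case by simp
qed

lemma SG_conj: "SG M k R \<Longrightarrow> SG M k S \<Longrightarrow> SG M k (\<lambda>e. R e \<and> S e)"
  and PG_conj: "PG M k R \<Longrightarrow> PG M k S \<Longrightarrow> PG M k (\<lambda>e. R e \<and> S e)"
  and SG_disj: "SG M k R \<Longrightarrow> SG M k S \<Longrightarrow> SG M k (\<lambda>e. R e \<or> S e)"
  and PG_disj: "PG M k R \<Longrightarrow> PG M k S \<Longrightarrow> PG M k (\<lambda>e. R e \<or> S e)"
  using SG_PG_bool_aux[of "(\<and>)" M k] SG_PG_bool_aux[of "(\<or>)" M k] by simp_all

lemma PG_imp: "SG M k R \<Longrightarrow> PG M k S \<Longrightarrow> PG M k (\<lambda>e. R e \<longrightarrow> S e)"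
  by (rule PG_iff[OF PG_disj[OF PG_not]]) auto

lemma SG0_DD: "SG M 0 R \<Longrightarrow> DD M R" and PG0_DD: "PG M 0 R \<Longrightarrow> DD M R"
  by (erule SG.cases; simp) (erule PG.cases; simp)

section \<open>Models of PA-minus and bounded functions\<close>

definition ple :: "'a arith_struct \<Rightarrow> 'a \<Rightarrow> 'a \<Rightarrow> bool" where
  "ple M x y \<longleftrightarrow> ls M x y \<or> x = y"

text \<open>Cut-off subtraction. It is defined so that \<open>M\<close> can be read as a
  \<open>linordered_semidom\<close>, whose signature contains a difference.\<close>

definition mns :: "'a arith_struct \<Rightarrow> 'a \<Rightarrow> 'a \<Rightarrow> 'a" where
  "mns M x y = (if ls M x y then zr M else (SOME w. ad M y w = x))"

text \<open>The carrier is the whole type, so that quantifiers of HOL and of the model agree. Models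
  with other carriers are transported to \<open>nat\<close> at the end.\<close>

locale pam =
  fixes M :: "'a arith_struct"
  assumes U: "carr M = UNIV" and PA: "PAminus M"
begin

abbreviation pa_add (infixl "\<oplus>" 65) where "x \<oplus> y \<equiv> ad M x y"
abbreviation pa_mul (infixl "\<otimes>" 70) where "x \<otimes> y \<equiv> mu M x y"
abbreviation pa_less (infix "\<prec>" 50) where "x \<prec> y \<equiv> ls M x y"
abbreviation pa_le (infix "\<preceq>" 50) where "x \<preceq> y \<equiv> ple M x y"
abbreviation pa_zero ("\<zero>") where "\<zero> \<equiv> zr M"
abbreviation pa_one ("\<one>") where "\<one> \<equiv> un M"

lemma ax:
  "x \<oplus> y \<oplus> z = x \<oplus> (y \<oplus> z)" "x \<oplus> y = y \<oplus> x" "x \<otimes> y \<otimes> z = x \<otimes> (y \<otimes> z)" "x \<otimes> y = y \<otimes> x"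
  "x \<otimes> (y \<oplus> z) = x \<otimes> y \<oplus> x \<otimes> z" "x \<oplus> \<zero> = x" "x \<otimes> \<zero> = \<zero>" "x \<otimes> \<one> = x"
  "\<not> x \<prec> x" "x \<prec> y \<Longrightarrow> y \<prec> z \<Longrightarrow> x \<prec> z" "x \<prec> y \<or> x = y \<or> y \<prec> x"
  "x \<prec> y \<Longrightarrow> x \<oplus> z \<prec> y \<oplus> z" "\<zero> \<prec> z \<Longrightarrow> x \<prec> y \<Longrightarrow> x \<otimes> z \<prec> y \<otimes> z"
  "x \<prec> y \<Longrightarrow> \<exists>w. x \<oplus> w = y" "\<zero> \<prec> \<one>" "\<zero> \<prec> x \<Longrightarrow> \<one> \<prec> x \<or> \<one> = x" "\<zero> \<prec> x \<or> \<zero> = x"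
  using PA[unfolded PAminus_def U ball_UNIV bex_UNIV] by (blast | metis)+

lemma ad_cancel: "x \<oplus> z = y \<oplus> z \<Longrightarrow> x = y"
  using ax(9,11,12) by metis

lemma mns_eq: "mns M (x \<oplus> y) y = x"
proof -
  have "\<not> x \<oplus> y \<prec> y" using ax(2,6,9,10,12,17) by metis
  moreover have "(SOME w. y \<oplus> w = x \<oplus> y) = x"
    by (rule some_equality) (metis ax(2), metis ax(2) ad_cancel)
  ultimately show ?thesis by (simp add: mns_def)
qed

lemma mns_zero: "ple M x y \<Longrightarrow> mns M x y = \<zero>"
proof -
  assume "ple M x y"
  then consider "x \<prec> y" | "x = y" unfolding ple_def by blast
  then show ?thesis
  proof cases
    case 1 then show ?thesis by (simp add: mns_def)
  next
    case 2
    have "\<zero> \<oplus> y = x" using ax(2)[of \<zero> y] ax(6)[of y] 2 by simp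
    then show ?thesis using mns_eq[of \<zero> y] by simp
  qed
qed

text \<open>Makes the library facts on ordered semidomains available for elements of the
  model.\<close>

sublocale A: linordered_semidom where minus = "mns M" and plus = "ad M" and zero = "zr M" and times = "mu M"
  and one = "un M" and less = "ls M" and less_eq = "ple M"
proof unfold_locales
  show "a \<oplus> b \<oplus> c = a \<oplus> (b \<oplus> c)" "a \<oplus> b = b \<oplus> a" "\<zero> \<oplus> a = a" "a \<otimes> b \<otimes> c = a \<otimes> (b \<otimes> c)" "a \<otimes> b = b \<otimes> a"
    "\<one> \<otimes> a = a" "\<zero> \<otimes> a = \<zero>" "a \<otimes> \<zero> = \<zero>" "(a \<oplus> b) \<otimes> c = a \<otimes> c \<oplus> b \<otimes> c" for a b c
    by (metis ax)+
  show "mns M (a \<oplus> b) a = b" for a b using mns_eq[of b a] by (metis ax(2))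
  show m2: "mns M (mns M a b) c = mns M a (b \<oplus> c)" for a b c
  proof (cases "b \<oplus> c \<preceq> a")
    case True
    then obtain w where "a = w \<oplus> (b \<oplus> c)" unfolding ple_def by (metis ax(2,6,14))
    then show ?thesis using mns_eq[of "w \<oplus> c" b] mns_eq[of w c] mns_eq[of w "b \<oplus> c"] ax(1,2) by metis
  next
    case False
    then have l: "a \<prec> b \<oplus> c" using ax(11) unfolding ple_def by blast
    then have r: "mns M a (b \<oplus> c) = \<zero>" by (simp add: mns_def)
    show ?thesis
    proof (cases "a \<prec> b")
      case True
      then have "mns M a b = \<zero>" by (simp add: mns_def)
      moreover have "mns M \<zero> c = \<zero>" using ax(17)[of c] by (intro mns_zero) (auto simp: ple_def)
      ultimately show ?thesis using r by simp
    next
      case False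
      then obtain w where w: "a = w \<oplus> b" using ax(2,6,11,14) by metis
      then have "w \<prec> c" using l by (metis ax(2,9,10,11,12))
      then show ?thesis using r w mns_eq[of w b] by (simp add: mns_def)
    qed
  qed
  show "(a \<prec> b) = (a \<preceq> b \<and> \<not> b \<preceq> a)" "a \<preceq> a" "a \<preceq> b \<or> b \<preceq> a" for a b
    unfolding ple_def using ax(9,10,11) by blast+
  show "a \<preceq> b \<Longrightarrow> b \<preceq> c \<Longrightarrow> a \<preceq> c" "a \<preceq> b \<Longrightarrow> b \<preceq> a \<Longrightarrow> a = b" for a b c
    unfolding ple_def using ax(9,10,11) by blast+
  show "a \<preceq> b \<Longrightarrow> c \<oplus> a \<preceq> c \<oplus> b" for a b c unfolding ple_def by (metis ax(2,12))
  show "a \<prec> b \<Longrightarrow> \<zero> \<prec> c \<Longrightarrow> c \<otimes> a \<prec> c \<otimes> b" for a b c by (metis ax(4,13))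
  show "\<zero> \<noteq> \<one>" using ax(9,15) by metis
  show "\<zero> \<prec> \<one>" by (rule ax)
  show "b \<preceq> a \<Longrightarrow> mns M a b \<oplus> b = a" for a b unfolding ple_def using mns_eq ax(2,6,14) by metis
  show nz: "a \<noteq> \<zero> \<Longrightarrow> b \<noteq> \<zero> \<Longrightarrow> a \<otimes> b \<noteq> \<zero>" for a b using ax(4,7,9,13,17) by metis
  show "a \<otimes> mns M b c = mns M (a \<otimes> b) (a \<otimes> c)" for a b c
  proof (cases "b \<prec> c")
    case True
    then have "mns M b c = \<zero>" by (simp add: mns_def)
    moreover have "mns M (a \<otimes> b) (a \<otimes> c) = \<zero>"
    proof (cases "a = \<zero>")
      case True
      then have "a \<otimes> b = a \<otimes> c" by (metis ax(4,7))
      then show ?thesis by (intro mns_zero) (simp add: ple_def)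
    next
      case False
      then have "\<zero> \<prec> a" using ax(17) by metis
      then have "a \<otimes> b \<prec> a \<otimes> c" using ax(13)[OF _ True] ax(4) by metis
      then show ?thesis by (intro mns_zero) (simp add: ple_def)
    qed
    ultimately show ?thesis by (simp add: ax(7))
  next
    case False
    then obtain w where "b = w \<oplus> c" using ax(2,6,11,14) by metis
    then show ?thesis using mns_eq by (metis ax(5))
  qed
qed (rule ax(5))

lemma le_iff: "x \<preceq> y \<longleftrightarrow> x \<prec> y \<or> x = y" by (rule ple_def)
lemma zero_le [simp]: "\<zero> \<preceq> x" using ax(17) by (auto simp: ple_def)
lemma not_less_zero [simp]: "\<not> x \<prec> \<zero>" using zero_le A.not_less by blast
lemma le_zero [simp]: "x \<preceq> \<zero> \<longleftrightarrow> x = \<zero>" by (auto simp: le_iff)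
lemma pos_iff: "\<zero> \<prec> x \<longleftrightarrow> x \<noteq> \<zero>" using ax(9,17) by metis
lemma diff_ex: "x \<preceq> y \<Longrightarrow> \<exists>w. y = x \<oplus> w" unfolding ple_def by (metis ax(6,14))
lemma le_add [simp]: "x \<preceq> x \<oplus> y" "y \<preceq> x \<oplus> y"
  using A.add_left_mono[OF zero_le, of x y] A.add_right_mono[OF zero_le, of x y] by simp_all
lemma less_add_one [simp]: "x \<prec> x \<oplus> \<one>" by (rule A.less_add_one)
lemma less_Suc_le: "x \<prec> y \<oplus> \<one> \<longleftrightarrow> x \<preceq> y"
proof
  assume l: "x \<prec> y \<oplus> \<one>"
  show "x \<preceq> y"
  proof (rule ccontr)
    assume "\<not> x \<preceq> y"
    then have "y \<prec> x" by (rule A.not_le_imp_less)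
    then obtain w where w: "x = y \<oplus> w" "w \<noteq> \<zero>" using ax(6,9,14) by metis
    then have "\<one> \<preceq> w" using ax(16) pos_iff by (auto simp: ple_def)
    then have "y \<oplus> \<one> \<preceq> x" using w by (simp add: A.add_left_mono)
    then show False using l by (simp add: A.not_less[symmetric])
  qed
qed (rule A.le_less_trans[OF _ less_add_one])
lemma Suc_le_less: "x \<oplus> \<one> \<preceq> y \<longleftrightarrow> x \<prec> y"
  using less_Suc_le[of y x] by (metis A.not_le)
lemma zero_or_Suc: "x = \<zero> \<or> (\<exists>y. x = y \<oplus> \<one>)"
  using Suc_le_less[of \<zero> x] pos_iff[of x] diff_ex[of \<one> x] by (metis A.add_0_left ax(2))
lemma Suc_neq_zero [simp]: "x \<oplus> \<one> \<noteq> \<zero>" by (metis less_add_one not_less_zero)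

lemma mult_mono': "a \<preceq> b \<Longrightarrow> c \<preceq> d \<Longrightarrow> a \<otimes> c \<preceq> b \<otimes> d"
  by (rule A.mult_mono) simp_all

lemma TT_mono: "TT M t \<Longrightarrow> (\<And>v. e v \<preceq> e' v) \<Longrightarrow> t e \<preceq> t e'"
  by (induction rule: TT.induct) (auto intro: A.add_mono mult_mono')

text \<open>Functions with a bounded graph and a polynomial bound; they can be substituted into all the classes.\<close>

definition FF :: "((nat \<Rightarrow> 'a) \<Rightarrow> 'a) \<Rightarrow> bool" where
  "FF t \<longleftrightarrow> DD M (\<lambda>e. e 0 = t (\<lambda>v. e (Suc v))) \<and> (\<exists>b. TT M b \<and> (\<forall>e. t e \<preceq> b e))"

lemma FF_TT: "TT M t \<Longrightarrow> FF t"
  unfolding FF_def by (auto intro!: DD_eq TT_var TT_shift)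

lemma FF_var [intro!]: "FF (\<lambda>e. e v)" by (rule FF_TT[OF TT_var])
lemma FF_const [intro!]: "FF (\<lambda>e. c)" by (rule FF_TT[OF TT_const])

lemma FF_Tsub: "FF t \<Longrightarrow> (\<And>v. TT M (\<lambda>e. \<sigma> e v)) \<Longrightarrow> FF (\<lambda>e. t (\<sigma> e))"
proof -
  assume t: "FF t" and s: "\<And>v. TT M (\<lambda>e. \<sigma> e v)"
  then obtain b where b: "TT M b" "\<forall>e. t e \<preceq> b e" and d: "DD M (\<lambda>e. e 0 = t (\<lambda>v. e (Suc v)))"
    unfolding FF_def by blast
  have "DD M (\<lambda>e. lift_sub \<sigma> e 0 = t (\<lambda>v. lift_sub \<sigma> e (Suc v)))"
    by (rule DD_Tsub[OF d]) (rule TT_lift_sub[OF s])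
  then have "DD M (\<lambda>e. e 0 = t (\<sigma> (\<lambda>v. e (Suc v))))" by (simp add: lift_sub_def)
  moreover have "TT M (\<lambda>e. b (\<sigma> e))" by (rule TT_Tsub[OF b(1) s])
  ultimately show "FF (\<lambda>e. t (\<sigma> e))" unfolding FF_def using b(2) by blast
qed

lemma FF_shift: "FF t \<Longrightarrow> FF (\<lambda>e. t (\<lambda>v. e (Suc v)))"
  by (erule FF_Tsub) (rule TT_var)

text \<open>Substituting a bounded function for a variable: quantify over its value.\<close>

lemma DD_Fex:
  assumes "FF t" "DD M (\<lambda>e. P (\<lambda>v. e (Suc v)) (e 0))"
  shows "DD M (\<lambda>e. P e (t e))"
proof -
  obtain b where b: "TT M b" "\<And>e. t e \<preceq> b e" and d: "DD M (\<lambda>e. e 0 = t (\<lambda>v. e (Suc v)))"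
    using assms(1) unfolding FF_def by blast
  have "DD M (\<lambda>e. \<exists>a. a \<prec> b e \<oplus> \<one> \<and> (a = t e \<and> P e a))"
    by (rule DD_Tbex) (intro TT_ad TT_const b(1), rule DD_conj[OF d assms(2)])
  then show ?thesis by (rule DD_iff) (auto simp: less_Suc_le b(2))
qed

lemma DD_Feq: assumes "FF s" "FF t" shows "DD M (\<lambda>e. s e = t e)"
  by (rule DD_Fex[OF assms(2)], rule DD_Fex[OF FF_shift[OF assms(1)]]) (intro DD_eq TT_var)
lemma DD_Fls: assumes "FF s" "FF t" shows "DD M (\<lambda>e. s e \<prec> t e)"
  by (rule DD_Fex[OF assms(2)], rule DD_Fex[OF FF_shift[OF assms(1)]]) (intro DD_ls TT_var)
lemma DD_Fle: assumes "FF s" "FF t" shows "DD M (\<lambda>e. s e \<preceq> t e)"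
  unfolding le_iff by (intro DD_disj DD_Feq DD_Fls assms)
lemma DD_Fbex: assumes "FF t" "DD M (\<lambda>e. P (\<lambda>v. e (Suc v)) (e 0))"
  shows "DD M (\<lambda>e. \<exists>a. a \<prec> t e \<and> P e a)"
proof -
  have "DD M (\<lambda>e. P (\<lambda>v. e (Suc (Suc v))) (e 0))"
  proof -
    have s: "TT M (\<lambda>e. case_nat (e 0) (\<lambda>v. e (Suc (Suc v))) v)" for v by (cases v) (auto intro: TT_var)
    show ?thesis using DD_Tsub[where \<sigma> = "\<lambda>e. case_nat (e 0) (\<lambda>v. e (Suc (Suc v)))", OF assms(2) s] by simp
  qed
  from DD_Tbex[OF TT_var this] show ?thesis by (rule DD_Fex[OF assms(1), where P = "\<lambda>e u. \<exists>a. a \<prec> u \<and> P e a"])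
qed
lemma DD_Fball: assumes "FF t" "DD M (\<lambda>e. P (\<lambda>v. e (Suc v)) (e 0))"
  shows "DD M (\<lambda>e. \<forall>a. a \<prec> t e \<longrightarrow> P e a)"
  by (rule DD_iff[OF DD_not[OF DD_Fbex[OF assms(1) DD_not[OF assms(2)]]]]) auto

lemma FF_I: assumes "FF b" "\<And>e. t e \<preceq> b e" "DD M (\<lambda>e. e 0 = t (\<lambda>v. e (Suc v)))" shows "FF t"
  using assms unfolding FF_def by (meson A.order_trans)

lemma FF_ad [intro!]: assumes "FF s" "FF t" shows "FF (\<lambda>e. s e \<oplus> t e)"
proof -
  obtain b c where b: "TT M b" "\<And>e. s e \<preceq> b e" and c: "TT M c" "\<And>e. t e \<preceq> c e"
    using assms unfolding FF_def by blast
  show ?thesis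
  proof (rule FF_I)
    show "FF (\<lambda>e. b e \<oplus> c e)" by (intro FF_TT TT_ad b c)
    show "s e \<oplus> t e \<preceq> b e \<oplus> c e" for e by (intro A.add_mono b c)
    show "DD M (\<lambda>e. e 0 = s (\<lambda>v. e (Suc v)) \<oplus> t (\<lambda>v. e (Suc v)))"
      by (rule DD_Fex[OF FF_shift[OF assms(2)]], rule DD_Fex[OF FF_Tsub[OF assms(1)]]) (intro DD_eq TT.intros)+
  qed
qed

lemma FF_mu [intro!]: assumes "FF s" "FF t" shows "FF (\<lambda>e. s e \<otimes> t e)"
proof -
  obtain b c where b: "TT M b" "\<And>e. s e \<preceq> b e" and c: "TT M c" "\<And>e. t e \<preceq> c e"
    using assms unfolding FF_def by blast
  show ?thesis
  proof (rule FF_I)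
    show "FF (\<lambda>e. b e \<otimes> c e)" by (intro FF_TT TT_mu b c)
    show "s e \<otimes> t e \<preceq> b e \<otimes> c e" for e by (intro mult_mono' b c)
    show "DD M (\<lambda>e. e 0 = s (\<lambda>v. e (Suc v)) \<otimes> t (\<lambda>v. e (Suc v)))"
      by (rule DD_Fex[OF FF_shift[OF assms(2)]], rule DD_Fex[OF FF_Tsub[OF assms(1)]]) (intro DD_eq TT.intros)+
  qed
qed

lemma TT_Fsub: "TT M t \<Longrightarrow> (\<And>v. FF (\<lambda>e. \<sigma> e v)) \<Longrightarrow> FF (\<lambda>e. t (\<sigma> e))"
  by (induction rule: TT.induct) auto

lemma FF_lift_sub: "(\<And>v. FF (\<lambda>e. \<sigma> e v)) \<Longrightarrow> FF (\<lambda>e. lift_sub \<sigma> e v)"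
  by (cases v) (auto simp: lift_sub_def intro: FF_shift)

lemma DD_Fsub: "DD M R \<Longrightarrow> (\<And>v. FF (\<lambda>e. \<sigma> e v)) \<Longrightarrow> DD M (\<lambda>e. R (\<sigma> e))"
proof (induction arbitrary: \<sigma> rule: DD.induct)
  case (DD_eq s t) show ?case
    by (rule DD_Feq[OF TT_Fsub[OF DD_eq.hyps(1) DD_eq.prems] TT_Fsub[OF DD_eq.hyps(2) DD_eq.prems]])
next
  case (DD_ls s t) show ?case
    by (rule DD_Fls[OF TT_Fsub[OF DD_ls.hyps(1) DD_ls.prems] TT_Fsub[OF DD_ls.hyps(2) DD_ls.prems]])
next
  case (DD_not R) show ?case by (rule DD.DD_not) (rule DD_not.IH, rule DD_not.prems)
next
  case (DD_conj R S) show ?case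
    by (rule DD.DD_conj) (rule DD_conj.IH, rule DD_conj.prems, rule DD_conj.IH, rule DD_conj.prems)
next
  case (DD_bex t R)
  have "DD M (\<lambda>e. R (lift_sub \<sigma> e))" by (rule DD_bex.IH) (rule FF_lift_sub, rule DD_bex.prems)
  then have "DD M (\<lambda>e. \<exists>a. a \<prec> t (\<sigma> e) \<and> R (case_nat a (\<sigma> e)))"
    by (intro DD_Fbex TT_Fsub[OF DD_bex.hyps(1) DD_bex.prems]) (simp add: lift_sub_def)
  then show ?case .
qed

lemma FF_comp: assumes "FF t" "\<And>v. FF (\<lambda>e. \<sigma> e v)" shows "FF (\<lambda>e. t (\<sigma> e))"
proof -
  obtain b where b: "TT M b" "\<And>e. t e \<preceq> b e" and d: "DD M (\<lambda>e. e 0 = t (\<lambda>v. e (Suc v)))"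
    using assms(1) unfolding FF_def by blast
  have "DD M (\<lambda>e. lift_sub \<sigma> e 0 = t (\<lambda>v. lift_sub \<sigma> e (Suc v)))"
    by (rule DD_Fsub[OF d]) (rule FF_lift_sub[OF assms(2)])
  then have "DD M (\<lambda>e. e 0 = t (\<sigma> (\<lambda>v. e (Suc v))))" by (simp add: lift_sub_def)
  then show ?thesis by (rule FF_I[OF TT_Fsub[OF b(1) assms(2)] b(2)])
qed

lemma FF_case: "FF s \<Longrightarrow> (\<And>v. FF (\<lambda>e. \<sigma> e v)) \<Longrightarrow> FF (\<lambda>e. case_nat (s e) (\<sigma> e) v)"
  by (cases v) auto

lemma SG_Fsub: "SG M k R \<Longrightarrow> (\<And>v. FF (\<lambda>e. \<sigma> e v)) \<Longrightarrow> SG M k (\<lambda>e. R (\<sigma> e))"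
  and PG_Fsub: "PG M k R \<Longrightarrow> (\<And>v. FF (\<lambda>e. \<sigma> e v)) \<Longrightarrow> PG M k (\<lambda>e. R (\<sigma> e))"
proof -
  let ?S = "\<lambda>k (R :: (nat \<Rightarrow> 'a) \<Rightarrow> bool). \<forall>\<sigma> :: (nat \<Rightarrow> 'a) \<Rightarrow> nat \<Rightarrow> 'a. (\<forall>v. FF (\<lambda>e. \<sigma> e v)) \<longrightarrow> SG M k (\<lambda>e. R (\<sigma> e))"
  let ?P = "\<lambda>k (R :: (nat \<Rightarrow> 'a) \<Rightarrow> bool). \<forall>\<sigma> :: (nat \<Rightarrow> 'a) \<Rightarrow> nat \<Rightarrow> 'a. (\<forall>v. FF (\<lambda>e. \<sigma> e v)) \<longrightarrow> PG M k (\<lambda>e. R (\<sigma> e))"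
  have "(SG M k1 R1 \<longrightarrow> ?S k1 R1) \<and> (PG M k2 R2 \<longrightarrow> ?P k2 R2)" for k1 R1 k2 R2
  proof (rule SG_PG.induct[of M ?S ?P])
    fix R k assume "DD M R" then show "?S k R" "?P k R" by (blast intro: SG_DD PG_DD DD_Fsub)+
  next
    fix k R assume "?P k R" then show "?S (Suc k) R" by (blast intro: SG_PG)
  next
    fix k R assume "?S k R" then show "?P (Suc k) R" by (blast intro: PG_SG)
  next
    fix k R assume IH: "?S (Suc k) R"
    show "?S (Suc k) (\<lambda>e. \<exists>a. R (case_nat a e))"
    proof (intro allI impI)
      fix \<sigma> :: "(nat \<Rightarrow> 'a) \<Rightarrow> nat \<Rightarrow> 'a" assume s: "\<forall>v. FF (\<lambda>e. \<sigma> e v)"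
      have "SG M (Suc k) (\<lambda>e. R (lift_sub \<sigma> e))" using IH s by (blast intro: FF_lift_sub)
      from SG_ex[OF this] show "SG M (Suc k) (\<lambda>e. \<exists>a. R (case_nat a (\<sigma> e)))" by simp
    qed
  next
    fix k R assume IH: "?P (Suc k) R"
    show "?P (Suc k) (\<lambda>e. \<forall>a. R (case_nat a e))"
    proof (intro allI impI)
      fix \<sigma> :: "(nat \<Rightarrow> 'a) \<Rightarrow> nat \<Rightarrow> 'a" assume s: "\<forall>v. FF (\<lambda>e. \<sigma> e v)"
      have "PG M (Suc k) (\<lambda>e. R (lift_sub \<sigma> e))" using IH s by (blast intro: FF_lift_sub)
      from PG_all[OF this] show "PG M (Suc k) (\<lambda>e. \<forall>a. R (case_nat a (\<sigma> e)))" by simp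
    qed
  qed
  then show "SG M k R \<Longrightarrow> (\<And>v. FF (\<lambda>e. \<sigma> e v)) \<Longrightarrow> SG M k (\<lambda>e. R (\<sigma> e))"
    "PG M k R \<Longrightarrow> (\<And>v. FF (\<lambda>e. \<sigma> e v)) \<Longrightarrow> PG M k (\<lambda>e. R (\<sigma> e))" by blast+
qed

lemmas DDI = DD_Fbex DD_Fball DD_conj DD_disj DD_imp DD_not DD_Feq DD_Fls DD_Fle

lemma DD_Fexle: assumes "FF t" "DD M (\<lambda>e. P (\<lambda>v. e (Suc v)) (e 0))"
  shows "DD M (\<lambda>e. \<exists>a. a \<preceq> t e \<and> P e a)"
  unfolding less_Suc_le[symmetric] using assms by (intro DD_Fbex) auto
lemma DD_Fallle: assumes "FF t" "DD M (\<lambda>e. P (\<lambda>v. e (Suc v)) (e 0))"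
  shows "DD M (\<lambda>e. \<forall>a. a \<preceq> t e \<longrightarrow> P e a)"
  unfolding less_Suc_le[symmetric] using assms by (intro DD_Fball) auto

lemma DD_sub1: "DD M (\<lambda>e. P (e 0)) \<Longrightarrow> FF s \<Longrightarrow> DD M (\<lambda>e. P (s e))"
  by (drule DD_Fsub[where \<sigma> = "\<lambda>e v. s e"]) auto
lemma FF_sub1: "FF (\<lambda>e. P (e 0)) \<Longrightarrow> FF s \<Longrightarrow> FF (\<lambda>e. P (s e))"
  by (drule FF_comp[where \<sigma> = "\<lambda>e v. s e"]) auto

lemma FF_pair: "FF s \<Longrightarrow> FF t \<Longrightarrow> FF (\<lambda>e. case_nat (s e) (\<lambda>_. t e) v)"
  by (intro FF_case)

lemma DD_sub2: "DD M (\<lambda>e. P (e 0) (e (Suc 0))) \<Longrightarrow> FF s \<Longrightarrow> FF t \<Longrightarrow> DD M (\<lambda>e. P (s e) (t e))"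
  by (drule DD_Fsub[where \<sigma> = "\<lambda>e. case_nat (s e) (\<lambda>_. t e)"]) (auto intro: FF_pair)
lemma FF_sub2: "FF (\<lambda>e. P (e 0) (e (Suc 0))) \<Longrightarrow> FF s \<Longrightarrow> FF t \<Longrightarrow> FF (\<lambda>e. P (s e) (t e))"
  by (drule FF_comp[where \<sigma> = "\<lambda>e. case_nat (s e) (\<lambda>_. t e)"]) (auto intro: FF_pair)
lemma SG_sub2: "SG M k (\<lambda>e. P (e 0) (e (Suc 0))) \<Longrightarrow> FF s \<Longrightarrow> FF t \<Longrightarrow> SG M k (\<lambda>e. P (s e) (t e))"
  by (drule SG_Fsub[where \<sigma> = "\<lambda>e. case_nat (s e) (\<lambda>_. t e)"]) (auto intro: FF_pair)
lemma PG_sub2: "PG M k (\<lambda>e. P (e 0) (e (Suc 0))) \<Longrightarrow> FF s \<Longrightarrow> FF t \<Longrightarrow> PG M k (\<lambda>e. P (s e) (t e))"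
  by (drule PG_Fsub[where \<sigma> = "\<lambda>e. case_nat (s e) (\<lambda>_. t e)"]) (auto intro: FF_pair)

lemma SG_bex: assumes "FF t" "SG M k (\<lambda>e. P (\<lambda>v. e (Suc v)) (e 0))" shows "SG M k (\<lambda>e. \<exists>a. a \<prec> t e \<and> P e a)"
proof (cases k)
  case 0 then show ?thesis using assms SG0_DD by (auto intro!: SG_DD DD_Fbex)
next
  case (Suc j) show ?thesis unfolding Suc
    by (rule SG_exI, rule SG_conj) (use assms Suc in \<open>auto intro!: SG_DD DD_Fls intro: FF_shift\<close>)
qed

lemma PG_ball: assumes "FF t" "PG M k (\<lambda>e. P (\<lambda>v. e (Suc v)) (e 0))" shows "PG M k (\<lambda>e. \<forall>a. a \<prec> t e \<longrightarrow> P e a)"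
  by (rule PG_iff[OF PG_not[OF SG_bex[OF assms(1) SG_not[OF assms(2)]]]]) auto

end

section \<open>Consequences of induction\<close>

context pam begin

text \<open>The new variable only has to exceed all old witnesses, which then reappear under bounded
  quantifiers. The hypothesis \<open>cl\<close> absorbs these into the Pi_m matrix;
  \<open>CL\<close> provides it for m \<le> n.\<close>

lemma contract:
  assumes cl: "\<And>P t. FF t \<Longrightarrow> PG M m (\<lambda>e. P (\<lambda>v. e (Suc v)) (e 0)) \<Longrightarrow> PG M m (\<lambda>e. \<exists>a. a \<prec> t e \<and> P e a)"
    and R: "SG M (Suc m) R"
  shows "\<exists>P. PG M m P \<and> (\<forall>e. R e \<longleftrightarrow> (\<exists>a. P (case_nat a e)))"
proof -
  let ?Q = "\<lambda>R. \<exists>P. PG M m P \<and> (\<forall>e. R e \<longleftrightarrow> (\<exists>a. P (case_nat a e)))"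
  have base: "?Q R" if "PG M m R" for R
    using PG_shift[OF that] by (intro exI[of _ "\<lambda>e. R (\<lambda>v. e (Suc v))"]) simp
  have "(SG M j1 R1 \<longrightarrow> (j1 = Suc m \<longrightarrow> ?Q R1)) \<and> (PG M j2 R2 \<longrightarrow> True)" for j1 R1 j2 R2
  proof (rule SG_PG.induct[of M "\<lambda>j R. j = Suc m \<longrightarrow> ?Q R" "\<lambda>j R. True"], goal_cases)
    case (1 R k) then show ?case using base PG_DD by blast
  next
    case (3 k R) then show ?case using base by blast
  next
    case (4 k R)
    show ?case
    proof
      assume "Suc k = Suc m"
      then obtain P where P: "PG M m P" "\<And>e. R e \<longleftrightarrow> (\<exists>a. P (case_nat a e))" using 4 by blast
      \<comment> \<open>The variable \<open>e 0\<close> is now a common bound of the old variable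
        \<open>b\<close> and of its witness \<open>y\<close>.\<close>
      let ?P = "\<lambda>e. \<exists>b. b \<prec> e 0 \<and> (\<exists>y. y \<prec> e 0 \<and> P (case_nat y (case_nat b (\<lambda>v. e (Suc v)))))"
      have "PG M m (\<lambda>e. P (case_nat (e 0) (case_nat (e (Suc 0)) (\<lambda>v. e (Suc (Suc (Suc v)))))))"
        by (rule PG_Fsub[OF P(1)]) (intro FF_case FF_var)
      then have "PG M m ?P"
        by (intro cl[OF FF_var, of "\<lambda>e b. \<exists>y. y \<prec> e 0 \<and> P (case_nat y (case_nat b (\<lambda>v. e (Suc v))))"]
           cl[OF FF_var, of "\<lambda>e y. P (case_nat y (case_nat (e 0) (\<lambda>v. e (Suc (Suc v)))))"])
      moreover have "(\<exists>a. R (case_nat a e)) \<longleftrightarrow> (\<exists>a. ?P (case_nat a e))" for e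
      proof
        assume "\<exists>a. R (case_nat a e)"
        then obtain a y where "P (case_nat y (case_nat a e))" using P(2) by blast
        moreover have "a \<prec> a \<oplus> y \<oplus> \<one>" "y \<prec> a \<oplus> y \<oplus> \<one>" by (simp_all add: less_Suc_le)
        ultimately have "?P (case_nat (a \<oplus> y \<oplus> \<one>) e)" by auto
        then show "\<exists>a. ?P (case_nat a e)" by blast
      next
        assume "\<exists>a. ?P (case_nat a e)" then show "\<exists>a. R (case_nat a e)" using P(2) by auto
      qed
      ultimately show "?Q (\<lambda>e. \<exists>a. R (case_nat a e))" by blast
    qed
  qed simp_all
  then show ?thesis using R by blast
qed

end

locale isig = pam +
  fixes n :: nat
  assumes IS: "ISigma n M"
begin

text \<open>The semantic form of the induction scheme: under \<open>mix\<close>, position 0 of the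
  environment is formula variable 0.\<close>

lemma ind:
  assumes P: "SG M n (\<lambda>e. P (e 0))" and 0: "P \<zero>" and S: "\<And>a. P a \<Longrightarrow> P (a \<oplus> \<one>)"
  shows "P a"
proof -
  obtain p c where p: "sigma n p" "\<And>e. P (e 0) = sat M (mix e c) p"
    using SG_PG_repr(1)[OF U P] unfolding repr_def by blast
  let ?E = "mix (\<lambda>_. \<zero>) c"
  have E: "sat M (?E(0 := a)) p = P a" for a
  proof -
    have "?E(0 := a) = mix ((\<lambda>_. \<zero>)(0 := a)) c" by (rule ext) (auto simp: mix_def elim!: evenE)
    then show ?thesis using p(2)[of "(\<lambda>_. \<zero>)(0 := a)"] by simp
  qed
  show ?thesis
    using IS p(1) 0 S unfolding ISigma_def U env_in_def E[symmetric] by blast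
qed

text \<open>Induction on m. For Sigma_{m+1}, contraction leaves one existential quantifier, and a
  common bound for the witnesses of all a below the term moves it in front of the bounded universal
  quantifier. That common bound is an instance of collection, obtained by Sigma_n induction on the
  length of the segment already treated; this is where m + 1 \<le> n enters. The Pi half follows by
  complement.\<close>

lemma CL:
  "m \<le> n \<Longrightarrow> (\<forall>P t. FF t \<longrightarrow> SG M m (\<lambda>e. P (\<lambda>v. e (Suc v)) (e 0)) \<longrightarrow> SG M m (\<lambda>e. \<forall>a. a \<prec> t e \<longrightarrow> P e a)) \<and>
    (\<forall>P t. FF t \<longrightarrow> PG M m (\<lambda>e. P (\<lambda>v. e (Suc v)) (e 0)) \<longrightarrow> PG M m (\<lambda>e. \<exists>a. a \<prec> t e \<and> P e a))"
proof (induction m)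
  case 0
  show ?case using SG0_DD PG0_DD by (auto intro!: SG_DD PG_DD DD_Fball DD_Fbex)
next
  case (Suc m)
  have cl: "PG M m (\<lambda>e. \<exists>a. a \<prec> t e \<and> P e a)" if "FF t" "PG M m (\<lambda>e. P (\<lambda>v. e (Suc v)) (e 0))" for P t
    using Suc that by simp
  have S: "SG M (Suc m) (\<lambda>e. \<forall>a. a \<prec> t e \<longrightarrow> P e a)" if t: "FF t" and P: "SG M (Suc m) (\<lambda>e. P (\<lambda>v. e (Suc v)) (e 0))" for P t
  proof -
    obtain Q where Q: "PG M m Q" "\<And>e. P (\<lambda>v. e (Suc v)) (e 0) \<longleftrightarrow> (\<exists>a. Q (case_nat a e))"
      using contract[OF cl P] by blast
    have Q': "P e a \<longleftrightarrow> (\<exists>y. Q (case_nat y (case_nat a e)))" for e a using Q(2)[of "case_nat a e"] by simp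
    have eq: "(\<exists>v. \<forall>a. a \<prec> t e \<longrightarrow> (\<exists>y. y \<prec> v \<and> Q (case_nat y (case_nat a e)))) \<longleftrightarrow> (\<forall>a. a \<prec> t e \<longrightarrow> P e a)" for e
    proof
      assume a: "\<forall>a. a \<prec> t e \<longrightarrow> P e a"
      \<comment> \<open>The second disjunct carries the induction beyond \<open>t e\<close>, where
        witnesses need not exist.\<close>
      let ?J = "\<lambda>j. (\<exists>v. \<forall>a. a \<prec> j \<longrightarrow> (\<exists>y. y \<prec> v \<and> Q (case_nat y (case_nat a e)))) \<or> t e \<prec> j"
      have "PG M m (\<lambda>e'. Q (case_nat (e' 0) (case_nat (e' (Suc 0)) e)))"
        by (rule PG_Fsub[OF Q(1)]) (intro FF_case FF_var FF_const)
      then have "PG M m (\<lambda>e'. \<forall>a. a \<prec> e' (Suc 0) \<longrightarrow> (\<exists>y. y \<prec> e' 0 \<and> Q (case_nat y (case_nat a e))))"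
        by (intro PG_ball[OF FF_var, where P = "\<lambda>e' a. (\<exists>y. y \<prec> e' 0 \<and> Q (case_nat y (case_nat a e)))"]
            cl[OF FF_var, of "\<lambda>e' y. Q (case_nat y (case_nat (e' 0) e))"])
      then have "SG M (Suc m) (\<lambda>e'. ?J (e' 0))"
        by (intro SG_disj SG_exI[where P = "\<lambda>e' v. \<forall>a. a \<prec> e' 0 \<longrightarrow> (\<exists>y. y \<prec> v \<and> Q (case_nat y (case_nat a e)))"])
          (simp add: SG_PG, intro SG_DD DD_Fls FF_const FF_var)
      then have J: "SG M n (\<lambda>e'. ?J (e' 0))" by (rule SG_mono) (rule Suc.prems)
      have "?J (t e)"
      proof (rule ind[OF J])
        show "?J \<zero>" by simp
        fix j assume j: "?J j"
        show "?J (j \<oplus> \<one>)"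
        proof (cases "t e \<preceq> j")
          case True then show ?thesis by (simp add: less_Suc_le)
        next
          case False
          then have jt: "j \<prec> t e" by (simp add: A.not_le)
          then have "\<not> t e \<prec> j" by (metis A.less_asym)
          then obtain v where v: "\<forall>a. a \<prec> j \<longrightarrow> (\<exists>y. y \<prec> v \<and> Q (case_nat y (case_nat a e)))" using j by blast
          obtain y where y: "Q (case_nat y (case_nat j e))" using a jt Q' by blast
          have "\<exists>z. z \<prec> v \<oplus> y \<oplus> \<one> \<and> Q (case_nat z (case_nat b e))" if "b \<prec> j \<oplus> \<one>" for b
          proof -
            consider "b \<prec> j" | "b = j" using \<open>b \<prec> j \<oplus> \<one>\<close> by (auto simp: less_Suc_le le_iff)
            then show ?thesis
            proof cases
              case 1
              then obtain z where "z \<prec> v" "Q (case_nat z (case_nat b e))" using v by blast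
              moreover have "z \<prec> v \<oplus> y \<oplus> \<one>" using \<open>z \<prec> v\<close> by (metis A.less_le_trans le_add(1))
              ultimately show ?thesis by blast
            next
              case 2 then show ?thesis using y le_add(2) by (metis less_Suc_le)
            qed
          qed
          then show ?thesis by blast
        qed
      qed
      then show "\<exists>v. \<forall>a. a \<prec> t e \<longrightarrow> (\<exists>y. y \<prec> v \<and> Q (case_nat y (case_nat a e)))" by simp
    qed (use Q' in blast)
    have "PG M m (\<lambda>e. Q (case_nat (e 0) (case_nat (e (Suc 0)) (\<lambda>v. e (Suc (Suc (Suc v)))))))"
      by (rule PG_Fsub[OF Q(1)]) (intro FF_case FF_var)
    then have "PG M m (\<lambda>e. \<forall>a. a \<prec> t (\<lambda>v. e (Suc v)) \<longrightarrow> (\<exists>y. y \<prec> e 0 \<and> Q (case_nat y (case_nat a (\<lambda>v. e (Suc v))))))"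
      by (intro PG_ball[OF FF_shift[OF t], where P = "\<lambda>e a. (\<exists>y. y \<prec> e 0 \<and> Q (case_nat y (case_nat a (\<lambda>v. e (Suc v)))))"]
            cl[OF FF_var, of "\<lambda>e y. Q (case_nat y (case_nat (e 0) (\<lambda>v. e (Suc (Suc v)))))"])
    then have "SG M (Suc m) (\<lambda>e. \<exists>v. \<forall>a. a \<prec> t e \<longrightarrow> (\<exists>y. y \<prec> v \<and> Q (case_nat y (case_nat a e))))"
      by (intro SG_exI[where P = "\<lambda>e v. \<forall>a. a \<prec> t e \<longrightarrow> (\<exists>y. y \<prec> v \<and> Q (case_nat y (case_nat a e)))"] SG_PG)
    then show ?thesis by (rule SG_iff) (rule eq)
  qed
  moreover have "PG M (Suc m) (\<lambda>e. \<exists>a. a \<prec> t e \<and> P e a)" if t: "FF t" and P: "PG M (Suc m) (\<lambda>e. P (\<lambda>v. e (Suc v)) (e 0))" for P t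
    by (rule PG_iff[OF PG_not[OF S[OF t SG_not[OF P]]]]) auto
  ultimately show ?case by blast
qed

lemma SG_ball: "FF t \<Longrightarrow> SG M n (\<lambda>e. P (\<lambda>v. e (Suc v)) (e 0)) \<Longrightarrow> SG M n (\<lambda>e. \<forall>a. a \<prec> t e \<longrightarrow> P e a)"
  and PG_bex: "FF t \<Longrightarrow> PG M n (\<lambda>e. P (\<lambda>v. e (Suc v)) (e 0)) \<Longrightarrow> PG M n (\<lambda>e. \<exists>a. a \<prec> t e \<and> P e a)"
  using CL[of n] by simp_all

lemma contract_n: "SG M (Suc n) R \<Longrightarrow> \<exists>P. PG M n P \<and> (\<forall>e. R e \<longleftrightarrow> (\<exists>a. P (case_nat a e)))"
  by (rule contract[OF PG_bex])

text \<open>Descent from a counterexample \<open>a\<close>: the y for which a - y is again a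
  counterexample form a Sigma_n set containing zero and closed under successor as long as zero is no
  counterexample. So y = a is reached, which makes zero a counterexample after all.\<close>

lemma ind_PG:
  assumes P: "PG M n (\<lambda>e. P (e 0))" and 0: "P \<zero>" and S: "\<And>a. P a \<Longrightarrow> P (a \<oplus> \<one>)"
  shows "P a"
proof (rule ccontr)
  assume a: "\<not> P a"
  let ?Q = "\<lambda>y. \<exists>x. x \<prec> a \<oplus> \<one> \<and> (x \<oplus> y = a \<and> \<not> P x)"
  have "SG M n (\<lambda>e. \<not> P (e 0))" by (rule SG_not[OF P])
  then have Q: "SG M n (\<lambda>e. ?Q (e 0))"
    by (intro SG_bex[OF FF_const] SG_conj) (auto intro!: SG_DD DD_Feq)
  have "?Q a"
  proof (rule ind[OF Q])
    show "?Q \<zero>" using a by (intro exI[of _ a]) simp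
    fix y assume "?Q y"
    then obtain x where x: "x \<oplus> y = a" "\<not> P x" by blast
    then obtain x' where x': "x = x' \<oplus> \<one>" using 0 zero_or_Suc by metis
    then have "\<not> P x'" "x' \<oplus> (y \<oplus> \<one>) = a" using x S by (auto simp: ac_simps A.add.assoc A.add.commute A.add.left_commute)
    moreover have "x' \<preceq> a" using calculation(2) le_add(1) by metis
    ultimately show "?Q (y \<oplus> \<one>)" by (auto simp: less_Suc_le)
  qed
  then show False using 0 by auto
qed

text \<open>Without a least element, the Pi_n statement that nothing below x satisfies
  \<open>P\<close> would be inductive.\<close>

lemma least_SG:
  assumes P: "SG M n (\<lambda>e. P (e 0))" and a: "P a"
  shows "\<exists>x. P x \<and> (\<forall>y. y \<prec> x \<longrightarrow> \<not> P y)"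
proof (rule ccontr)
  assume no: "\<not> ?thesis"
  let ?Q = "\<lambda>x. \<forall>y. y \<prec> x \<longrightarrow> \<not> P y"
  have "PG M n (\<lambda>e. ?Q (e 0))" by (intro PG_ball[OF FF_var] PG_not[OF P])
  then have "?Q (a \<oplus> \<one>)"
    by (rule ind_PG) (use no in \<open>auto simp: less_Suc_le le_iff\<close>)
  then show False using a by auto
qed

lemma least_PG:
  assumes P: "PG M n (\<lambda>e. P (e 0))" and a: "P a"
  shows "\<exists>x. P x \<and> (\<forall>y. y \<prec> x \<longrightarrow> \<not> P y)"
proof (rule ccontr)
  assume no: "\<not> ?thesis"
  let ?Q = "\<lambda>x. \<forall>y. y \<prec> x \<longrightarrow> \<not> P y"
  have "SG M n (\<lambda>e. ?Q (e 0))" by (intro SG_ball[OF FF_var] SG_not[OF P])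
  then have "?Q (a \<oplus> \<one>)"
    by (rule ind) (use no in \<open>auto simp: less_Suc_le le_iff\<close>)
  then show False using a by auto
qed

lemma ind_DD: "DD M (\<lambda>e. P (e 0)) \<Longrightarrow> P \<zero> \<Longrightarrow> (\<And>a. P a \<Longrightarrow> P (a \<oplus> \<one>)) \<Longrightarrow> P a"
  by (rule ind) (rule SG_DD)

lemma least_DD: "DD M (\<lambda>e. P (e 0)) \<Longrightarrow> P a \<Longrightarrow> \<exists>x. P x \<and> (\<forall>y. y \<prec> x \<longrightarrow> \<not> P y)"
  by (rule least_SG) (rule SG_DD)

text \<open>The reflection of x to B - x turns a largest element into a least one.\<close>

lemma max_PG:
  assumes P: "PG M n (\<lambda>e. P (e 0))" and a: "P a" and B: "\<And>x. P x \<Longrightarrow> x \<prec> B"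
  shows "\<exists>x. P x \<and> (\<forall>y. x \<prec> y \<longrightarrow> \<not> P y)"
proof -
  let ?Q = "\<lambda>y. \<exists>x. x \<prec> B \<and> (x \<oplus> y = B \<and> P x)"
  have "PG M n (\<lambda>e. ?Q (e 0))"
    by (intro PG_bex[OF FF_const] PG_conj) (auto intro!: PG_DD DD_Feq P)
  moreover obtain w where "?Q w" using a B diff_ex by (metis le_iff)
  ultimately obtain y where y: "?Q y" "\<And>y'. y' \<prec> y \<Longrightarrow> \<not> ?Q y'" using least_PG[of ?Q w] by blast
  then obtain x where x: "x \<prec> B" "x \<oplus> y = B" "P x" by blast
  have "\<not> P x'" if l: "x \<prec> x'" for x'
  proof
    assume p: "P x'"
    obtain y' where y': "x' \<oplus> y' = B" using B[OF p] diff_ex by (metis le_iff)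
    have "y' \<prec> y"
    proof (rule ccontr)
      assume "\<not> y' \<prec> y"
      then have "x \<oplus> y \<prec> x' \<oplus> y'" using l by (simp add: A.not_less A.add_less_le_mono)
      then show False using x y' by simp
    qed
    then show False using y(2) p y' B by blast
  qed
  then show ?thesis using x by blast
qed

text \<open>The same induction on initial segments as in \<open>CL\<close>. With n a successor, the
  unbounded quantifier over the bound \<open>v\<close> stays within Sigma_n.\<close>

lemma coll_SG:
  assumes m: "n = Suc m" and R: "SG M n (\<lambda>e. R (e 0) (e (Suc 0)))" and tot: "\<And>i. i \<prec> u \<Longrightarrow> \<exists>a. R i a"
  shows "\<exists>v. \<forall>i. i \<prec> u \<longrightarrow> (\<exists>a. a \<prec> v \<and> R i a)"
proof -
  let ?J = "\<lambda>j. (\<exists>v. \<forall>i. i \<prec> j \<longrightarrow> (\<exists>a. a \<prec> v \<and> R i a)) \<or> u \<prec> j"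
  have "SG M n (\<lambda>e. R (e (Suc 0)) (e 0))" by (rule SG_sub2[OF R]) auto
  then have "SG M n (\<lambda>e. \<forall>i. i \<prec> e (Suc 0) \<longrightarrow> (\<exists>a. a \<prec> e 0 \<and> R i a))"
    by (intro SG_ball[OF FF_var, where P = "\<lambda>e i. \<exists>a. a \<prec> e 0 \<and> R i a"] SG_bex[OF FF_var, where P = "\<lambda>e a. R (e 0) a"])
  then have "SG M n (\<lambda>e. ?J (e 0))" unfolding m
    by (intro SG_disj SG_exI[where P = "\<lambda>e v. \<forall>i. i \<prec> e 0 \<longrightarrow> (\<exists>a. a \<prec> v \<and> R i a)"]) (auto intro!: SG_DD DD_Fls)
  then have "?J u"
  proof (rule ind)
    fix j assume j: "?J j"
    show "?J (j \<oplus> \<one>)"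
    proof (cases "u \<preceq> j")
      case True then show ?thesis by (simp add: less_Suc_le)
    next
      case False
      then have ju: "j \<prec> u" by (simp add: A.not_le)
      then obtain v where v: "\<forall>i. i \<prec> j \<longrightarrow> (\<exists>a. a \<prec> v \<and> R i a)" using j by (metis A.less_asym)
      obtain y where y: "R j y" using tot ju by blast
      have "\<exists>z. z \<prec> v \<oplus> y \<oplus> \<one> \<and> R b z" if "b \<prec> j \<oplus> \<one>" for b
      proof -
        consider "b \<prec> j" | "b = j" using \<open>b \<prec> j \<oplus> \<one>\<close> by (auto simp: less_Suc_le le_iff)
        then show ?thesis
        proof cases
          case 1
          then obtain z where z: "z \<prec> v" "R b z" using v by blast
          moreover have "z \<prec> v \<oplus> y \<oplus> \<one>" using z(1) by (metis A.less_le_trans le_add(1))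
          ultimately show ?thesis by blast
        next
          case 2 then show ?thesis using y le_add(2) by (metis less_Suc_le)
        qed
      qed
      then show ?thesis by blast
    qed
  qed simp
  then show ?thesis by simp
qed

lemma div_ex:
  assumes "d \<noteq> \<zero>" shows "\<exists>q r. x = q \<otimes> d \<oplus> r \<and> r \<prec> d"
proof -
  let ?P = "\<lambda>x. \<exists>q. q \<prec> x \<oplus> \<one> \<and> (\<exists>r. r \<prec> d \<and> x = q \<otimes> d \<oplus> r)"
  have "DD M (\<lambda>e. ?P (e 0))" by (intro DDI) auto
  then have "?P x"
  proof (rule ind_DD)
    show "?P \<zero>" using assms by (intro exI[of _ \<zero>] conjI) (simp_all add: pos_iff)
    fix x assume "?P x"
    then obtain q r where x: "x = q \<otimes> d \<oplus> r" "r \<prec> d" "q \<prec> x \<oplus> \<one>" by blast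
    show "?P (x \<oplus> \<one>)"
    proof (cases "r \<oplus> \<one> \<prec> d")
      case True
      have a: "q \<prec> x \<oplus> \<one> \<oplus> \<one>" by (rule A.less_trans[OF x(3) less_add_one])
      have "x \<oplus> \<one> = q \<otimes> d \<oplus> (r \<oplus> \<one>)" using x(1) by (simp add: A.add.assoc)
      then have "\<exists>r. r \<prec> d \<and> x \<oplus> \<one> = q \<otimes> d \<oplus> r" using True by (intro exI[of _ "r \<oplus> \<one>"] conjI)
      from conjI[OF a this] show ?thesis by (rule exI[of _ q])
    next
      case False
      then have "r \<oplus> \<one> = d" using x(2) Suc_le_less[of r d] le_iff[of "r \<oplus> \<one>" d] by blast
      then have "x \<oplus> \<one> = (q \<oplus> \<one>) \<otimes> d \<oplus> \<zero>" using x(1) by (simp add: A.add.assoc A.distrib_right)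
      moreover have "\<zero> \<prec> d" using assms by (simp add: pos_iff)
      ultimately have "\<exists>r. r \<prec> d \<and> x \<oplus> \<one> = (q \<oplus> \<one>) \<otimes> d \<oplus> r" by (intro exI[of _ \<zero>] conjI)
      from conjI[OF A.add_strict_right_mono[OF x(3)] this] show ?thesis by (rule exI[of _ "q \<oplus> \<one>"])
    qed
  qed
  then show ?thesis by blast
qed

end

context pam begin

lemma div_uniq_aux:
  assumes "q \<otimes> d \<oplus> r = q' \<otimes> d \<oplus> r'" "r \<prec> d" shows "\<not> q \<prec> q'"
proof
  assume "q \<prec> q'"
  then have "(q \<oplus> \<one>) \<otimes> d \<preceq> q' \<otimes> d" by (intro mult_mono') (auto simp: Suc_le_less)
  moreover have "q \<otimes> d \<oplus> r \<prec> (q \<oplus> \<one>) \<otimes> d" using assms(2) by (simp add: A.distrib_right)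
  ultimately have "q \<otimes> d \<oplus> r \<prec> q' \<otimes> d \<oplus> r'" by (meson A.less_le_trans le_add(1))
  then show False using assms(1) by simp
qed

lemma div_uniq:
  assumes "q \<otimes> d \<oplus> r = q' \<otimes> d \<oplus> r'" "r \<prec> d" "r' \<prec> d" shows "q = q'" "r = r'"
proof -
  show "q = q'" using div_uniq_aux[OF assms(1,2)] div_uniq_aux[OF assms(1)[symmetric] assms(3)] ax(11) by blast
  then show "r = r'" using assms(1) by simp
qed

end

section \<open>Exponentiation and coding\<close>

locale isige = isig +
  assumes EX: "Exp M"
begin

text \<open>Goedel's beta function, \<open>r\<close> being the remainder of \<open>c\<close> modulo
  1 + (i+1) d, in the form in which \<open>exp_matrix\<close> spells it out.\<close>

definition beta_rel :: "'a \<Rightarrow> 'a \<Rightarrow> 'a \<Rightarrow> 'a \<Rightarrow> bool" where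
  "beta_rel c d i r \<longleftrightarrow> (\<exists>q. q \<prec> c \<oplus> \<one> \<and> (c = q \<otimes> (\<one> \<oplus> (i \<oplus> \<one>) \<otimes> d) \<oplus> r \<and> r \<prec> \<one> \<oplus> (i \<oplus> \<one>) \<otimes> d))"

lemma exp_codes:
  "\<exists>c d. beta_rel c d \<zero> \<one> \<and> (\<forall>i. i \<prec> W \<longrightarrow> (\<exists>r. r \<prec> c \<oplus> \<one> \<and> (beta_rel c d i r \<and> beta_rel c d (i \<oplus> \<one>) (r \<oplus> r))))"
proof -
  let ?e = "(\<lambda>_. \<zero>) :: nat \<Rightarrow> 'a"
  have "sat M ?e exp_sentence" using EX unfolding Exp_def env_in_def U by blast
  then obtain y c d where s: "sat M (?e(0 := W, 1 := y, 2 := c, 3 := d)) exp_matrix"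
    unfolding exp_sentence_def sat.simps U by blast
  have "beta_rel c d \<zero> \<one>" using s unfolding exp_matrix_def rem_is_def bmod_def beta_rel_def by (simp add: U)
  moreover have "\<exists>r. r \<prec> c \<oplus> \<one> \<and> (beta_rel c d i r \<and> beta_rel c d (i \<oplus> \<one>) (r \<oplus> r))" if "i \<prec> W" for i
    using s that unfolding exp_matrix_def rem_is_def bmod_def beta_rel_def by (simp add: U)
  ultimately show ?thesis by blast
qed

text \<open>The beta code of the powers 2^0, ..., 2^W is kept as a parameter, so that powers of two
  up to \<open>W\<close> have a bounded graph with values at most \<open>c\<close>. Beyond
  \<open>W\<close> the function returns whatever remainder the code gives.\<close>

lemma exp_fun: "\<exists>E. FF (\<lambda>e. E (e 0)) \<and> E \<zero> = \<one> \<and> (\<forall>i. i \<prec> W \<longrightarrow> E (i \<oplus> \<one>) = E i \<oplus> E i)"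
proof -
  obtain c d where cd: "beta_rel c d \<zero> \<one>"
    "\<And>i. i \<prec> W \<Longrightarrow> \<exists>r. r \<prec> c \<oplus> \<one> \<and> (beta_rel c d i r \<and> beta_rel c d (i \<oplus> \<one>) (r \<oplus> r))" using exp_codes by blast
  have uniq: "r = r'" if "beta_rel c d i r" "beta_rel c d i r'" for i r r'
    using that div_uniq(2) unfolding beta_rel_def by metis
  define E where "E i = (THE r. beta_rel c d i r)" for i
  have E: "E i = r" if "beta_rel c d i r" for i r
    unfolding E_def using that uniq by blast
  have tot: "\<exists>r. beta_rel c d i r" for i
  proof -
    have nz: "\<one> \<oplus> (i \<oplus> \<one>) \<otimes> d \<noteq> \<zero>" by (metis ax(2) Suc_neq_zero)
    obtain q r where qr: "c = q \<otimes> (\<one> \<oplus> (i \<oplus> \<one>) \<otimes> d) \<oplus> r" "r \<prec> \<one> \<oplus> (i \<oplus> \<one>) \<otimes> d" using div_ex[OF nz] by blast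
    have "\<one> \<preceq> \<one> \<oplus> (i \<oplus> \<one>) \<otimes> d" by simp
    then have "q \<otimes> \<one> \<preceq> q \<otimes> (\<one> \<oplus> (i \<oplus> \<one>) \<otimes> d)" by (intro mult_mono') simp_all
    then have "q \<preceq> c" using qr(1) le_add(1) by (metis A.order_trans ax(8))
    then show ?thesis using qr unfolding beta_rel_def less_Suc_le by blast
  qed
  have Eiff: "r = E i \<longleftrightarrow> beta_rel c d i r" for i r using E tot by metis
  have "DD M (\<lambda>e. beta_rel c d (e (Suc 0)) (e 0))" unfolding beta_rel_def by (intro DDI) auto
  then have "DD M (\<lambda>e. e 0 = E (e (Suc 0)))" unfolding Eiff .
  moreover have "E i \<preceq> c" for i
  proof -
    have "beta_rel c d i (E i)" using Eiff by blast
    then show ?thesis unfolding beta_rel_def using le_add(2) by metis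
  qed
  ultimately have "FF (\<lambda>e. E (e 0))" by (intro FF_I[OF FF_const])
  moreover have "E \<zero> = \<one>" by (rule E) (rule cd)
  moreover have "E (i \<oplus> \<one>) = E i \<oplus> E i" if "i \<prec> W" for i
    using cd(2)[OF that] E by metis
  ultimately show ?thesis by blast
qed

end

section \<open>Binary digits and codes of bounded sets\<close>

locale pow2 = isig +
  fixes E :: "'a \<Rightarrow> 'a" and W :: 'a
  assumes FE: "FF (\<lambda>e. E (e 0))" and E0: "E \<zero> = \<one>" and ES: "\<And>i. i \<prec> W \<Longrightarrow> E (i \<oplus> \<one>) = E i \<oplus> E i"
begin

lemma FF_E: "FF t \<Longrightarrow> FF (\<lambda>e. E (t e))" by (rule FF_sub1[OF FE])

lemma E_pos: "i \<preceq> W \<Longrightarrow> \<zero> \<prec> E i"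
proof -
  have "DD M (\<lambda>e. e 0 \<preceq> W \<longrightarrow> \<zero> \<prec> E (e 0))" by (intro DDI FF_E) auto
  then have "i \<preceq> W \<longrightarrow> \<zero> \<prec> E i"
  proof (rule ind_DD)
    fix a assume "a \<preceq> W \<longrightarrow> \<zero> \<prec> E a"
    then show "a \<oplus> \<one> \<preceq> W \<longrightarrow> \<zero> \<prec> E (a \<oplus> \<one>)"
      using ES[of a] Suc_le_less[of a W] by (auto simp: le_iff A.add_pos_pos)
  qed (simp add: E0)
  then show "i \<preceq> W \<Longrightarrow> \<zero> \<prec> E i" by blast
qed

lemma E_dvd: assumes "i \<prec> j" "j \<preceq> W" shows "\<exists>m. E j = m \<otimes> (E i \<oplus> E i)"
proof -
  let ?P = "\<lambda>j. (i \<prec> j \<and> j \<preceq> W) \<longrightarrow> (\<exists>m. m \<prec> E j \<oplus> \<one> \<and> E j = m \<otimes> (E i \<oplus> E i))"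
  have iW: "i \<prec> W" using assms by (rule A.less_le_trans)
  have "DD M (\<lambda>e. ?P (e 0))" by (intro DDI FF_E) (auto intro: FF_E)
  then have "?P j"
  proof (rule ind_DD)
    fix a assume IH: "?P a"
    show "?P (a \<oplus> \<one>)"
    proof
      assume a: "i \<prec> a \<oplus> \<one> \<and> a \<oplus> \<one> \<preceq> W"
      then have aW: "a \<prec> W" by (simp add: Suc_le_less)
      have Ea: "E (a \<oplus> \<one>) = E a \<oplus> E a" by (rule ES[OF aW])
      consider "i = a" | "i \<prec> a" using a by (auto simp: less_Suc_le le_iff)
      then have "\<exists>m. E (a \<oplus> \<one>) = m \<otimes> (E i \<oplus> E i)"
      proof cases
        case 1 then show ?thesis using Ea by (metis A.mult_1_left)
      next
        case 2
        then obtain m where "E a = m \<otimes> (E i \<oplus> E i)" using IH aW by (auto simp: le_iff)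
        then have "E (a \<oplus> \<one>) = (m \<oplus> m) \<otimes> (E i \<oplus> E i)" using Ea by (simp only: A.distrib_right)
        then show ?thesis by blast
      qed
      then obtain m where m: "E (a \<oplus> \<one>) = m \<otimes> (E i \<oplus> E i)" by blast
      have "\<zero> \<prec> E i" using E_pos iW by (simp add: le_iff)
      then have "\<one> \<preceq> E i \<oplus> E i" using Suc_le_less[of \<zero> "E i \<oplus> E i"] A.add_pos_pos by simp
      then have "m \<otimes> \<one> \<preceq> E (a \<oplus> \<one>)" unfolding m by (intro mult_mono') simp_all
      then show "\<exists>m. m \<prec> E (a \<oplus> \<one>) \<oplus> \<one> \<and> E (a \<oplus> \<one>) = m \<otimes> (E i \<oplus> E i)" using m by (auto simp: less_Suc_le)
    qed
  qed simp
  then show ?thesis using assms by blast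
qed

text \<open>\<open>E i \<oplus> E i\<close> stands for 2^(i+1); it has this value even at i = W,
  where the recursion for \<open>E\<close> ends.\<close>

definition bit :: "'a \<Rightarrow> 'a \<Rightarrow> bool" where
  "bit z i \<longleftrightarrow> (\<exists>q. q \<prec> z \<oplus> \<one> \<and> (\<exists>r. r \<prec> E i \<and> z = q \<otimes> (E i \<oplus> E i) \<oplus> (E i \<oplus> r)))"

lemma DD_bit: "DD M (\<lambda>e. bit (e 0) (e (Suc 0)))"
  unfolding bit_def by (intro DDI) (auto intro!: FF_E)

lemma E_le_T: "i \<preceq> W \<Longrightarrow> r \<prec> E i \<Longrightarrow> r \<prec> E i \<oplus> E i" "i \<preceq> W \<Longrightarrow> r \<prec> E i \<Longrightarrow> E i \<oplus> r \<prec> E i \<oplus> E i"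
  by (auto intro: A.less_le_trans)

lemma bit_iff:
  assumes i: "i \<preceq> W" and z: "z = q \<otimes> (E i \<oplus> E i) \<oplus> r" and r: "r \<prec> E i \<oplus> E i"
  shows "bit z i \<longleftrightarrow> E i \<preceq> r"
proof
  assume "bit z i"
  then obtain q' r' where "r' \<prec> E i" "z = q' \<otimes> (E i \<oplus> E i) \<oplus> (E i \<oplus> r')" unfolding bit_def by blast
  then have "r = E i \<oplus> r'" using div_uniq(2)[of q "E i \<oplus> E i" r q' "E i \<oplus> r'"] z r by auto
  then show "E i \<preceq> r" by simp
next
  assume "E i \<preceq> r"
  then obtain r' where r': "r = E i \<oplus> r'" using diff_ex by blast
  then have "r' \<prec> E i" using r by simp
  moreover have "q \<preceq> z"
  proof -
    have "\<one> \<preceq> E i \<oplus> E i" using Suc_le_less[of \<zero> "E i \<oplus> E i"] E_pos[OF i] A.add_pos_pos by simp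
    then have "q \<otimes> \<one> \<preceq> q \<otimes> (E i \<oplus> E i)" by (intro mult_mono') simp_all
    then show ?thesis using z le_add(1) by (metis A.order_trans ax(8))
  qed
  ultimately show "bit z i" unfolding bit_def less_Suc_le using z r' by blast
qed

lemma T_nz: "i \<preceq> W \<Longrightarrow> E i \<oplus> E i \<noteq> \<zero>"
  using E_pos[of i] A.add_pos_pos[of "E i" "E i"] pos_iff by blast

lemma bit_shift: assumes i: "i \<preceq> W" shows "bit (k \<otimes> (E i \<oplus> E i) \<oplus> z) i \<longleftrightarrow> bit z i"
proof -
  obtain q r where z: "z = q \<otimes> (E i \<oplus> E i) \<oplus> r" "r \<prec> E i \<oplus> E i" using div_ex[OF T_nz[OF i]] by blast
  have "k \<otimes> (E i \<oplus> E i) \<oplus> z = (k \<oplus> q) \<otimes> (E i \<oplus> E i) \<oplus> r" unfolding z(1) A.distrib_right A.add.assoc ..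
  then show ?thesis using bit_iff[OF i _ z(2)] z(1) by blast
qed

text \<open>A zero digit at place i leaves room for 2^i inside the current block of length 2^(i+1),
  so the addition does not reach the next multiple.\<close>

lemma bit_grow:
  assumes i: "i \<preceq> W" and nb: "\<not> bit R i" and l: "R \<prec> k \<otimes> (E i \<oplus> E i)"
  shows "R \<oplus> E i \<prec> k \<otimes> (E i \<oplus> E i)"
proof -
  let ?T = "E i \<oplus> E i"
  obtain q r where R: "R = q \<otimes> ?T \<oplus> r" "r \<prec> ?T" using div_ex[OF T_nz[OF i]] by blast
  have r: "r \<prec> E i" using bit_iff[OF i R] nb by (simp add: A.not_le)
  have "q \<prec> k"
  proof (rule ccontr)
    assume "\<not> q \<prec> k"
    then have "k \<otimes> ?T \<preceq> q \<otimes> ?T" by (intro mult_mono') (auto simp: A.not_less)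
    then have "k \<otimes> ?T \<preceq> R" unfolding R(1) using le_add(1) A.order_trans by blast
    then show False using l by (simp add: A.not_le[symmetric])
  qed
  then have "(q \<oplus> \<one>) \<otimes> ?T \<preceq> k \<otimes> ?T" by (intro mult_mono') (auto simp: Suc_le_less)
  moreover have "R \<oplus> E i \<prec> (q \<oplus> \<one>) \<otimes> ?T"
    using r unfolding R(1) by (simp add: A.distrib_right A.add.assoc)
  ultimately show ?thesis by (rule A.less_le_trans[rotated])
qed

text \<open>Adding 2^j at a zero digit causes no carry. For places i below j the summand is a
  multiple of 2^(i+1) and disappears modulo it; for places above j, \<open>bit_grow\<close> keeps
  the sum on the same side of both 2^i and 2^(i+1).\<close>

lemma bit_flip:
  assumes j: "j \<prec> W" and nb: "\<not> bit z j" and z: "z \<prec> E W"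
  shows "z \<oplus> E j \<prec> E W" "i \<prec> W \<Longrightarrow> bit (z \<oplus> E j) i \<longleftrightarrow> bit z i \<or> i = j"
proof -
  have j': "j \<preceq> W" using j by (simp add: le_iff)
  obtain m where "E W = m \<otimes> (E j \<oplus> E j)" using E_dvd[OF j] by auto
  then show "z \<oplus> E j \<prec> E W" using bit_grow[OF j' nb, of m] z by simp
  assume i: "i \<prec> W"
  then have i': "i \<preceq> W" by (simp add: le_iff)
  consider "i = j" | "i \<prec> j" | "j \<prec> i" using ax(11) by blast
  then show "bit (z \<oplus> E j) i \<longleftrightarrow> bit z i \<or> i = j"
  proof cases
    case 1
    obtain q r where R: "z = q \<otimes> (E j \<oplus> E j) \<oplus> r" "r \<prec> E j \<oplus> E j" using div_ex[OF T_nz[OF j']] by blast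
    have r: "r \<prec> E j" using bit_iff[OF j' R] nb by (simp add: A.not_le)
    have "z \<oplus> E j = q \<otimes> (E j \<oplus> E j) \<oplus> (E j \<oplus> r)" unfolding R(1) by (simp add: A.add.assoc A.add.commute A.add.left_commute)
    then have "bit (z \<oplus> E j) j" using bit_iff[OF j'] E_le_T(2)[OF j' r] by auto
    then show ?thesis using 1 by simp
  next
    case 2
    obtain m where "E j = m \<otimes> (E i \<oplus> E i)" using E_dvd[OF 2 j'] by auto
    then have "bit (z \<oplus> E j) i \<longleftrightarrow> bit z i" using bit_shift[OF i', of m z] by (simp add: A.add.commute)
    then show ?thesis using 2 by auto
  next
    case 3
    \<comment> \<open>Both 2^i and 2^(i+1) are multiples of 2^(j+1), so \<open>bit_grow\<close>
      applies with either of them as the barrier.\<close>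
    obtain m where m: "E i = m \<otimes> (E j \<oplus> E j)" using E_dvd[OF 3 i'] by auto
    have T: "E i \<oplus> E i = (m \<oplus> m) \<otimes> (E j \<oplus> E j)" unfolding m A.distrib_right ..
    obtain q r where R: "z = q \<otimes> (E i \<oplus> E i) \<oplus> r" "r \<prec> E i \<oplus> E i" using div_ex[OF T_nz[OF i']] by blast
    have "z = (q \<otimes> (m \<oplus> m)) \<otimes> (E j \<oplus> E j) \<oplus> r" unfolding R(1) T A.mult.assoc ..
    then have nr: "\<not> bit r j" using bit_shift[OF j'] nb by blast
    have r': "r \<oplus> E j \<prec> E i \<oplus> E i" using bit_grow[OF j' nr] R(2) unfolding T .
    have "z \<oplus> E j = q \<otimes> (E i \<oplus> E i) \<oplus> (r \<oplus> E j)" unfolding R(1) A.add.assoc ..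
    then have "bit (z \<oplus> E j) i \<longleftrightarrow> E i \<preceq> r \<oplus> E j" using bit_iff[OF i' _ r'] by blast
    also have "\<dots> \<longleftrightarrow> E i \<preceq> r"
    proof
      assume a: "E i \<preceq> r \<oplus> E j"
      show "E i \<preceq> r"
      proof (rule ccontr)
        assume "\<not> E i \<preceq> r"
        then have "r \<prec> m \<otimes> (E j \<oplus> E j)" using m by (simp add: A.not_le)
        then have "r \<oplus> E j \<prec> E i" using bit_grow[OF j' nr] m by simp
        then show False using a by (simp add: A.not_le[symmetric])
      qed
    next
      assume "E i \<preceq> r" then show "E i \<preceq> r \<oplus> E j" using A.order_trans le_add(1) by blast
    qed
    also have "\<dots> \<longleftrightarrow> bit z i" using bit_iff[OF i' R] by simp
    finally show ?thesis using 3 by auto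
  qed
qed

text \<open>A bounded \<open>\<Pi>\<^sub>n\<close> set is coded by the largest number all of whose binary digits belong
  to the set; this needs the least number principle only, not collection.\<close>

lemma comp_PG:
  assumes X: "PG M n (\<lambda>e. X (e 0))"
  shows "\<exists>z. z \<prec> E W \<and> (\<forall>i. i \<prec> W \<longrightarrow> (bit z i \<longleftrightarrow> X i))"
proof -
  let ?P = "\<lambda>z. z \<prec> E W \<and> (\<forall>i. i \<prec> W \<longrightarrow> bit z i \<longrightarrow> X i)"
  have "DD M (\<lambda>e. bit (e (Suc 0)) (e 0))" by (rule DD_sub2[OF DD_bit]) auto
  then have "PG M n (\<lambda>e. ?P (e 0))"
    by (intro PG_conj PG_ball[OF FF_const, where P = "\<lambda>e i. bit (e 0) i \<longrightarrow> X i"] PG_imp X)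
      (simp_all add: SG_DD PG_DD DD_Fls FF_var FF_const)
  moreover have "?P \<zero>"
  proof -
    have "\<not> bit \<zero> i" if "i \<prec> W" for i
    proof -
      have i: "i \<preceq> W" "\<zero> \<prec> E i" using that E_pos by (auto simp: le_iff)
      then have "bit \<zero> i \<longleftrightarrow> E i \<preceq> \<zero>" by (intro bit_iff[where q = \<zero>]) (auto intro: E_le_T)
      then show ?thesis using i by auto
    qed
    then show ?thesis using E_pos by auto
  qed
  ultimately obtain z where z: "?P z" and mx: "\<And>y. z \<prec> y \<Longrightarrow> \<not> ?P y"
    using max_PG[of ?P \<zero> "E W"] by blast
  have "bit z i" if i: "i \<prec> W" "X i" for i
  proof (rule ccontr)
    assume nb: "\<not> bit z i"
    have "z \<prec> z \<oplus> E i" using E_pos[of i] i by (auto simp: le_iff)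
    moreover have "?P (z \<oplus> E i)" using bit_flip[OF i(1) nb] z i by blast
    ultimately show False using mx by blast
  qed
  then show ?thesis using z by blast
qed

end

context isige begin

text \<open>The interface used from here on: a membership predicate with bounded definition, and a
  bound \<open>B\<close> on the codes, so that quantification over codes is bounded too.\<close>

lemma coding:
  "\<exists>B mem. DD M (\<lambda>e. mem (e 0) (e (Suc 0))) \<and>
     (\<forall>X. PG M n (\<lambda>e. X (e 0)) \<longrightarrow> (\<exists>z. z \<prec> B \<and> (\<forall>i. i \<prec> W \<longrightarrow> (mem z i \<longleftrightarrow> X i))))"
proof -
  obtain E where "FF (\<lambda>e. E (e 0))" "E \<zero> = \<one>" "\<forall>i. i \<prec> W \<longrightarrow> E (i \<oplus> \<one>) = E i \<oplus> E i" using exp_fun by blast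
  then interpret pow2 M n E W by unfold_locales auto
  show ?thesis using DD_bit comp_PG by blast
qed

end

section \<open>Comprehension and recursion\<close>

context pam begin

lemma FF_if: assumes "DD M P" "FF s" "FF t" shows "FF (\<lambda>e. if P e then s e else t e)"
proof (rule FF_I)
  show "FF (\<lambda>e. s e \<oplus> t e)" by (intro FF_ad assms)
  show "(if P e then s e else t e) \<preceq> s e \<oplus> t e" for e by simp
  have "DD M (\<lambda>e. (P (\<lambda>v. e (Suc v)) \<and> e 0 = s (\<lambda>v. e (Suc v))) \<or> (\<not> P (\<lambda>v. e (Suc v)) \<and> e 0 = t (\<lambda>v. e (Suc v))))"
    by (intro DDI DD_shift[OF assms(1)] FF_shift[OF assms(2)] FF_shift[OF assms(3)] FF_var)
  then show "DD M (\<lambda>e. e 0 = (if P (\<lambda>v. e (Suc v)) then s (\<lambda>v. e (Suc v)) else t (\<lambda>v. e (Suc v))))"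
    by (rule DD_iff) simp
qed

lemma pair_less: assumes "i \<prec> B" "y \<prec> Vb" shows "i \<otimes> Vb \<oplus> y \<prec> B \<otimes> Vb"
proof -
  have "(i \<oplus> \<one>) \<otimes> Vb \<preceq> B \<otimes> Vb" using assms(1) by (intro mult_mono') (auto simp: Suc_le_less)
  moreover have "i \<otimes> Vb \<oplus> y \<prec> (i \<oplus> \<one>) \<otimes> Vb" using assms(2) by (simp add: A.distrib_right)
  ultimately show ?thesis by (rule A.less_le_trans[rotated])
qed

end

context isige begin

text \<open>The code of the set becomes a parameter, and below \<open>W\<close> the complexity drops
  from level n to bounded; a Sigma_n set is reached through its complement. This collapse is why
  functions with bounded graphs suffice for Los at level n.\<close>

lemma comp1:
  assumes "PG M n (\<lambda>e. X (e 0)) \<or> SG M n (\<lambda>e. X (e 0))"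
  shows "\<exists>D. DD M (\<lambda>e. D (e 0)) \<and> (\<forall>i. i \<prec> W \<longrightarrow> D i = X i)"
proof -
  have 1: "\<exists>D. DD M (\<lambda>e. D (e 0)) \<and> (\<forall>i. i \<prec> W \<longrightarrow> D i = X i)" if X: "PG M n (\<lambda>e. X (e 0))" for X
  proof -
    obtain B mem where "DD M (\<lambda>e. mem (e 0) (e (Suc 0)))"
      "\<forall>X. PG M n (\<lambda>e. X (e 0)) \<longrightarrow> (\<exists>z. z \<prec> B \<and> (\<forall>i. i \<prec> W \<longrightarrow> (mem z i \<longleftrightarrow> X i)))"
      using coding by blast
    moreover from this obtain z where "\<forall>i. i \<prec> W \<longrightarrow> (mem z i \<longleftrightarrow> X i)" using X by blast
    ultimately show ?thesis by (intro exI[of _ "\<lambda>i. mem z i"]) (auto intro: DD_sub2)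
  qed
  show ?thesis
  proof (cases "PG M n (\<lambda>e. X (e 0))")
    case False
    then have "PG M n (\<lambda>e. \<not> X (e 0))" using assms PG_not by blast
    from 1[OF this] obtain D where "DD M (\<lambda>e. D (e 0))" "\<forall>i. i \<prec> W \<longrightarrow> D i = (\<not> X i)" by blast
    then show ?thesis by (intro exI[of _ "\<lambda>i. \<not> D i"]) (auto intro: DD_not)
  qed (rule 1)
qed

text \<open>The pair (i, y) is written as the number i Vb + y, from which division with remainder
  recovers both parts.\<close>

lemma comp2:
  assumes "PG M n (\<lambda>e. X (e 0) (e (Suc 0))) \<or> SG M n (\<lambda>e. X (e 0) (e (Suc 0)))"
  shows "\<exists>D. DD M (\<lambda>e. D (e 0) (e (Suc 0))) \<and> (\<forall>i y. i \<prec> B \<longrightarrow> y \<prec> Vb \<longrightarrow> D i y = X i y)"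
proof -
  have 1: "\<exists>D. DD M (\<lambda>e. D (e 0) (e (Suc 0))) \<and> (\<forall>i y. i \<prec> B \<longrightarrow> y \<prec> Vb \<longrightarrow> D i y = X i y)"
    if X: "PG M n (\<lambda>e. X (e 0) (e (Suc 0)))" for X
  proof -
    let ?X = "\<lambda>p. \<exists>i. i \<prec> B \<and> (\<exists>y. y \<prec> Vb \<and> (p = i \<otimes> Vb \<oplus> y \<and> X i y))"
    have "PG M n (\<lambda>e. X (e (Suc 0)) (e 0))" by (rule PG_sub2[OF X]) auto
    moreover have "DD M (\<lambda>e. e (Suc (Suc 0)) = e (Suc 0) \<otimes> Vb \<oplus> e 0)" by (intro DDI) auto
    ultimately have "PG M n (\<lambda>e. e (Suc (Suc 0)) = e (Suc 0) \<otimes> Vb \<oplus> e 0 \<and> X (e (Suc 0)) (e 0))"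
      by (intro PG_conj) (auto intro: PG_DD)
    then have "PG M n (\<lambda>e. ?X (e 0))"
      by (intro PG_bex[OF FF_const, where P = "\<lambda>e i. \<exists>y. y \<prec> Vb \<and> (e 0 = i \<otimes> Vb \<oplus> y \<and> X i y)"]
         PG_bex[OF FF_const, where P = "\<lambda>e y. e (Suc 0) = e 0 \<otimes> Vb \<oplus> y \<and> X (e 0) y"])
    then obtain D where D: "DD M (\<lambda>e. D (e 0))" "\<And>p. p \<prec> B \<otimes> Vb \<Longrightarrow> D p = ?X p" using comp1[of ?X "B \<otimes> Vb"] by blast
    have "D (i \<otimes> Vb \<oplus> y) = X i y" if "i \<prec> B" "y \<prec> Vb" for i y
      unfolding D(2)[OF pair_less[OF that]] using div_uniq[OF _ that(2)] that by blast
    moreover have "DD M (\<lambda>e. D (e 0 \<otimes> Vb \<oplus> e (Suc 0)))" by (rule DD_sub1[OF D(1)]) auto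
    ultimately show ?thesis by (intro exI[of _ "\<lambda>i y. D (i \<otimes> Vb \<oplus> y)"]) auto
  qed
  show ?thesis
  proof (cases "PG M n (\<lambda>e. X (e 0) (e (Suc 0)))")
    case False
    then have "PG M n (\<lambda>e. \<not> X (e 0) (e (Suc 0)))" using assms PG_not by blast
    from 1[of "\<lambda>i y. \<not> X i y", OF this] obtain D where "DD M (\<lambda>e. D (e 0) (e (Suc 0)))"
      "\<forall>i y. i \<prec> B \<longrightarrow> y \<prec> Vb \<longrightarrow> D i y = (\<not> X i y)" by blast
    then show ?thesis by (intro exI[of _ "\<lambda>i y. \<not> D i y"]) (auto intro: DD_not)
  qed (rule 1)
qed

text \<open>A sequence is coded as a bounded set, namely its graph with pairs written in base B + 1.
  The common bound \<open>C\<close> on codes keeps quantifiers over computations bounded.\<close>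

lemma seqs:
  "\<exists>C sq. FF (\<lambda>e. sq (e 0) (e (Suc 0))) \<and> (\<forall>z i. sq z i \<preceq> B) \<and>
     (\<forall>g. DD M (\<lambda>e. e 0 = g (e (Suc 0))) \<longrightarrow> (\<forall>i. i \<preceq> W \<longrightarrow> g i \<preceq> B) \<longrightarrow>
       (\<exists>z. z \<prec> C \<and> (\<forall>i. i \<preceq> W \<longrightarrow> sq z i = g i)))"
proof -
  let ?Vb = "B \<oplus> \<one>"
  obtain C mem where mem: "DD M (\<lambda>e. mem (e 0) (e (Suc 0)))"
    and code: "\<And>X. PG M n (\<lambda>e. X (e 0)) \<Longrightarrow> \<exists>z. z \<prec> C \<and> (\<forall>i. i \<prec> (W \<oplus> \<one>) \<otimes> ?Vb \<longrightarrow> (mem z i \<longleftrightarrow> X i))"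
    using coding by blast
  \<comment> \<open>Decoding is made total and single-valued: the least entry recorded at i, or zero
    if there is none.\<close>
  define G where "G z i s \<longleftrightarrow> (s \<prec> ?Vb \<and> mem z (i \<otimes> ?Vb \<oplus> s) \<and> (\<forall>t. t \<prec> s \<longrightarrow> \<not> mem z (i \<otimes> ?Vb \<oplus> t)))
      \<or> (s = \<zero> \<and> (\<forall>t. t \<prec> ?Vb \<longrightarrow> \<not> mem z (i \<otimes> ?Vb \<oplus> t)))" for z i s
  have DG: "DD M (\<lambda>e. G (e (Suc 0)) (e (Suc (Suc 0))) (e 0))"
    unfolding G_def by (intro DDI DD_sub2[OF mem]) auto
  have ex: "\<exists>s. G z i s" for z i
  proof (cases "\<exists>s. s \<prec> ?Vb \<and> mem z (i \<otimes> ?Vb \<oplus> s)")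
    case True
    then obtain s0 where s0: "s0 \<prec> ?Vb \<and> mem z (i \<otimes> ?Vb \<oplus> s0)" by blast
    have "DD M (\<lambda>e. e 0 \<prec> ?Vb \<and> mem z (i \<otimes> ?Vb \<oplus> e 0))" by (intro DDI DD_sub2[OF mem]) auto
    from least_DD[OF this s0] obtain s where s: "s \<prec> ?Vb" "mem z (i \<otimes> ?Vb \<oplus> s)" "\<And>t. t \<prec> s \<Longrightarrow> \<not> (t \<prec> ?Vb \<and> mem z (i \<otimes> ?Vb \<oplus> t))" by blast
    have "\<not> mem z (i \<otimes> ?Vb \<oplus> t)" if "t \<prec> s" for t using s(3)[OF that] A.less_trans[OF that s(1)] by blast
    then show ?thesis using s(1,2) unfolding G_def by blast
  next
    case False then show ?thesis unfolding G_def by blast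
  qed
  have un: "s = s'" if "G z i s" "G z i s'" for z i s s'
    using that ax(11)[of s s'] unfolding G_def by blast
  define sq where "sq z i = (SOME s. G z i s)" for z i
  have sqG: "s = sq z i \<longleftrightarrow> G z i s" for s z i
    unfolding sq_def using someI_ex[OF ex] un by metis
  have bd: "sq z i \<preceq> B" for z i
  proof -
    have "G z i (sq z i)" using sqG by blast
    then show ?thesis unfolding G_def by (auto simp: less_Suc_le)
  qed
  have "FF (\<lambda>e. sq (e 0) (e (Suc 0)))"
    by (rule FF_I[OF FF_const bd]) (unfold sqG, rule DG)
  moreover have "\<exists>z. z \<prec> C \<and> (\<forall>i. i \<preceq> W \<longrightarrow> sq z i = g i)"
    if g: "DD M (\<lambda>e. e 0 = g (e (Suc 0)))" "\<forall>i. i \<preceq> W \<longrightarrow> g i \<preceq> B" for g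
  proof -
    let ?X = "\<lambda>p. \<exists>i. i \<prec> W \<oplus> \<one> \<and> (\<exists>s. s \<prec> ?Vb \<and> (p = i \<otimes> ?Vb \<oplus> s \<and> s = g i))"
    have "DD M (\<lambda>e. ?X (e 0))" by (intro DDI DD_sub2[OF g(1)]) auto
    from code[OF PG_DD[OF this]] obtain z where z: "z \<prec> C" "\<And>i. i \<prec> (W \<oplus> \<one>) \<otimes> ?Vb \<Longrightarrow> (mem z i \<longleftrightarrow> ?X i)" by blast
    have m: "mem z (i \<otimes> ?Vb \<oplus> s) \<longleftrightarrow> s = g i" if "i \<preceq> W" "s \<prec> ?Vb" for i s
    proof -
      have i: "i \<prec> W \<oplus> \<one>" using that by (simp add: less_Suc_le)
      show ?thesis unfolding z(2)[OF pair_less[OF i that(2)]] using div_uniq[OF _ that(2)] that i by blast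
    qed
    have "sq z i = g i" if "i \<preceq> W" for i
    proof -
      have gi: "g i \<prec> ?Vb" using g(2) that by (simp add: less_Suc_le)
      have "\<not> mem z (i \<otimes> ?Vb \<oplus> t)" if "t \<prec> g i" for t
        using m[OF \<open>i \<preceq> W\<close> A.less_trans[OF that gi]] that by auto
      then have "G z i (g i)" unfolding G_def using m[OF that gi] gi by blast
      then show ?thesis using sqG by metis
    qed
    then show ?thesis using z(1) by blast
  qed
  ultimately show ?thesis using bd by blast
qed

text \<open>The values are read from the least code of a correct computation of length
  \<open>W\<close>. Codes lie below \<open>C\<close>, so this is a bounded definition, uniform in
  the parameters \<open>e\<close>; that correct computations of each length up to \<open>W\<close>
  exist is a bounded statement and follows by induction.\<close>

lemma rec_param:
  assumes h: "FF (\<lambda>e. h (e 0) (e (Suc 0)) (\<lambda>v. e (Suc (Suc v))))" and s0: "FF s0"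
    and b0: "\<And>e. s0 e \<preceq> B" and bh: "\<And>i s e. i \<prec> W \<Longrightarrow> s \<preceq> B \<Longrightarrow> h i s e \<preceq> B"
  shows "\<exists>S. FF (\<lambda>e. S (e 0) (\<lambda>v. e (Suc v))) \<and> (\<forall>e. S \<zero> e = s0 e \<and> (\<forall>i. i \<prec> W \<longrightarrow> S (i \<oplus> \<one>) e = h i (S i e) e) \<and> (\<forall>i. S i e \<preceq> B))"
proof -
  obtain C sq where sq: "FF (\<lambda>e. sq (e 0) (e (Suc 0)))" and sqB: "\<And>z i. sq z i \<preceq> B"
    and code: "\<And>g. DD M (\<lambda>e. e 0 = g (e (Suc 0))) \<Longrightarrow> (\<And>i. i \<preceq> W \<Longrightarrow> g i \<preceq> B) \<Longrightarrow> \<exists>z. z \<prec> C \<and> (\<forall>i. i \<preceq> W \<longrightarrow> sq z i = g i)"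
    using seqs by blast
  define Good where "Good z j e \<longleftrightarrow> sq z \<zero> = s0 e \<and> (\<forall>i. i \<prec> j \<longrightarrow> sq z (i \<oplus> \<one>) = h i (sq z i) e)" for z j e
  have hsub: "FF (\<lambda>e. h (s e) (t e) (\<sigma> e))" if "FF s" "FF t" "\<And>v. FF (\<lambda>e. \<sigma> e v)" for s t \<sigma>
    using FF_comp[where \<sigma> = "\<lambda>e. case_nat (s e) (case_nat (t e) (\<sigma> e))", OF h FF_case[OF that(1) FF_case[OF that(2,3)]]] by simp
  have s0sub: "FF (\<lambda>e. s0 (\<sigma> e))" if "\<And>v. FF (\<lambda>e. \<sigma> e v)" for \<sigma>
    by (rule FF_comp[OF s0 that])
  have DGood: "DD M (\<lambda>e. Good (z e) (j e) (\<sigma> e))" if z: "FF z" and j: "FF j" and s: "\<And>v. FF (\<lambda>e. \<sigma> e v)" for z j \<sigma>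
  proof -
    have z': "FF (\<lambda>e. z (\<lambda>v. e (Suc v)))" by (rule FF_shift[OF z])
    have s': "FF (\<lambda>e. \<sigma> (\<lambda>v. e (Suc v)) w)" for w by (rule FF_shift[OF s])
    have "DD M (\<lambda>e. sq (z (\<lambda>v. e (Suc v))) (e 0 \<oplus> \<one>) = h (e 0) (sq (z (\<lambda>v. e (Suc v))) (e 0)) (\<sigma> (\<lambda>v. e (Suc v))))"
      by (intro DD_Feq hsub FF_sub2[OF sq] FF_var FF_ad FF_const z' s')
    note b = DD_Fball[where P = "\<lambda>e i. sq (z e) (i \<oplus> \<one>) = h i (sq (z e) i) (\<sigma> e)", OF j this]
    have "DD M (\<lambda>e. sq (z e) \<zero> = s0 (\<sigma> e))" by (intro DD_Feq FF_sub2[OF sq] z FF_const s0sub s)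
    then show ?thesis unfolding Good_def by (rule DD_conj[OF _ b])
  qed
  have ex: "j \<preceq> W \<longrightarrow> (\<exists>z. z \<prec> C \<and> Good z j e)" for j e
  proof -
    have "DD M (\<lambda>e'. e' 0 \<preceq> W \<longrightarrow> (\<exists>z. z \<prec> C \<and> Good z (e' 0) e))"
      by (intro DDI DGood) auto
    then show ?thesis
    proof (rule ind_DD)
      have "DD M (\<lambda>e'. e' 0 = s0 e)" by (intro DDI) auto
      from code[of "\<lambda>_. s0 e", OF this b0] obtain z where "z \<prec> C" "\<forall>i. i \<preceq> W \<longrightarrow> sq z i = s0 e" by blast
      then show "\<zero> \<preceq> W \<longrightarrow> (\<exists>z. z \<prec> C \<and> Good z \<zero> e)" unfolding Good_def by auto
    next
      fix j assume IH: "j \<preceq> W \<longrightarrow> (\<exists>z. z \<prec> C \<and> Good z j e)"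
      show "j \<oplus> \<one> \<preceq> W \<longrightarrow> (\<exists>z. z \<prec> C \<and> Good z (j \<oplus> \<one>) e)"
      proof
        assume jW: "j \<oplus> \<one> \<preceq> W"
        then have jW': "j \<prec> W" by (simp add: Suc_le_less)
        then obtain z where z: "Good z j e" using IH by (auto simp: le_iff)
        \<comment> \<open>The new sequence is constant beyond position j; of that tail only the
          entry at j + 1 matters.\<close>
        define g where "g i = (if i \<preceq> j then sq z i else h j (sq z j) e)" for i
        have "DD M (\<lambda>e'. (e' (Suc 0) \<preceq> j \<and> e' 0 = sq z (e' (Suc 0))) \<or> (\<not> e' (Suc 0) \<preceq> j \<and> e' 0 = h j (sq z j) e))"
          by (intro DDI FF_sub2[OF sq] FF_var FF_const)
        then have "DD M (\<lambda>e'. e' 0 = g (e' (Suc 0)))" by (rule DD_iff) (auto simp: g_def)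
        moreover have "g i \<preceq> B" for i unfolding g_def using sqB bh[OF jW' sqB] by auto
        ultimately obtain z' where z': "z' \<prec> C" "\<And>i. i \<preceq> W \<Longrightarrow> sq z' i = g i" using code[of g] by blast
        have "Good z' (j \<oplus> \<one>) e"
          unfolding Good_def
        proof (intro conjI allI impI)
          show "sq z' \<zero> = s0 e" using z z'(2)[of \<zero>] unfolding Good_def g_def by simp
          fix i assume "i \<prec> j \<oplus> \<one>"
          then have ij: "i \<preceq> j" by (simp add: less_Suc_le)
          have "i \<prec> W" by (rule A.le_less_trans[OF ij jW'])
          then have iW: "i \<oplus> \<one> \<preceq> W" "i \<preceq> W" unfolding Suc_le_less by (simp_all add: A.less_imp_le)
          have zi: "sq z' i = sq z i" using z'(2)[OF iW(2)] ij by (simp add: g_def)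
          show "sq z' (i \<oplus> \<one>) = h i (sq z' i) e"
          proof (cases "i = j")
            case True
            have "\<not> j \<oplus> \<one> \<preceq> j" by (simp add: A.not_le)
            then show ?thesis using True z'(2)[OF iW(1)] zi by (simp add: g_def)
          next
            case False
            then have "i \<prec> j" using ij by (simp add: le_iff)
            then show ?thesis using z'(2)[OF iW(1)] zi z by (simp add: g_def Good_def Suc_le_less)
          qed
        qed
        then show "\<exists>z. z \<prec> C \<and> Good z (j \<oplus> \<one>) e" using z'(1) by blast
      qed
    qed
  qed
  \<comment> \<open>Minimality makes the code unique, so the value read from it has a bounded
    graph.\<close>
  define L where "L z e \<longleftrightarrow> Good z W e \<and> (\<forall>z'. z' \<prec> z \<longrightarrow> \<not> Good z' W e)" for z e
  have exL: "\<exists>z. z \<prec> C \<and> L z e" for e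
  proof -
    obtain z where z: "z \<prec> C" "Good z W e" using ex[of W e] by blast
    have "DD M (\<lambda>e'. Good (e' 0) W e)" by (intro DGood FF_var FF_const)
    from least_DD[OF this z(2)] obtain y where y: "Good y W e" "\<forall>z'. z' \<prec> y \<longrightarrow> \<not> Good z' W e" by blast
    then have "y \<preceq> z" using z A.not_less by blast
    then show ?thesis using y z(1) A.le_less_trans unfolding L_def by blast
  qed
  have unL: "z = z'" if "L z e" "L z' e" for z z' e
    using that ax(11)[of z z'] unfolding L_def by blast
  define zz where "zz e = (SOME z. z \<prec> C \<and> L z e)" for e
  have zz: "zz e \<prec> C" "L (zz e) e" for e using someI_ex[OF exL[of e]] unfolding zz_def by blast+
  define S where "S j e = sq (zz e) j" for j e
  have Siff: "y = S j e \<longleftrightarrow> (\<exists>z. z \<prec> C \<and> (L z e \<and> y = sq z j))" for y j e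
    unfolding S_def using zz unL by blast
  have "DD M (\<lambda>e. \<exists>z. z \<prec> C \<and> (L z (\<lambda>v. e (Suc (Suc v))) \<and> e 0 = sq z (e (Suc 0))))"
    unfolding L_def by (intro DDI DGood FF_sub2[OF sq] FF_var FF_const)
  then have "DD M (\<lambda>e. e 0 = S (e (Suc 0)) (\<lambda>v. e (Suc (Suc v))))" unfolding Siff .
  moreover have "S j e \<preceq> B" for j e unfolding S_def by (rule sqB)
  ultimately have "FF (\<lambda>e. S (e 0) (\<lambda>v. e (Suc v)))" by (intro FF_I[OF FF_const])
  moreover have "S \<zero> e = s0 e \<and> (\<forall>i. i \<prec> W \<longrightarrow> S (i \<oplus> \<one>) e = h i (S i e) e) \<and> (\<forall>i. S i e \<preceq> B)" for e
    using zz(2)[of e] sqB unfolding L_def Good_def S_def by blast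
  ultimately show ?thesis by blast
qed

end

section \<open>Counting\<close>

text \<open>The number of elements of \<open>X\<close> below \<open>j\<close>, taken as the value of
  any function with bounded graph that obeys the counting recursion. By \<open>cnt_eq\<close> all
  such functions agree.\<close>

definition cnt :: "'a arith_struct \<Rightarrow> ('a \<Rightarrow> bool) \<Rightarrow> 'a \<Rightarrow> 'a" where
  "cnt M X j = (SOME y. \<exists>c. pam.FF M (\<lambda>e. c (e 0)) \<and> c (zr M) = zr M \<and>
     (\<forall>i. ls M i j \<longrightarrow> c (ad M i (un M)) = (if X i then ad M (c i) (un M) else c i)) \<and> y = c j)"

context isige begin

lemma cnt_eq:
  assumes c: "FF (\<lambda>e. c (e 0))" "c \<zero> = \<zero>" "\<And>i. i \<prec> j \<Longrightarrow> c (i \<oplus> \<one>) = (if X i then c i \<oplus> \<one> else c i)"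
  shows "cnt M X j = c j"
  unfolding cnt_def
proof (rule some_equality)
  show "\<exists>c'. FF (\<lambda>e. c' (e 0)) \<and> c' \<zero> = \<zero> \<and> (\<forall>i. i \<prec> j \<longrightarrow> c' (i \<oplus> \<one>) = (if X i then c' i \<oplus> \<one> else c' i)) \<and> c j = c' j"
    using c by blast
next
  fix y assume "\<exists>c'. FF (\<lambda>e. c' (e 0)) \<and> c' \<zero> = \<zero> \<and> (\<forall>i. i \<prec> j \<longrightarrow> c' (i \<oplus> \<one>) = (if X i then c' i \<oplus> \<one> else c' i)) \<and> y = c' j"
  then obtain c' where c': "FF (\<lambda>e. c' (e 0))" "c' \<zero> = \<zero>" "\<And>i. i \<prec> j \<Longrightarrow> c' (i \<oplus> \<one>) = (if X i then c' i \<oplus> \<one> else c' i)" "y = c' j"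
    by blast
  have "DD M (\<lambda>e. e 0 \<preceq> j \<longrightarrow> c' (e 0) = c (e 0))" by (intro DDI c(1) c'(1)) auto
  then have "j \<preceq> j \<longrightarrow> c' j = c j"
  proof (rule ind_DD)
    fix i assume "i \<preceq> j \<longrightarrow> c' i = c i"
    then show "i \<oplus> \<one> \<preceq> j \<longrightarrow> c' (i \<oplus> \<one>) = c (i \<oplus> \<one>)"
      unfolding Suc_le_less using c(3) c'(3) A.less_imp_le by auto
  qed (simp add: c c')
  then show "y = c j" using c'(4) by simp
qed

lemma cnt_fun:
  assumes R: "DD M (\<lambda>e. R (e 0) (\<lambda>v. e (Suc v)))"
  shows "\<exists>S. FF (\<lambda>e. S (e 0) (\<lambda>v. e (Suc v))) \<and> (\<forall>e j. j \<preceq> W \<longrightarrow> cnt M (\<lambda>i. R i e) j = S j e) \<and>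
    (\<forall>e. S \<zero> e = \<zero>) \<and> (\<forall>e i. i \<prec> W \<longrightarrow> S (i \<oplus> \<one>) e = (if R i e then S i e \<oplus> \<one> else S i e))"
proof -
  \<comment> \<open>The test \<open>s \<prec> W\<close> keeps all values within the bound that
    \<open>rec_param\<close> demands; \<open>bd\<close> then gives S i \<le> i, so that every
    increment below \<open>W\<close> is carried out.\<close>
  define h where "h i s e = (if R i e \<and> s \<prec> W then s \<oplus> \<one> else s)" for i s e
  have Rs: "DD M (\<lambda>e. R (e 0) (\<lambda>v. e (Suc (Suc v))))"
  proof -
    have s: "TT M (\<lambda>e. case_nat (e 0) (\<lambda>v. e (Suc (Suc v))) v)" for v by (cases v) (auto intro: TT_var)
    show ?thesis using DD_Tsub[where \<sigma> = "\<lambda>e. case_nat (e 0) (\<lambda>v. e (Suc (Suc v)))", OF R s] by simp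
  qed
  have "FF (\<lambda>e. h (e 0) (e (Suc 0)) (\<lambda>v. e (Suc (Suc v))))"
    unfolding h_def by (intro FF_if DD_conj Rs DD_Fls FF_var FF_const FF_ad)
  moreover have "h i s e \<preceq> W" if "s \<preceq> W" for i s e unfolding h_def using that by (auto simp: Suc_le_less)
  ultimately obtain S where S: "FF (\<lambda>e. S (e 0) (\<lambda>v. e (Suc v)))"
    "\<And>e. S \<zero> e = \<zero>" "\<And>i e. i \<prec> W \<Longrightarrow> S (i \<oplus> \<one>) e = h i (S i e) e"
    using rec_param[of h "\<lambda>_. \<zero>" W W, OF _ FF_const zero_le] by blast
  have FS: "FF (\<lambda>e'. S (e' 0) e)" for e
    using FF_comp[where \<sigma> = "\<lambda>e'. case_nat (e' 0) e", OF S(1) FF_case[OF FF_var FF_const]] by simp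
  have bd: "S i e \<preceq> i" if "i \<preceq> W" for i e
  proof -
    have "DD M (\<lambda>e'. e' 0 \<preceq> W \<longrightarrow> S (e' 0) e \<preceq> e' 0)" by (intro DDI DD_Fle FS) auto
    then have "i \<preceq> W \<longrightarrow> S i e \<preceq> i"
    proof (rule ind_DD)
      fix i assume IH: "i \<preceq> W \<longrightarrow> S i e \<preceq> i"
      show "i \<oplus> \<one> \<preceq> W \<longrightarrow> S (i \<oplus> \<one>) e \<preceq> i \<oplus> \<one>"
      proof
        assume "i \<oplus> \<one> \<preceq> W"
        then have i: "i \<prec> W" by (simp add: Suc_le_less)
        then have "S i e \<preceq> i" using IH by (simp add: A.less_imp_le)
        then show "S (i \<oplus> \<one>) e \<preceq> i \<oplus> \<one>" unfolding S(3)[OF i] h_def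
          using A.add_right_mono[of "S i e" i \<one>] A.order_trans[of "S i e" i "i \<oplus> \<one>"] by auto
      qed
    qed (simp add: S)
    then show ?thesis using that by blast
  qed
  have rec: "S (i \<oplus> \<one>) e = (if R i e then S i e \<oplus> \<one> else S i e)" if "i \<prec> W" for i e
    using bd[of i e] that A.le_less_trans[of "S i e" i W] unfolding S(3)[OF that] h_def by (auto simp: A.less_imp_le)
  have "cnt M (\<lambda>i. R i e) j = S j e" if "j \<preceq> W" for e j
    by (rule cnt_eq[OF FS]) (use S(2) rec A.less_le_trans[OF _ that] in auto)
  then show ?thesis using S(1,2) rec by blast
qed

lemma cnt_fun1:
  assumes X: "DD M (\<lambda>e. X (e 0))"
  shows "\<exists>c. FF (\<lambda>e. c (e 0)) \<and> (\<forall>j. j \<preceq> W \<longrightarrow> cnt M X j = c j) \<and> c \<zero> = \<zero> \<and>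
    (\<forall>i. i \<prec> W \<longrightarrow> c (i \<oplus> \<one>) = (if X i then c i \<oplus> \<one> else c i))"
proof -
  obtain S where S: "FF (\<lambda>e. S (e 0) (\<lambda>v. e (Suc v)))" "\<forall>e j. j \<preceq> W \<longrightarrow> cnt M X j = S j e"
    "\<forall>e. S \<zero> e = \<zero>" "\<forall>e i. i \<prec> W \<longrightarrow> S (i \<oplus> \<one>) e = (if X i then S i e \<oplus> \<one> else S i e)"
    using cnt_fun[of "\<lambda>i e. X i" W] X by blast
  have "FF (\<lambda>e'. S (e' 0) (\<lambda>_. \<zero>))"
    using FF_comp[where \<sigma> = "\<lambda>e'. case_nat (e' 0) (\<lambda>_. \<zero>)", OF S(1) FF_case[OF FF_var FF_const]] by simp
  then show ?thesis using S by (intro exI[of _ "\<lambda>j. S j (\<lambda>_. \<zero>)"]) blast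
qed

lemma cnt_le_add:
  assumes X: "DD M (\<lambda>e. X (e 0))" and Y: "DD M (\<lambda>e. Y (e 0))" and Z: "DD M (\<lambda>e. Z (e 0))"
    and sub: "\<And>i. i \<prec> j \<Longrightarrow> Z i \<Longrightarrow> X i \<or> Y i"
  shows "cnt M Z j \<preceq> cnt M X j \<oplus> cnt M Y j"
proof -
  obtain x where x: "FF (\<lambda>e. x (e 0))" "cnt M X j = x j" "x \<zero> = \<zero>" "\<And>i. i \<prec> j \<Longrightarrow> x (i \<oplus> \<one>) = (if X i then x i \<oplus> \<one> else x i)"
    using cnt_fun1[OF X, of j] by auto
  obtain y where y: "FF (\<lambda>e. y (e 0))" "cnt M Y j = y j" "y \<zero> = \<zero>" "\<And>i. i \<prec> j \<Longrightarrow> y (i \<oplus> \<one>) = (if Y i then y i \<oplus> \<one> else y i)"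
    using cnt_fun1[OF Y, of j] by auto
  obtain z where z: "FF (\<lambda>e. z (e 0))" "cnt M Z j = z j" "z \<zero> = \<zero>" "\<And>i. i \<prec> j \<Longrightarrow> z (i \<oplus> \<one>) = (if Z i then z i \<oplus> \<one> else z i)"
    using cnt_fun1[OF Z, of j] by auto
  have "DD M (\<lambda>e. e 0 \<preceq> j \<longrightarrow> z (e 0) \<preceq> x (e 0) \<oplus> y (e 0))" by (intro DDI FF_ad x(1) y(1) z(1)) auto
  then have "j \<preceq> j \<longrightarrow> z j \<preceq> x j \<oplus> y j"
  proof (rule ind_DD)
    fix i assume IH: "i \<preceq> j \<longrightarrow> z i \<preceq> x i \<oplus> y i"
    show "i \<oplus> \<one> \<preceq> j \<longrightarrow> z (i \<oplus> \<one>) \<preceq> x (i \<oplus> \<one>) \<oplus> y (i \<oplus> \<one>)"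
    proof
      assume "i \<oplus> \<one> \<preceq> j"
      then have i: "i \<prec> j" by (simp add: Suc_le_less)
      then have h: "z i \<preceq> x i \<oplus> y i" using IH by (simp add: A.less_imp_le)
      have h1: "z i \<oplus> \<one> \<preceq> x i \<oplus> y i \<oplus> \<one>" using h by (rule A.add_right_mono)
      have h2: "x i \<oplus> y i \<preceq> x i \<oplus> y i \<oplus> \<one>" "x i \<oplus> y i \<oplus> \<one> \<preceq> x i \<oplus> y i \<oplus> \<one> \<oplus> \<one>" by (rule le_add(1))+
      have e: "x i \<oplus> \<one> \<oplus> y i = x i \<oplus> y i \<oplus> \<one>" "x i \<oplus> (y i \<oplus> \<one>) = x i \<oplus> y i \<oplus> \<one>" "x i \<oplus> \<one> \<oplus> (y i \<oplus> \<one>) = x i \<oplus> y i \<oplus> \<one> \<oplus> \<one>"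
        by (metis ax(1,2))+
      show "z (i \<oplus> \<one>) \<preceq> x (i \<oplus> \<one>) \<oplus> y (i \<oplus> \<one>)"
        unfolding x(4)[OF i] y(4)[OF i] z(4)[OF i] using sub[OF i] h h1 h2
        by (cases "X i"; cases "Y i"; cases "Z i") (auto simp only: e if_True if_False intro: A.order_trans simp_thms)
    qed
  qed (simp add: x y z)
  then show ?thesis using x y z by simp
qed

lemma cnt_add_le:
  assumes X: "DD M (\<lambda>e. X (e 0))" and Y: "DD M (\<lambda>e. Y (e 0))" and Z: "DD M (\<lambda>e. Z (e 0))"
    and sub: "\<And>i. i \<prec> j \<Longrightarrow> X i \<Longrightarrow> Z i \<and> \<not> Y i" "\<And>i. i \<prec> j \<Longrightarrow> Y i \<Longrightarrow> Z i"
  shows "cnt M X j \<oplus> cnt M Y j \<preceq> cnt M Z j"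
proof -
  obtain x where x: "FF (\<lambda>e. x (e 0))" "cnt M X j = x j" "x \<zero> = \<zero>" "\<And>i. i \<prec> j \<Longrightarrow> x (i \<oplus> \<one>) = (if X i then x i \<oplus> \<one> else x i)"
    using cnt_fun1[OF X, of j] by auto
  obtain y where y: "FF (\<lambda>e. y (e 0))" "cnt M Y j = y j" "y \<zero> = \<zero>" "\<And>i. i \<prec> j \<Longrightarrow> y (i \<oplus> \<one>) = (if Y i then y i \<oplus> \<one> else y i)"
    using cnt_fun1[OF Y, of j] by auto
  obtain z where z: "FF (\<lambda>e. z (e 0))" "cnt M Z j = z j" "z \<zero> = \<zero>" "\<And>i. i \<prec> j \<Longrightarrow> z (i \<oplus> \<one>) = (if Z i then z i \<oplus> \<one> else z i)"
    using cnt_fun1[OF Z, of j] by auto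
  have "DD M (\<lambda>e. e 0 \<preceq> j \<longrightarrow> x (e 0) \<oplus> y (e 0) \<preceq> z (e 0))" by (intro DDI FF_ad x(1) y(1) z(1)) auto
  then have "j \<preceq> j \<longrightarrow> x j \<oplus> y j \<preceq> z j"
  proof (rule ind_DD)
    fix i assume IH: "i \<preceq> j \<longrightarrow> x i \<oplus> y i \<preceq> z i"
    show "i \<oplus> \<one> \<preceq> j \<longrightarrow> x (i \<oplus> \<one>) \<oplus> y (i \<oplus> \<one>) \<preceq> z (i \<oplus> \<one>)"
    proof
      assume "i \<oplus> \<one> \<preceq> j"
      then have i: "i \<prec> j" by (simp add: Suc_le_less)
      then have h: "x i \<oplus> y i \<preceq> z i" using IH by (simp add: A.less_imp_le)
      have h1: "x i \<oplus> y i \<oplus> \<one> \<preceq> z i \<oplus> \<one>" using h by (rule A.add_right_mono)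
      have h2: "z i \<preceq> z i \<oplus> \<one>" by (rule le_add(1))
      have e: "x i \<oplus> \<one> \<oplus> y i = x i \<oplus> y i \<oplus> \<one>" "x i \<oplus> (y i \<oplus> \<one>) = x i \<oplus> y i \<oplus> \<one>"
        by (metis ax(1,2))+
      show "x (i \<oplus> \<one>) \<oplus> y (i \<oplus> \<one>) \<preceq> z (i \<oplus> \<one>)"
        unfolding x(4)[OF i] y(4)[OF i] z(4)[OF i] using sub[OF i] h h1 h2
        by (cases "X i"; cases "Y i"; cases "Z i") (auto simp only: e if_True if_False intro: A.order_trans simp_thms)
    qed
  qed (simp add: x y z)
  then show ?thesis using x y z by simp
qed

lemma cnt_empty: "(\<And>i. i \<prec> j \<Longrightarrow> \<not> X i) \<Longrightarrow> cnt M X j = \<zero>"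
  by (rule cnt_eq) auto

lemma cnt_full: "(\<And>i. i \<prec> j \<Longrightarrow> X i) \<Longrightarrow> cnt M X j = j"
  by (rule cnt_eq[where c = "\<lambda>j. j"]) auto

lemma cnt_mono:
  assumes "DD M (\<lambda>e. X (e 0))" "DD M (\<lambda>e. Z (e 0))" "\<And>i. i \<prec> j \<Longrightarrow> Z i \<Longrightarrow> X i"
  shows "cnt M Z j \<preceq> cnt M X j"
  using cnt_le_add[OF assms(1) DD_triv[of M False] assms(2), of j] assms(3) cnt_empty[of j "\<lambda>_. False"] by auto

lemma cnt_le: "DD M (\<lambda>e. X (e 0)) \<Longrightarrow> cnt M X j \<preceq> j"
  using cnt_mono[OF DD_triv[of M True], of X j] cnt_full[of j "\<lambda>_. True"] by auto

lemma cnt_sub1: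
  assumes X: "DD M (\<lambda>e. X (e 0))" and u: "\<And>i i'. i \<prec> j \<Longrightarrow> i' \<prec> j \<Longrightarrow> X i \<Longrightarrow> X i' \<Longrightarrow> i = i'"
  shows "cnt M X j \<preceq> \<one>"
proof -
  obtain x where x: "FF (\<lambda>e. x (e 0))" "\<And>i. i \<preceq> j \<Longrightarrow> cnt M X i = x i" "x \<zero> = \<zero>" "\<And>i. i \<prec> j \<Longrightarrow> x (i \<oplus> \<one>) = (if X i then x i \<oplus> \<one> else x i)"
    using cnt_fun1[OF X, of j] by auto
  have "DD M (\<lambda>e. e 0 \<preceq> j \<longrightarrow> x (e 0) \<preceq> \<one>)" by (intro DDI x(1)) auto
  then have "j \<preceq> j \<longrightarrow> x j \<preceq> \<one>"
  proof (rule ind_DD)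
    fix i assume IH: "i \<preceq> j \<longrightarrow> x i \<preceq> \<one>"
    show "i \<oplus> \<one> \<preceq> j \<longrightarrow> x (i \<oplus> \<one>) \<preceq> \<one>"
    proof
      assume "i \<oplus> \<one> \<preceq> j"
      then have i: "i \<prec> j" by (simp add: Suc_le_less)
      show "x (i \<oplus> \<one>) \<preceq> \<one>"
      proof (cases "X i")
        case True
        have "cnt M X i = \<zero>" by (rule cnt_empty) (use u[OF i _ True] A.less_trans[OF _ i] in blast)
        then show ?thesis using True x(2)[of i] x(4)[OF i] i by (simp add: A.less_imp_le)
      next
        case False then show ?thesis using IH x(4)[OF i] i by (simp add: A.less_imp_le)
      qed
    qed
  qed (simp add: x)
  then show ?thesis using x(2)[of j] by simp
qed

text \<open>A pigeonhole principle, by induction on the bound y for the values: raising y by one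
  admits a single further value, which has at most one preimage. It limits the sets on which a
  partial injection into \<open>x\<close> can be followed.\<close>

lemma cnt_inj:
  assumes X: "DD M (\<lambda>e. X (e 0))" and g: "FF (\<lambda>e. g (e 0))"
    and into: "\<And>i. i \<prec> j \<Longrightarrow> X i \<Longrightarrow> g i \<prec> x"
    and inj: "\<And>i i'. i \<prec> j \<Longrightarrow> i' \<prec> j \<Longrightarrow> X i \<Longrightarrow> X i' \<Longrightarrow> g i = g i' \<Longrightarrow> i = i'"
  shows "cnt M X j \<preceq> x"
proof -
  let ?R = "\<lambda>i e. X i \<and> g i \<prec> e (0::nat)"
  have "DD M (\<lambda>e. ?R (e 0) (\<lambda>v. e (Suc v)))" by (intro DDI DD_sub1[OF X] FF_sub1[OF g]) auto
  from cnt_fun[of ?R j, OF this] obtain S where S: "FF (\<lambda>e. S (e 0) (\<lambda>v. e (Suc v)))"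
    "\<And>e. cnt M (\<lambda>i. ?R i e) j = S j e" by auto
  have FS: "FF (\<lambda>e'. S j (\<lambda>_. e' 0))"
    using FF_comp[where \<sigma> = "\<lambda>e'. case_nat j (\<lambda>_. e' 0)", OF S(1) FF_case[OF FF_const FF_var]] by simp
  have DY: "DD M (\<lambda>e. X (e 0) \<and> g (e 0) \<prec> y)" for y by (intro DDI X g) auto
  have DYe: "DD M (\<lambda>e. X (e 0) \<and> g (e 0) = y)" for y by (intro DDI X g) auto
  have "DD M (\<lambda>e. S j (\<lambda>_. e 0) \<preceq> e 0)" by (intro DDI FS) auto
  then have "S j (\<lambda>_. x) \<preceq> x"
  proof (rule ind_DD)
    show "S j (\<lambda>_. \<zero>) \<preceq> \<zero>" unfolding S(2)[symmetric] by (simp add: cnt_empty)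
    fix y assume IH: "S j (\<lambda>_. y) \<preceq> y"
    have "cnt M (\<lambda>i. X i \<and> g i \<prec> y \<oplus> \<one>) j \<preceq> cnt M (\<lambda>i. X i \<and> g i \<prec> y) j \<oplus> cnt M (\<lambda>i. X i \<and> g i = y) j"
      by (rule cnt_le_add[OF DY DYe DY]) (auto simp: less_Suc_le le_iff)
    also have "\<dots> \<preceq> y \<oplus> \<one>"
      by (rule A.add_mono) (use IH S(2)[of "\<lambda>_. y"] in simp, rule cnt_sub1[OF DYe], use inj in blast)
    finally show "S j (\<lambda>_. y \<oplus> \<one>) \<preceq> y \<oplus> \<one>" unfolding S(2)[symmetric] .
  qed
  moreover have "cnt M X j \<preceq> cnt M (\<lambda>i. X i \<and> g i \<prec> x) j"
    by (rule cnt_mono[OF DY X]) (use into in auto)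
  ultimately show ?thesis using S(2)[of "\<lambda>_. x"] A.order_trans by simp
qed

text \<open>Multiplication by the standard number 2^k. A density of at most 2^-k is stated as
  \<open>dbl k (cnt M X \<Omega>) \<preceq> \<Omega>\<close>, without division.\<close>

primrec dbl :: "nat \<Rightarrow> 'a \<Rightarrow> 'a" where
  "dbl 0 c = c"
| "dbl (Suc k) c = dbl k c \<oplus> dbl k c"

lemma dbl_add: "dbl k (a \<oplus> b) = dbl k a \<oplus> dbl k b"
  by (induction k) (simp_all add: A.add.assoc A.add.left_commute)

lemma dbl_mono: "a \<preceq> b \<Longrightarrow> dbl k a \<preceq> dbl k b"
  by (induction k) (simp_all add: A.add_mono)

lemma dbl_zero [simp]: "dbl k \<zero> = \<zero>"
  by (induction k) simp_all

text \<open>A definable function cannot jump across a proper cut on a set of more than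
  infinitesimal density: bisect the set of arguments mapped into an interval around the cut.\<close>

lemma cut_halving:
  assumes f: "FF (\<lambda>e. f (e 0))" and cut: "is_cut M I" and proper: "I \<noteq> UNIV"
  shows "\<exists>i\<in>I. \<exists>j. j \<notin> I \<and> dbl k (cnt M (\<lambda>s. i \<prec> f s \<and> f s \<preceq> j) \<Omega>) \<preceq> \<Omega>"
proof (induction k)
  case 0
  obtain i j where "i \<in> I" "j \<notin> I" using cut proper unfolding is_cut_def by blast
  moreover have "DD M (\<lambda>e. i \<prec> f (e 0) \<and> f (e 0) \<preceq> j)" by (intro DDI f) auto
  ultimately show ?case using cnt_le[of "\<lambda>s. i \<prec> f s \<and> f s \<preceq> j" \<Omega>] by (intro bexI[of _ i] exI[of _ j]) simp_all
next
  case (Suc k)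
  then obtain i j where ij: "i \<in> I" "j \<notin> I" and d: "dbl k (cnt M (\<lambda>s. i \<prec> f s \<and> f s \<preceq> j) \<Omega>) \<preceq> \<Omega>" by blast
  let ?c = "\<lambda>i j. cnt M (\<lambda>s. i \<prec> f s \<and> f s \<preceq> j) \<Omega>"
  have down: "b \<in> I" if "a \<in> I" "b \<preceq> a" for a b using cut that unfolding is_cut_def U le_iff by auto
  have up: "a \<oplus> \<one> \<in> I" if "a \<in> I" for a using cut that unfolding is_cut_def by auto
  have D: "DD M (\<lambda>e. a \<prec> f (e 0) \<and> f (e 0) \<preceq> b)" for a b by (intro DDI f) auto
  have ilj: "i \<prec> j" using down ij A.not_le by blast
  have half: "\<exists>i\<in>I. \<exists>j. j \<notin> I \<and> dbl (Suc k) (?c i j) \<preceq> \<Omega>" if "a \<in> I" "b \<notin> I" "?c a b \<oplus> ?c a b \<preceq> ?c i j" for a b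
  proof -
    have "dbl (Suc k) (?c a b) = dbl k (?c a b \<oplus> ?c a b)" by (simp add: dbl_add)
    also have "\<dots> \<preceq> dbl k (?c i j)" by (rule dbl_mono[OF that(3)])
    finally show ?thesis using d that A.order_trans by blast
  qed
  \<comment> \<open>The points t such that (i, t] receives at most half of the arguments counted for
    (i, j]. Such a point outside the cut is a better upper end; if there is none, the largest such
    point lies inside the cut.\<close>
  let ?T = "\<lambda>t. i \<preceq> t \<and> t \<preceq> j \<and> ?c i t \<oplus> ?c i t \<preceq> ?c i j"
  show ?case
  proof (cases "\<exists>t. t \<notin> I \<and> ?T t")
    case True then show ?thesis using half ij by blast
  next
    case False
    let ?R = "\<lambda>s e. i \<prec> f s \<and> f s \<preceq> e (0::nat)"
    have "DD M (\<lambda>e. ?R (e 0) (\<lambda>v. e (Suc v)))" by (intro DDI FF_sub1[OF f]) auto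
    from cnt_fun[of ?R \<Omega>, OF this] obtain S where S: "FF (\<lambda>e. S (e 0) (\<lambda>v. e (Suc v)))"
      "\<And>e. cnt M (\<lambda>s. ?R s e) \<Omega> = S \<Omega> e" by auto
    have FS: "FF (\<lambda>e'. S \<Omega> (\<lambda>_. e' 0))"
      using FF_comp[where \<sigma> = "\<lambda>e'. case_nat \<Omega> (\<lambda>_. e' 0)", OF S(1) FF_case[OF FF_const FF_var]] by simp
    have "DD M (\<lambda>e. i \<preceq> e 0 \<and> e 0 \<preceq> j \<and> S \<Omega> (\<lambda>_. e 0) \<oplus> S \<Omega> (\<lambda>_. e 0) \<preceq> ?c i j)" by (intro DDI FS FF_ad) auto
    then have DT: "DD M (\<lambda>e. ?T (e 0))" by (rule DD_iff) (simp add: S(2)[symmetric])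
    have "?c i i = \<zero>" by (rule cnt_empty) (simp add: A.not_le)
    then have Ti: "?T i" using ilj by (simp add: A.less_imp_le)
    have lt: "t \<prec> j \<oplus> \<one>" if "?T t" for t using that by (simp add: less_Suc_le)
    obtain t where t: "?T t" "\<And>y. t \<prec> y \<Longrightarrow> \<not> ?T y" using max_PG[of ?T i "j \<oplus> \<one>", OF PG_DD[OF DT] Ti lt] by blast
    then have tI: "t \<in> I" using False by blast
    then have tI1: "t \<oplus> \<one> \<in> I" by (rule up)
    then have tj: "t \<oplus> \<one> \<preceq> j" using down ij(2) A.le_cases by blast
    have it: "i \<preceq> t \<oplus> \<one>" using t(1) A.order_trans le_add(1) by blast
    have "\<not> ?T (t \<oplus> \<one>)" by (rule t(2)) simp
    \<comment> \<open>The interval (i, t+1] receives more than half, so (t+1, j] receives at most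
      half, and t + 1 is still in the cut: it becomes the new lower end.\<close>
    then have big: "?c i j \<prec> ?c i (t \<oplus> \<one>) \<oplus> ?c i (t \<oplus> \<one>)" using it tj by (simp add: A.not_le)
    have sum: "?c i (t \<oplus> \<one>) \<oplus> ?c (t \<oplus> \<one>) j \<preceq> ?c i j"
      by (rule cnt_add_le[OF D D D]) (use it tj A.order_trans A.le_less_trans in \<open>auto simp: A.not_less\<close>)
    have "?c (t \<oplus> \<one>) j \<oplus> ?c (t \<oplus> \<one>) j \<preceq> ?c i j"
    proof (rule ccontr)
      assume "\<not> ?c (t \<oplus> \<one>) j \<oplus> ?c (t \<oplus> \<one>) j \<preceq> ?c i j"
      then have "?c i j \<prec> ?c (t \<oplus> \<one>) j \<oplus> ?c (t \<oplus> \<one>) j" by (simp add: A.not_le)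
      from A.add_strict_mono[OF big this]
      have "?c i j \<oplus> ?c i j \<prec> (?c i (t \<oplus> \<one>) \<oplus> ?c (t \<oplus> \<one>) j) \<oplus> (?c i (t \<oplus> \<one>) \<oplus> ?c (t \<oplus> \<one>) j)"
        by (simp only: A.add.assoc A.add.commute A.add.left_commute)
      moreover have "\<dots> \<preceq> ?c i j \<oplus> ?c i j" by (rule A.add_mono[OF sum sum])
      ultimately show False using A.less_le_trans by blast
    qed
    then show ?thesis using half tI1 ij(2) by blast
  qed
qed

end

section \<open>Restricted ultrapowers\<close>

definition ultra :: "'i set set \<Rightarrow> bool" where
  "ultra U \<longleftrightarrow> {} \<notin> U \<and> (\<forall>A B. A \<in> U \<longrightarrow> A \<subseteq> B \<longrightarrow> B \<in> U) \<and> (\<forall>A B. A \<in> U \<longrightarrow> B \<in> U \<longrightarrow> A \<inter> B \<in> U) \<and>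
     (\<forall>A. A \<in> U \<or> - A \<in> U)"

text \<open>Zorn's lemma for families with the finite intersection property that contain
  \<open>S\<close>. A set missing from a maximal family is disjoint from some finite intersection of
  members, so a set and its complement cannot both be missing.\<close>

lemma ultra_ex:
  assumes fip: "\<And>G. finite G \<Longrightarrow> G \<subseteq> S \<Longrightarrow> \<Inter>G \<noteq> {}"
  shows "\<exists>U. ultra U \<and> S \<subseteq> (U :: 'i set set)"
proof -
  define fp where "fp X \<longleftrightarrow> (\<forall>G. finite G \<longrightarrow> G \<subseteq> X \<longrightarrow> \<Inter>G \<noteq> {})" for X :: "'i set set"
  let ?A = "{X. S \<subseteq> X \<and> fp X}"
  have "\<exists>U\<in>?A. \<forall>X\<in>?A. U \<subseteq> X \<longrightarrow> X = U"
  proof (rule subset_Zorn_nonempty)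
    show "?A \<noteq> {}" using fip unfolding fp_def by blast
    fix \<C> assume ne: "\<C> \<noteq> {}" and ch: "subset.chain ?A \<C>"
    have "fp (\<Union>\<C>)" unfolding fp_def
    proof (intro allI impI)
      fix G assume G: "finite G" "G \<subseteq> \<Union>\<C>"
      obtain B where "B \<in> \<C>" "G \<subseteq> B" using finite_subset_Union_chain[OF G ne ch] by blast
      then show "\<Inter>G \<noteq> {}" using ch G(1) unfolding subset.chain_def fp_def by blast
    qed
    moreover have "S \<subseteq> \<Union>\<C>" using ne ch unfolding subset.chain_def by blast
    ultimately show "\<Union>\<C> \<in> ?A" by blast
  qed
  then obtain U where UA: "U \<in> ?A" and mx': "\<forall>X\<in>?A. U \<subseteq> X \<longrightarrow> X = U" by (rule bexE)
  have SU: "S \<subseteq> U" and fU: "fp U" using UA by simp_all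
  have mx: "X = U" if "S \<subseteq> X" "fp X" "U \<subseteq> X" for X using mx' that by simp
  have f: "\<Inter>G \<noteq> {}" if "finite G" "G \<subseteq> U" for G using fU that unfolding fp_def by blast
  have add: "\<exists>G. finite G \<and> G \<subseteq> U \<and> \<Inter>G \<inter> A = {}" if "A \<notin> U" for A
  proof -
    have "\<not> fp (insert A U)" using mx[of "insert A U"] SU that by blast
    then obtain G where G: "finite G" "G \<subseteq> insert A U" "\<Inter>G = {}" unfolding fp_def by blast
    then show ?thesis by (intro exI[of _ "G - {A}"]) blast
  qed
  have or: "A \<in> U \<or> - A \<in> U" for A
  proof (rule ccontr)
    assume "\<not> (A \<in> U \<or> - A \<in> U)"
    then obtain G H where GH: "finite G" "G \<subseteq> U" "\<Inter>G \<inter> A = {}" "finite H" "H \<subseteq> U" "\<Inter>H \<inter> - A = {}" using add by metis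
    have "\<Inter>G \<inter> \<Inter>H = {}" using GH(3,6) by blast
    then have "\<Inter>(G \<union> H) = {}" by (simp only: Inter_Un_distrib)
    then show False using f[of "G \<union> H"] GH by simp
  qed
  have "{} \<notin> U" using f[of "{{}}"] by auto
  moreover have "B \<in> U" if "A \<in> U" "A \<subseteq> B" for A B
    using or[of B] f[of "{A, - B}"] that by auto
  moreover have "A \<inter> B \<in> U" if "A \<in> U" "B \<in> U" for A B
    using or[of "A \<inter> B"] f[of "{A, B, - (A \<inter> B)}"] that by auto
  ultimately show ?thesis using or SU unfolding ultra_def by blast
qed

lemma ultra_D:
  assumes "ultra U"
  shows "A \<in> U \<Longrightarrow> A \<subseteq> B \<Longrightarrow> B \<in> U" "A \<in> U \<Longrightarrow> B \<in> U \<Longrightarrow> A \<inter> B \<in> U" "{} \<notin> U" "- A \<in> U \<longleftrightarrow> A \<notin> U" "UNIV \<in> U"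
proof -
  show 1: "A \<in> U \<Longrightarrow> A \<subseteq> B \<Longrightarrow> B \<in> U" and 2: "A \<in> U \<Longrightarrow> B \<in> U \<Longrightarrow> A \<inter> B \<in> U" and 3: "{} \<notin> U" for A B
    using assms unfolding ultra_def by blast+
  show "- A \<in> U \<longleftrightarrow> A \<notin> U" using 2[of A "- A"] 3 assms unfolding ultra_def by auto
  show "UNIV \<in> U" using 3 assms unfolding ultra_def by (metis Compl_UNIV_eq)
qed

section \<open>Bounded axioms and the theorem of Los up to level n\<close>

definition imf :: "fm \<Rightarrow> fm \<Rightarrow> fm" where "imf p q = Dj (Nt p) q"

text \<open>The difference of x < y is sought below y + 1, which makes the whole of PA^- one bounded
  formula; it then passes to ultrapowers and to limits of chains by preservation of bounded
  truth.\<close>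

definition PAax :: fm where
  "PAax = (let x = V 0; y = V 1; z = V 2 in
     Cj (Eqf (Pl (Pl x y) z) (Pl x (Pl y z))) (Cj (Eqf (Pl x y) (Pl y x)) (Cj (Eqf (Ml (Ml x y) z) (Ml x (Ml y z)))
     (Cj (Eqf (Ml x y) (Ml y x)) (Cj (Eqf (Ml x (Pl y z)) (Pl (Ml x y) (Ml x z))) (Cj (Eqf (Pl x Zr) x) (Cj (Eqf (Ml x Zr) Zr)
     (Cj (Eqf (Ml x On) x) (Cj (Nt (Ltf x x)) (Cj (imf (Cj (Ltf x y) (Ltf y z)) (Ltf x z))
     (Cj (Dj (Ltf x y) (Dj (Eqf x y) (Ltf y x))) (Cj (imf (Ltf x y) (Ltf (Pl x z) (Pl y z)))
     (Cj (imf (Cj (Ltf Zr z) (Ltf x y)) (Ltf (Ml x z) (Ml y z))) (Cj (imf (Ltf x y) (BEx 3 (Pl y On) (Eqf (Pl x (V 3)) y)))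
     (Cj (Ltf Zr On) (Cj (imf (Ltf Zr x) (Dj (Ltf On x) (Eqf On x))) (Dj (Ltf Zr x) (Eqf Zr x))))))))))))))))))"

lemma delta0_PAax: "delta0 PAax"
  unfolding PAax_def imf_def Let_def by (intro delta0.intros)

lemma PAminus_iff:
  assumes U: "carr M = UNIV" shows "PAminus M \<longleftrightarrow> (\<forall>e. sat M e PAax)"
proof
  assume PA: "PAminus M"
  then interpret pam M using U by unfold_locales
  have "\<exists>w. w \<prec> y \<oplus> \<one> \<and> x \<oplus> w = y" if "x \<prec> y" for x y
    using ax(14)[OF that] le_add(2) less_Suc_le by metis
  then have ex: "x \<prec> y \<longrightarrow> (\<exists>w. w \<prec> y \<oplus> \<one> \<and> x \<oplus> w = y)" for x y by blast
  show "\<forall>e. sat M e PAax"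
  proof
    fix e
    show "sat M e PAax" unfolding PAax_def imf_def Let_def
      using ax(1,3,5)[of "e 0" "e 1" "e 2"] ax(2,4,11)[of "e 0" "e 1"] ax(6,7,8,9,16,17)[of "e 0"] ax(10)[of "e 0" "e 1" "e 2"]
        ax(12,13)[of "e 0" "e 1" "e 2"] ax(13)[of "e 2" "e 0" "e 1"] ax(15) ex[of "e 0" "e 1"]
      by (auto simp: U)
  qed
next
  assume a: "\<forall>e. sat M e PAax"
  have s: "sat M (\<lambda>v. if v = 0 then x else if v = 1 then y else z) PAax" for x y z using a by blast
  show "PAminus M" unfolding PAminus_def U ball_UNIV bex_UNIV
    using s unfolding PAax_def imf_def Let_def sat.simps tval.simps by (simp add: U) metis
qed

text \<open>The ultrapower restricted to a class of definable functions: least witnesses within \<open>Fn\<close> take the place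
  of arbitrary choice functions in the theorem of Los, which therefore holds for \<open>\<Sigma>\<^sub>n\<close> and \<open>\<Pi>\<^sub>n\<close>
  formulas only.\<close>

locale rup =
  fixes M :: "'a arith_struct" and n :: nat and Fn :: "('i \<Rightarrow> 'a) set" and D :: "'i set"
    and U :: "'i set set" and Df :: "'i set set" and cl :: "('i \<Rightarrow> 'a) \<Rightarrow> nat"
  assumes UM: "carr M = UNIV" and PAM: "PAminus M" and ult: "ultra U" and DU: "D \<in> U"
    and F_const: "(\<lambda>_. c) \<in> Fn" and F_ad: "f \<in> Fn \<Longrightarrow> g \<in> Fn \<Longrightarrow> (\<lambda>i. ad M (f i) (g i)) \<in> Fn"
    and F_mu: "f \<in> Fn \<Longrightarrow> g \<in> Fn \<Longrightarrow> (\<lambda>i. mu M (f i) (g i)) \<in> Fn"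
    and F_least: "sigma n p \<or> pi n p \<Longrightarrow> (\<And>v. e v \<in> Fn) \<Longrightarrow> g \<in> Fn \<Longrightarrow>
       \<exists>h\<in>Fn. \<forall>i\<in>D. (\<exists>a. ple M a (g i) \<and> sat M ((\<lambda>v. e v i)(x := a)) p = b) \<longrightarrow>
         sat M ((\<lambda>v. e v i)(x := h i)) p = b \<and> (\<forall>a. ls M a (h i) \<longrightarrow> sat M ((\<lambda>v. e v i)(x := a)) p \<noteq> b)"
    and F_bound_ex: "sigma n p \<Longrightarrow> 0 < n \<Longrightarrow> (\<And>v. e v \<in> Fn) \<Longrightarrow>
       \<exists>g\<in>Fn. \<forall>i\<in>D. (\<exists>a. sat M ((\<lambda>v. e v i)(x := a)) p) \<longrightarrow> (\<exists>a. ple M a (g i) \<and> sat M ((\<lambda>v. e v i)(x := a)) p)"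
    and F_bound_all: "pi n p \<Longrightarrow> 0 < n \<Longrightarrow> (\<And>v. e v \<in> Fn) \<Longrightarrow>
       \<exists>g\<in>Fn. \<forall>i\<in>D. (\<exists>a. \<not> sat M ((\<lambda>v. e v i)(x := a)) p) \<longrightarrow> (\<exists>a. ple M a (g i) \<and> \<not> sat M ((\<lambda>v. e v i)(x := a)) p)"
    and Df: "sigma n p \<or> pi n p \<Longrightarrow> (\<And>v. e v \<in> Fn) \<Longrightarrow> {i\<in>D. sat M (\<lambda>v. e v i) p} \<in> Df"
    and cl_eq: "f \<in> Fn \<Longrightarrow> g \<in> Fn \<Longrightarrow> cl f = cl g \<longleftrightarrow> {i. f i = g i} \<in> U"
    and cl_surj: "cl ` Fn = UNIV"
begin

sublocale P: pam M by unfold_locales (rule UM, rule PAM)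

definition rp :: "nat \<Rightarrow> 'i \<Rightarrow> 'a" where "rp = inv_into Fn cl"

lemma rp: "rp x \<in> Fn" "cl (rp x) = x"
  unfolding rp_def using cl_surj by (auto simp: inv_into_into f_inv_into_f)

text \<open>Classes of functions are replaced by their numbers under \<open>cl\<close>, so the
  ultrapower is again a structure on \<open>nat\<close> and the construction can be
  iterated.\<close>

definition N :: "nat arith_struct" where
  "N = \<lparr>carr = UNIV, zr = cl (\<lambda>_. zr M), un = cl (\<lambda>_. un M), ad = (\<lambda>x y. cl (\<lambda>i. ad M (rp x i) (rp y i))),
     mu = (\<lambda>x y. cl (\<lambda>i. mu M (rp x i) (rp y i))), ls = (\<lambda>x y. {i. ls M (rp x i) (rp y i)} \<in> U)\<rparr>"

lemma U_mono: "A \<in> U \<Longrightarrow> A \<subseteq> B \<Longrightarrow> B \<in> U" and U_Int: "A \<in> U \<Longrightarrow> B \<in> U \<Longrightarrow> A \<inter> B \<in> U"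
  and U_empty: "{} \<notin> U" and U_Compl: "- A \<in> U \<longleftrightarrow> A \<notin> U" and U_UNIV: "UNIV \<in> U"
  using ultra_D[OF ult] by blast+

lemma U_not: "{i. \<not> P i} \<in> U \<longleftrightarrow> {i. P i} \<notin> U"
  using U_Compl[of "{i. P i}"] by (simp add: Collect_neg_eq)

lemma U_conj: "{i. P i \<and> Q i} \<in> U \<longleftrightarrow> {i. P i} \<in> U \<and> {i. Q i} \<in> U"
  using U_mono[of "{i. P i \<and> Q i}" "{i. P i}"] U_mono[of "{i. P i \<and> Q i}" "{i. Q i}"] U_Int[of "{i. P i}" "{i. Q i}"]
  by (auto simp: Collect_conj_eq)

lemma rp_cl: "f \<in> Fn \<Longrightarrow> {i. rp (cl f) i = f i} \<in> U"
  using cl_eq[of "rp (cl f)" f] rp by simp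

lemma N_carr [simp]: "carr N = UNIV" and N_zr: "zr N = cl (\<lambda>_. zr M)" and N_un: "un N = cl (\<lambda>_. un M)"
  by (simp_all add: N_def)

lemma N_op:
  assumes "f \<in> Fn" "g \<in> Fn"
  shows "ad N (cl f) (cl g) = cl (\<lambda>i. ad M (f i) (g i))" "mu N (cl f) (cl g) = cl (\<lambda>i. mu M (f i) (g i))"
    "ls N (cl f) (cl g) \<longleftrightarrow> {i. ls M (f i) (g i)} \<in> U"
proof -
  have E: "{i. rp (cl f) i = f i \<and> rp (cl g) i = g i} \<in> U" using rp_cl assms by (simp add: U_conj)
  show "ad N (cl f) (cl g) = cl (\<lambda>i. ad M (f i) (g i))"
    unfolding N_def by (simp, subst cl_eq) (use E in \<open>auto intro!: F_ad rp assms elim: U_mono\<close>)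
  show "mu N (cl f) (cl g) = cl (\<lambda>i. mu M (f i) (g i))"
    unfolding N_def by (simp, subst cl_eq) (use E in \<open>auto intro!: F_mu rp assms elim: U_mono\<close>)
  have "{i. ls M (rp (cl f) i) (rp (cl g) i)} \<in> U \<longleftrightarrow> {i. ls M (f i) (g i)} \<in> U"
  proof
    assume "{i. ls M (rp (cl f) i) (rp (cl g) i)} \<in> U"
    from U_Int[OF this E] show "{i. ls M (f i) (g i)} \<in> U" by (rule U_mono) auto
  next
    assume "{i. ls M (f i) (g i)} \<in> U"
    from U_Int[OF this E] show "{i. ls M (rp (cl f) i) (rp (cl g) i)} \<in> U" by (rule U_mono) auto
  qed
  then show "ls N (cl f) (cl g) \<longleftrightarrow> {i. ls M (f i) (g i)} \<in> U" by (simp add: N_def)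
qed

lemma tval_N:
  fixes e :: "nat \<Rightarrow> 'i \<Rightarrow> 'a"
  assumes "\<And>v. e v \<in> Fn"
  shows "(\<lambda>i. tval M (\<lambda>v. e v i) t) \<in> Fn \<and> tval N (\<lambda>v. cl (e v)) t = cl (\<lambda>i. tval M (\<lambda>v. e v i) t)"
  by (induction t) (auto simp: assms F_const F_ad F_mu N_zr N_un N_op)

lemma env_upd: fixes e :: "nat \<Rightarrow> 'i \<Rightarrow> 'a" shows "(\<lambda>v. cl (e v))(x := cl g) = (\<lambda>v. cl ((e(x := g)) v))" "(\<lambda>v. e v i)(x := g i) = (\<lambda>v. (e(x := g)) v i)"
  by auto

definition los :: "fm \<Rightarrow> bool" where
  "los p \<longleftrightarrow> (\<forall>e. (\<forall>v. e v \<in> Fn) \<longrightarrow> (sat N (\<lambda>v. cl (e v)) p \<longleftrightarrow> {i. sat M (\<lambda>v. e v i) p} \<in> U))"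

lemma los_upd: "los p \<Longrightarrow> (\<And>v. e v \<in> Fn) \<Longrightarrow> g \<in> Fn \<Longrightarrow>
    sat N ((\<lambda>v. cl (e v))(x := cl g)) p \<longleftrightarrow> {i. sat M ((\<lambda>v. e v i)(x := g i)) p} \<in> U"
  unfolding env_upd los_def by simp

lemma ex_cl: "(\<exists>a. P a) \<longleftrightarrow> (\<exists>g\<in>Fn. P (cl g))" "(\<forall>a. P a) \<longleftrightarrow> (\<forall>g\<in>Fn. P (cl g))"
  by (metis rp)+

lemma los_BEx:
  assumes l: "los p" and d: "delta0 p" shows "los (BEx x t p)"
  unfolding los_def
proof (intro allI impI)
  fix e :: "nat \<Rightarrow> 'i \<Rightarrow> 'a" assume "\<forall>v. e v \<in> Fn" then have e: "\<And>v. e v \<in> Fn" by blast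
  let ?t = "\<lambda>i. tval M (\<lambda>v. e v i) t"
  have t: "?t \<in> Fn" "tval N (\<lambda>v. cl (e v)) t = cl ?t" using tval_N[of e t] e by simp_all
  have "sat N (\<lambda>v. cl (e v)) (BEx x t p) \<longleftrightarrow> (\<exists>g\<in>Fn. {i. ls M (g i) (?t i) \<and> sat M ((\<lambda>v. e v i)(x := g i)) p} \<in> U)"
    unfolding sat.simps t(2) N_carr bex_UNIV ex_cl(1) using los_upd[OF l e] N_op(3)[OF _ t(1)] by (auto simp: U_conj)
  also have "\<dots> \<longleftrightarrow> {i. \<exists>a. ls M a (?t i) \<and> sat M ((\<lambda>v. e v i)(x := a)) p} \<in> U"
  proof
    assume "\<exists>g\<in>Fn. {i. ls M (g i) (?t i) \<and> sat M ((\<lambda>v. e v i)(x := g i)) p} \<in> U"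
    then show "{i. \<exists>a. ls M a (?t i) \<and> sat M ((\<lambda>v. e v i)(x := a)) p} \<in> U" by (auto elim: U_mono)
  next
    assume B: "{i. \<exists>a. ls M a (?t i) \<and> sat M ((\<lambda>v. e v i)(x := a)) p} \<in> U"
    have "sigma n p \<or> pi n p" using d by (auto intro: sigma_pi.intros)
    from F_least[where e=e and x=x and b=True, OF this e t(1)] obtain h where h: "h \<in> Fn" and hl: "\<And>i. i \<in> D \<Longrightarrow> (\<exists>a. ple M a (?t i) \<and> sat M ((\<lambda>v. e v i)(x := a)) p) \<Longrightarrow>
         sat M ((\<lambda>v. e v i)(x := h i)) p \<and> (\<forall>a. ls M a (h i) \<longrightarrow> \<not> sat M ((\<lambda>v. e v i)(x := a)) p)" by auto
    \<comment> \<open>\<open>F_least\<close> searches up to and including the bound; minimality puts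
      its result strictly below, as the bounded quantifier requires.\<close>
    have "ls M (h i) (?t i) \<and> sat M ((\<lambda>v. e v i)(x := h i)) p" if "i \<in> D" "ls M a (?t i)" "sat M ((\<lambda>v. e v i)(x := a)) p" for i a
      using hl[OF that(1)] that(2,3) P.le_iff P.ax(10,11) by blast
    then have "{i. ls M (h i) (?t i) \<and> sat M ((\<lambda>v. e v i)(x := h i)) p} \<in> U"
      using U_Int[OF B DU] by (auto elim!: U_mono)
    then show "\<exists>g\<in>Fn. {i. ls M (g i) (?t i) \<and> sat M ((\<lambda>v. e v i)(x := g i)) p} \<in> U" using h by blast
  qed
  finally show "sat N (\<lambda>v. cl (e v)) (BEx x t p) \<longleftrightarrow> {i. sat M (\<lambda>v. e v i) (BEx x t p)} \<in> U" by (simp add: UM)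
qed

lemma los_Nt: "los p \<Longrightarrow> los (Nt p)"
  unfolding los_def by (simp add: U_not)

lemma los_delta0: "delta0 p \<Longrightarrow> los p"
proof (induction rule: delta0.induct)
  case (1 s t)
  have "sat N (\<lambda>v. cl (e v)) (Eqf s t) \<longleftrightarrow> {i. sat M (\<lambda>v. e v i) (Eqf s t)} \<in> U" if "\<And>v. e v \<in> Fn" for e
    using tval_N[of e s] tval_N[of e t] that by (simp add: cl_eq)
  then show ?case unfolding los_def by blast
next
  case (2 s t)
  have "sat N (\<lambda>v. cl (e v)) (Ltf s t) \<longleftrightarrow> {i. sat M (\<lambda>v. e v i) (Ltf s t)} \<in> U" if "\<And>v. e v \<in> Fn" for e
    using tval_N[of e s] tval_N[of e t] that by (simp add: N_op)
  then show ?case unfolding los_def by blast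
next
  case (3 p) then show ?case by (simp add: los_Nt)
next
  case (4 p q) then show ?case unfolding los_def by (simp add: U_conj)
next
  case (5 p q)
  have "{i. P i \<or> Q i} \<in> U \<longleftrightarrow> {i. P i} \<in> U \<or> {i. Q i} \<in> U" for P Q
    using U_not[of "\<lambda>i. P i \<or> Q i"] U_conj[of "\<lambda>i. \<not> P i" "\<lambda>i. \<not> Q i"] unfolding U_not de_Morgan_disj[symmetric] by blast
  then show ?case using 5 unfolding los_def by simp
next
  case (6 p x t) then show ?case by (simp add: los_BEx)
next
  case (7 p x t)
  have "los (Nt (BEx x t (Nt p)))" using 7 by (intro los_Nt los_BEx delta0.intros) auto
  then show ?case unfolding los_def by simp
qed

text \<open>The function \<open>g\<close> confines the unbounded search, after which
  \<open>F_least\<close> applies. Comparing truth with a Boolean \<open>b\<close> treats witnesses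
  for \<open>Ex\<close> and counterexamples for \<open>Al\<close> by one argument.\<close>

lemma los_ex_all:
  assumes l: "los p" and e: "\<And>v. e v \<in> Fn"
  shows "sigma n p \<Longrightarrow> 0 < n \<Longrightarrow> sat N (\<lambda>v. cl (e v)) (Ex x p) \<longleftrightarrow> {i. sat M (\<lambda>v. e v i) (Ex x p)} \<in> U"
    and "pi n p \<Longrightarrow> 0 < n \<Longrightarrow> sat N (\<lambda>v. cl (e v)) (Al x p) \<longleftrightarrow> {i. sat M (\<lambda>v. e v i) (Al x p)} \<in> U"
proof -
  have main: "(\<exists>h\<in>Fn. {i. sat M ((\<lambda>v. e v i)(x := h i)) p = b} \<in> U) \<longleftrightarrow> {i. \<exists>a. sat M ((\<lambda>v. e v i)(x := a)) p = b} \<in> U"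
    if p: "sigma n p \<or> pi n p" and g: "\<exists>g\<in>Fn. \<forall>i\<in>D. (\<exists>a. sat M ((\<lambda>v. e v i)(x := a)) p = b) \<longrightarrow> (\<exists>a. ple M a (g i) \<and> sat M ((\<lambda>v. e v i)(x := a)) p = b)"
    for b
  proof
    assume "\<exists>h\<in>Fn. {i. sat M ((\<lambda>v. e v i)(x := h i)) p = b} \<in> U"
    then show "{i. \<exists>a. sat M ((\<lambda>v. e v i)(x := a)) p = b} \<in> U" by (auto elim: U_mono)
  next
    assume B: "{i. \<exists>a. sat M ((\<lambda>v. e v i)(x := a)) p = b} \<in> U"
    obtain g where g: "g \<in> Fn" "\<forall>i\<in>D. (\<exists>a. sat M ((\<lambda>v. e v i)(x := a)) p = b) \<longrightarrow> (\<exists>a. ple M a (g i) \<and> sat M ((\<lambda>v. e v i)(x := a)) p = b)"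
      using g by blast
    from F_least[where e=e and x=x and b=b, OF p e g(1)] obtain h where h: "h \<in> Fn" and hl: "\<And>i. i \<in> D \<Longrightarrow> (\<exists>a. ple M a (g i) \<and> sat M ((\<lambda>v. e v i)(x := a)) p = b) \<Longrightarrow>
         sat M ((\<lambda>v. e v i)(x := h i)) p = b" by blast
    have "D \<inter> {i. \<exists>a. sat M ((\<lambda>v. e v i)(x := a)) p = b} \<subseteq> {i. sat M ((\<lambda>v. e v i)(x := h i)) p = b}" using hl g(2) by blast
    then have "{i. sat M ((\<lambda>v. e v i)(x := h i)) p = b} \<in> U" using U_mono[OF U_Int[OF DU B]] by blast
    then show "\<exists>h\<in>Fn. {i. sat M ((\<lambda>v. e v i)(x := h i)) p = b} \<in> U" using h by blast
  qed
  show "sat N (\<lambda>v. cl (e v)) (Ex x p) \<longleftrightarrow> {i. sat M (\<lambda>v. e v i) (Ex x p)} \<in> U" if "sigma n p" "0 < n"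
    unfolding sat.simps N_carr UM bex_UNIV ex_cl(1) using los_upd[OF l e] main[of True] F_bound_ex[where e=e and x=x, OF that e] that by auto
  have "{i. \<exists>a. sat M ((\<lambda>v. e v i)(x := a)) p = False} \<in> U \<longleftrightarrow> {i. \<forall>a. sat M ((\<lambda>v. e v i)(x := a)) p} \<notin> U"
    using U_not[of "\<lambda>i. \<forall>a. sat M ((\<lambda>v. e v i)(x := a)) p"] by simp
  then show "sat N (\<lambda>v. cl (e v)) (Al x p) \<longleftrightarrow> {i. sat M (\<lambda>v. e v i) (Al x p)} \<in> U" if "pi n p" "0 < n"
    unfolding sat.simps N_carr UM ball_UNIV ex_cl(2) using los_upd[OF l e] main[of False] F_bound_all[where e=e and x=x, OF that e] that by (auto simp: U_not)
qed

lemma los_sigma_pi: "sigma n p \<Longrightarrow> los p" "pi n p \<Longrightarrow> los p"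
proof -
  have "(sigma k1 p1 \<longrightarrow> (k1 \<le> n \<longrightarrow> los p1)) \<and> (pi k2 p2 \<longrightarrow> (k2 \<le> n \<longrightarrow> los p2))" for k1 k2 p1 p2
  proof (rule sigma_pi.induct[of "\<lambda>k p. k \<le> n \<longrightarrow> los p" "\<lambda>k p. k \<le> n \<longrightarrow> los p"], goal_cases)
    case (4 k p x)
    have "los (Ex x p)" if k: "Suc k \<le> n"
    proof -
      have p: "sigma n p" "0 < n" "los p" using 4 k sigma_le by auto
      show ?thesis unfolding los_def by (intro allI impI los_ex_all(1) p) blast
    qed
    then show ?case by blast
  next
    case (6 k p x)
    have "los (Al x p)" if k: "Suc k \<le> n"
    proof -
      have p: "pi n p" "0 < n" "los p" using 6 k pi_le by auto
      show ?thesis unfolding los_def by (intro allI impI los_ex_all(2) p) blast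
    qed
    then show ?case by blast
  qed (auto intro: sigma_pi.intros los_delta0)
  then show "sigma n p \<Longrightarrow> los p" "pi n p \<Longrightarrow> los p" by auto
qed

text \<open>At level n + 1 no least witnesses are available, so each quantifier passes in one
  direction only: a witness in the ultrapower is the class of a function in \<open>Fn\<close>, whose
  values are witnesses at the indices. Membership of \<open>A\<close> in \<open>Df\<close> records
  definability, which is what later rules out an image of the identity.\<close>

lemma half_los:
  shows "sigma (Suc n) p \<Longrightarrow> (\<And>v. e v \<in> Fn) \<Longrightarrow> sat N (\<lambda>v. cl (e v)) p \<Longrightarrow>
      \<exists>A\<in>U. A \<in> Df \<and> A \<subseteq> D \<and> (\<forall>i\<in>A. sat M (\<lambda>v. e v i) p)"
    and "pi (Suc n) p \<Longrightarrow> (\<And>v. e v \<in> Fn) \<Longrightarrow> {i. sat M (\<lambda>v. e v i) p} \<in> U \<Longrightarrow> sat N (\<lambda>v. cl (e v)) p"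
proof -
  let ?S = "\<lambda>p. \<forall>e. (\<forall>v. e v \<in> Fn) \<longrightarrow> sat N (\<lambda>v. cl (e v)) p \<longrightarrow> (\<exists>A\<in>U. A \<in> Df \<and> A \<subseteq> D \<and> (\<forall>i\<in>A. sat M (\<lambda>v. e v i) p))"
  let ?P = "\<lambda>p. \<forall>e. (\<forall>v. e v \<in> Fn) \<longrightarrow> {i. sat M (\<lambda>v. e v i) p} \<in> U \<longrightarrow> sat N (\<lambda>v. cl (e v)) p"
  have low: "?S p \<and> ?P p" if p: "sigma n p \<or> pi n p" for p
  proof (intro conjI allI impI)
    fix e :: "nat \<Rightarrow> 'i \<Rightarrow> 'a" assume e: "\<forall>v. e v \<in> Fn"
    have l: "sat N (\<lambda>v. cl (e v)) p \<longleftrightarrow> {i. sat M (\<lambda>v. e v i) p} \<in> U" using los_sigma_pi p e unfolding los_def by blast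
    show "{i. sat M (\<lambda>v. e v i) p} \<in> U \<Longrightarrow> sat N (\<lambda>v. cl (e v)) p" using l by blast
    assume "sat N (\<lambda>v. cl (e v)) p"
    then have "D \<inter> {i. sat M (\<lambda>v. e v i) p} \<in> U" using l U_Int[OF DU] by blast
    moreover have "D \<inter> {i. sat M (\<lambda>v. e v i) p} = {i\<in>D. sat M (\<lambda>v. e v i) p}" by blast
    ultimately show "\<exists>A\<in>U. A \<in> Df \<and> A \<subseteq> D \<and> (\<forall>i\<in>A. sat M (\<lambda>v. e v i) p)" using Df[OF p] e
      by (intro bexI[of _ "{i\<in>D. sat M (\<lambda>v. e v i) p}"]) auto
  qed
  have "(sigma k1 p1 \<longrightarrow> (k1 = Suc n \<longrightarrow> ?S p1)) \<and> (pi k2 p2 \<longrightarrow> (k2 = Suc n \<longrightarrow> ?P p2))" for k1 k2 p1 p2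
  proof (rule sigma_pi.induct[of "\<lambda>k p. k = Suc n \<longrightarrow> ?S p" "\<lambda>k p. k = Suc n \<longrightarrow> ?P p"], goal_cases)
    case (1 p k) then show ?case using low[of p] by (auto intro: sigma_pi.intros)
  next
    case (2 p k) then show ?case using low[of p] by (auto intro: sigma_pi.intros)
  next
    case (3 k p) then show ?case using low[of p] by auto
  next
    case (5 k p) then show ?case using low[of p] by auto
  next
    case (4 k p x)
    show ?case
    proof (intro impI allI)
      fix e :: "nat \<Rightarrow> 'i \<Rightarrow> 'a" assume k: "Suc k = Suc n" and e: "\<forall>v. e v \<in> Fn" and "sat N (\<lambda>v. cl (e v)) (Ex x p)"
      then obtain g where g: "g \<in> Fn" "sat N ((\<lambda>v. cl (e v))(x := cl g)) p"
        unfolding sat.simps N_carr bex_UNIV ex_cl(1) by blast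
      have e': "\<forall>v. (e(x := g)) v \<in> Fn" using e g(1) by simp
      obtain A where "A \<in> U" "A \<in> Df" "A \<subseteq> D" "\<forall>i\<in>A. sat M (\<lambda>v. (e(x := g)) v i) p"
        using 4(2)[rule_format, OF k, of "e(x := g)"] e' g(2) unfolding env_upd(1) by auto
      then show "\<exists>A\<in>U. A \<in> Df \<and> A \<subseteq> D \<and> (\<forall>i\<in>A. sat M (\<lambda>v. e v i) (Ex x p))"
        unfolding env_upd(2)[symmetric] by (intro bexI[of _ A]) (auto simp: UM)
    qed
  next
    case (6 k p x)
    show ?case
    proof (intro impI allI)
      fix e :: "nat \<Rightarrow> 'i \<Rightarrow> 'a" assume k: "Suc k = Suc n" and e: "\<forall>v. e v \<in> Fn" and A: "{i. sat M (\<lambda>v. e v i) (Al x p)} \<in> U"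
      have "sat N ((\<lambda>v. cl (e v))(x := cl g)) p" if g: "g \<in> Fn" for g
      proof -
        have e': "\<forall>v. (e(x := g)) v \<in> Fn" using e g by simp
        have "{i. sat M (\<lambda>v. (e(x := g)) v i) p} \<in> U" unfolding env_upd(2)[symmetric] using A by (rule U_mono) (auto simp: UM)
        then show ?thesis unfolding env_upd(1) using 6(2)[rule_format, OF k, of "e(x := g)"] e' by blast
      qed
      then show "sat N (\<lambda>v. cl (e v)) (Al x p)" unfolding sat.simps N_carr ball_UNIV ex_cl(2) by blast
    qed
  qed
  then show "sigma (Suc n) p \<Longrightarrow> (\<And>v. e v \<in> Fn) \<Longrightarrow> sat N (\<lambda>v. cl (e v)) p \<Longrightarrow>
      \<exists>A\<in>U. A \<in> Df \<and> A \<subseteq> D \<and> (\<forall>i\<in>A. sat M (\<lambda>v. e v i) p)"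
    "pi (Suc n) p \<Longrightarrow> (\<And>v. e v \<in> Fn) \<Longrightarrow> {i. sat M (\<lambda>v. e v i) p} \<in> U \<Longrightarrow> sat N (\<lambda>v. cl (e v)) p" by blast+
qed

definition dg :: "'a \<Rightarrow> nat" where "dg c = cl (\<lambda>_. c)"

lemma dg_upd: "(\<lambda>v. dg (e v))(x := dg a) = (\<lambda>v. dg ((e(x := a)) v))" by auto

text \<open>For constant functions truth in \<open>M\<close> is the same at every index, so a
  nonempty set of indices settles it. This turns each direction of \<open>half_los\<close> into the
  one that plain induction on the prefix cannot give.\<close>

lemma elementary: "sigma (Suc n) p \<or> pi (Suc n) p \<Longrightarrow> sat N (\<lambda>v. dg (e v)) p = sat M e p"
proof -
  have K: "{i :: 'i. Q} \<in> U \<longleftrightarrow> Q" for Q using U_UNIV U_empty by (cases Q) auto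
  let ?S = "\<lambda>p. \<forall>e. sat M e p \<longrightarrow> sat N (\<lambda>v. dg (e v)) p"
  let ?P = "\<lambda>p. \<forall>e. sat N (\<lambda>v. dg (e v)) p \<longrightarrow> sat M e p"
  have low: "sat N (\<lambda>v. dg (e v)) p = sat M e p" if p: "sigma n p \<or> pi n p" for p e
  proof -
    have "los p" using los_sigma_pi p by blast
    then have "sat N (\<lambda>v. dg (e v)) p \<longleftrightarrow> {i :: 'i. sat M e p} \<in> U"
      unfolding los_def dg_def using F_const by (simp add: spec[of _ "\<lambda>v (_ :: 'i). e v"])
    then show ?thesis unfolding K .
  qed
  have "(sigma k1 p1 \<longrightarrow> (k1 = Suc n \<longrightarrow> ?S p1)) \<and> (pi k2 p2 \<longrightarrow> (k2 = Suc n \<longrightarrow> ?P p2))" for k1 k2 p1 p2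
  proof (rule sigma_pi.induct[of "\<lambda>k p. k = Suc n \<longrightarrow> ?S p" "\<lambda>k p. k = Suc n \<longrightarrow> ?P p"], goal_cases)
    case (1 p k) then show ?case using low[of p] by (auto intro: sigma_pi.intros)
  next
    case (2 p k) then show ?case using low[of p] by (auto intro: sigma_pi.intros)
  next
    case (3 k p) then show ?case using low[of p] by auto
  next
    case (5 k p) then show ?case using low[of p] by auto
  next
    case (4 k p x)
    have "sat M e (Ex x p) \<longrightarrow> sat N (\<lambda>v. dg (e v)) (Ex x p)" if "Suc k = Suc n" for e
    proof
      assume "sat M e (Ex x p)"
      then obtain a where "sat M (e(x := a)) p" by auto
      then have "sat N (\<lambda>v. dg ((e(x := a)) v)) p" using 4(2) that by blast
      then show "sat N (\<lambda>v. dg (e v)) (Ex x p)" unfolding dg_upd[symmetric] by auto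
    qed
    then show ?case by blast
  next
    case (6 k p x)
    have "sat N (\<lambda>v. dg (e v)) (Al x p) \<longrightarrow> sat M e (Al x p)" if "Suc k = Suc n" for e
    proof
      assume a: "sat N (\<lambda>v. dg (e v)) (Al x p)"
      have "sat M (e(x := b)) p" for b
      proof -
        have "sat N ((\<lambda>v. dg (e v))(x := dg b)) p" using a by simp
        then show ?thesis unfolding dg_upd using 6(2) that by blast
      qed
      then show "sat M e (Al x p)" by simp
    qed
    then show ?case by blast
  qed
  then have 1: "sigma (Suc n) p \<Longrightarrow> sat M e p \<Longrightarrow> sat N (\<lambda>v. dg (e v)) p" "pi (Suc n) p \<Longrightarrow> sat N (\<lambda>v. dg (e v)) p \<Longrightarrow> sat M e p"
    by blast+
  have 2: "sat M e p" if h: "sigma (Suc n) p" "sat N (\<lambda>v. dg (e v)) p"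
  proof -
    obtain A where A: "A \<in> U" "\<forall>i\<in>A. sat M e p"
      using half_los(1)[OF h(1), of "\<lambda>v _. e v"] h(2) F_const unfolding dg_def by blast
    then have "A \<noteq> {}" using U_empty by blast
    then show ?thesis using A(2) by blast
  qed
  have 3: "sat N (\<lambda>v. dg (e v)) p" if "pi (Suc n) p" "sat M e p"
    using half_los(2)[OF that(1), of "\<lambda>v _. e v"] that(2) F_const U_UNIV unfolding dg_def by simp
  assume "sigma (Suc n) p \<or> pi (Suc n) p"
  then show ?thesis using 1 2 3 by blast
qed

lemma env_ex: fixes e :: "nat \<Rightarrow> nat" shows "\<exists>e'. (\<forall>v. e' v \<in> Fn) \<and> e = (\<lambda>v. cl (e' v))"
  using rp by (intro exI[of _ "\<lambda>v. rp (e v)"]) simp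

lemma PAminus_N: "PAminus N"
  unfolding PAminus_iff[OF N_carr]
proof
  fix e :: "nat \<Rightarrow> nat"
  obtain e' where e': "\<forall>v. e' v \<in> Fn" "e = (\<lambda>v. cl (e' v))" using env_ex[of e] by (elim exE conjE)
  have "sat M e PAax" for e using PAM unfolding PAminus_iff[OF UM] by simp
  then have "{i. sat M (\<lambda>v. e' v i) PAax} = UNIV" by simp
  then show "sat N e PAax" using los_delta0[OF delta0_PAax] e' U_UNIV unfolding los_def by simp
qed

text \<open>At the indices where induction fails, \<open>h\<close> picks the least counterexample
  and \<open>k\<close> its predecessor. The class of \<open>k\<close> then satisfies the formula
  while its successor, the class of \<open>h\<close>, does not.\<close>

lemma ISigma_N: "ISigma n N"
  unfolding ISigma_def N_carr ball_UNIV
proof (intro conjI PAminus_N allI impI)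
  fix p x a and e :: "nat \<Rightarrow> nat"
  assume p: "sigma n p" and z: "sat N (e(x := zr N)) p"
    and S: "\<forall>a. sat N (e(x := a)) p \<longrightarrow> sat N (e(x := ad N a (un N))) p"
  obtain e' where e': "\<forall>v. e' v \<in> Fn" "e = (\<lambda>v. cl (e' v))" using env_ex[of e] by (elim exE conjE)
  have l: "los p" using p by (rule los_sigma_pi)
  have lu: "sat N (e(x := cl g)) p \<longleftrightarrow> {i. sat M ((\<lambda>v. e' v i)(x := g i)) p} \<in> U" if "g \<in> Fn" for g
    unfolding e'(2) by (rule los_upd[OF l]) (use e' that in auto)
  let ?Q = "\<lambda>i a. sat M ((\<lambda>v. e' v i)(x := a)) p"
  obtain g where g: "g \<in> Fn" "a = cl g" using rp[of a] by metis
  show "sat N (e(x := a)) p"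
  proof (rule ccontr)
    assume "\<not> sat N (e(x := a)) p"
    then have B: "{i. \<not> ?Q i (g i)} \<in> U" using lu[OF g(1)] g(2) by (simp add: U_not)
    have B0: "{i. ?Q i (zr M)} \<in> U" using z lu[OF F_const, of "zr M"] by (simp add: N_zr)
    obtain h where h: "h \<in> Fn" and hl: "\<And>i. i \<in> D \<Longrightarrow> \<exists>a. ple M a (g i) \<and> ?Q i a = False \<Longrightarrow> ?Q i (h i) = False \<and> (\<forall>a. ls M a (h i) \<longrightarrow> ?Q i a)"
      using F_least[of p e' g x False] p e'(1) g(1) by auto
    have d: "delta0 (Eqf (Pl (V 0) On) (V 1))" by (rule delta0.intros)
    have s: "sigma n (Eqf (Pl (V 0) On) (V 1)) \<or> pi n (Eqf (Pl (V 0) On) (V 1))" using d by (auto intro: sigma_pi.intros)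
    obtain k where k: "k \<in> Fn" and kl: "\<And>i. i \<in> D \<Longrightarrow> \<exists>a. ple M a (h i) \<and> ad M a (un M) = h i \<Longrightarrow> ad M (k i) (un M) = h i"
      using F_least[OF s, of "\<lambda>_. h" h 0 True] h by auto
    have good: "?Q i (k i) \<and> ad M (k i) (un M) = h i \<and> \<not> ?Q i (h i)" if "i \<in> D" "\<not> ?Q i (g i)" "?Q i (zr M)" for i
    proof -
      have h': "\<not> ?Q i (h i)" "\<And>a. ls M a (h i) \<Longrightarrow> ?Q i a" using hl[OF that(1)] that(2) P.le_iff by blast+
      then have "h i \<noteq> zr M" using that(3) by metis
      then obtain b where "h i = ad M b (un M)" using P.zero_or_Suc by blast
      then have "ad M (k i) (un M) = h i" using kl[OF that(1)] P.le_add(1) by metis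
      then show ?thesis using h' P.less_add_one by metis
    qed
    have G: "D \<inter> ({i. \<not> ?Q i (g i)} \<inter> {i. ?Q i (zr M)}) \<in> U" using B B0 DU by (intro U_Int)
    have "{i. ?Q i (k i)} \<in> U" by (rule U_mono[OF G]) (use good in auto)
    then have "sat N (e(x := cl k)) p" using lu[OF k] by simp
    then have "sat N (e(x := ad N (cl k) (un N))) p" using S by blast
    moreover have "ad N (cl k) (un N) = cl h" unfolding N_un N_op[OF k F_const]
      by (subst cl_eq[OF F_ad[OF k F_const] h], rule U_mono[OF G]) (use good in auto)
    moreover have "{i. \<not> ?Q i (h i)} \<in> U" by (rule U_mono[OF G]) (use good in auto)
    ultimately show False using lu[OF h] by (simp add: U_not)
  qed
qed

end

text \<open>There are infinitely many classes because distinct constants stay distinct, and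
  countably many because \<open>Fn\<close> is countable.\<close>

lemma class_numbering:
  fixes Fn :: "('i \<Rightarrow> 'a) set"
  assumes u: "ultra U" and c: "countable Fn" and const: "\<And>c. (\<lambda>_. c) \<in> Fn" and inf: "infinite (UNIV :: 'a set)"
  shows "\<exists>cl :: ('i \<Rightarrow> 'a) \<Rightarrow> nat. (\<forall>f\<in>Fn. \<forall>g\<in>Fn. cl f = cl g \<longleftrightarrow> {i. f i = g i} \<in> U) \<and> cl ` Fn = UNIV"
proof -
  note U = ultra_D[OF u]
  define cls where "cls f = {g \<in> Fn. {i. f i = g i} \<in> U}" for f
  have cls: "cls f = cls g \<longleftrightarrow> {i. f i = g i} \<in> U" if fg: "f \<in> Fn" "g \<in> Fn" for f g
  proof
    assume "cls f = cls g"
    moreover have "g \<in> cls g" using fg U(5) unfolding cls_def by simp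
    ultimately show "{i. f i = g i} \<in> U" unfolding cls_def by blast
  next
    assume e: "{i. f i = g i} \<in> U"
    have "{i. f i = k i} \<in> U \<longleftrightarrow> {i. g i = k i} \<in> U" for k
    proof
      assume "{i. f i = k i} \<in> U" from U(2)[OF this e] show "{i. g i = k i} \<in> U" by (rule U(1)) auto
    next
      assume "{i. g i = k i} \<in> U" from U(2)[OF this e] show "{i. f i = k i} \<in> U" by (rule U(1)) auto
    qed
    then show "cls f = cls g" unfolding cls_def by blast
  qed
  let ?Q = "cls ` Fn"
  have "inj (\<lambda>c. cls (\<lambda>_. c))"
  proof (rule injI)
    fix c d assume "cls (\<lambda>_. c) = cls (\<lambda>_. d)"
    then have "{i :: 'i. c = d} \<in> U" using cls[OF const const] by simp
    then show "c = d" using U(3) by (cases "c = d") auto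
  qed
  then have "infinite (range (\<lambda>c. cls (\<lambda>_. c)))" using inf by (metis finite_imageD)
  then have "infinite ?Q" by (rule infinite_super[rotated]) (use const in auto)
  then have bij: "bij_betw (to_nat_on ?Q) ?Q UNIV" using c by (intro to_nat_on_infinite) auto
  show ?thesis
  proof (intro exI[of _ "\<lambda>f. to_nat_on ?Q (cls f)"] conjI ballI)
    fix f g assume fg: "f \<in> Fn" "g \<in> Fn"
    have "inj_on (to_nat_on ?Q) ?Q" using bij by (rule bij_betw_imp_inj_on)
    from inj_on_eq_iff[OF this imageI[OF fg(1)] imageI[OF fg(2)]] show "to_nat_on ?Q (cls f) = to_nat_on ?Q (cls g) \<longleftrightarrow> {i. f i = g i} \<in> U"
      using cls[OF fg] by simp
  next
    show "(\<lambda>f. to_nat_on ?Q (cls f)) ` Fn = UNIV" using bij unfolding bij_betw_def by (simp add: image_image)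
  qed
qed

section \<open>Ultrapowers over bounded functions\<close>

definition el :: "nat \<Rightarrow> 'a arith_struct \<Rightarrow> 'b arith_struct \<Rightarrow> ('a \<Rightarrow> 'b) \<Rightarrow> bool" where
  "el k M N h \<longleftrightarrow> (\<forall>p e. sigma k p \<or> pi k p \<longrightarrow> sat N (\<lambda>v. h (e v)) p = sat M e p)"

definition bounded_by :: "'a arith_struct \<Rightarrow> 'b arith_struct \<Rightarrow> ('a \<Rightarrow> 'b) \<Rightarrow> bool" where
  "bounded_by M N h \<longleftrightarrow> (\<forall>y. \<exists>x. ple N y (h x))"

lemma el_delta0: "el k M N h \<Longrightarrow> delta0 p \<Longrightarrow> sat N (\<lambda>v. h (e v)) p = sat M e p"
  unfolding el_def by (auto intro: sigma_pi.intros)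

lemma el_ops:
  assumes "el k M N h"
  shows "h (zr M) = zr N" "h (un M) = un N" "h (ad M x y) = ad N (h x) (h y)" "h (mu M x y) = mu N (h x) (h y)"
    "ls N (h x) (h y) = ls M x y" "h x = h y \<longleftrightarrow> x = y" "ple N (h x) (h y) = ple M x y"
proof -
  note d = el_delta0[OF assms]
  have d3: "sat N (\<lambda>v. h ((\<lambda>v. if v = 0 then a else if v = 1 then b else c) v)) p = sat M (\<lambda>v. if v = 0 then a else if v = 1 then b else c) p"
    if "delta0 p" for a b c p by (rule d[OF that])
  show "h (zr M) = zr N" using d3[of "Eqf (V 0) Zr" "zr M"] delta0.intros by simp
  show "h (un M) = un N" using d3[of "Eqf (V 0) On" "un M"] delta0.intros by simp
  show "h (ad M x y) = ad N (h x) (h y)" using d3[of "Eqf (V 2) (Pl (V 0) (V 1))" x y "ad M x y"] delta0.intros by simp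
  show "h (mu M x y) = mu N (h x) (h y)" using d3[of "Eqf (V 2) (Ml (V 0) (V 1))" x y "mu M x y"] delta0.intros by simp
  show l: "ls N (h x) (h y) = ls M x y" using d3[of "Ltf (V 0) (V 1)" x y] delta0.intros by simp
  show e: "h x = h y \<longleftrightarrow> x = y" using d3[of "Eqf (V 0) (V 1)" x y] delta0.intros by simp
  show "ple N (h x) (h y) = ple M x y" unfolding ple_def l e ..
qed

text \<open>A code of the powers of two up to some \<open>h m\<close> above X also serves X itself:
  only the final value changes, to the entry at X. Cofinality provides such an m.\<close>

lemma Exp_cofinal:
  assumes UM: "carr M = UNIV" and EM: "Exp M" and UN: "carr N = UNIV" and PN: "PAminus N"
    and el: "el k M N h" and cf: "bounded_by M N h"
  shows "Exp N"
proof -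
  interpret N: pam N by unfold_locales (fact UN PN)+
  have d: "delta0 exp_matrix" unfolding exp_matrix_def rem_is_def by (intro delta0.intros)
  show ?thesis unfolding Exp_def
  proof (intro allI impI)
    fix e
    have "\<exists>y c d. sat N (e(0 := X, 1 := y, 2 := c, 3 := d)) exp_matrix" for X
    proof -
      obtain m where m: "ple N X (h m)" using cf unfolding bounded_by_def by blast
      let ?e = "(\<lambda>_. zr M)"
      have "sat M ?e exp_sentence" using EM unfolding Exp_def env_in_def UM by blast
      then obtain y c d where "sat M (?e(0 := m, 1 := y, 2 := c, 3 := d)) exp_matrix"
        unfolding exp_sentence_def sat.simps UM by blast
      then have "sat N (\<lambda>v. h ((?e(0 := m, 1 := y, 2 := c, 3 := d)) v)) exp_matrix" using el_delta0[OF el d] by blast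
      then have s: "sat N (e(0 := h m, 1 := h y, 2 := h c, 3 := h d)) exp_matrix"
        unfolding exp_matrix_def rem_is_def bmod_def by (simp add: UN)
      show ?thesis
      proof (cases "X = h m")
        case True then show ?thesis using s by blast
      next
        case False
        then have l: "ls N X (h m)" using m by (simp add: ple_def)
        then obtain r where "sat N (e(0 := h m, 1 := h y, 2 := h c, 3 := h d, 4 := X, 6 := r)) (rem_is (bmod (V 4)) (V 6))"
        proof -
          assume r: "\<And>r. sat N (e(0 := h m, 1 := h y, 2 := h c, 3 := h d, 4 := X, 6 := r)) (rem_is (bmod (V 4)) (V 6)) \<Longrightarrow> thesis"
          have "ls N X (tval N (e(0 := h m, 1 := h y, 2 := h c, 3 := h d)) (V 0))" using l by simp
          then show thesis using s r unfolding exp_matrix_def sat.simps UN ball_UNIV bex_UNIV by blast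
        qed
        then have "sat N (e(0 := X, 1 := r, 2 := h c, 3 := h d)) exp_matrix"
          using s l N.ax(10)[OF _ l] unfolding exp_matrix_def rem_is_def bmod_def by (simp add: UN)
        then show ?thesis by blast
      qed
    qed
    then show "sat N e exp_sentence" unfolding exp_sentence_def sat.simps UN by blast
  qed
qed

section \<open>From formulas back to the semantic classes\<close>

context pam begin

lemma tval_fsub: "(\<And>v. FF (F v)) \<Longrightarrow> FF (\<lambda>e. tval M (\<lambda>v. F v e) t)"
  by (induction t) auto

text \<open>Passing under a quantifier over \<open>x\<close>: now \<open>x\<close> reads the new
  position 0, and every other inserted function is shifted by one.\<close>

lemma fsub_env: "(\<lambda>v. F v e)(x := a) = (\<lambda>v. (if v = x then (\<lambda>e. e 0) else (\<lambda>e. F v (\<lambda>w. e (Suc w)))) (case_nat a e))"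
  by auto

lemma fsub_FF: "(\<And>v. FF (F v)) \<Longrightarrow> FF (if v = x then (\<lambda>e. e 0) else (\<lambda>e. F v (\<lambda>w. e (Suc w))))"
  using FF_shift[of "F v"] by auto

text \<open>The converse of \<open>DD_repr\<close>, with a function of bounded graph inserted for
  each variable; so a formula evaluated along functions of one index defines a predicate of the same
  class in that index.\<close>

lemma delta0_fsub: "delta0 p \<Longrightarrow> (\<And>v. FF (F v)) \<Longrightarrow> DD M (\<lambda>e. sat M (\<lambda>v. F v e) p)"
proof (induction arbitrary: F rule: delta0.induct)
  case (1 s t) show ?case unfolding sat.simps by (rule DD_Feq; rule tval_fsub; rule 1)
next
  case (2 s t) show ?case unfolding sat.simps by (rule DD_Fls; rule tval_fsub; rule 2)
next
  case (3 p) show ?case unfolding sat.simps by (rule DD_not, rule 3, rule 3)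
next
  case (4 p q) show ?case unfolding sat.simps by (rule DD_conj) (rule 4, rule 4)+
next
  case (5 p q) show ?case unfolding sat.simps by (rule DD_disj) (rule 5, rule 5)+
next
  case (6 p x t)
  let ?F = "\<lambda>v. if v = x then (\<lambda>e. e 0) else (\<lambda>e. F v (\<lambda>w. e (Suc w)))"
  have "DD M (\<lambda>e. sat M (\<lambda>v. ?F v e) p)" by (rule 6) (rule fsub_FF, rule 6)
  then have b: "DD M (\<lambda>e. sat M (\<lambda>v. ?F v (case_nat (e 0) (\<lambda>v. e (Suc v)))) p)"
    by (rule DD_iff) (simp add: if_distribR cong: if_cong)
  have "DD M (\<lambda>e. \<exists>a. a \<prec> tval M (\<lambda>v. F v e) t \<and> sat M (\<lambda>v. ?F v (case_nat a e)) p)"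
    by (rule DD_Fbex[where P = "\<lambda>e a. sat M (\<lambda>v. ?F v (case_nat a e)) p", OF tval_fsub[of F, OF 6(3)] b])
  then show ?case unfolding sat.simps U bex_UNIV fsub_env .
next
  case (7 p x t)
  let ?F = "\<lambda>v. if v = x then (\<lambda>e. e 0) else (\<lambda>e. F v (\<lambda>w. e (Suc w)))"
  have "DD M (\<lambda>e. sat M (\<lambda>v. ?F v e) p)" by (rule 7) (rule fsub_FF, rule 7)
  then have b: "DD M (\<lambda>e. sat M (\<lambda>v. ?F v (case_nat (e 0) (\<lambda>v. e (Suc v)))) p)"
    by (rule DD_iff) (simp add: if_distribR cong: if_cong)
  have "DD M (\<lambda>e. \<forall>a. a \<prec> tval M (\<lambda>v. F v e) t \<longrightarrow> sat M (\<lambda>v. ?F v (case_nat a e)) p)"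
    by (rule DD_Fball[where P = "\<lambda>e a. sat M (\<lambda>v. ?F v (case_nat a e)) p", OF tval_fsub[of F, OF 7(3)] b])
  then show ?case unfolding sat.simps U ball_UNIV fsub_env .
qed

lemma sigma_fsub: "sigma k p \<Longrightarrow> (\<And>v. FF (F v)) \<Longrightarrow> SG M k (\<lambda>e. sat M (\<lambda>v. F v e) p)"
  and pi_fsub: "pi k p \<Longrightarrow> (\<And>v. FF (F v)) \<Longrightarrow> PG M k (\<lambda>e. sat M (\<lambda>v. F v e) p)"
proof -
  let ?S = "\<lambda>k p. \<forall>F. (\<forall>v. FF (F v)) \<longrightarrow> SG M k (\<lambda>e. sat M (\<lambda>v. F v e) p)"
  let ?P = "\<lambda>k p. \<forall>F. (\<forall>v. FF (F v)) \<longrightarrow> PG M k (\<lambda>e. sat M (\<lambda>v. F v e) p)"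
  have "(sigma k1 p1 \<longrightarrow> ?S k1 p1) \<and> (pi k2 p2 \<longrightarrow> ?P k2 p2)" for k1 p1 k2 p2
  proof (rule sigma_pi.induct[of ?S ?P], goal_cases)
    case (1 p k) then show ?case by (intro allI impI SG_DD delta0_fsub) auto
  next
    case (2 p k) then show ?case by (intro allI impI PG_DD delta0_fsub) auto
  next
    case (3 k p) then show ?case by (simp add: SG_PG)
  next
    case (5 k p) then show ?case by (simp add: PG_SG)
  next
    case (4 k p x)
    show ?case
    proof (intro allI impI)
      fix F :: "nat \<Rightarrow> (nat \<Rightarrow> 'a) \<Rightarrow> 'a" assume F: "\<forall>v. FF (F v)"
      let ?F = "\<lambda>v. if v = x then (\<lambda>e. e 0) else (\<lambda>e. F v (\<lambda>w. e (Suc w)))"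
      have "\<forall>v. FF (?F v)" using F by (intro allI fsub_FF) blast
      then have "SG M (Suc k) (\<lambda>e. sat M (\<lambda>v. ?F v e) p)" by (rule mp[OF spec[OF 4(2), of ?F]])
      from SG_ex[OF this] show "SG M (Suc k) (\<lambda>e. sat M (\<lambda>v. F v e) (Ex x p))" unfolding sat.simps U bex_UNIV fsub_env .
    qed
  next
    case (6 k p x)
    show ?case
    proof (intro allI impI)
      fix F :: "nat \<Rightarrow> (nat \<Rightarrow> 'a) \<Rightarrow> 'a" assume F: "\<forall>v. FF (F v)"
      let ?F = "\<lambda>v. if v = x then (\<lambda>e. e 0) else (\<lambda>e. F v (\<lambda>w. e (Suc w)))"
      have "\<forall>v. FF (?F v)" using F by (intro allI fsub_FF) blast
      then have "PG M (Suc k) (\<lambda>e. sat M (\<lambda>v. ?F v e) p)" by (rule mp[OF spec[OF 6(2), of ?F]])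
      from PG_all[OF this] show "PG M (Suc k) (\<lambda>e. sat M (\<lambda>v. F v e) (Al x p))" unfolding sat.simps U ball_UNIV fsub_env .
    qed
  qed
  then show "sigma k p \<Longrightarrow> (\<And>v. FF (F v)) \<Longrightarrow> SG M k (\<lambda>e. sat M (\<lambda>v. F v e) p)"
    "pi k p \<Longrightarrow> (\<And>v. FF (F v)) \<Longrightarrow> PG M k (\<lambda>e. sat M (\<lambda>v. F v e) p)" by blast+
qed

text \<open>Terms are monotone, so the polynomial bound taken at \<open>\<Omega>\<close> dominates
  the values at all smaller arguments.\<close>

lemma FF_bounded: assumes "FF (\<lambda>e. f (e 0))" shows "\<exists>B. \<forall>i. i \<preceq> \<Omega> \<longrightarrow> f i \<prec> B"
proof -
  obtain b where b: "TT M b" "\<And>e. f (e 0) \<preceq> b e" using assms unfolding FF_def by blast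
  have "f i \<prec> b (\<lambda>_. \<Omega>) \<oplus> \<one>" if "i \<preceq> \<Omega>" for i
  proof -
    have "f i \<preceq> b (\<lambda>_. i)" using b(2)[of "\<lambda>_. i"] .
    also have "\<dots> \<preceq> b (\<lambda>_. \<Omega>)" by (rule TT_mono[OF b(1)]) (rule that)
    finally show ?thesis by (simp add: less_Suc_le)
  qed
  then show ?thesis by blast
qed

end

section \<open>Least witnesses and bounds among functions with bounded graphs\<close>

context isige begin

lemma FF_least:
  assumes R: "DD M (\<lambda>e. R (e 0) (e (Suc 0)))" and g: "FF (\<lambda>e. g (e 0))"
  shows "\<exists>h. FF (\<lambda>e. h (e 0)) \<and> (\<forall>i. (\<exists>a. a \<preceq> g i \<and> R i a) \<longrightarrow> h i \<preceq> g i \<and> R i (h i) \<and> (\<forall>a. a \<prec> h i \<longrightarrow> \<not> R i a))"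
proof -
  define G where "G i s \<longleftrightarrow> (s \<prec> g i \<oplus> \<one> \<and> R i s \<and> (\<forall>t. t \<prec> s \<longrightarrow> \<not> R i t))
      \<or> (s = \<zero> \<and> (\<forall>t. t \<prec> g i \<oplus> \<one> \<longrightarrow> \<not> R i t))" for i s
  have DG: "DD M (\<lambda>e. G (e (Suc 0)) (e 0))"
    unfolding G_def by (intro DDI DD_sub2[OF R] FF_ad FF_sub1[OF g] FF_var FF_const)
  have ex: "\<exists>s. G i s" for i
  proof (cases "\<exists>s. s \<prec> g i \<oplus> \<one> \<and> R i s")
    case True
    then obtain s0 where s0: "s0 \<prec> g i \<oplus> \<one> \<and> R i s0" by blast
    have "DD M (\<lambda>e. e 0 \<prec> g i \<oplus> \<one> \<and> R i (e 0))" by (intro DDI DD_sub2[OF R] FF_var FF_const)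
    from least_DD[OF this s0] obtain s where s: "s \<prec> g i \<oplus> \<one>" "R i s" "\<And>t. t \<prec> s \<Longrightarrow> \<not> (t \<prec> g i \<oplus> \<one> \<and> R i t)" by blast
    have "\<not> R i t" if "t \<prec> s" for t using s(3)[OF that] A.less_trans[OF that s(1)] by blast
    then show ?thesis using s(1,2) unfolding G_def by blast
  next
    case False then show ?thesis unfolding G_def by blast
  qed
  have un: "s = s'" if "G i s" "G i s'" for i s s'
    using that ax(11)[of s s'] unfolding G_def by blast
  define h where "h i = (SOME s. G i s)" for i
  have hG: "s = h i \<longleftrightarrow> G i s" for s i
    unfolding h_def using someI_ex[OF ex] un by metis
  have Gh: "G i (h i)" for i using hG by blast
  have bd: "h i \<preceq> g i" for i using Gh[of i] unfolding G_def by (auto simp: less_Suc_le)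
  have "FF (\<lambda>e. h (e 0))"
    by (rule FF_I[OF g bd]) (unfold hG, rule DG)
  moreover have "R i (h i) \<and> (\<forall>a. a \<prec> h i \<longrightarrow> \<not> R i a)" if "a \<preceq> g i" "R i a" for i a
    using Gh[of i] that unfolding G_def less_Suc_le by blast
  ultimately show ?thesis using bd by blast
qed

text \<open>Collection needs totality, so indices without a witness must be released. The Sigma_n
  set of indices with a witness agrees below \<open>u\<close> with a bounded set \<open>X\<close>,
  and the negation of \<open>X\<close> may stand inside a Sigma_n formula.\<close>

lemma strong_coll:
  assumes m: "n = Suc m" and R: "SG M n (\<lambda>e. R (e 0) (e (Suc 0)))"
  shows "\<exists>v. \<forall>i. i \<prec> u \<longrightarrow> (\<exists>a. R i a) \<longrightarrow> (\<exists>a. a \<prec> v \<and> R i a)"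
proof -
  have "SG M n (\<lambda>e. R (e (Suc 0)) (e 0))" by (rule SG_sub2[OF R FF_var FF_var])
  then have "SG M n (\<lambda>e. \<exists>a. R (e 0) a)" unfolding m by (rule SG_exI[where P = "\<lambda>e a. R (e 0) a"])
  then obtain X where X: "DD M (\<lambda>e. X (e 0))" "\<And>i. i \<prec> u \<Longrightarrow> X i \<longleftrightarrow> (\<exists>a. R i a)"
    using comp1[of "\<lambda>i. \<exists>a. R i a" u] by blast
  have "SG M n (\<lambda>e. R (e 0) (e (Suc 0)) \<or> \<not> X (e 0))"
    by (intro SG_disj R SG_DD DD_not X)
  from coll_SG[OF m this, of u] X(2) obtain v where v: "\<forall>i. i \<prec> u \<longrightarrow> (\<exists>a. a \<prec> v \<and> (R i a \<or> \<not> X i))" by blast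
  have "\<exists>a. a \<prec> v \<and> R i a" if i: "i \<prec> u" and ex: "\<exists>a. R i a" for i
  proof -
    have "X i" using X(2)[OF i] ex by blast
    then show ?thesis using v i by blast
  qed
  then show ?thesis by blast
qed

definition FnI :: "('a \<Rightarrow> 'a) set" where "FnI = {f. FF (\<lambda>e. f (e 0))}"

lemma countable_FnI: assumes "countable (UNIV :: 'a set)" shows "countable FnI"
proof -
  let ?g = "\<lambda>f. (\<lambda>e :: nat \<Rightarrow> 'a. e 0 = f (e (Suc 0)))"
  have "?g ` FnI \<subseteq> {R. repr M delta0 R}"
    unfolding FnI_def FF_def using DD_repr[OF U] by auto
  then have "countable (?g ` FnI)" using countable_repr[OF assms] by (meson countable_subset)
  moreover have "inj_on ?g FnI"
  proof (rule inj_onI, rule ext)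
    fix f f' i assume "?g f = ?g f'"
    from fun_cong[OF this, of "case_nat (f i) (\<lambda>_. i)"] show "f i = f' i" by simp
  qed
  ultimately show ?thesis by (rule countable_image_inj_on)
qed

lemma FnI_fsub: assumes "\<And>v. e v \<in> FnI"
  shows "sigma k p \<Longrightarrow> SG M k (\<lambda>e'. sat M ((\<lambda>v. e v (e' 0))(x := e' (Suc 0))) p)"
    "pi k p \<Longrightarrow> PG M k (\<lambda>e'. sat M ((\<lambda>v. e v (e' 0))(x := e' (Suc 0))) p)"
    "sigma k p \<Longrightarrow> SG M k (\<lambda>e'. sat M (\<lambda>v. e v (e' 0)) p)"
    "pi k p \<Longrightarrow> PG M k (\<lambda>e'. sat M (\<lambda>v. e v (e' 0)) p)"
proof -
  let ?F = "\<lambda>v. if v = x then (\<lambda>e'. e' (Suc 0)) else (\<lambda>e'. e v (e' 0))"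
  have F: "FF (?F v)" for v using assms[of v] unfolding FnI_def by auto
  have eq: "(\<lambda>v. e v (e' 0))(x := e' (Suc 0)) = (\<lambda>v. ?F v e')" for e' by auto
  have F2: "FF (\<lambda>e'. e v (e' 0))" for v using assms[of v] unfolding FnI_def by simp
  show "sigma k p \<Longrightarrow> SG M k (\<lambda>e'. sat M ((\<lambda>v. e v (e' 0))(x := e' (Suc 0))) p)"
    "pi k p \<Longrightarrow> PG M k (\<lambda>e'. sat M ((\<lambda>v. e v (e' 0))(x := e' (Suc 0))) p)"
    unfolding eq by (rule sigma_fsub[OF _ F], assumption) (rule pi_fsub[OF _ F], assumption)
  show "sigma k p \<Longrightarrow> SG M k (\<lambda>e'. sat M (\<lambda>v. e v (e' 0)) p)"
    "pi k p \<Longrightarrow> PG M k (\<lambda>e'. sat M (\<lambda>v. e v (e' 0)) p)"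
    by (rule sigma_fsub[OF _ F2], assumption) (rule pi_fsub[OF _ F2], assumption)
qed

text \<open>On the rectangle of indices below \<open>\<Omega>\<close> and values below a common
  bound of \<open>g\<close>, the formula agrees with a bounded predicate by \<open>comp2\<close>,
  and least values of a bounded predicate form a function with bounded graph.\<close>

lemma FnI_least:
  assumes p: "sigma n p \<or> pi n p" and e: "\<And>v. e v \<in> FnI" and g: "g \<in> FnI"
  shows "\<exists>h\<in>FnI. \<forall>i\<in>{i. i \<prec> \<Omega>}. (\<exists>a. a \<preceq> g i \<and> sat M ((\<lambda>v. e v i)(x := a)) p = b) \<longrightarrow>
         sat M ((\<lambda>v. e v i)(x := h i)) p = b \<and> (\<forall>a. a \<prec> h i \<longrightarrow> sat M ((\<lambda>v. e v i)(x := a)) p \<noteq> b)"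
proof -
  let ?X = "\<lambda>i a. sat M ((\<lambda>v. e v i)(x := a)) p"
  have gF: "FF (\<lambda>e. g (e 0))" using g unfolding FnI_def by simp
  obtain B where B: "\<forall>i. i \<preceq> \<Omega> \<longrightarrow> g i \<prec> B" using FF_bounded[OF gF] by blast
  have "PG M n (\<lambda>e. ?X (e 0) (e (Suc 0))) \<or> SG M n (\<lambda>e. ?X (e 0) (e (Suc 0)))"
    using p FnI_fsub(1,2)[of e n p x, OF e] by blast
  from comp2[of ?X \<Omega> B, OF this] obtain D where D: "DD M (\<lambda>e. D (e 0) (e (Suc 0)))"
    "\<And>i y. i \<prec> \<Omega> \<Longrightarrow> y \<prec> B \<Longrightarrow> D i y = ?X i y" by blast
  have "DD M (\<lambda>e. D (e 0) (e (Suc 0)) = b)" by (intro DD_equiv D(1) DD_triv)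
  from FF_least[of "\<lambda>i a. D i a = b", OF this gF] obtain h where h: "FF (\<lambda>e. h (e 0))"
    "\<And>i. \<exists>a. a \<preceq> g i \<and> D i a = b \<Longrightarrow> h i \<preceq> g i \<and> D i (h i) = b \<and> (\<forall>a. a \<prec> h i \<longrightarrow> D i a \<noteq> b)" by blast
  have "?X i (h i) = b \<and> (\<forall>a. a \<prec> h i \<longrightarrow> ?X i a \<noteq> b)" if i: "i \<prec> \<Omega>" and ex: "\<exists>a. a \<preceq> g i \<and> ?X i a = b" for i
  proof -
    have gB: "g i \<prec> B" using B i by (simp add: A.less_imp_le)
    have eq: "D i a = ?X i a" if "a \<preceq> g i" for a using D(2)[OF i A.le_less_trans[OF that gB]] .
    have hh: "h i \<preceq> g i \<and> D i (h i) = b \<and> (\<forall>a. a \<prec> h i \<longrightarrow> D i a \<noteq> b)" using h(2) ex eq by metis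
    moreover have "a \<preceq> g i" if "a \<prec> h i" for a using hh that A.less_imp_le A.order_trans by blast
    ultimately show ?thesis using eq by metis
  qed
  then show ?thesis using h(1) unfolding FnI_def by blast
qed

text \<open>Strong collection bounds the witnesses for all indices below \<open>\<Omega>\<close> at
  once, so a constant function is enough.\<close>

lemma FnI_bound:
  assumes n: "0 < n" and e: "\<And>v. e v \<in> FnI"
  shows "sigma n p \<Longrightarrow> \<exists>g\<in>FnI. \<forall>i\<in>{i. i \<prec> \<Omega>}. (\<exists>a. sat M ((\<lambda>v. e v i)(x := a)) p) \<longrightarrow> (\<exists>a. a \<preceq> g i \<and> sat M ((\<lambda>v. e v i)(x := a)) p)"
    "pi n p \<Longrightarrow> \<exists>g\<in>FnI. \<forall>i\<in>{i. i \<prec> \<Omega>}. (\<exists>a. \<not> sat M ((\<lambda>v. e v i)(x := a)) p) \<longrightarrow> (\<exists>a. a \<preceq> g i \<and> \<not> sat M ((\<lambda>v. e v i)(x := a)) p)"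
proof -
  obtain m where m: "n = Suc m" using n gr0_implies_Suc by blast
  have K: "\<exists>g\<in>FnI. \<forall>i\<in>{i. i \<prec> \<Omega>}. (\<exists>a. R i a) \<longrightarrow> (\<exists>a. a \<preceq> g i \<and> R i a)" if r: "SG M n (\<lambda>e. R (e 0) (e (Suc 0)))" for R
  proof -
    obtain v where "\<forall>i. i \<prec> \<Omega> \<longrightarrow> (\<exists>a. R i a) \<longrightarrow> (\<exists>a. a \<prec> v \<and> R i a)" using strong_coll[OF m r] by blast
    then show ?thesis by (intro bexI[of _ "\<lambda>_. v"]) (auto simp: FnI_def intro: A.less_imp_le)
  qed
  show "sigma n p \<Longrightarrow> \<exists>g\<in>FnI. \<forall>i\<in>{i. i \<prec> \<Omega>}. (\<exists>a. sat M ((\<lambda>v. e v i)(x := a)) p) \<longrightarrow> (\<exists>a. a \<preceq> g i \<and> sat M ((\<lambda>v. e v i)(x := a)) p)"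
    by (rule K, rule FnI_fsub(1)[OF e])
  show "pi n p \<Longrightarrow> \<exists>g\<in>FnI. \<forall>i\<in>{i. i \<prec> \<Omega>}. (\<exists>a. \<not> sat M ((\<lambda>v. e v i)(x := a)) p) \<longrightarrow> (\<exists>a. a \<preceq> g i \<and> \<not> sat M ((\<lambda>v. e v i)(x := a)) p)"
    by (rule K, rule SG_not, rule FnI_fsub(2)[OF e])
qed

lemma FnI_def_sets:
  assumes p: "sigma n p \<or> pi n p" and e: "\<And>v. e v \<in> FnI"
  shows "{i\<in>{i. i \<prec> \<Omega>}. sat M (\<lambda>v. e v i) p} \<in> {A. DD M (\<lambda>e. e 0 \<in> A)}"
proof -
  have "PG M n (\<lambda>e'. sat M (\<lambda>v. e v (e' 0)) p) \<or> SG M n (\<lambda>e'. sat M (\<lambda>v. e v (e' 0)) p)"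
    using p FnI_fsub(3,4)[of e n p, OF e] by blast
  from comp1[of "\<lambda>i. sat M (\<lambda>v. e v i) p" \<Omega>, OF this] obtain X where X: "DD M (\<lambda>e. X (e 0))" "\<And>i. i \<prec> \<Omega> \<Longrightarrow> X i = sat M (\<lambda>v. e v i) p" by blast
  have "DD M (\<lambda>e. e 0 \<prec> \<Omega> \<and> X (e 0))" by (intro DDI X FF_var FF_const)
  then have "DD M (\<lambda>e'. e' 0 \<in> {i\<in>{i. i \<prec> \<Omega>}. sat M (\<lambda>v. e v i) p})" by (rule DD_iff) (use X(2) in auto)
  then show ?thesis by simp
qed

end

section \<open>The one-step extension\<close>

definition model :: "nat \<Rightarrow> 'a arith_struct \<Rightarrow> bool" where
  "model n M \<longleftrightarrow> carr M = UNIV \<and> ISigma n M \<and> Exp M"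

text \<open>If \<open>p\<close> defines a partial injection from \<open>2x\<close> into \<open>x\<close>, then some element of \<open>2x\<close> has no image in the extension.\<close>

definition kill :: "'a arith_struct \<Rightarrow> 'b arith_struct \<Rightarrow> ('a \<Rightarrow> 'b) \<Rightarrow> fm \<Rightarrow> nat \<Rightarrow> nat \<Rightarrow> (nat \<Rightarrow> 'a) \<Rightarrow> 'a \<Rightarrow> bool" where
  "kill M N h p u v e x \<longleftrightarrow> 
    ((\<forall>a b a' b'. ls M a (ad M x x) \<longrightarrow> ls M a' (ad M x x) \<longrightarrow> ls M b x \<longrightarrow> ls M b' x \<longrightarrow>
        sat M (e(u := a, v := b)) p \<longrightarrow> sat M (e(u := a', v := b')) p \<longrightarrow> (a = a' \<longleftrightarrow> b = b')) \<longrightarrow>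
      (\<exists>c. ls N c (h (ad M x x)) \<and> (\<forall>b. ls N b (h x) \<longrightarrow> \<not> sat N ((\<lambda>w. h (e w))(u := c, v := b)) p)))"

text \<open>The last clause says that no new element fills a cut; for an improper cut it amounts to
  cofinality.\<close>

definition good_ext :: "nat \<Rightarrow> (nat \<Rightarrow> 'a set) \<Rightarrow> 'a arith_struct \<Rightarrow> 'b arith_struct \<Rightarrow> ('a \<Rightarrow> 'b) \<Rightarrow> bool" where
  "good_ext n I M N h \<longleftrightarrow> model n N \<and> el (Suc n) M N h \<and> bounded_by M N h \<and>
    (\<forall>k y. (\<exists>i\<in>I k. ple N y (h i)) \<or> (\<exists>j. j \<notin> I k \<and> ple N (h j) y))"

context isige begin

text \<open>\<open>A\<close> may occupy half of \<open>\<Omega>\<close>, that is x out of 2x. The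
  sets C_l have densities at most 2^-(l+2), and finitely many of these add up to less than the other
  half.\<close>

lemma step_filter_base:
  assumes xx: "x \<noteq> \<zero>" and \<Omega>: "\<Omega> = x \<oplus> x"
    and A: "DD M (\<lambda>e. A (e 0))" and Ax: "cnt M A \<Omega> \<preceq> x"
    and C: "\<And>l. DD M (\<lambda>e. C l (e 0))" and Cb: "\<And>l. dbl (l + 2) (cnt M (C l) \<Omega>) \<preceq> \<Omega>"
  shows "\<exists>i. i \<prec> \<Omega> \<and> \<not> A i \<and> (\<forall>l < L. \<not> C l i)"
proof (rule ccontr)
  assume no: "\<not> ?thesis"
  let ?u = "\<lambda>L i. \<exists>l<L. C l i"
  have Du: "DD M (\<lambda>e. ?u L (e 0))" for L :: nat
  proof (induction L)
    case 0 show ?case by (simp add: DD_triv)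
  next
    case (Suc L)
    show ?case by (rule DD_iff[OF DD_disj[OF Suc C[of L]]]) (auto simp: less_Suc_eq)
  qed
  \<comment> \<open>In densities: the union of the first L sets takes at most 1/2 - 2^-(L+1) of
    \<open>\<Omega>\<close>.\<close>
  have cu: "dbl (Suc L) (cnt M (?u L) \<Omega>) \<oplus> \<Omega> \<preceq> dbl L \<Omega>" for L :: nat
  proof (induction L)
    case 0 show ?case using cnt_empty[of \<Omega> "?u 0"] by simp
  next
    case (Suc L)
    have "cnt M (?u (Suc L)) \<Omega> \<preceq> cnt M (?u L) \<Omega> \<oplus> cnt M (C L) \<Omega>"
      by (rule cnt_le_add[OF Du C Du]) (auto simp: less_Suc_eq)
    then have "dbl (L + 2) (cnt M (?u (Suc L)) \<Omega>) \<preceq> dbl (L + 2) (cnt M (?u L) \<Omega>) \<oplus> dbl (L + 2) (cnt M (C L) \<Omega>)"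
      unfolding dbl_add[symmetric] by (rule dbl_mono)
    also have "\<dots> \<preceq> dbl (L + 2) (cnt M (?u L) \<Omega>) \<oplus> \<Omega>" by (rule A.add_left_mono[OF Cb])
    finally have "dbl (L + 2) (cnt M (?u (Suc L)) \<Omega>) \<oplus> \<Omega> \<preceq> dbl (L + 2) (cnt M (?u L) \<Omega>) \<oplus> \<Omega> \<oplus> \<Omega>"
      by (rule A.add_right_mono)
    also have "\<dots> = (dbl (Suc L) (cnt M (?u L) \<Omega>) \<oplus> \<Omega>) \<oplus> (dbl (Suc L) (cnt M (?u L) \<Omega>) \<oplus> \<Omega>)"
      by (simp add: A.add.assoc A.add.left_commute)
    also have "\<dots> \<preceq> dbl L \<Omega> \<oplus> dbl L \<Omega>" by (rule A.add_mono[OF Suc Suc])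
    finally show ?case by simp
  qed
  have "\<Omega> = cnt M (\<lambda>_. True) \<Omega>" by (rule cnt_full[symmetric]) simp
  also have "\<dots> \<preceq> cnt M A \<Omega> \<oplus> cnt M (?u L) \<Omega>"
    by (rule cnt_le_add[OF A Du DD_triv]) (use no in blast)
  also have "\<dots> \<preceq> x \<oplus> cnt M (?u L) \<Omega>" by (rule A.add_right_mono[OF Ax])
  finally have "dbl (Suc L) \<Omega> \<preceq> dbl (Suc L) (x \<oplus> cnt M (?u L) \<Omega>)" by (rule dbl_mono)
  then have "dbl L \<Omega> \<oplus> dbl L \<Omega> \<preceq> dbl L \<Omega> \<oplus> dbl (Suc L) (cnt M (?u L) \<Omega>)"
    unfolding dbl_add by (simp add: \<Omega> dbl_add)
  then have "dbl L \<Omega> \<preceq> dbl (Suc L) (cnt M (?u L) \<Omega>)" by simp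
  then have "dbl L \<Omega> \<oplus> \<Omega> \<preceq> dbl L \<Omega>" using cu[of L] A.add_right_mono A.order_trans by blast
  then have "\<Omega> \<preceq> \<zero>" using A.add_le_cancel_left[of "dbl L \<Omega>" \<Omega> \<zero>] by simp
  then show False using xx \<Omega> le_add(1)[of x x] A.order_trans by auto
qed

lemma step:
  assumes cnt: "countable (UNIV :: 'a set)" and inf: "infinite (UNIV :: 'a set)"
    and cuts: "\<And>k :: nat. is_cut M (I k)"
    and p: "sigma (Suc n) p" and uv: "u \<noteq> v" and xx: "x \<noteq> \<zero>"
  shows "\<exists>(N :: nat arith_struct) h. good_ext n I M N h \<and> kill M N h p u v e x"
proof -
  define \<Omega> where "\<Omega> = x \<oplus> x"
  define D where "D = {i. i \<prec> \<Omega>}"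
  define pinj where "pinj \<longleftrightarrow> (\<forall>a b a' b'. a \<prec> x \<oplus> x \<longrightarrow> a' \<prec> x \<oplus> x \<longrightarrow> b \<prec> x \<longrightarrow> b' \<prec> x \<longrightarrow>
        sat M (e(u := a, v := b)) p \<longrightarrow> sat M (e(u := a', v := b')) p \<longrightarrow> (a = a' \<longleftrightarrow> b = b'))"
  \<comment> \<open>Including \<open>pinj\<close> makes \<open>G\<close> injective on the relevant
    range in every case: if \<open>p\<close> is no partial injection, \<open>G\<close> is
    empty.\<close>
  define G where "G a b \<longleftrightarrow> pinj \<and> sat M (e(u := a, v := b)) p" for a b
  have Ginj: "a = a' \<longleftrightarrow> b = b'" if "a \<prec> \<Omega>" "a' \<prec> \<Omega>" "b \<prec> x" "b' \<prec> x" "G a b" "G a' b'" for a b a' b'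
    using that unfolding G_def pinj_def \<Omega>_def by blast
  \<comment> \<open>The definable index sets along which some function in \<open>FnI\<close> follows
    the injection. They are closed under union, as two functions can be glued by cases, and their
    complements enter the filter.\<close>
  define small where "small A \<longleftrightarrow> DD M (\<lambda>e. e 0 \<in> A) \<and> A \<subseteq> D \<and> (\<exists>g\<in>FnI. \<forall>i\<in>A. g i \<prec> x \<and> G i (g i))" for A
  have small_cnt: "cnt M (\<lambda>i. i \<in> A) \<Omega> \<preceq> x" if A: "small A" for A
  proof -
    obtain g where g: "FF (\<lambda>e. g (e 0))" "\<forall>i\<in>A. g i \<prec> x \<and> G i (g i)" using A unfolding small_def FnI_def by blast
    have AD: "i \<prec> \<Omega>" if "i \<in> A" for i using A that unfolding small_def D_def by blast
    show ?thesis
    proof (rule cnt_inj[OF _ g(1)])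
      show "DD M (\<lambda>e. e 0 \<in> A)" using A unfolding small_def by blast
      fix i i' assume "i \<in> A" "i' \<in> A" "g i = g i'"
      then show "i = i'" using Ginj[of i i' "g i" "g i'"] g(2) AD by metis
    qed (use g(2) in blast)
  qed
  have small_Un: "small (A \<union> B)" if A: "small A" and B: "small B" for A B
  proof -
    obtain g where g: "FF (\<lambda>e. g (e 0))" "\<forall>i\<in>A. g i \<prec> x \<and> G i (g i)" using A unfolding small_def FnI_def by blast
    obtain g' where g': "FF (\<lambda>e. g' (e 0))" "\<forall>i\<in>B. g' i \<prec> x \<and> G i (g' i)" using B unfolding small_def FnI_def by blast
    have dA: "DD M (\<lambda>e. e 0 \<in> A)" "DD M (\<lambda>e. e 0 \<in> B)" using A B unfolding small_def by blast+
    have "DD M (\<lambda>e. e 0 \<in> A \<union> B)" by (rule DD_iff[OF DD_disj[OF dA]]) simp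
    moreover have "FF (\<lambda>e. if e 0 \<in> A then g (e 0) else g' (e 0))" by (rule FF_if[OF dA(1) g(1) g'(1)])
    ultimately show ?thesis using A B g(2) g'(2) unfolding small_def FnI_def
      by (intro conjI bexI[of _ "\<lambda>i. if i \<in> A then g i else g' i"]) auto
  qed
  have small_empty: "small {}" unfolding small_def FnI_def using DD_triv[of M False] by auto
  have cF: "countable FnI" by (rule countable_FnI[OF cnt])
  have neF: "FnI \<noteq> {}" unfolding FnI_def by auto
  \<comment> \<open>The number l codes a pair of a function and a cut, and thereby also fixes the
    density 2^-(l+2) granted to that pair.\<close>
  define fn where "fn l = from_nat_into FnI (fst (prod_decode l))" for l
  have fn: "fn l \<in> FnI" for l unfolding fn_def by (rule from_nat_into[OF neF])
  have "\<exists>C. DD M (\<lambda>e. C (e 0)) \<and> dbl (l + 2) (cnt M C \<Omega>) \<preceq> \<Omega> \<and>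
     (I (snd (prod_decode l)) \<noteq> UNIV \<longrightarrow> (\<exists>i\<in>I (snd (prod_decode l)). \<exists>j. j \<notin> I (snd (prod_decode l)) \<and> (\<forall>s. i \<prec> fn l s \<and> fn l s \<preceq> j \<longrightarrow> C s)))" for l
  proof (cases "I (snd (prod_decode l)) = UNIV")
    case True
    then show ?thesis using DD_triv[of M False] cnt_empty[of \<Omega> "\<lambda>_. False"] by (intro exI[of _ "\<lambda>_. False"]) simp
  next
    case False
    have f: "FF (\<lambda>e. fn l (e 0))" using fn unfolding FnI_def by blast
    obtain i j where ij: "i \<in> I (snd (prod_decode l))" "j \<notin> I (snd (prod_decode l))" "dbl (l + 2) (cnt M (\<lambda>s. i \<prec> fn l s \<and> fn l s \<preceq> j) \<Omega>) \<preceq> \<Omega>"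
      using cut_halving[OF f cuts False] by blast
    define C where "C s \<longleftrightarrow> i \<prec> fn l s \<and> fn l s \<preceq> j" for s
    have "DD M (\<lambda>e. C (e 0))" unfolding C_def by (intro DDI f FF_const)
    moreover have "dbl (l + 2) (cnt M C \<Omega>) \<preceq> \<Omega>" using ij(3) unfolding C_def .
    moreover have "\<forall>s. i \<prec> fn l s \<and> fn l s \<preceq> j \<longrightarrow> C s" unfolding C_def by simp
    ultimately show ?thesis using ij(1,2) by blast
  qed
  then obtain C where C: "\<And>l. DD M (\<lambda>e. C l (e 0))" "\<And>l. dbl (l + 2) (cnt M (C l) \<Omega>) \<preceq> \<Omega>"
    "\<And>l. I (snd (prod_decode l)) \<noteq> UNIV \<Longrightarrow> \<exists>i\<in>I (snd (prod_decode l)). \<exists>j. j \<notin> I (snd (prod_decode l)) \<and> (\<forall>s. i \<prec> fn l s \<and> fn l s \<preceq> j \<longrightarrow> C l s)"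
    by metis
  let ?S = "{D} \<union> {- A | A. small A} \<union> range (\<lambda>l. {s. \<not> C l s})"
  have fip0: "\<exists>A L. small A \<and> {i. i \<prec> \<Omega> \<and> i \<notin> A \<and> (\<forall>l < L. \<not> C l i)} \<subseteq> \<Inter>H" if "finite H" "H \<subseteq> ?S" for H
    using that
  proof (induction H)
    case empty then show ?case using small_empty by auto
  next
    case (insert X H)
    then obtain A L where AL: "small A" "{i. i \<prec> \<Omega> \<and> i \<notin> A \<and> (\<forall>l < L. \<not> C l i)} \<subseteq> \<Inter>H" by auto
    consider "X = D" | B where "X = - B" "small B" | l where "X = {s. \<not> C l s}" using insert.prems by auto
    then show ?case
    proof cases
      case 1 then show ?thesis using AL unfolding D_def by (intro exI[of _ A] exI[of _ L]) auto
    next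
      case 2 then show ?thesis using AL small_Un[OF AL(1) 2(2)] by (intro exI[of _ "A \<union> B"] exI[of _ L]) auto
    next
      case 3
      have "{i. i \<prec> \<Omega> \<and> i \<notin> A \<and> (\<forall>l' < max L (Suc l). \<not> C l' i)} \<subseteq> \<Inter>(insert X H)"
      proof
        fix i assume i: "i \<in> {i. i \<prec> \<Omega> \<and> i \<notin> A \<and> (\<forall>l' < max L (Suc l). \<not> C l' i)}"
        then have "i \<in> X" using 3 by auto
        moreover have "i \<in> \<Inter>H" using i AL(2) by auto
        ultimately show "i \<in> \<Inter>(insert X H)" by simp
      qed
      then show ?thesis using AL(1) by blast
    qed
  qed
  have fip: "\<Inter>H \<noteq> {}" if H: "finite H" "H \<subseteq> ?S" for H
  proof -
    obtain A L where AL: "small A" "{i. i \<prec> \<Omega> \<and> i \<notin> A \<and> (\<forall>l < L. \<not> C l i)} \<subseteq> \<Inter>H" using fip0[OF H] by blast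
    have "DD M (\<lambda>e. e 0 \<in> A)" using AL(1) unfolding small_def by blast
    from step_filter_base[of x \<Omega> "\<lambda>i. i \<in> A" C L, OF xx \<Omega>_def this small_cnt[OF AL(1)] C(1,2)] AL(2)
    show ?thesis by blast
  qed
  obtain W where ult: "ultra W" and SW: "?S \<subseteq> W" using ultra_ex[of ?S, OF fip] by blast
  have DW: "D \<in> W" and smallW: "\<And>A. small A \<Longrightarrow> A \<notin> W" and CW: "\<And>l. {s. \<not> C l s} \<in> W"
    using SW ultra_D(4)[OF ult] by auto
  have constF: "(\<lambda>_. c) \<in> FnI" for c unfolding FnI_def by auto
  obtain cl :: "('a \<Rightarrow> 'a) \<Rightarrow> nat" where cl: "\<forall>f\<in>FnI. \<forall>g\<in>FnI. cl f = cl g \<longleftrightarrow> {i. f i = g i} \<in> W" "cl ` FnI = UNIV"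
    using class_numbering[OF ult cF constF inf] by blast
  interpret R: rup M n FnI D W "{A. DD M (\<lambda>e. e 0 \<in> A)}" cl
  proof unfold_locales
    show "D \<in> W" by (rule DW)
    show "(\<lambda>_. c) \<in> FnI" for c by (rule constF)
    show "f \<in> FnI \<Longrightarrow> g \<in> FnI \<Longrightarrow> (\<lambda>i. f i \<oplus> g i) \<in> FnI" "f \<in> FnI \<Longrightarrow> g \<in> FnI \<Longrightarrow> (\<lambda>i. f i \<otimes> g i) \<in> FnI" for f g
      unfolding FnI_def by auto
    show "cl f = cl g \<longleftrightarrow> {i. f i = g i} \<in> W" if "f \<in> FnI" "g \<in> FnI" for f g using cl that by blast
  qed (unfold D_def, (rule ult cl(2) FnI_least FnI_bound FnI_def_sets U PA; assumption?)+)
  have elN: "el (Suc n) M R.N R.dg" unfolding el_def using R.elementary by blast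
  have bdN: "bounded_by M R.N R.dg" unfolding bounded_by_def
  proof
    fix y
    obtain f where f: "f \<in> FnI" "y = cl f" using R.rp by metis
    obtain B where B: "\<forall>i. i \<preceq> \<Omega> \<longrightarrow> f i \<prec> B" using FF_bounded f(1) unfolding FnI_def by blast
    have "{i. f i \<prec> B} \<in> W" by (rule ultra_D(1)[OF ult DW]) (use B A.less_imp_le in \<open>auto simp: D_def\<close>)
    then show "\<exists>x. ple R.N y (R.dg x)" unfolding ple_def R.dg_def f(2) using R.N_op(3)[OF f(1) constF] by blast
  qed
  have ExpN: "Exp R.N" by (rule Exp_cofinal[OF U EX R.N_carr R.PAminus_N elN bdN])
  have gap: "(\<exists>i\<in>I k. ple R.N y (R.dg i)) \<or> (\<exists>j. j \<notin> I k \<and> ple R.N (R.dg j) y)" for k y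
  proof (cases "I k = UNIV")
    case True then show ?thesis using bdN unfolding bounded_by_def by blast
  next
    case False
    obtain f where f: "f \<in> FnI" "y = cl f" using R.rp by metis
    obtain t where t: "f = from_nat_into FnI t" using f(1) cF from_nat_into_surj by metis
    let ?l = "prod_encode (t, k)"
    have l: "fn ?l = f" "snd (prod_decode ?l) = k" unfolding fn_def t by simp_all
    obtain i j where ij: "i \<in> I k" "j \<notin> I k" "\<And>s. i \<prec> f s \<and> f s \<preceq> j \<Longrightarrow> C ?l s"
      using C(3)[of ?l] False unfolding l by blast
    \<comment> \<open>Off the set C_l the function avoids the interval around the cut, and the
      ultrafilter must choose one of the two sides.\<close>
    have cov: "{s. f s \<preceq> i} \<union> {s. j \<prec> f s} \<in> W"
      by (rule ultra_D(1)[OF ult CW[of ?l]]) (use ij(3) A.not_le in blast)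
    then have "{s. f s \<preceq> i} \<in> W \<or> {s. j \<prec> f s} \<in> W"
      using ultra_D(2)[OF ult, of "- {s. f s \<preceq> i}" "- {s. j \<prec> f s}"] ultra_D(4)[OF ult] by (metis Compl_Un)
    then show ?thesis
    proof
      assume h: "{s. f s \<preceq> i} \<in> W"
      have "ple R.N y (R.dg i)"
      proof (cases "{s. f s \<prec> i} \<in> W")
        case True then show ?thesis unfolding ple_def R.dg_def f(2) using R.N_op(3)[OF f(1) constF] by blast
      next
        case False
        then have "{s. f s \<preceq> i} \<inter> - {s. f s \<prec> i} \<in> W" using h ultra_D(2,4)[OF ult] by blast
        then have "{s. f s = i} \<in> W" by (rule ultra_D(1)[OF ult]) (auto simp: le_iff)
        then show ?thesis unfolding ple_def R.dg_def f(2) using R.cl_eq[OF f(1) constF] by blast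
      qed
      then show ?thesis using ij(1) by blast
    next
      assume "{s. j \<prec> f s} \<in> W"
      then have "ls R.N (R.dg j) y" unfolding R.dg_def f(2) using R.N_op(3)[OF constF f(1)] by blast
      then show ?thesis using ij(2) unfolding ple_def by blast
    qed
  qed
  have wphp: "\<exists>c. ls R.N c (R.dg (x \<oplus> x)) \<and> (\<forall>b. ls R.N b (R.dg x) \<longrightarrow> \<not> sat R.N ((\<lambda>w. R.dg (e w))(u := c, v := b)) p)" if pj: pinj
  proof -
    have idF: "(\<lambda>i. i) \<in> FnI" unfolding FnI_def by auto
    have "ls R.N (cl (\<lambda>i. i)) (R.dg (x \<oplus> x))"
      unfolding R.dg_def R.N_op(3)[OF idF constF] using DW unfolding D_def \<Omega>_def .
    moreover have "\<not> sat R.N ((\<lambda>w. R.dg (e w))(u := cl (\<lambda>i. i), v := b)) p" if b: "ls R.N b (R.dg x)" for b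
    proof
      assume s: "sat R.N ((\<lambda>w. R.dg (e w))(u := cl (\<lambda>i. i), v := b)) p"
      obtain g where g: "g \<in> FnI" "b = cl g" using R.rp by metis
      let ?e = "(\<lambda>w (_ :: 'a). e w)(u := (\<lambda>i. i), v := g)"
      have e: "?e w \<in> FnI" for w using constF idF g(1) by auto
      have "(\<lambda>w. R.dg (e w))(u := cl (\<lambda>i. i), v := b) = (\<lambda>w. cl (?e w))" unfolding R.dg_def g(2) by auto
      then have "sat R.N (\<lambda>w. cl (?e w)) p" using s by simp
      \<comment> \<open>The Sigma_{n+1} formula descends to a definable \<open>A\<close>. Its part
        with g i < x is small, so its complement is in the ultrafilter, a contradiction.\<close>
      from R.half_los(1)[OF p e this] obtain A where A: "A \<in> W" "DD M (\<lambda>e. e 0 \<in> A)" "A \<subseteq> D" "\<forall>i\<in>A. sat M (\<lambda>w. ?e w i) p" by blast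
      have "(\<lambda>w. ?e w i) = e(u := i, v := g i)" for i by auto
      then have GA: "G i (g i)" if "i \<in> A" for i using A(4) that pj unfolding G_def by auto
      have gx: "{i. g i \<prec> x} \<in> W" using b R.N_op(3)[OF g(1) constF] unfolding g(2) R.dg_def by blast
      have "DD M (\<lambda>e. e 0 \<in> A \<and> g (e 0) \<prec> x)" using A(2) g(1) unfolding FnI_def by (intro DDI) auto
      then have "DD M (\<lambda>e. e 0 \<in> A \<inter> {i. g i \<prec> x})" by (rule DD_iff) auto
      then have "small (A \<inter> {i. g i \<prec> x})" unfolding small_def using A(3) GA g(1) by (intro conjI bexI[of _ g]) auto
      moreover have "A \<inter> {i. g i \<prec> x} \<in> W" using A(1) gx ultra_D(2)[OF ult] by blast
      ultimately show False using smallW by blast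
    qed
    ultimately show ?thesis by blast
  qed
  have "good_ext n I M R.N R.dg" unfolding good_ext_def model_def using R.N_carr R.ISigma_N ExpN elN bdN gap by blast
  moreover have "kill M R.N R.dg p u v e x" unfolding kill_def by (rule impI, rule wphp) (simp only: pinj_def)
  ultimately show ?thesis by blast
qed

end

section \<open>The chain of extensions\<close>

lemma sigma_pi_quant:
  "(sigma k p \<longrightarrow> (\<forall>x q. p = Ex x q \<or> p = Al x q \<longrightarrow> sigma k q \<or> pi k q))"
  "(pi k p \<longrightarrow> (\<forall>x q. p = Ex x q \<or> p = Al x q \<longrightarrow> sigma k q \<or> pi k q))"
  "(sigma k p \<longrightarrow> (\<forall>x q. p \<noteq> Ex x q \<and> p \<noteq> Al x q) \<longrightarrow> delta0 p)"
  "(pi k p \<longrightarrow> (\<forall>x q. p \<noteq> Ex x q \<and> p \<noteq> Al x q) \<longrightarrow> delta0 p)"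
proof -
  let ?Q = "\<lambda>k p. (\<forall>x q. p = Ex x q \<or> p = Al x q \<longrightarrow> sigma k q \<or> pi k q) \<and> ((\<forall>x q. p \<noteq> Ex x q \<and> p \<noteq> Al x q) \<longrightarrow> delta0 p)"
  have d: "\<not> delta0 (Ex x q)" "\<not> delta0 (Al x q)" for x q by (auto elim: delta0.cases)
  have m: "sigma k q \<or> pi k q \<Longrightarrow> sigma (Suc k) q \<or> pi (Suc k) q" for k q using sigma_mono by blast
  have "(sigma k1 p1 \<longrightarrow> ?Q k1 p1) \<and> (pi k2 p2 \<longrightarrow> ?Q k2 p2)" for k1 p1 k2 p2
  proof (rule sigma_pi.induct[of ?Q ?Q], goal_cases)
    case (1 p n) then show ?case using d by auto
  next
    case (2 p n) then show ?case using d by auto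
  next
    case (3 n p) then show ?case using m by blast
  next
    case (5 n p) then show ?case using m by blast
  qed auto
  then show "(sigma k p \<longrightarrow> (\<forall>x q. p = Ex x q \<or> p = Al x q \<longrightarrow> sigma k q \<or> pi k q))"
  "(pi k p \<longrightarrow> (\<forall>x q. p = Ex x q \<or> p = Al x q \<longrightarrow> sigma k q \<or> pi k q))"
  "(sigma k p \<longrightarrow> (\<forall>x q. p \<noteq> Ex x q \<and> p \<noteq> Al x q) \<longrightarrow> delta0 p)"
  "(pi k p \<longrightarrow> (\<forall>x q. p \<noteq> Ex x q \<and> p \<noteq> Al x q) \<longrightarrow> delta0 p)" by blast+
qed

text \<open>The union of Sigma_k and Pi_k is closed under subformulas, so truth in the limit of a
  chain can be treated by plain induction on formulas.\<close>

lemma class_sub: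
  "sigma k (Ex x p) \<or> pi k (Ex x p) \<Longrightarrow> sigma k p \<or> pi k p"
  "sigma k (Al x p) \<or> pi k (Al x p) \<Longrightarrow> sigma k p \<or> pi k p"
  "sigma k (Nt p) \<or> pi k (Nt p) \<Longrightarrow> sigma k p \<or> pi k p"
  "sigma k (Cj p q) \<or> pi k (Cj p q) \<Longrightarrow> sigma k p \<or> pi k p" "sigma k (Cj p q) \<or> pi k (Cj p q) \<Longrightarrow> sigma k q \<or> pi k q"
  "sigma k (Dj p q) \<or> pi k (Dj p q) \<Longrightarrow> sigma k p \<or> pi k p" "sigma k (Dj p q) \<or> pi k (Dj p q) \<Longrightarrow> sigma k q \<or> pi k q"
  "sigma k (BEx x t p) \<or> pi k (BEx x t p) \<Longrightarrow> sigma k p \<or> pi k p"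
  "sigma k (BAl x t p) \<or> pi k (BAl x t p) \<Longrightarrow> sigma k p \<or> pi k p"
proof -
  note q = sigma_pi_quant
  show "sigma k (Ex x p) \<or> pi k (Ex x p) \<Longrightarrow> sigma k p \<or> pi k p" "sigma k (Al x p) \<or> pi k (Al x p) \<Longrightarrow> sigma k p \<or> pi k p"
    using q(1,2) by blast+
  have d: "sigma k r \<or> pi k r \<Longrightarrow> (\<And>x q. r \<noteq> Ex x q \<and> r \<noteq> Al x q) \<Longrightarrow> delta0 r" for r using q(3,4) by blast
  have s: "delta0 r \<Longrightarrow> sigma k r \<or> pi k r" for r by (auto intro: sigma_pi.intros)
  have ds: "delta0 (Nt p) \<Longrightarrow> delta0 p" "delta0 (Cj p q) \<Longrightarrow> delta0 p" "delta0 (Cj p q) \<Longrightarrow> delta0 q"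
    "delta0 (Dj p q) \<Longrightarrow> delta0 p" "delta0 (Dj p q) \<Longrightarrow> delta0 q"
    "delta0 (BEx x t p) \<Longrightarrow> delta0 p" "delta0 (BAl x t p) \<Longrightarrow> delta0 p" by (auto elim: delta0.cases)
  show "sigma k (Nt p) \<or> pi k (Nt p) \<Longrightarrow> sigma k p \<or> pi k p" by (rule s, rule ds(1), rule d) simp_all
  show "sigma k (Cj p q) \<or> pi k (Cj p q) \<Longrightarrow> sigma k p \<or> pi k p" by (rule s, rule ds(2), rule d) simp_all
  show "sigma k (Cj p q) \<or> pi k (Cj p q) \<Longrightarrow> sigma k q \<or> pi k q" by (rule s, rule ds(3), rule d) simp_all
  show "sigma k (Dj p q) \<or> pi k (Dj p q) \<Longrightarrow> sigma k p \<or> pi k p" by (rule s, rule ds(4), rule d) simp_all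
  show "sigma k (Dj p q) \<or> pi k (Dj p q) \<Longrightarrow> sigma k q \<or> pi k q" by (rule s, rule ds(5), rule d) simp_all
  show "sigma k (BEx x t p) \<or> pi k (BEx x t p) \<Longrightarrow> sigma k p \<or> pi k p" by (rule s, rule ds(6), rule d) simp_all
  show "sigma k (BAl x t p) \<or> pi k (BAl x t p) \<Longrightarrow> sigma k p \<or> pi k p" by (rule s, rule ds(7), rule d) simp_all
qed

lemma el_comp: "el k M N h \<Longrightarrow> el k N K g \<Longrightarrow> el k M K (\<lambda>x. g (h x))"
  unfolding el_def by metis

lemma el_id: "el k M M (\<lambda>x. x)" unfolding el_def by simp

locale chain =
  fixes Ns :: "nat \<Rightarrow> nat arith_struct" and hs :: "nat \<Rightarrow> nat \<Rightarrow> nat" and k :: nat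
  assumes UN: "carr (Ns l) = UNIV" and els: "el k (Ns l) (Ns (Suc l)) (hs l)"
begin

text \<open>The map from stage l to stage m. For m \<le> l it is the identity by default, which is
  right only at m = l.\<close>

primrec H :: "nat \<Rightarrow> nat \<Rightarrow> nat \<Rightarrow> nat" where
  "H l 0 = (\<lambda>a. a)"
| "H l (Suc m) = (if Suc m \<le> l then (\<lambda>a. a) else (\<lambda>a. hs m (H l m a)))"

lemma H_id: "m \<le> l \<Longrightarrow> H l m = (\<lambda>a. a)" by (cases m) auto

lemma H_Suc: "l \<le> m \<Longrightarrow> H l (Suc m) = (\<lambda>a. hs m (H l m a))" by auto

lemma H_el: "l \<le> m \<Longrightarrow> el k (Ns l) (Ns m) (H l m)"
proof (induction rule: dec_induct)
  case base show ?case by (simp add: H_id el_id)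
next
  case (step m) then show ?case unfolding H_Suc[OF step(1)] by (intro el_comp[OF _ els])
qed

lemma inj_hs: "inj (hs l)" using el_ops(6)[OF els] by (auto intro: injI)

text \<open>A direct limit without quotients: an element is pulled back along the injective maps as
  far as possible and is named by the stage and the value reached.\<close>

primrec gp :: "nat \<Rightarrow> nat \<Rightarrow> nat \<times> nat" where
  "gp 0 a = (0, a)"
| "gp (Suc l) b = (if b \<in> range (hs l) then gp l (inv (hs l) b) else (Suc l, b))"

lemma gp_hs: "gp (Suc l) (hs l a) = gp l a"
  using inj_hs[of l] by simp

lemma gp_fst: "fst (gp l a) \<le> l"
  by (induction l arbitrary: a) (auto intro: le_SucI)

lemma gp_inj: "gp l a = gp l b \<Longrightarrow> a = b"
proof (induction l arbitrary: a b)
  case (Suc l)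
  have f: "gp l c \<noteq> (Suc l, d)" for c d using gp_fst[of l c] by auto
  show ?case
  proof (cases "a \<in> range (hs l) \<and> b \<in> range (hs l)")
    case True
    then have "inv (hs l) a = inv (hs l) b" using Suc by simp
    then show ?thesis using True by (metis f_inv_into_f)
  next
    case False
    then show ?thesis using Suc.prems f[of "inv (hs l) a" b] f[of "inv (hs l) b" a] by (auto split: if_splits)
  qed
qed simp

definition Z :: "(nat \<times> nat) set" where "Z = (\<Union>l. range (gp l))"

definition g :: "nat \<Rightarrow> nat \<Rightarrow> nat" where "g l a = to_nat_on Z (gp l a)"

lemma Z_bij: "bij_betw (to_nat_on Z) Z UNIV"
proof (rule to_nat_on_infinite)
  have "inj (gp 0)" by (auto intro: injI)
  then have "infinite (range (gp 0))" by (rule range_inj_infinite)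
  then show "infinite Z" unfolding Z_def by (meson UN_upper UNIV_I infinite_super)
qed simp

lemma g_eq: "g l a = g m b \<longleftrightarrow> gp l a = gp m b"
proof -
  have "inj_on (to_nat_on Z) Z" using Z_bij by (rule bij_betw_imp_inj_on)
  moreover have "gp l a \<in> Z" "gp m b \<in> Z" unfolding Z_def by blast+
  ultimately show ?thesis unfolding g_def by (rule inj_on_eq_iff)
qed

lemma g_inj: "g l a = g l b \<longleftrightarrow> a = b" unfolding g_eq using gp_inj by blast

lemma g_hs: "g (Suc l) (hs l a) = g l a" unfolding g_eq by (rule gp_hs)

lemma g_H: "l \<le> m \<Longrightarrow> g m (H l m a) = g l a"
proof (induction rule: dec_induct)
  case base show ?case by (simp add: H_id)
next
  case (step m) then show ?case unfolding H_Suc[OF step(1)] by (simp add: g_hs)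
qed

lemma g_surj: "\<exists>l a. y = g l a"
proof -
  have "y \<in> to_nat_on Z ` Z" using Z_bij unfolding bij_betw_def by simp
  then show ?thesis unfolding Z_def g_def by blast
qed

lemma g_surj_above: "\<exists>l a. l0 \<le> l \<and> y = g l a"
proof -
  obtain l a where y: "y = g l a" using g_surj by blast
  then have "y = g (max l l0) (H l (max l l0) a)" by (simp add: g_H)
  then show ?thesis by (metis max.cobounded2)
qed

text \<open>The operations are read off at any stage holding both arguments; \<open>L_ops\<close>
  shows that all such stages agree.\<close>

definition L :: "nat arith_struct" where
  "L = \<lparr>carr = UNIV, zr = g 0 (zr (Ns 0)), un = g 0 (un (Ns 0)),
     ad = (\<lambda>x y. SOME z. \<exists>l a b. x = g l a \<and> y = g l b \<and> z = g l (ad (Ns l) a b)),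
     mu = (\<lambda>x y. SOME z. \<exists>l a b. x = g l a \<and> y = g l b \<and> z = g l (mu (Ns l) a b)),
     ls = (\<lambda>x y. \<exists>l a b. x = g l a \<and> y = g l b \<and> ls (Ns l) a b)\<rparr>"

lemma L_carr [simp]: "carr L = UNIV" by (simp add: L_def)

lemma g_common:
  assumes "g l a = g m c" "g l b = g m d"
  shows "\<exists>r. l \<le> r \<and> m \<le> r \<and> H l r a = H m r c \<and> H l r b = H m r d"
proof (intro exI[of _ "max l m"] conjI)
  let ?r = "max l m"
  have r: "l \<le> ?r" "m \<le> ?r" by simp_all
  show "H l ?r a = H m ?r c" "H l ?r b = H m ?r d" using assms g_H[OF r(1)] g_H[OF r(2)] g_inj by metis+
qed simp_all

lemma L_ops:
  "g l (zr (Ns l)) = zr L" "g l (un (Ns l)) = un L"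
  "ad L (g l a) (g l b) = g l (ad (Ns l) a b)" "mu L (g l a) (g l b) = g l (mu (Ns l) a b)"
  "ls L (g l a) (g l b) = ls (Ns l) a b"
proof -
  note e0 = el_ops[OF H_el[of 0 l]]
  show "g l (zr (Ns l)) = zr L" unfolding L_def using e0(1) g_H[of 0 l "zr (Ns 0)"] by simp
  show "g l (un (Ns l)) = un L" unfolding L_def using e0(2) g_H[of 0 l "un (Ns 0)"] by simp
  have A: "g l (ad (Ns l) a b) = g m (ad (Ns m) c d) \<and> g l (mu (Ns l) a b) = g m (mu (Ns m) c d) \<and> ls (Ns l) a b = ls (Ns m) c d"
    if eq: "g l a = g m c" "g l b = g m d" for m c d
  proof -
    obtain r where r: "l \<le> r" "m \<le> r" "H l r a = H m r c" "H l r b = H m r d" using g_common[OF eq] by blast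
    note e1 = el_ops[OF H_el[OF r(1)]] and e2 = el_ops[OF H_el[OF r(2)]]
    have "g l (ad (Ns l) a b) = g r (H l r (ad (Ns l) a b))" "g m (ad (Ns m) c d) = g r (H m r (ad (Ns m) c d))"
      "g l (mu (Ns l) a b) = g r (H l r (mu (Ns l) a b))" "g m (mu (Ns m) c d) = g r (H m r (mu (Ns m) c d))" using g_H r by simp_all
    then show ?thesis unfolding e1(3,4) e2(3,4) using r(3,4) e1(5)[of a b] e2(5)[of c d] by simp
  qed
  show "ad L (g l a) (g l b) = g l (ad (Ns l) a b)" unfolding L_def arith_struct.simps
    by (rule some_equality) (blast, elim exE conjE, drule (1) A, simp)
  show "mu L (g l a) (g l b) = g l (mu (Ns l) a b)" unfolding L_def arith_struct.simps
    by (rule some_equality) (blast, elim exE conjE, drule (1) A, simp)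
  show "ls L (g l a) (g l b) = ls (Ns l) a b" unfolding L_def arith_struct.simps using A by blast
qed

lemma L_tval: "tval L (\<lambda>v. g l (e v)) t = g l (tval (Ns l) e t)"
  by (induction t) (simp_all add: L_ops)

text \<open>The chain argument of Tarski and Vaught within Sigma_k and Pi_k: a witness in the limit
  lives at some later stage m, and elementarity from l to m, applied to the quantified formula
  itself, brings it back to l.\<close>

lemma L_el_aux: "sigma k p \<or> pi k p \<Longrightarrow> sat L (\<lambda>v. g l (e v)) p = sat (Ns l) e p"
proof (induction p arbitrary: l e)
  case (Eqf s t) show ?case by (simp add: L_tval g_inj)
next
  case (Ltf s t) show ?case by (simp add: L_tval L_ops)
next
  case (Nt p) then show ?case using class_sub(3)[OF Nt.prems] by simp
next
  case (Cj p q) then show ?case using class_sub(4,5)[OF Cj.prems] by simp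
next
  case (Dj p q) then show ?case using class_sub(6,7)[OF Dj.prems] by simp
next
  case (Ex x p)
  note IH = Ex.IH[OF class_sub(1)[OF Ex.prems]]
  show ?case
  proof
    assume "sat L (\<lambda>v. g l (e v)) (Ex x p)"
    then obtain y where y: "sat L ((\<lambda>v. g l (e v))(x := y)) p" by auto
    obtain m a where m: "l \<le> m" "y = g m a" using g_surj_above by blast
    have eq: "(\<lambda>v. g l (e v))(x := y) = (\<lambda>v. g m (((\<lambda>v. H l m (e v))(x := a)) v))" using m by (auto simp: g_H)
    have "sat (Ns m) ((\<lambda>v. H l m (e v))(x := a)) p" using y unfolding eq IH .
    then have "sat (Ns m) (\<lambda>v. H l m (e v)) (Ex x p)" by (auto simp: UN)
    then show "sat (Ns l) e (Ex x p)" using H_el[OF m(1)] Ex.prems unfolding el_def by blast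
  next
    assume "sat (Ns l) e (Ex x p)"
    then obtain a where "sat (Ns l) (e(x := a)) p" by auto
    then have "sat L (\<lambda>v. g l ((e(x := a)) v)) p" using IH by blast
    moreover have "(\<lambda>v. g l ((e(x := a)) v)) = (\<lambda>v. g l (e v))(x := g l a)" by auto
    ultimately show "sat L (\<lambda>v. g l (e v)) (Ex x p)" by auto
  qed
next
  case (Al x p)
  note IH = Al.IH[OF class_sub(2)[OF Al.prems]]
  show ?case
  proof
    assume a: "sat (Ns l) e (Al x p)"
    have "sat L ((\<lambda>v. g l (e v))(x := y)) p" for y
    proof -
      obtain m b where m: "l \<le> m" "y = g m b" using g_surj_above by blast
      have eq: "(\<lambda>v. g l (e v))(x := y) = (\<lambda>v. g m (((\<lambda>v. H l m (e v))(x := b)) v))" using m by (auto simp: g_H)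
      have "sat (Ns m) (\<lambda>v. H l m (e v)) (Al x p)" using a H_el[OF m(1)] Al.prems unfolding el_def by blast
      then have "sat (Ns m) ((\<lambda>v. H l m (e v))(x := b)) p" by (simp add: UN)
      then show ?thesis unfolding eq IH .
    qed
    then show "sat L (\<lambda>v. g l (e v)) (Al x p)" by simp
  next
    assume a: "sat L (\<lambda>v. g l (e v)) (Al x p)"
    have "sat (Ns l) (e(x := b)) p" for b
    proof -
      have eq: "(\<lambda>v. g l ((e(x := b)) v)) = (\<lambda>v. g l (e v))(x := g l b)" by auto
      have "sat L (\<lambda>v. g l ((e(x := b)) v)) p" unfolding eq using a by simp
      then show ?thesis unfolding IH .
    qed
    then show "sat (Ns l) e (Al x p)" by simp
  qed
next
  case (BEx x t p)
  note IH = BEx.IH[OF class_sub(8)[OF BEx.prems]]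
  show ?case
  proof
    assume "sat L (\<lambda>v. g l (e v)) (BEx x t p)"
    then obtain y where y: "ls L y (g l (tval (Ns l) e t))" "sat L ((\<lambda>v. g l (e v))(x := y)) p" by (auto simp: L_tval)
    obtain m a where m: "l \<le> m" "y = g m a" using g_surj_above by blast
    have eq: "(\<lambda>v. g l (e v))(x := y) = (\<lambda>v. g m (((\<lambda>v. H l m (e v))(x := a)) v))" using m by (auto simp: g_H)
    have "sat (Ns m) ((\<lambda>v. H l m (e v))(x := a)) p" using y(2) unfolding eq IH .
    moreover have "ls (Ns m) a (tval (Ns m) (\<lambda>v. H l m (e v)) t)"
      using y(1) m L_tval[of l e t] L_tval[of m "\<lambda>v. H l m (e v)" t] by (simp add: g_H L_ops)
    ultimately have "sat (Ns m) (\<lambda>v. H l m (e v)) (BEx x t p)" by (auto simp: UN)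
    then show "sat (Ns l) e (BEx x t p)" using H_el[OF m(1)] BEx.prems unfolding el_def by blast
  next
    assume "sat (Ns l) e (BEx x t p)"
    then obtain a where a: "ls (Ns l) a (tval (Ns l) e t)" "sat (Ns l) (e(x := a)) p" by auto
    then have "sat L (\<lambda>v. g l ((e(x := a)) v)) p" using IH by blast
    moreover have "(\<lambda>v. g l ((e(x := a)) v)) = (\<lambda>v. g l (e v))(x := g l a)" by auto
    ultimately show "sat L (\<lambda>v. g l (e v)) (BEx x t p)" using a(1) by (auto simp: L_tval L_ops intro!: exI[of _ "g l a"])
  qed
next
  case (BAl x t p)
  note IH = BAl.IH[OF class_sub(9)[OF BAl.prems]]
  show ?case
  proof
    assume a: "sat (Ns l) e (BAl x t p)"
    have "sat L ((\<lambda>v. g l (e v))(x := y)) p" if y: "ls L y (g l (tval (Ns l) e t))" for y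
    proof -
      obtain m b where m: "l \<le> m" "y = g m b" using g_surj_above by blast
      have eq: "(\<lambda>v. g l (e v))(x := y) = (\<lambda>v. g m (((\<lambda>v. H l m (e v))(x := b)) v))" using m by (auto simp: g_H)
      have "sat (Ns m) (\<lambda>v. H l m (e v)) (BAl x t p)" using a H_el[OF m(1)] BAl.prems unfolding el_def by blast
      moreover have "ls (Ns m) b (tval (Ns m) (\<lambda>v. H l m (e v)) t)"
        using y m L_tval[of l e t] L_tval[of m "\<lambda>v. H l m (e v)" t] by (simp add: g_H L_ops)
      ultimately have "sat (Ns m) ((\<lambda>v. H l m (e v))(x := b)) p" by (simp add: UN)
      then show ?thesis unfolding eq IH .
    qed
    then show "sat L (\<lambda>v. g l (e v)) (BAl x t p)" by (simp add: L_tval)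
  next
    assume a: "sat L (\<lambda>v. g l (e v)) (BAl x t p)"
    have "sat (Ns l) (e(x := b)) p" if "ls (Ns l) b (tval (Ns l) e t)" for b
    proof -
      have eq: "(\<lambda>v. g l ((e(x := b)) v)) = (\<lambda>v. g l (e v))(x := g l b)" by auto
      have "sat L (\<lambda>v. g l ((e(x := b)) v)) p" unfolding eq using a that by (simp add: L_tval L_ops)
      then show ?thesis unfolding IH .
    qed
    then show "sat (Ns l) e (BAl x t p)" by simp
  qed
qed

lemma L_el: "el k (Ns l) L (g l)" unfolding el_def using L_el_aux by blast

text \<open>A formula sees finitely many variables, and finitely many elements of the limit share a
  stage.\<close>

lemma env_stage:
  fixes e :: "nat \<Rightarrow> nat" and m :: nat
  shows "\<exists>l e0. l0 \<le> l \<and> (\<forall>v < m. e v = g l (e0 v))"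
proof (induction m)
  case 0 show ?case by auto
next
  case (Suc m)
  then obtain l e0 where l: "l0 \<le> l" "\<forall>v < m. e v = g l (e0 v)" by blast
  obtain r a where r: "l \<le> r" "e m = g r a" using g_surj_above by blast
  then show ?case using l by (intro exI[of _ r] exI[of _ "(\<lambda>v. H l r (e0 v))(m := a)"]) (auto simp: less_Suc_eq g_H)
qed

lemma PAminus_L: assumes "\<And>l. PAminus (Ns l)" shows "PAminus L"
  unfolding PAminus_iff[OF L_carr]
proof
  fix e
  obtain l e0 where l: "\<forall>v < fbound PAax. e v = g l (e0 v)" using env_stage[of 0 _ e] by blast
  have "sat (Ns l) e0 PAax" using assms PAminus_iff[OF UN] by blast
  then have "sat L (\<lambda>v. g l (e0 v)) PAax" using L_el_aux delta0_PAax by (auto intro: sigma_pi.intros)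
  then show "sat L e PAax" using l sat_cong[of PAax e "\<lambda>v. g l (e0 v)" L] by simp
qed

text \<open>One instance of induction involves finitely many parameters and one target element, all
  present at a single stage, where the instance holds.\<close>

lemma ISigma_L: assumes IS: "\<And>l. ISigma n (Ns l)" and nk: "n \<le> k" shows "ISigma n L"
  unfolding ISigma_def L_carr ball_UNIV
proof (intro conjI allI impI)
  show "PAminus L" using IS by (intro PAminus_L) (simp add: ISigma_def)
  fix p x e a
  assume p: "sigma n p" and z: "sat L (e(x := zr L)) p"
    and S: "\<forall>a. sat L (e(x := a)) p \<longrightarrow> sat L (e(x := ad L a (un L))) p"
  have pk: "sigma k p" by (rule sigma_le[OF p nk])
  obtain l0 e0 where l0: "\<forall>v < fbound p. e v = g l0 (e0 v)" using env_stage[of 0 _ e] by blast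
  obtain l a0 where l: "l0 \<le> l" "a = g l a0" using g_surj_above by blast
  have tr: "sat L (e(x := g l b)) p = sat (Ns l) ((\<lambda>v. H l0 l (e0 v))(x := b)) p" for b
  proof -
    have "sat L (e(x := g l b)) p = sat L (\<lambda>v. g l (((\<lambda>v. H l0 l (e0 v))(x := b)) v)) p"
      by (rule sat_cong) (use l0 l(1) in \<open>simp add: g_H\<close>)
    also have "\<dots> = sat (Ns l) ((\<lambda>v. H l0 l (e0 v))(x := b)) p" by (rule L_el_aux) (use pk in blast)
    finally show ?thesis .
  qed
  have "sat (Ns l) ((\<lambda>v. H l0 l (e0 v))(x := zr (Ns l))) p" using z tr[of "zr (Ns l)"] by (simp add: L_ops)
  moreover have "sat (Ns l) ((\<lambda>v. H l0 l (e0 v))(x := ad (Ns l) b (un (Ns l)))) p" if "sat (Ns l) ((\<lambda>v. H l0 l (e0 v))(x := b)) p" for b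
  proof -
    have "sat L (e(x := g l b)) p" using that tr by blast
    then have "sat L (e(x := ad L (g l b) (un L))) p" using S by blast
    then show ?thesis unfolding L_ops(2)[of l, symmetric] L_ops(3) tr .
  qed
  ultimately have "sat (Ns l) ((\<lambda>v. H l0 l (e0 v))(x := a0)) p"
    using IS[of l] p unfolding ISigma_def UN env_in_def by blast
  then show "sat L (e(x := a)) p" unfolding l(2) tr .
qed

end

lemma ISigma_PAminus: "ISigma n M \<Longrightarrow> PAminus M" by (simp only: ISigma_def)

lemma model_isige: assumes "model n M" shows "isige M n"
proof unfold_locales
  show "carr M = UNIV" "ISigma n M" "Exp M" using assms unfolding model_def by blast+
  then show "PAminus M" by (blast intro: ISigma_PAminus)
qed

definition cutext :: "nat arith_struct \<Rightarrow> (nat \<Rightarrow> nat) \<Rightarrow> nat set \<Rightarrow> nat set" where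
  "cutext N h I = {y. \<exists>i\<in>I. ple N y (h i)}"

lemma is_cut_cutext:
  fixes M N :: "nat arith_struct"
  assumes M: "model n M" and N: "model n N" and el: "el k M N h" and I: "is_cut M I"
  shows "is_cut N (cutext N h I)"
proof -
  interpret N: isige N n by (rule model_isige[OF N])
  have UM: "carr M = UNIV" using M unfolding model_def by blast
  show ?thesis unfolding is_cut_def N.U
  proof (intro conjI ballI impI)
    obtain i where "i \<in> I" using I unfolding is_cut_def by blast
    then show "cutext N h I \<noteq> {}" unfolding cutext_def ple_def by blast
    fix a assume "a \<in> cutext N h I"
    then obtain i where i: "i \<in> I" "ple N a (h i)" unfolding cutext_def by blast
    show "b \<in> cutext N h I" if "ls N b a" for b
      using i that N.A.less_le_trans[OF that i(2)] N.A.less_imp_le unfolding cutext_def by blast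
    have "ad M i (un M) \<in> I" using I i(1) unfolding is_cut_def by blast
    moreover have "ple N (ad N a (un N)) (h (ad M i (un M)))" unfolding el_ops[OF el] by (rule N.A.add_right_mono[OF i(2)])
    ultimately show "ad N a (un N) \<in> cutext N h I" unfolding cutext_def by blast
  qed simp
qed

text \<open>A potential injection with its data: a stage, a formula, its argument and value
  variables, the finite list of parameters and the bound x, the last two being elements of that
  stage.\<close>

type_synonym task = "nat \<times> fm \<times> nat \<times> nat \<times> nat list \<times> nat"

lemma step_nat:
  fixes M :: "nat arith_struct" and I :: "nat \<Rightarrow> nat set"
  assumes M: "model n M" and cuts: "\<And>k. is_cut M (I k)"
  shows "\<exists>(N :: nat arith_struct) h. good_ext n I M N h \<and> (sigma (Suc n) p \<longrightarrow> u \<noteq> v \<longrightarrow> x \<noteq> zr M \<longrightarrow> kill M N h p u v e x)"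
proof -
  interpret isige M n by (rule model_isige[OF M])
  have inf: "infinite (UNIV :: nat set)" "countable (UNIV :: nat set)" by simp_all
  show ?thesis
  proof (cases "sigma (Suc n) p \<and> u \<noteq> v \<and> x \<noteq> zr M")
    case True
    then show ?thesis using step[where I=I and p=p and u=u and v=v and x=x and e=e, OF inf(2,1) cuts] by blast
  next
    case False
    \<comment> \<open>A task that asks for nothing still needs an extension, so the step is run with
      the formula 0 = 0.\<close>
    have "sigma (Suc n) (Eqf Zr Zr)" by (intro sigma_pi.intros delta0.intros)
    then obtain N :: "nat arith_struct" and h where "good_ext n I M N h"
      using step[where I=I and p="Eqf Zr Zr" and u=0 and v=1 and x="un M" and e="\<lambda>_. un M", OF inf(2,1) cuts] A.zero_neq_one by (metis zero_neq_one)
    then show ?thesis using False by blast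
  qed
qed

text \<open>Bookkeeping over all potential injections with parameters from any stage. Dependent
  choice runs over pairs of the current model and the maps into it from all earlier stages.\<close>

lemma main_nat:
  fixes M :: "nat arith_struct" and I :: "nat \<Rightarrow> nat set"
  assumes M: "model n M" and cuts: "\<And>k. is_cut M (I k)"
  shows "\<exists>(N :: nat arith_struct) h. good_ext n I M N h \<and> WPHP (Suc n) N"
proof -
  define tenv where "tenv J es w = (if w < length es then J (es ! w) else 0)" for J :: "nat \<Rightarrow> nat" and es and w :: nat
  \<comment> \<open>\<open>snd s m\<close> maps stage m to the current stage, and is the identity
    for m not yet passed. The task served at j is coded by the first component of j only, so each
    task recurs at arbitrarily late stages.\<close>
  define Q where "Q j s s' \<longleftrightarrow> (\<exists>h. good_ext n (\<lambda>k. cutext (fst s) (snd s 0) (I k)) (fst s) (fst s') h \<and>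
      (\<forall>m. snd s' m = (if m \<le> j then (\<lambda>a. h (snd s m a)) else (\<lambda>a. a))) \<and>
      (case from_nat (fst (prod_decode j)) :: task of (l, p, u, v, es, x) \<Rightarrow>
        sigma (Suc n) p \<longrightarrow> u \<noteq> v \<longrightarrow> snd s l x \<noteq> zr (fst s) \<longrightarrow> kill (fst s) (fst s') h p u v (tenv (snd s l) es) (snd s l x)))"
    for j :: nat and s s' :: "nat arith_struct \<times> (nat \<Rightarrow> nat \<Rightarrow> nat)"
  define P where "P j s \<longleftrightarrow> model n (fst s) \<and> el (Suc n) M (fst s) (snd s 0) \<and> (j = 0 \<longrightarrow> s = (M, \<lambda>_ a. a))"
    for j :: nat and s :: "nat arith_struct \<times> (nat \<Rightarrow> nat \<Rightarrow> nat)"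
  have "\<exists>f. \<forall>j. P j (f j) \<and> Q j (f j) (f (Suc j))"
  proof (rule dependent_nat_choice)
    show "\<exists>s. P 0 s" unfolding P_def using M el_id by (intro exI[of _ "(M, \<lambda>_ a. a)"]) simp
    fix s j assume s: "P j s"
    have Ms: "model n (fst s)" and es: "el (Suc n) M (fst s) (snd s 0)" using s unfolding P_def by blast+
    obtain l p u v es x where t: "(from_nat (fst (prod_decode j)) :: task) = (l, p, u, v, es, x)" by (metis prod_cases6)
    have cs: "is_cut (fst s) (cutext (fst s) (snd s 0) (I k))" for k by (rule is_cut_cutext[OF M Ms es cuts])
    from step_nat[where I="\<lambda>k. cutext (fst s) (snd s 0) (I k)" and p=p and u=u and v=v and e="tenv (snd s l) es" and x="snd s l x", OF Ms cs]
    obtain N :: "nat arith_struct" and h where N: "good_ext n (\<lambda>k. cutext (fst s) (snd s 0) (I k)) (fst s) N h"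
      "sigma (Suc n) p \<longrightarrow> u \<noteq> v \<longrightarrow> snd s l x \<noteq> zr (fst s) \<longrightarrow> kill (fst s) N h p u v (tenv (snd s l) es) (snd s l x)" by blast
    let ?s = "(N, \<lambda>m. if m \<le> j then (\<lambda>a. h (snd s m a)) else (\<lambda>a. a))"
    have "Q j s ?s" unfolding Q_def t using N by auto
    moreover have "P (Suc j) ?s"
    proof -
      have "model n N" "el (Suc n) (fst s) N h" using N(1) unfolding good_ext_def by blast+
      then show ?thesis unfolding P_def using el_comp[OF es, of N h] by simp
    qed
    ultimately show "\<exists>s'. P (Suc j) s' \<and> Q j s s'" by blast
  qed
  then obtain f where Pf: "\<And>j. P j (f j)" and Qf: "\<And>j. Q j (f j) (f (Suc j))" by blast
  define Ns where "Ns j = fst (f j)" for j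
  define Jf where "Jf j = snd (f j)" for j
  define W where "W j h \<longleftrightarrow> good_ext n (\<lambda>k. cutext (Ns j) (Jf j 0) (I k)) (Ns j) (Ns (Suc j)) h \<and>
      (\<forall>m. Jf (Suc j) m = (if m \<le> j then (\<lambda>a. h (Jf j m a)) else (\<lambda>a. a))) \<and>
      (case from_nat (fst (prod_decode j)) :: task of (l, p, u, v, es, x) \<Rightarrow>
        sigma (Suc n) p \<longrightarrow> u \<noteq> v \<longrightarrow> Jf j l x \<noteq> zr (Ns j) \<longrightarrow> kill (Ns j) (Ns (Suc j)) h p u v (tenv (Jf j l) es) (Jf j l x))" for j h
  have "\<exists>h. W j h" for j using Qf[of j] unfolding Q_def W_def Ns_def Jf_def .
  then obtain hs where W: "\<And>j. W j (hs j)" by metis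
  have hs: "\<And>j. good_ext n (\<lambda>k. cutext (Ns j) (Jf j 0) (I k)) (Ns j) (Ns (Suc j)) (hs j)"
    "\<And>j m. Jf (Suc j) m = (if m \<le> j then (\<lambda>a. hs j (Jf j m a)) else (\<lambda>a. a))"
    "\<And>j. case from_nat (fst (prod_decode j)) :: task of (l, p, u, v, es, x) \<Rightarrow>
        sigma (Suc n) p \<longrightarrow> u \<noteq> v \<longrightarrow> Jf j l x \<noteq> zr (Ns j) \<longrightarrow> kill (Ns j) (Ns (Suc j)) (hs j) p u v (tenv (Jf j l) es) (Jf j l x)"
    using W unfolding W_def by simp_all
  have mod: "model n (Ns j)" for j using Pf unfolding P_def Ns_def by blast
  have s0: "Ns 0 = M" "Jf 0 = (\<lambda>_ a. a)" using Pf[of 0] unfolding P_def Ns_def Jf_def by simp_all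
  interpret C: chain Ns hs "Suc n"
    using mod hs(1) by unfold_locales (auto simp: model_def good_ext_def)
  have JH: "Jf j m = C.H m j" for j m
    by (induction j) (auto simp: s0 hs(2) C.H_id)
  have IL: "ISigma n C.L" using C.ISigma_L[of n] mod unfolding model_def by simp
  interpret L: pam C.L using ISigma_PAminus[OF IL] by unfold_locales simp_all
  have elM: "el (Suc n) M C.L (C.g 0)" using C.L_el[of 0] s0 by simp
  \<comment> \<open>Each step leaves unfilled the cut generated by \<open>I k\<close> in the
    previous stage; by induction the two ends are replaced by images of elements of
    \<open>M\<close>.\<close>
  have tri: "(\<exists>i\<in>I k. ple (Ns l) y (C.H 0 l i)) \<or> (\<exists>j. j \<notin> I k \<and> ple (Ns l) (C.H 0 l j) y)" for k l y
  proof (induction l arbitrary: y)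
    case 0 show ?case using s0 by (cases "y \<in> I k") (auto simp: ple_def)
  next
    case (Suc l)
    interpret N: isige "Ns (Suc l)" n by (rule model_isige[OF mod])
    have el: "el (Suc n) (Ns l) (Ns (Suc l)) (hs l)" by (rule C.els)
    have H: "C.H 0 (Suc l) i = hs l (C.H 0 l i)" for i by simp
    consider i where "i \<in> cutext (Ns l) (C.H 0 l) (I k)" "ple (Ns (Suc l)) y (hs l i)"
      | j where "j \<notin> cutext (Ns l) (C.H 0 l) (I k)" "ple (Ns (Suc l)) (hs l j) y"
      using hs(1)[of l] unfolding good_ext_def JH by blast
    then show ?case
    proof cases
      case 1
      then obtain i' where i': "i' \<in> I k" "ple (Ns l) i (C.H 0 l i')" unfolding cutext_def by blast
      then have "ple (Ns (Suc l)) (hs l i) (C.H 0 (Suc l) i')" unfolding H el_ops(7)[OF el] by blast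
      then show ?thesis using N.A.order_trans[OF 1(2)] i'(1) by blast
    next
      case 2
      then obtain j' where j': "j' \<notin> I k" "ple (Ns l) (C.H 0 l j') j" using Suc.IH[of j] unfolding cutext_def by blast
      then have "ple (Ns (Suc l)) (C.H 0 (Suc l) j') (hs l j)" unfolding H el_ops(7)[OF el] by blast
      then show ?thesis using N.A.order_trans[OF _ 2(2)] j'(1) by blast
    qed
  qed
  have gap: "(\<exists>i\<in>I k. ple C.L y (C.g 0 i)) \<or> (\<exists>j. j \<notin> I k \<and> ple C.L (C.g 0 j) y)" for k y
  proof -
    obtain l a where y: "y = C.g l a" using C.g_surj by blast
    have e: "C.g 0 i = C.g l (C.H 0 l i)" for i by (simp add: C.g_H)
    show ?thesis unfolding y e el_ops(7)[OF C.L_el] by (rule tri)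
  qed
  have bdl: "\<exists>x. ple (Ns l) y (C.H 0 l x)" for l y
  proof (induction l arbitrary: y)
    case 0 show ?case by (auto simp: ple_def)
  next
    case (Suc l)
    interpret N: isige "Ns (Suc l)" n by (rule model_isige[OF mod])
    have el: "el (Suc n) (Ns l) (Ns (Suc l)) (hs l)" by (rule C.els)
    obtain z where z: "ple (Ns (Suc l)) y (hs l z)" using hs(1)[of l] unfolding good_ext_def bounded_by_def by blast
    obtain x where "ple (Ns l) z (C.H 0 l x)" using Suc by blast
    then have "ple (Ns (Suc l)) (hs l z) (C.H 0 (Suc l) x)" using el_ops(7)[OF el] by simp
    then show ?case using N.A.order_trans[OF z] by blast
  qed
  have bd: "bounded_by M C.L (C.g 0)" unfolding bounded_by_def
  proof
    fix y
    obtain l a where y: "y = C.g l a" using C.g_surj by blast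
    have e: "C.g 0 i = C.g l (C.H 0 l i)" for i by (simp add: C.g_H)
    show "\<exists>x. ple C.L y (C.g 0 x)" unfolding y e el_ops(7)[OF C.L_el] by (rule bdl)
  qed
  have ExpL: "Exp C.L" using M elM bd L.PA Exp_cofinal[OF _ _ C.L_carr] unfolding model_def by blast
  have "WPHP (Suc n) C.L"
    unfolding WPHP_def Let_def
  proof (intro allI impI notI)
    fix p x and u v :: nat and e :: "nat \<Rightarrow> nat"
    assume p: "sigma (Suc n) p" and uv: "u \<noteq> v" and x: "\<not> ls C.L x (un C.L)"
    assume bad: "(\<forall>a\<in>carr C.L. ls C.L a (ad C.L x x) \<longrightarrow> (\<exists>!b. b \<in> carr C.L \<and> ls C.L a (ad C.L x x) \<and> ls C.L b x \<and> sat C.L (e(u := a, v := b)) p)) \<and>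
       (\<forall>a\<in>carr C.L. \<forall>a'\<in>carr C.L. \<forall>b\<in>carr C.L. (ls C.L a (ad C.L x x) \<and> ls C.L b x \<and> sat C.L (e(u := a, v := b)) p) \<and>
            (ls C.L a' (ad C.L x x) \<and> ls C.L b x \<and> sat C.L (e(u := a', v := b)) p) \<longrightarrow> a = a')"
    let ?xx = "ad C.L x x"
    have tot: "\<exists>b. ls C.L b x \<and> sat C.L (e(u := a, v := b)) p" if "ls C.L a ?xx" for a using bad that by auto
    have fn: "b = b'" if "ls C.L a ?xx" "ls C.L b x" "ls C.L b' x" "sat C.L (e(u := a, v := b)) p" "sat C.L (e(u := a, v := b')) p" for a b b'
    proof -
      have "\<exists>!b. b \<in> carr C.L \<and> ls C.L a ?xx \<and> ls C.L b x \<and> sat C.L (e(u := a, v := b)) p" using bad that(1) by auto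
      then show ?thesis using that by auto
    qed
    have inj: "a = a'" if "ls C.L a ?xx" "ls C.L a' ?xx" "ls C.L b x" "sat C.L (e(u := a, v := b)) p" "sat C.L (e(u := a', v := b)) p" for a a' b
      using bad[THEN conjunct2, unfolded C.L_carr ball_UNIV] that by blast
    obtain l0 x0 where x0: "x = C.g l0 x0" using C.g_surj by blast
    obtain l e0 where l: "l0 \<le> l" "\<forall>w < fbound p. e w = C.g l (e0 w)" using C.env_stage by blast
    define x1 where "x1 = C.H l0 l x0"
    have x1: "x = C.g l x1" unfolding x0 x1_def using l(1) by (simp add: C.g_H)
    define t :: task where "t = (l, p, u, v, map e0 [0..<fbound p], x1)"
    \<comment> \<open>The second component l forces l \<le> j, so the elements named by the task
      already have images at stage j.\<close>
    define j where "j = prod_encode (to_nat t, l)"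
    have lj: "l \<le> j" unfolding j_def by (rule le_prod_encode_2)
    have tj: "(from_nat (fst (prod_decode j)) :: task) = t" unfolding j_def by simp
    define E where "E = tenv (C.H l j) (map e0 [0..<fbound p])"
    define X where "X = C.H l j x1"
    have Xg: "C.g j X = x" unfolding X_def x1 using lj by (rule C.g_H)
    have Eg: "C.g j (E w) = e w" if "w < fbound p" for w
      unfolding E_def tenv_def using that l(2) by (simp add: C.g_H[OF lj])
    have tr: "sat C.L (e(u := C.g j a, v := C.g j b)) p = sat (Ns j) (E(u := a, v := b)) p" for a b
    proof -
      have "sat C.L (e(u := C.g j a, v := C.g j b)) p = sat C.L (\<lambda>w. C.g j ((E(u := a, v := b)) w)) p"
        by (rule sat_cong) (simp add: Eg)
      also have "\<dots> = sat (Ns j) (E(u := a, v := b)) p" using C.L_el_aux p by blast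
      finally show ?thesis .
    qed
    note ej = el_ops[OF C.L_el[of j]]
    have Xnz: "X \<noteq> zr (Ns j)"
    proof
      assume "X = zr (Ns j)"
      then have "x = zr C.L" using Xg ej(1) by simp
      then show False using x L.A.zero_less_one by simp
    qed
    have k: "kill (Ns j) (Ns (Suc j)) (hs j) p u v E X"
      using hs(3)[of j] p uv Xnz unfolding tj t_def JH E_def X_def by simp
    \<comment> \<open>In the limit \<open>p\<close> is assumed to define an injection; being
      Sigma_{n+1}, it defines at least a partial injection at stage j, as \<open>kill\<close>
      requires.\<close>
    have "a = a' \<longleftrightarrow> b = b'" if a: "ls (Ns j) a (ad (Ns j) X X)" "ls (Ns j) a' (ad (Ns j) X X)" "ls (Ns j) b X" "ls (Ns j) b' X"
        "sat (Ns j) (E(u := a, v := b)) p" "sat (Ns j) (E(u := a', v := b')) p" for a b a' b'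
    proof -
      have g: "ls C.L (C.g j a) ?xx" "ls C.L (C.g j a') ?xx" "ls C.L (C.g j b) x" "ls C.L (C.g j b') x"
        using a(1-4) unfolding Xg[symmetric] ej(3)[symmetric] ej(5) by blast+
      show ?thesis
      proof
        assume "a = a'"
        then show "b = b'" using fn[OF g(1,3,4)] a(5,6) unfolding tr C.g_inj by simp
      next
        assume "b = b'"
        then show "a = a'" using inj[OF g(1,2,3)] a(5,6) unfolding tr C.g_inj by simp
      qed
    qed
    then obtain c where c: "ls (Ns (Suc j)) c (hs j (ad (Ns j) X X))" "\<And>b. ls (Ns (Suc j)) b (hs j X) \<Longrightarrow> \<not> sat (Ns (Suc j)) ((\<lambda>w. hs j (E w))(u := c, v := b)) p"
      using k unfolding kill_def by blast
    \<comment> \<open>Fresh variables: \<open>z\<close> holds the bound x and \<open>Suc z\<close>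
      the value. That \<open>c\<close> has a value below x is then one Sigma_{n+1} formula
      \<open>q\<close>, which descends from the limit to stage j + 1, where \<open>c\<close> was
      left without an image.\<close>
    define z where "z = max (fbound p) (Suc (max u v))"
    let ?d = "Ltf (V (Suc z)) (V z)"
    have zs: "fbound p \<le> z" "fbound p \<le> Suc z" "v \<noteq> Suc z" unfolding z_def by auto
    have dd: "delta0 ?d" by (rule delta0.intros)
    have vs: "sat M e ?d = sat M e' ?d" if "e z = e' z" "e (Suc z) = e' (Suc z)" for M :: "nat arith_struct" and e e'
      using that by simp
    obtain q where q: "sigma (Suc n) q" "\<And>(M :: nat arith_struct) e. carr M \<noteq> {} \<Longrightarrow>
           sat M e q = (\<exists>b\<in>carr M. sat M (e(Suc z := b)) ?d \<and> sat M (e(v := b)) p)"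
      using sigma_ex_conj[OF p dd vs zs] by blast
    define E1 where "E1 = (\<lambda>w. hs j (E w))(u := c, z := hs j X)"
    note ej1 = el_ops[OF C.L_el[of "Suc j"]]
    have zu: "z \<noteq> u" "z \<noteq> v" "\<And>w. w < fbound p \<Longrightarrow> w \<noteq> z" unfolding z_def by auto
    have "ls C.L (C.g (Suc j) c) ?xx"
    proof -
      have "?xx = C.g (Suc j) (hs j (ad (Ns j) X X))" unfolding C.g_hs ej(3) Xg ..
      then show ?thesis using c(1) ej1(5) by simp
    qed
    from tot[OF this] obtain b where b: "ls C.L b x" "sat C.L (e(u := C.g (Suc j) c, v := b)) p" by blast
    have "sat C.L ((\<lambda>w. C.g (Suc j) (E1 w))(v := b)) p"
      using b(2) sat_cong[of p "(\<lambda>w. C.g (Suc j) (E1 w))(v := b)" "e(u := C.g (Suc j) c, v := b)" C.L] zu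
      by (simp add: E1_def C.g_hs Eg)
    moreover have "sat C.L ((\<lambda>w. C.g (Suc j) (E1 w))(Suc z := b)) ?d" using b(1) by (simp add: E1_def C.g_hs Xg)
    ultimately have "sat C.L (\<lambda>w. C.g (Suc j) (E1 w)) q" using q(2)[of C.L] by auto
    then have "sat (Ns (Suc j)) E1 q" using C.L_el_aux q(1) by blast
    then obtain b' where b': "sat (Ns (Suc j)) (E1(Suc z := b')) ?d" "sat (Ns (Suc j)) (E1(v := b')) p" using q(2)[of "Ns (Suc j)"] C.UN by auto
    have "ls (Ns (Suc j)) b' (hs j X)" using b'(1) by (simp add: E1_def)
    moreover have "sat (Ns (Suc j)) ((\<lambda>w. hs j (E w))(u := c, v := b')) p"
      using b'(2) sat_cong[of p "E1(v := b')" "(\<lambda>w. hs j (E w))(u := c, v := b')" "Ns (Suc j)"] zu by (simp add: E1_def)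
    ultimately show False using c(2) by blast
  qed
  then show ?thesis unfolding good_ext_def model_def using IL ExpL elM bd gap C.L_carr by blast
qed

section \<open>Transfer to arbitrary countable models\<close>

lemma PAminus_infinite:
  assumes "PAminus M" shows "infinite (carr M)"
proof -
  have c: "un M \<in> carr M" "\<And>x y. x \<in> carr M \<Longrightarrow> y \<in> carr M \<Longrightarrow> ad M x y \<in> carr M" "zr M \<in> carr M"
    using assms unfolding PAminus_def by blast+
  have irr: "\<And>x. x \<in> carr M \<Longrightarrow> \<not> ls M x x" using assms unfolding PAminus_def by blast
  have tr: "\<And>x y z. x \<in> carr M \<Longrightarrow> y \<in> carr M \<Longrightarrow> z \<in> carr M \<Longrightarrow> ls M x y \<Longrightarrow> ls M y z \<Longrightarrow> ls M x z"
    using assms unfolding PAminus_def by blast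
  have suc: "ls M x (ad M (un M) x)" if x: "x \<in> carr M" for x
  proof -
    have "ls M (zr M) (un M)" using assms unfolding PAminus_def by blast
    moreover have "\<And>a b z. a \<in> carr M \<Longrightarrow> b \<in> carr M \<Longrightarrow> z \<in> carr M \<Longrightarrow> ls M a b \<Longrightarrow> ls M (ad M a z) (ad M b z)"
      using assms unfolding PAminus_def by blast
    ultimately have "ls M (ad M (zr M) x) (ad M (un M) x)" using c x by blast
    moreover have "ad M (zr M) x = ad M x (zr M)" "ad M x (zr M) = x" using assms c x unfolding PAminus_def by blast+
    ultimately show ?thesis by simp
  qed
  define f where "f k = ((\<lambda>x. ad M (un M) x) ^^ k) (zr M)" for k
  have fc: "f k \<in> carr M" for k unfolding f_def by (induction k) (auto simp: c)
  have "ls M (f k) (f (Suc (k + d)))" for k d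
  proof (induction d)
    case 0 show ?case using suc[OF fc[of k]] by (simp add: f_def)
  next
    case (Suc d)
    have "ls M (f (Suc (k + d))) (f (Suc (k + Suc d)))" using suc[OF fc[of "Suc (k + d)"]] by (simp add: f_def)
    then show ?case using tr Suc fc by blast
  qed
  then have lt: "i < j \<Longrightarrow> ls M (f i) (f j)" for i j by (metis less_natE)
  have "inj f"
  proof (rule injI, rule ccontr)
    fix i j assume eq: "f i = f j" and ne: "i \<noteq> j"
    consider "i < j" | "j < i" using ne by linarith
    then show False
    proof cases
      case 1 then show ?thesis using lt[of i j] eq irr[OF fc[of j]] by simp
    next
      case 2 then show ?thesis using lt[of j i] eq irr[OF fc[of j]] by simp
    qed
  qed
  then show ?thesis using fc by (meson image_subsetI infinite_super range_inj_infinite)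
qed

locale transport =
  fixes M :: "'a arith_struct" and h :: "'a \<Rightarrow> nat"
  assumes bij: "bij_betw h (carr M) UNIV"
begin

definition k :: "nat \<Rightarrow> 'a" where "k = inv_into (carr M) h"

lemma k: "k x \<in> carr M" "a \<in> carr M \<Longrightarrow> k (h a) = a" "h (k x) = x"
  unfolding k_def using bij
  by (simp_all add: bij_betw_def inv_into_into f_inv_into_f)

definition N :: "nat arith_struct" where
  "N = \<lparr>carr = UNIV, zr = h (zr M), un = h (un M), ad = (\<lambda>x y. h (ad M (k x) (k y))),
     mu = (\<lambda>x y. h (mu M (k x) (k y))), ls = (\<lambda>x y. ls M (k x) (k y))\<rparr>"

lemma N_simps [simp]: "carr N = UNIV" "zr N = h (zr M)" "un N = h (un M)" "ad N x y = h (ad M (k x) (k y))"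
  "mu N x y = h (mu M (k x) (k y))" "ls N x y = ls M (k x) (k y)"
  by (simp_all add: N_def)

context assumes PA: "PAminus M" begin

lemma closed: "zr M \<in> carr M" "un M \<in> carr M" "a \<in> carr M \<Longrightarrow> b \<in> carr M \<Longrightarrow> ad M a b \<in> carr M"
    "a \<in> carr M \<Longrightarrow> b \<in> carr M \<Longrightarrow> mu M a b \<in> carr M"
  using PA unfolding PAminus_def by blast+

lemma tval_transport: "env_in M e \<Longrightarrow> tval M e t \<in> carr M \<and> tval N (\<lambda>v. h (e v)) t = h (tval M e t)"
  by (induction t) (auto simp: env_in_def closed k)

lemma sat_transport: "env_in M e \<Longrightarrow> sat N (\<lambda>v. h (e v)) p = sat M e p"
proof (induction p arbitrary: e)
  case (Eqf s t) then show ?case using tval_transport[OF Eqf] by (metis k(2) sat.simps(1))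
next
  case (Ltf s t) then show ?case using tval_transport[OF Ltf] by (simp add: k)
next
  case (Ex x p)
  have "sat N ((\<lambda>v. h (e v))(x := y)) p = sat M (e(x := k y)) p" for y
  proof -
    have "(\<lambda>v. h ((e(x := k y)) v)) = (\<lambda>v. h (e v))(x := y)" by (auto simp: k)
    moreover have "env_in M (e(x := k y))" using Ex.prems k(1) by (simp add: env_in_def)
    ultimately show ?thesis using Ex.IH by metis
  qed
  then show ?case using k by simp metis
next
  case (Al x p)
  have "sat N ((\<lambda>v. h (e v))(x := y)) p = sat M (e(x := k y)) p" for y
  proof -
    have "(\<lambda>v. h ((e(x := k y)) v)) = (\<lambda>v. h (e v))(x := y)" by (auto simp: k)
    moreover have "env_in M (e(x := k y))" using Al.prems k(1) by (simp add: env_in_def)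
    ultimately show ?thesis using Al.IH by metis
  qed
  then show ?case using k by simp metis
next
  case (BEx x t p)
  have "sat N ((\<lambda>v. h (e v))(x := y)) p = sat M (e(x := k y)) p" for y
  proof -
    have "(\<lambda>v. h ((e(x := k y)) v)) = (\<lambda>v. h (e v))(x := y)" by (auto simp: k)
    moreover have "env_in M (e(x := k y))" using BEx.prems k(1) by (simp add: env_in_def)
    ultimately show ?thesis using BEx.IH by metis
  qed
  then show ?case using k tval_transport[OF BEx.prems, of t] by simp metis
next
  case (BAl x t p)
  have "sat N ((\<lambda>v. h (e v))(x := y)) p = sat M (e(x := k y)) p" for y
  proof -
    have "(\<lambda>v. h ((e(x := k y)) v)) = (\<lambda>v. h (e v))(x := y)" by (auto simp: k)
    moreover have "env_in M (e(x := k y))" using BAl.prems k(1) by (simp add: env_in_def)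
    ultimately show ?thesis using BAl.IH by metis
  qed
  then show ?case using k tval_transport[OF BAl.prems, of t] by simp metis
qed simp_all

lemma sat_transport': "sat N e p = sat M (\<lambda>v. k (e v)) p" "env_in M (\<lambda>v. k (e v))"
proof -
  show e: "env_in M (\<lambda>v. k (e v))" by (simp add: env_in_def k)
  show "sat N e p = sat M (\<lambda>v. k (e v)) p" using sat_transport[OF e, of p] by (simp add: k)
qed

lemma sat_transport_upd: "sat N (e(x := y)) p = sat M ((\<lambda>v. k (e v))(x := k y)) p"
proof -
  have "(\<lambda>v. k ((e(x := y)) v)) = (\<lambda>v. k (e v))(x := k y)" by auto
  then show ?thesis using sat_transport'(1)[of "e(x := y)" p] by simp
qed

lemma PAminus_transport: "PAminus N"
proof -
  note P = PA[unfolded PAminus_def]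
  show ?thesis
    unfolding PAminus_def N_simps ball_UNIV bex_UNIV
  proof (intro conjI allI impI, simp_all only: k closed UNIV_I)
    fix x y z
    note c = k(1)[of x] k(1)[of y] k(1)[of z]
    show "h (ad M (ad M (k x) (k y)) (k z)) = h (ad M (k x) (ad M (k y) (k z)))" using P c by metis
    show "h (ad M (k x) (k y)) = h (ad M (k y) (k x))" using P c by metis
    show "h (mu M (mu M (k x) (k y)) (k z)) = h (mu M (k x) (mu M (k y) (k z)))" using P c by metis
    show "h (mu M (k x) (k y)) = h (mu M (k y) (k x))" using P c by metis
    show "h (mu M (k x) (ad M (k y) (k z))) = h (ad M (mu M (k x) (k y)) (mu M (k x) (k z)))" using P c by metis
    show "h (ad M (k x) (zr M)) = x" using P c k(3) by metis
    show "h (mu M (k x) (zr M)) = h (zr M)" using P c by metis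
    show "h (mu M (k x) (un M)) = x" using P c k(3) by metis
    show "\<not> ls M (k x) (k x)" using P c by blast
    show "ls M (k x) (k y) \<or> x = y \<or> ls M (k y) (k x)" using P c k(3) by metis
    show "ls M (k x) (k z)" if "ls M (k x) (k y) \<and> ls M (k y) (k z)" using P c that by blast
    show "ls M (ad M (k x) (k z)) (ad M (k y) (k z))" if "ls M (k x) (k y)" using P c that by blast
    show "ls M (mu M (k x) (k z)) (mu M (k y) (k z))" if "ls M (zr M) (k z) \<and> ls M (k x) (k y)" using P c that by blast
    show "\<exists>w. h (ad M (k x) (k w)) = y" if "ls M (k x) (k y)"
    proof -
      have "\<forall>x\<in>carr M. \<forall>y\<in>carr M. ls M x y \<longrightarrow> (\<exists>w\<in>carr M. ad M x w = y)" using P by blast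
      from mp[OF bspec[OF bspec[OF this c(1)] c(2)] that]
      obtain w where "w \<in> carr M" "ad M (k x) w = k y" by (rule bexE)
      then show ?thesis by (intro exI[of _ "h w"]) (simp add: k)
    qed
    show "ls M (zr M) (un M)" using P by blast
    show "ls M (un M) (k x) \<or> h (un M) = x" if "ls M (zr M) (k x)" using P c that k(3) by metis
    show "ls M (zr M) (k x) \<or> h (zr M) = x" using P c k(3) by metis
  qed
qed

end

end

lemma ISigma_transport:
  assumes "bij_betw h (carr M) UNIV" "ISigma n M" "Exp M"
  shows "model n (transport.N M h)"
proof -
  interpret transport M h by unfold_locales (rule assms)
  have PA: "PAminus M" using assms(2) by (rule ISigma_PAminus)
  have "ISigma n N" unfolding ISigma_def ball_UNIV N_simps
  proof (intro conjI PAminus_transport PA allI impI)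
    fix p x e a
    assume p: "sigma n p" and z: "sat N (e(x := h (zr M))) p" 
      and S: "\<forall>a. sat N (e(x := a)) p \<longrightarrow> sat N (e(x := h (ad M (k a) (k (h (un M)))))) p"
    let ?e = "\<lambda>v. k (e v)"
    have "sat M (?e(x := zr M)) p" using z unfolding sat_transport_upd[OF PA] by (simp only: k closed[OF PA])
    moreover have "sat M (?e(x := ad M b (un M))) p" if b: "b \<in> carr M" "sat M (?e(x := b)) p" for b
      using S[rule_format, of "h b"] b unfolding sat_transport_upd[OF PA] by (simp only: k closed[OF PA])
    ultimately have "sat M (?e(x := k a)) p" using assms(2) p sat_transport'(2)[OF PA, of e] k(1)[of a]
      unfolding ISigma_def by blast
    then show "sat N (e(x := a)) p" unfolding sat_transport_upd[OF PA] .
  qed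
  moreover have "Exp N" using assms(3) unfolding Exp_def sat_transport'(1)[OF PA] using sat_transport'(2)[OF PA] by blast
  ultimately show ?thesis unfolding model_def by simp
qed

text \<open>The carrier is renumbered by \<open>nat\<close> and \<open>main_nat\<close> is applied.
  One inclusion between supremum and infimum is the order between a cut and its complement, the
  other says that no element fills the cut.\<close>

theorem main_ext:
  fixes M :: "'a arith_struct" and I :: "nat \<Rightarrow> 'a set"
  assumes c: "countable (carr M)" and IS: "ISigma n M" and E: "Exp M" and cuts: "\<forall>k. is_cut M (I k)"
  shows "\<exists>(N :: nat arith_struct) h.
            ISigma n N \<and> Exp N \<and> WPHP (Suc n) N \<and>
            sigma_elementary (Suc n) M N h \<and> cofinal M N h \<and>
            (\<forall>k. supN N h (I k) = infN N h (carr M - I k))"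
proof -
  have PA: "PAminus M" using IS by (rule ISigma_PAminus)
  obtain h :: "'a \<Rightarrow> nat" where h: "bij_betw h (carr M) UNIV" using to_nat_on_infinite[OF c PAminus_infinite[OF PA]] by blast
  interpret T: transport M h by unfold_locales (rule h)
  note cl = T.closed[OF PA]
  have mod: "model n T.N" by (rule ISigma_transport[OF h IS E])
  have "is_cut T.N (h ` I k)" for k
  proof -
    have I: "I k \<subseteq> carr M" "I k \<noteq> {}" "\<And>a b. a \<in> I k \<Longrightarrow> b \<in> carr M \<Longrightarrow> ls M b a \<Longrightarrow> b \<in> I k" "\<And>a. a \<in> I k \<Longrightarrow> ad M a (un M) \<in> I k"
      using cuts unfolding is_cut_def by blast+
    show ?thesis unfolding is_cut_def T.N_simps
    proof (intro conjI ballI impI)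
      show "h ` I k \<noteq> {}" using I by blast
      fix a assume "a \<in> h ` I k"
      then obtain a' where a: "a' \<in> I k" "a = h a'" by blast
      have a': "T.k a = a'" "a' \<in> carr M" using a I(1) T.k(2) by auto
      show "b \<in> h ` I k" if "ls M (T.k b) (T.k a)" for b
        using I(3)[OF a(1) T.k(1), of b] that T.k(3)[of b] unfolding a'(1) by (metis image_eqI)
      show "h (ad M (T.k a) (T.k (h (un M)))) \<in> h ` I k" using I(4)[OF a(1)] unfolding a'(1) by (simp add: T.k cl)
    qed simp
  qed
  then obtain N :: "nat arith_struct" and g where g: "good_ext n (\<lambda>k. h ` I k) T.N N g" and W: "WPHP (Suc n) N"
    using main_nat[OF mod, of "\<lambda>k. h ` I k"] by blast
  have N: "model n N" and el: "el (Suc n) T.N N g" and bd: "bounded_by T.N N g"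
    and gap: "\<And>k y. (\<exists>i\<in>h ` I k. ple N y (g i)) \<or> (\<exists>j. j \<notin> h ` I k \<and> ple N (g j) y)"
    using g unfolding good_ext_def by blast+
  interpret N: isige N n by (rule model_isige[OF N])
  let ?h = "\<lambda>a. g (h a)"
  note ops = el_ops[OF el]
  have lsh: "ls N (?h a) (?h b) = ls M a b" if "a \<in> carr M" "b \<in> carr M" for a b
    unfolding ops(5) using that by (simp add: T.k)
  have emb: "embedding M N ?h" unfolding embedding_def N.U
  proof (intro conjI ballI)
    show "inj_on ?h (carr M)" using h ops(6) unfolding bij_betw_def inj_on_def by auto
    show "?h (zr M) = zr N" "?h (un M) = un N" using ops(1,2) by simp_all
    fix x y assume xy: "x \<in> carr M" "y \<in> carr M"
    have "ad T.N (h x) (h y) = h (ad M x y)" "mu T.N (h x) (h y) = h (mu M x y)" using xy by (simp_all add: T.k)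
    then show "?h (ad M x y) = ad N (?h x) (?h y)" "?h (mu M x y) = mu N (?h x) (?h y)" using ops(3,4) by metis+
    show "ls M x y = ls N (?h x) (?h y)" using lsh xy by simp
  qed simp
  have sel: "sigma_elementary (Suc n) M N ?h" unfolding sigma_elementary_def
  proof (intro conjI emb allI impI)
    fix p e assume p: "sigma (Suc n) p" and e: "env_in M e"
    have "sat N (\<lambda>v. g (h (e v))) p = sat T.N (\<lambda>v. h (e v)) p"
      using el[unfolded el_def, rule_format, of p "\<lambda>v. h (e v)"] p by simp
    then show "sat M e p = sat N (?h \<circ> e) p" using T.sat_transport[OF PA e] by (simp add: comp_def)
  qed
  have cof: "cofinal M N ?h" unfolding cofinal_def
  proof
    fix y
    obtain x where "ple N y (g x)" using bd unfolding bounded_by_def by blast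
    then show "\<exists>x\<in>carr M. ls N y (?h x) \<or> y = ?h x" using T.k(1,3)[of x] unfolding ple_def by (intro bexI[of _ "T.k x"]) simp_all
  qed
  have "supN N ?h (I k) = infN N ?h (carr M - I k)" for k
  proof -
    have I: "I k \<subseteq> carr M" "\<And>a b. a \<in> I k \<Longrightarrow> b \<in> carr M \<Longrightarrow> ls M b a \<Longrightarrow> b \<in> I k"
      using cuts unfolding is_cut_def by blast+
    have "ls N x (?h j)" if "i \<in> I k" "ls N x (?h i) \<or> x = ?h i" "j \<in> carr M - I k" for x i j
    proof -
      have "ls M i j" using that(1,3) I PA unfolding PAminus_def by (metis DiffE subsetD)
      then have "ls N (?h i) (?h j)" using lsh that(1,3) I(1) by blast
      then show ?thesis using that(2) N.A.less_trans by blast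
    qed
    moreover have "\<exists>i\<in>I k. ls N x (?h i) \<or> x = ?h i" if inf: "\<forall>j\<in>carr M - I k. ls N x (?h j)" for x
      using gap[of k x]
    proof
      assume "\<exists>i\<in>h ` I k. ple N x (g i)" then show ?thesis unfolding ple_def by blast
    next
      assume "\<exists>j. j \<notin> h ` I k \<and> ple N (g j) x"
      then obtain j where j: "j \<notin> h ` I k" "ple N (g j) x" by blast
      have "T.k j \<in> carr M - I k" using j(1) T.k(1,3)[of j] by (metis DiffI image_eqI)
      then have "ls N x (g j)" using inf T.k(3)[of j] by metis
      then show ?thesis using j(2) N.A.not_le by blast
    qed
    ultimately show ?thesis unfolding supN_def infN_def N.U by blast
  qed
  then show ?thesis using N W sel cof unfolding model_def by blast
qed

section \<open>A universal relation in the standard model\<close>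

definition NN :: "nat arith_struct" where
  "NN = \<lparr>carr = UNIV, zr = 0, un = 1, ad = (+), mu = (*), ls = (<)\<rparr>"

lemma NN_simps [simp]: "carr NN = UNIV" "zr NN = 0" "un NN = 1" "ad NN = (+)" "mu NN = (*)" "ls NN = (<)" "ple NN = (\<le>)"
  by (auto simp: NN_def ple_def fun_eq_iff)

lemma PAminus_NN: "PAminus NN"
proof -
  have "\<exists>w. x + w = y" if "x < y" for x y :: nat using that by (intro exI[of _ "y - x"]) simp
  then show ?thesis unfolding PAminus_def NN_simps by (simp add: algebra_simps) auto
qed

lemma ISigma_NN: "ISigma n NN"
  unfolding ISigma_def
proof (intro conjI PAminus_NN allI impI ballI)
  fix p x e a
  assume "sat NN (e(x := zr NN)) p" and "\<forall>a\<in>carr NN. sat NN (e(x := a)) p \<longrightarrow> sat NN (e(x := ad NN a (un NN))) p"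
  then show "sat NN (e(x := a)) p" by (induction a) auto
qed

text \<open>A common prime p divides the difference (j - i) d. If it divides j - i, it is at most b,
  hence divides the factorial of b and so d; in either case p divides d, against p dividing 1 +
  (i+1) d.\<close>

lemma moduli_coprime:
  fixes i j b :: nat
  assumes "i < b" "j < b" "i \<noteq> j" "fact b dvd d"
  shows "coprime (1 + (i + 1) * d) (1 + (j + 1) * d)"
proof -
  have main: "coprime (1 + (i + 1) * d) (1 + (j + 1) * d)" if ij: "i < j" "j < b" for i j
  proof (rule ccontr)
    assume "\<not> coprime (1 + (i + 1) * d) (1 + (j + 1) * d)"
    then have "gcd (1 + (i + 1) * d) (1 + (j + 1) * d) \<noteq> 1" unfolding coprime_iff_gcd_eq_1 .
    then obtain p where p0: "prime p" "p dvd gcd (1 + (i + 1) * d) (1 + (j + 1) * d)" using prime_factor_nat by blast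
    then have p: "prime p" "p dvd 1 + (i + 1) * d" "p dvd 1 + (j + 1) * d" by (auto dest: dvd_trans[OF _ gcd_dvd1] dvd_trans[OF _ gcd_dvd2])
    have "p dvd (1 + (j + 1) * d) - (1 + (i + 1) * d)" using p by (intro dvd_diff_nat)
    moreover have "(1 + (j + 1) * d) - (1 + (i + 1) * d) = (j - i) * d" by (simp add: diff_mult_distrib)
    ultimately have "p dvd (j - i) * d" by simp
    then have "p dvd d"
    proof (cases "p dvd d")
      case False
      then have "p dvd j - i" using \<open>p dvd (j - i) * d\<close> p(1) by (simp add: prime_dvd_mult_iff)
      then have "p \<le> b" using ij by (metis dvd_imp_le diff_le_self le_trans less_imp_le_nat zero_less_diff)
      then have "p dvd fact b" using p(1) by (intro dvd_fact prime_ge_1_nat)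
      then show ?thesis using assms(4) dvd_trans by blast
    qed
    then have "p dvd 1" using p(2) by (metis dvd_add_left_iff dvd_mult)
    then show False using p(1) by simp
  qed
  show ?thesis using main[of i j] main[of j i] assms by (cases "i < j") (auto simp: coprime_commute)
qed

lemma Exp_NN: "Exp NN"
  unfolding Exp_def
proof (intro allI impI)
  fix e
  have "\<exists>y c d. sat NN (e(0 := x, 1 := y, 2 := c, 3 := d)) exp_matrix" for x
  proof -
    \<comment> \<open>The factorial serves twice: it is divisible by (x+1)!, which makes the moduli
      coprime, and it is at least 2^(x+1), which keeps the entries below the moduli.\<close>
    define d :: nat where "d = fact (x + 2 ^ (x + 1))"
    have f: "fact (Suc x) dvd d" unfolding d_def by (rule fact_dvd) simp
    let ?m = "\<lambda>i. 1 + (i + 1) * d"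
    have "\<forall>i\<in>{..x}. \<forall>j\<in>{..x}. i \<noteq> j \<longrightarrow> coprime (?m i) (?m j)"
      using moduli_coprime[of _ "Suc x" _ d] f by auto
    then obtain c where c: "\<forall>i\<in>{..x}. [c = 2 ^ i] (mod ?m i)"
      using chinese_remainder_nat[of "{..x}" ?m "\<lambda>i. 2 ^ i"] by auto
    have dl: "2 ^ (x + 1) \<le> d" unfolding d_def by (rule order_trans[OF _ fact_ge_self]) simp
    have small: "2 ^ i < ?m i" if "i \<le> x" for i
    proof -
      have "(2 :: nat) ^ i \<le> 2 ^ (x + 1)" using that by (intro power_increasing) auto
      also have "\<dots> \<le> (i + 1) * d" using dl by simp
      finally show ?thesis by simp
    qed
    have R: "\<exists>q. q < c + 1 \<and> c = q * ?m i + 2 ^ i" if "i \<le> x" for i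
    proof -
      have "c mod ?m i = 2 ^ i" using c that small[OF that] by (simp add: cong_def)
      then have "c = (c div ?m i) * ?m i + 2 ^ i" by (metis div_mult_mod_eq)
      moreover have "c div ?m i < c + 1" by (simp add: less_Suc_eq_le)
      ultimately show ?thesis by blast
    qed
    have lt: "2 ^ i < c + 1" if "i \<le> x" for i using R[OF that] by auto
    let ?e = "e(0 := x, 1 := 2 ^ x, 2 := c, 3 := d)"
    have "sat NN ?e (rem_is (bmod Zr) On)" unfolding rem_is_def bmod_def using R[of 0] small[of 0] by simp
    moreover have "sat NN ?e (BAl 4 (V 0) (BEx 6 (Pl (V 2) On)
              (Cj (rem_is (bmod (V 4)) (V 6)) (rem_is (bmod (Pl (V 4) On)) (Pl (V 6) (V 6))))))"
      unfolding sat.simps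
    proof (intro ballI impI)
      fix i assume "ls NN i (tval NN ?e (V 0))"
      then have i: "i \<le> x" "i + 1 \<le> x" by simp_all
      let ?e' = "?e(4 := i, 6 := 2 ^ i)"
      have "ls NN (2 ^ i) (tval NN (?e(4 := i)) (Pl (V 2) On))" using lt[OF i(1)] by simp
      moreover have "sat NN ?e' (rem_is (bmod (V 4)) (V 6))"
        unfolding rem_is_def bmod_def using R[OF i(1)] small[OF i(1)] by simp
      moreover have "sat NN ?e' (rem_is (bmod (Pl (V 4) On)) (Pl (V 6) (V 6)))"
        unfolding rem_is_def bmod_def using R[OF i(2)] small[OF i(2)] by (simp add: mult_2)
      ultimately show "\<exists>a\<in>carr NN. ls NN a (tval NN (?e(4 := i)) (Pl (V 2) On)) \<and>
         sat NN (?e(4 := i, 6 := a)) (rem_is (bmod (V 4)) (V 6)) \<and> sat NN (?e(4 := i, 6 := a)) (rem_is (bmod (Pl (V 4) On)) (Pl (V 6) (V 6)))"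
        by (intro bexI[of _ "2 ^ i"]) simp_all
    qed
    moreover have "sat NN ?e (rem_is (bmod (V 0)) (V 1))"
      unfolding rem_is_def bmod_def using R[of x] small[of x] by simp
    ultimately have "sat NN ?e exp_matrix" unfolding exp_matrix_def by (simp only: sat.simps)
    then show ?thesis by blast
  qed
  then show "sat NN e exp_sentence" unfolding exp_sentence_def sat.simps NN_simps bex_UNIV ball_UNIV by blast
qed

lemma model_NN: "model n NN" unfolding model_def using ISigma_NN Exp_NN by simp

locale std = isige NN m for m :: nat

lemma std: "std m" unfolding std_def by (rule model_isige[OF model_NN])

section \<open>Cantor pairing, and programs certified by finite sets\<close>

abbreviation pr :: "nat \<Rightarrow> nat \<Rightarrow> nat" where "pr a b \<equiv> prod_encode (a, b)"
abbreviation p1 :: "nat \<Rightarrow> nat" where "p1 z \<equiv> fst (prod_decode z)"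
abbreviation p2 :: "nat \<Rightarrow> nat" where "p2 z \<equiv> snd (prod_decode z)"

text \<open>Doubling removes the division from the triangular number, so the graph of pairing
  becomes a polynomial equation.\<close>

lemma pr_iff: "z = pr a b \<longleftrightarrow> 2 * z = (a + b) * (a + b + 1) + 2 * a"
proof -
  have "2 * triangle (a + b) = (a + b) * (a + b + 1)" unfolding triangle_def by simp
  moreover have "pr a b = triangle (a + b) + a" unfolding prod_encode_def by simp
  ultimately show ?thesis by linarith
qed

lemma le_pr: "a \<le> pr a b" "b \<le> pr a b" by (rule le_prod_encode_1, rule le_prod_encode_2)

lemma pr_inj [simp]: "pr a b = pr c d \<longleftrightarrow> a = c \<and> b = d" by (simp add: prod_encode_eq)

lemma pr_p: "pr (p1 z) (p2 z) = z" by simp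

text \<open>A program takes one number, a nested pair coding the environment. Its value is certified by a finite
  set of triples (program, input, value), each justified by other members of the set; finite sets are
  coded by divisibility, so being a certificate is a bounded property.\<close>

datatype prg = Cst nat | Unp nat | Compp prg prg | BExp prg prg | Bin nat prg prg

text \<open>Zero is falsity, everything else truth. The default operation is NAND; conjunction is
  obtained by comparing its value with zero.\<close>

definition bop :: "nat \<Rightarrow> nat \<Rightarrow> nat \<Rightarrow> nat" where
  "bop q a c = (if q = 0 then a + c else if q = 1 then a * c else if q = 2 then (if a = c then 1 else 0)
     else if q = 3 then (if a < c then 1 else 0) else (if a \<noteq> 0 \<and> c \<noteq> 0 then 0 else 1))"

primrec val :: "prg \<Rightarrow> nat \<Rightarrow> nat" where
  "val (Cst c) x = c"
| "val (Unp q) x = (if q = 0 then x else if q = 1 then p1 x else p2 x)"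
| "val (Compp p r) x = val p (val r x)"
| "val (BExp p r) x = (if \<exists>y < val p x. val r (pr x y) \<noteq> 0 then 1 else 0)"
| "val (Bin q p r) x = bop q (val p x) (val r x)"

primrec code :: "prg \<Rightarrow> nat" where
  "code (Cst c) = pr 0 c"
| "code (Unp q) = pr 1 q"
| "code (Compp p r) = pr 2 (pr (code p) (code r))"
| "code (BExp p r) = pr 3 (pr (code p) (code r))"
| "code (Bin q p r) = pr 4 (pr q (pr (code p) (code r)))"

abbreviation tr :: "nat \<Rightarrow> nat \<Rightarrow> nat \<Rightarrow> nat" where "tr k x v \<equiv> pr k (pr x v)"

text \<open>In this and the next two definitions \<open>m\<close> is the set of available triples
  and \<open>b\<close> bounds intermediate values. Components of the program code \<open>k\<close>
  are at most \<open>k\<close>, so all quantifiers are bounded.\<close>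

definition justC :: "(nat \<Rightarrow> bool) \<Rightarrow> nat \<Rightarrow> nat \<Rightarrow> nat \<Rightarrow> nat \<Rightarrow> bool" where
  "justC m b k x v \<longleftrightarrow> (\<exists>i. i \<le> k \<and> (\<exists>j. j \<le> k \<and> (k = pr 2 (pr i j) \<and> (\<exists>a. a < b \<and> (m (tr j x a) \<and> m (tr i a v))))))"

definition justO :: "(nat \<Rightarrow> bool) \<Rightarrow> nat \<Rightarrow> nat \<Rightarrow> nat \<Rightarrow> nat \<Rightarrow> bool" where
  "justO m b k x v \<longleftrightarrow> (\<exists>q. q \<le> k \<and> (\<exists>i. i \<le> k \<and> (\<exists>j. j \<le> k \<and> (k = pr 4 (pr q (pr i j)) \<and> (\<exists>a. a < b \<and> (\<exists>c. c < b \<and>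
        (m (tr i x a) \<and> (m (tr j x c) \<and> v = bop q a c))))))))"

definition justB :: "(nat \<Rightarrow> bool) \<Rightarrow> nat \<Rightarrow> nat \<Rightarrow> nat \<Rightarrow> nat \<Rightarrow> bool" where
  "justB m b k x v \<longleftrightarrow> (\<exists>i. i \<le> k \<and> (\<exists>j. j \<le> k \<and> (k = pr 3 (pr i j) \<and> (\<exists>a. a < b \<and> (m (tr i x a) \<and>
        ((v = 1 \<and> (\<exists>y. y < a \<and> (\<exists>c. c < b \<and> (m (tr j (pr x y) c) \<and> c \<noteq> 0)))) \<or>
         (v = 0 \<and> (\<forall>y. y < a \<longrightarrow> m (tr j (pr x y) 0))))))))) "

definition just :: "(nat \<Rightarrow> bool) \<Rightarrow> nat \<Rightarrow> nat \<Rightarrow> nat \<Rightarrow> nat \<Rightarrow> bool" where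
  "just m b k x v \<longleftrightarrow>
     (\<exists>c. c \<le> k \<and> (k = pr 0 c \<and> v = c)) \<or>
     (\<exists>q. q \<le> k \<and> (k = pr 1 q \<and> ((q = 0 \<and> v = x) \<or> (q = 1 \<and> v = p1 x) \<or> (q \<noteq> 0 \<and> q \<noteq> 1 \<and> v = p2 x)))) \<or>
     justC m b k x v \<or>
     justB m b k x v \<or>
     justO m b k x v"

definition mem :: "nat \<Rightarrow> nat \<Rightarrow> bool" where
  "mem w z \<longleftrightarrow> z < p1 w \<and> (\<exists>q. q \<le> p1 (p2 w) \<and> p1 (p2 w) = q * (1 + (z + 1) * p2 (p2 w)))"

text \<open>Members of \<open>w\<close>, and the values in its triples, lie below \<open>w\<close>,
  which can therefore act as the bound for both.\<close>

definition cert :: "nat \<Rightarrow> bool" where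
  "cert w \<longleftrightarrow> (\<forall>t. t < w \<longrightarrow> mem w t \<longrightarrow> just (mem w) w (p1 t) (p1 (p2 t)) (p2 (p2 t)))"

lemma mem_less: "mem w z \<Longrightarrow> z < w"
  unfolding mem_def using le_pr(1)[of "p1 w" "p2 w"] by simp

lemma mem_tr_less: "mem w (tr k x v) \<Longrightarrow> v < w"
  using mem_less[of w "tr k x v"] le_pr(2)[where a=x and b=v] le_pr(2)[where a=k and b="pr x v"] by linarith

context std begin

lemmas nFF = FF_var FF_const FF_ad[unfolded NN_simps] FF_mu[unfolded NN_simps]
lemmas nDD = DD_Fbex[unfolded NN_simps] DD_Fball[unfolded NN_simps] DD_Fexle[unfolded NN_simps] DD_Fallle[unfolded NN_simps]
  DD_conj DD_disj DD_imp DD_not DD_Feq DD_Fls[unfolded NN_simps] DD_Fle[unfolded NN_simps]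

lemma FF_pr: assumes "FF s" "FF t" shows "FF (\<lambda>e. pr (s e) (t e))"
proof (rule FF_I)
  show "FF (\<lambda>e. (s e + t e) * (s e + t e + 1) + 2 * s e)" by (intro nFF assms)
  show "ple NN (pr (s e) (t e)) ((s e + t e) * (s e + t e + 1) + 2 * s e)" for e
    using pr_iff[of "pr (s e) (t e)" "s e" "t e"] by simp
  show "DD NN (\<lambda>e. e 0 = pr (s (\<lambda>v. e (Suc v))) (t (\<lambda>v. e (Suc v))))"
    unfolding pr_iff by (intro DD_Feq nFF FF_shift[OF assms(1)] FF_shift[OF assms(2)])
qed

lemma FF_p: assumes "FF s" shows "FF (\<lambda>e. p1 (s e))" "FF (\<lambda>e. p2 (s e))"
proof -
  have i: "x = p1 z \<longleftrightarrow> (\<exists>y. y \<le> z \<and> z = pr x y)" "x = p2 z \<longleftrightarrow> (\<exists>y. y \<le> z \<and> z = pr y x)" for x z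
    using le_pr pr_p by (metis fst_conv prod_encode_inverse, metis snd_conv prod_encode_inverse)
  have l: "p1 z \<le> z" "p2 z \<le> z" for z using le_pr pr_p by metis+
  note s = FF_shift[OF assms]
  show "FF (\<lambda>e. p1 (s e))"
    by (rule FF_I[OF assms]) (simp add: l, unfold i, intro nDD s FF_pr nFF FF_shift[OF s])
  show "FF (\<lambda>e. p2 (s e))"
    by (rule FF_I[OF assms]) (simp add: l, unfold i, intro nDD s FF_pr nFF FF_shift[OF s])
qed

lemma FF_bop: assumes "FF q" "FF a" "FF c" shows "FF (\<lambda>e. bop (q e) (a e) (c e))"
  unfolding bop_def by (intro FF_if nDD nFF assms)

lemma DD_mem: assumes "FF w" "FF z" shows "DD NN (\<lambda>e. mem (w e) (z e))"
  unfolding mem_def by (intro nDD nFF FF_p assms FF_shift[OF assms(1)] FF_shift[OF assms(2)])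

lemma DD_cert: "DD NN (\<lambda>e. cert (e 0))"
  unfolding cert_def just_def justC_def justO_def justB_def by (intro nDD nFF FF_p DD_mem FF_pr FF_bop)

end

text \<open>Induction on the program: a justification refers to subprograms only, so a certificate
  cannot support itself in a circle.\<close>

lemma cert_sound: "cert w \<Longrightarrow> mem w (tr (code p) x v) \<Longrightarrow> v = val p x"
proof (induction p arbitrary: x v)
  case (Cst c)
  have "just (mem w) w (code (Cst c)) x v" using Cst mem_less[OF Cst(2)] unfolding cert_def by fastforce
  then show ?case by (simp add: just_def justC_def justO_def justB_def)
next
  case (Unp q)
  have "just (mem w) w (code (Unp q)) x v" using Unp mem_less[OF Unp(2)] unfolding cert_def by fastforce
  then show ?case by (auto simp: just_def justC_def justO_def justB_def)
next
  case (Compp p r)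
  have "just (mem w) w (code (Compp p r)) x v" using Compp.prems mem_less[OF Compp.prems(2)] unfolding cert_def by fastforce
  then obtain a where "mem w (tr (code r) x a)" "mem w (tr (code p) a v)" by (auto simp: just_def justC_def justO_def justB_def)
  then show ?case using Compp.IH Compp.prems(1) by simp
next
  case (BExp p r)
  have "just (mem w) w (code (BExp p r)) x v" using BExp.prems mem_less[OF BExp.prems(2)] unfolding cert_def by fastforce
  then obtain a where a: "mem w (tr (code p) x a)" "(v = 1 \<and> (\<exists>y. y < a \<and> (\<exists>c. c < w \<and> (mem w (tr (code r) (pr x y) c) \<and> c \<noteq> 0)))) \<or>
         (v = 0 \<and> (\<forall>y. y < a \<longrightarrow> mem w (tr (code r) (pr x y) 0)))" by (auto simp: just_def justC_def justO_def justB_def)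
  have "a = val p x" using BExp.IH(1)[OF BExp.prems(1) a(1)] .
  moreover have "c = val r (pr x y)" if "mem w (tr (code r) (pr x y) c)" for y c using BExp.IH(2)[OF BExp.prems(1) that] .
  ultimately show ?case using a(2) by fastforce
next
  case (Bin q p r)
  have "just (mem w) w (code (Bin q p r)) x v" using Bin.prems mem_less[OF Bin.prems(2)] unfolding cert_def by fastforce
  then obtain a c where "mem w (tr (code p) x a)" "mem w (tr (code r) x c)" "v = bop q a c" by (auto simp: just_def justC_def justO_def justB_def)
  then show ?case using Bin.IH Bin.prems(1) by simp
qed

lemma justB_mono:
  assumes "justB m b k x v" "\<And>z. m z \<Longrightarrow> m' z" "\<And>k x a. m (tr k x a) \<Longrightarrow> a < b'"
  shows "justB m' b' k x v"
proof -
  obtain i j a where 1: "i \<le> k" "j \<le> k" "k = pr 3 (pr i j)" "m (tr i x a)"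
    and 2: "(v = 1 \<and> (\<exists>y. y < a \<and> (\<exists>c. m (tr j (pr x y) c) \<and> c \<noteq> 0))) \<or> (v = 0 \<and> (\<forall>y. y < a \<longrightarrow> m (tr j (pr x y) 0)))"
    using assms(1) unfolding justB_def by blast
  have "(v = 1 \<and> (\<exists>y. y < a \<and> (\<exists>c. c < b' \<and> (m' (tr j (pr x y) c) \<and> c \<noteq> 0)))) \<or> (v = 0 \<and> (\<forall>y. y < a \<longrightarrow> m' (tr j (pr x y) 0)))"
    using 2 assms(2,3) by blast
  then show ?thesis unfolding justB_def using 1 assms(2,3) by blast
qed

text \<open>Justification is positive in the set, so certificates may be united; the bound only has
  to dominate the values occurring in triples.\<close>

lemma just_mono:
  assumes "just m b k x v" "\<And>z. m z \<Longrightarrow> m' z" "\<And>k x a. m (tr k x a) \<Longrightarrow> a < b'"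
  shows "just m' b' k x v"
proof -
  have C: "justC m b k x v \<Longrightarrow> justC m' b' k x v" unfolding justC_def using assms(2,3) by blast
  have O: "justO m b k x v \<Longrightarrow> justO m' b' k x v"
  proof -
    assume "justO m b k x v"
    then obtain q i j a c where "q \<le> k" "i \<le> k" "j \<le> k" "k = pr 4 (pr q (pr i j))" "m (tr i x a)" "m (tr j x c)" "v = bop q a c"
      unfolding justO_def by (elim exE conjE)
    moreover from this have "a < b'" "c < b'" "m' (tr i x a)" "m' (tr j x c)" using assms(2,3) by simp_all
    ultimately show ?thesis unfolding justO_def by (intro exI conjI)
  qed
  have B: "justB m b k x v \<Longrightarrow> justB m' b' k x v" by (rule justB_mono[OF _ assms(2,3)])
  show ?thesis using assms(1) C O B unfolding just_def by (elim disjE) (simp_all only: simp_thms)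
qed

definition closed_set :: "nat set \<Rightarrow> bool" where
  "closed_set F \<longleftrightarrow> (\<forall>t\<in>F. \<exists>b. just (\<lambda>z. z \<in> F) b (p1 t) (p1 (p2 t)) (p2 (p2 t)))"

lemma finite_bound: assumes "finite F" shows "\<exists>b. \<forall>k x a. tr k x a \<in> F \<longrightarrow> a < (b :: nat)"
proof -
  have "a < Suc (Max F)" if "tr k x a \<in> F" for k x a
    using Max_ge[OF assms that] le_pr(2)[where a=x and b=a] le_pr(2)[where a=k and b="pr x a"] by linarith
  then show ?thesis by blast
qed

lemma closed_UN: 
  assumes "\<And>F. F \<in> S \<Longrightarrow> closed_set F" "finite (\<Union>S)"
  shows "closed_set (\<Union>S)"
  unfolding closed_set_def
proof
  fix t assume "t \<in> \<Union>S"
  then obtain F where F: "F \<in> S" "t \<in> F" by blast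
  obtain b where b: "\<forall>k x a. tr k x a \<in> \<Union>S \<longrightarrow> a < b" using finite_bound[OF assms(2)] by blast
  obtain b' where "just (\<lambda>z. z \<in> F) b' (p1 t) (p1 (p2 t)) (p2 (p2 t))" using assms(1)[OF F(1)] F(2) unfolding closed_set_def by blast
  then have "just (\<lambda>z. z \<in> \<Union>S) b (p1 t) (p1 (p2 t)) (p2 (p2 t))" by (rule just_mono) (use F(1) b in blast)+
  then show "\<exists>b. just (\<lambda>z. z \<in> \<Union>S) b (p1 t) (p1 (p2 t)) (p2 (p2 t))" by blast
qed

lemma closed_insert:
  assumes F: "closed_set F" "finite F" and j: "\<And>b. (\<And>k x a. tr k x a \<in> F \<Longrightarrow> a < b) \<Longrightarrow> just (\<lambda>z. z \<in> F) b k x v"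
  shows "closed_set (insert (tr k x v) F)"
  unfolding closed_set_def
proof
  let ?F = "insert (tr k x v) F"
  fix t assume t: "t \<in> ?F"
  have "finite ?F" using F(2) by simp
  then obtain b where b: "\<forall>k' x' a. tr k' x' a \<in> ?F \<longrightarrow> a < b" using finite_bound by blast
  obtain b' where b': "just (\<lambda>z. z \<in> F) b' (p1 t) (p1 (p2 t)) (p2 (p2 t))"
  proof (cases "t = tr k x v")
    case True
    have "just (\<lambda>z. z \<in> F) b k x v" by (rule j) (use b in blast)
    then show ?thesis using that True by simp
  next
    case False then show ?thesis using that F(1) t unfolding closed_set_def by blast
  qed
  have "just (\<lambda>z. z \<in> ?F) b (p1 t) (p1 (p2 t)) (p2 (p2 t))" by (rule just_mono[OF b']) (use b in blast)+
  then show "\<exists>b. just (\<lambda>z. z \<in> ?F) b (p1 t) (p1 (p2 t)) (p2 (p2 t))" by blast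
qed

text \<open>Closed sets for the subprograms are united and the new triple is added; a bounded search
  takes in one set for each candidate below its bound.\<close>

lemma closed_ex: "\<exists>F. finite F \<and> closed_set F \<and> tr (code p) x (val p x) \<in> F"
proof (induction p arbitrary: x)
  case (Cst c)
  have "just m b (code (Cst c)) x c" for m b
    unfolding just_def by (intro disjI1 exI[of _ c]) (simp add: le_pr)
  then have "closed_set (insert (tr (code (Cst c)) x c) {})"
    by (intro closed_insert) (simp_all add: closed_set_def)
  then show ?case by (intro exI[of _ "insert (tr (code (Cst c)) x c) {}"]) simp
next
  case (Unp q)
  have "just m b (code (Unp q)) x (val (Unp q) x)" for m b
  proof -
    let ?v = "val (Unp q) x"
    have "\<exists>q'. q' \<le> code (Unp q) \<and> (code (Unp q) = pr 1 q' \<and> ((q' = 0 \<and> ?v = x) \<or> (q' = 1 \<and> ?v = p1 x) \<or> (q' \<noteq> 0 \<and> q' \<noteq> 1 \<and> ?v = p2 x)))"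
      by (rule exI[of _ q]) (simp add: le_pr)
    then show ?thesis unfolding just_def by (simp only: simp_thms)
  qed
  then have "closed_set (insert (tr (code (Unp q)) x (val (Unp q) x)) {})"
    by (intro closed_insert) (simp_all add: closed_set_def)
  then show ?case by (intro exI[of _ "insert (tr (code (Unp q)) x (val (Unp q) x)) {}"]) simp
next
  case (Compp p r)
  obtain F where F: "finite F" "closed_set F" "tr (code r) x (val r x) \<in> F" using Compp.IH(2) by blast
  obtain G where G: "finite G" "closed_set G" "tr (code p) (val r x) (val p (val r x)) \<in> G" using Compp.IH(1) by blast
  let ?F = "\<Union>{F, G}"
  have c: "closed_set ?F" by (rule closed_UN) (use F G in auto)
  have i: "code p \<le> code (Compp p r)" "code r \<le> code (Compp p r)"
    using le_pr[where a="code p" and b="code r"] le_pr(2)[where a=2 and b="pr (code p) (code r)"] by auto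
  have "closed_set (insert (tr (code (Compp p r)) x (val (Compp p r) x)) ?F)"
  proof (rule closed_insert[OF c])
    show "finite ?F" using F G by simp
    fix b assume b: "\<And>k x a. tr k x a \<in> ?F \<Longrightarrow> a < b"
    have "val r x < b" using b F(3) by blast
    then show "just (\<lambda>z. z \<in> ?F) b (code (Compp p r)) x (val (Compp p r) x)"
    proof -
      have "\<exists>a. a < b \<and> (tr (code r) x a \<in> ?F \<and> tr (code p) a (val (Compp p r) x) \<in> ?F)"
        using F(3) G(3) \<open>val r x < b\<close> by (intro exI[of _ "val r x"]) simp
      moreover have "code (Compp p r) = pr 2 (pr (code p) (code r))" by simp
      ultimately have "justC (\<lambda>z. z \<in> ?F) b (code (Compp p r)) x (val (Compp p r) x)" unfolding justC_def using i by blast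
      then show ?thesis unfolding just_def by simp
    qed
  qed
  then show ?case using F G by (intro exI[of _ "insert (tr (code (Compp p r)) x (val (Compp p r) x)) ?F"]) simp
next
  case (Bin q p r)
  obtain F where F: "finite F" "closed_set F" "tr (code p) x (val p x) \<in> F" using Bin.IH(1) by blast
  obtain G where G: "finite G" "closed_set G" "tr (code r) x (val r x) \<in> G" using Bin.IH(2) by blast
  let ?F = "\<Union>{F, G}"
  have c: "closed_set ?F" by (rule closed_UN) (use F G in auto)
  have i: "code p \<le> code (Bin q p r)" "code r \<le> code (Bin q p r)" "q \<le> code (Bin q p r)"
    using le_pr[where a="code p" and b="code r"] le_pr[where a=q and b="pr (code p) (code r)"] le_pr(2)[where a=4 and b="pr q (pr (code p) (code r))"] by auto
  have "closed_set (insert (tr (code (Bin q p r)) x (val (Bin q p r) x)) ?F)"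
  proof (rule closed_insert[OF c])
    show "finite ?F" using F G by simp
    fix b assume b: "\<And>k x a. tr k x a \<in> ?F \<Longrightarrow> a < b"
    have "val p x < b" "val r x < b" using b F(3) G(3) by blast+
    then show "just (\<lambda>z. z \<in> ?F) b (code (Bin q p r)) x (val (Bin q p r) x)"
    proof -
      have "\<exists>a. a < b \<and> (\<exists>c. c < b \<and> (tr (code p) x a \<in> ?F \<and> (tr (code r) x c \<in> ?F \<and> val (Bin q p r) x = bop q a c)))"
        using F(3) G(3) \<open>val p x < b\<close> \<open>val r x < b\<close> by auto
      moreover have "code (Bin q p r) = pr 4 (pr q (pr (code p) (code r)))" by simp
      ultimately have "justO (\<lambda>z. z \<in> ?F) b (code (Bin q p r)) x (val (Bin q p r) x)" unfolding justO_def using i by blast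
      then show ?thesis unfolding just_def by simp
    qed
  qed
  then show ?case using F G by (intro exI[of _ "insert (tr (code (Bin q p r)) x (val (Bin q p r) x)) ?F"]) simp
next
  case (BExp p r)
  obtain F where F: "finite F" "closed_set F" "tr (code p) x (val p x) \<in> F" using BExp.IH(1) by blast
  have "\<forall>y. \<exists>G. finite G \<and> closed_set G \<and> tr (code r) (pr x y) (val r (pr x y)) \<in> G" using BExp.IH(2) by blast
  from choice[OF this] obtain G where G': "\<forall>y. finite (G y) \<and> closed_set (G y) \<and> tr (code r) (pr x y) (val r (pr x y)) \<in> G y" ..
  have G: "finite (G y)" "closed_set (G y)" "tr (code r) (pr x y) (val r (pr x y)) \<in> G y" for y using spec[OF G', of y] by simp_all
  let ?F = "\<Union>(insert F (G ` {..<val p x}))"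
  have fin: "finite ?F" using F(1) G(1) by (intro finite_Union) auto
  have c: "closed_set ?F"
  proof (rule closed_UN[OF _ fin])
    fix H assume "H \<in> insert F (G ` {..<val p x})"
    then show "closed_set H" using F(2) G(2) by (elim insertE imageE) (simp_all only:)
  qed
  have i: "code p \<le> code (BExp p r)" "code r \<le> code (BExp p r)"
    using le_pr[where a="code p" and b="code r"] le_pr(2)[where a=3 and b="pr (code p) (code r)"] by auto
  have "closed_set (insert (tr (code (BExp p r)) x (val (BExp p r) x)) ?F)"
  proof (rule closed_insert[OF c fin])
    fix b assume b: "\<And>k x a. tr k x a \<in> ?F \<Longrightarrow> a < b"
    have m1: "tr (code p) x (val p x) \<in> ?F" by (rule UnionI[OF insertI1 F(3)])
    have m2: "tr (code r) (pr x y) (val r (pr x y)) \<in> ?F" if "y < val p x" for y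
    proof (rule UnionI[OF _ G(3)])
      show "G y \<in> insert F (G ` {..<val p x})" by (rule insertI2, rule imageI) (simp add: that)
    qed
    let ?v = "val (BExp p r) x"
    have "(?v = 1 \<and> (\<exists>y. y < val p x \<and> (\<exists>c. c < b \<and> (tr (code r) (pr x y) c \<in> ?F \<and> c \<noteq> 0)))) \<or>
         (?v = 0 \<and> (\<forall>y. y < val p x \<longrightarrow> tr (code r) (pr x y) 0 \<in> ?F))"
    proof (cases "\<exists>y < val p x. val r (pr x y) \<noteq> 0")
      case True
      then obtain y where y: "y < val p x" "val r (pr x y) \<noteq> 0" by blast
      have "?v = 1" using True by simp
      moreover have "val r (pr x y) < b" using b[OF m2[OF y(1)]] .
      ultimately show ?thesis by (intro disjI1 conjI exI[of _ y] exI[of _ "val r (pr x y)"] y m2[OF y(1)])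
    next
      case False
      then have "?v = 0" by simp
      moreover have "tr (code r) (pr x y) 0 \<in> ?F" if "y < val p x" for y using m2[OF that] False that by simp
      ultimately show ?thesis by (intro disjI2 conjI allI impI)
    qed
    note step = this
    have l: "val p x < b" using b[OF m1] .
    have q: "code (BExp p r) = pr 3 (pr (code p) (code r))" by simp
    have "justB (\<lambda>z. z \<in> ?F) b (code (BExp p r)) x ?v"
      unfolding justB_def by (rule exI[of _ "code p"], rule conjI[OF i(1)], rule exI[of _ "code r"], rule conjI[OF i(2)],
        rule conjI[OF q], rule exI[of _ "val p x"], rule conjI[OF l], rule conjI[OF m1], rule step)
    then show "just (\<lambda>z. z \<in> ?F) b (code (BExp p r)) x ?v" unfolding just_def by simp
  qed
  then show ?case using F fin by (intro exI[of _ "insert (tr (code (BExp p r)) x (val (BExp p r) x)) ?F"]) simp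
qed

text \<open>The code contains the product of the moduli belonging to the elements of
  \<open>F\<close>. With a factorial for d the moduli below b are pairwise coprime, so no modulus of
  a non-element divides the product.\<close>

lemma mem_code: assumes "finite F" shows "\<exists>w. \<forall>z. mem w z \<longleftrightarrow> z \<in> F"
proof -
  define b where "b = Suc (Max (insert 0 F))"
  define d :: nat where "d = fact b"
  have Fb: "z < b" if "z \<in> F" for z unfolding b_def using assms that by (simp add: less_Suc_eq_le)
  let ?m = "\<lambda>z. 1 + (z + 1) * d"
  define c where "c = (\<Prod>z\<in>F. ?m z)"
  have "?m z dvd c \<longleftrightarrow> z \<in> F" if z: "z < b" for z
  proof
    assume "z \<in> F" then show "?m z dvd c" unfolding c_def using assms by (rule dvd_prodI[rotated])
  next
    assume dv: "?m z dvd c"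
    show "z \<in> F"
    proof (rule ccontr)
      assume "z \<notin> F"
      then have "coprime (?m z) (?m y)" if "y \<in> F" for y
        by (intro moduli_coprime[of z b y d]) (use z Fb[OF that] that in \<open>auto simp: d_def\<close>)
      then have "coprime (?m z) c" unfolding c_def by (intro prod_coprime_right)
      then have "?m z = 1" using dv by (metis coprime_common_divisor dvd_refl nat_dvd_1_iff_1)
      then show False by (simp add: d_def)
    qed
  qed
  moreover have "(\<exists>q. q \<le> c \<and> c = q * ?m z) \<longleftrightarrow> ?m z dvd c" for z
  proof
    assume "?m z dvd c"
    then obtain q where q: "c = ?m z * q" by blast
    then have "q \<le> c" by simp
    then show "\<exists>q. q \<le> c \<and> c = q * ?m z" using q by (intro exI[of _ q]) (simp only: mult.commute simp_thms)
  qed (auto simp only: dvd_triv_right)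
  ultimately have "mem (pr b (pr c d)) z \<longleftrightarrow> z \<in> F" for z unfolding mem_def using Fb by auto
  then show ?thesis by blast
qed

lemma cert_complete: "\<exists>w. cert w \<and> mem w (tr (code p) x (val p x))"
proof -
  obtain F where F: "finite F" "closed_set F" "tr (code p) x (val p x) \<in> F" using closed_ex by blast
  obtain w where w: "\<And>z. mem w z \<longleftrightarrow> z \<in> F" using mem_code[OF F(1)] by blast
  have "just (mem w) w (p1 t) (p1 (p2 t)) (p2 (p2 t))" if t: "mem w t" for t
  proof -
    obtain b where "just (\<lambda>z. z \<in> F) b (p1 t) (p1 (p2 t)) (p2 (p2 t))" using F(2) t w unfolding closed_set_def by blast
    then show ?thesis by (rule just_mono) (use w mem_tr_less in blast)+
  qed
  then show ?thesis unfolding cert_def using w F(3) by blast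
qed

lemma cert_iff: "(\<exists>w. cert w \<and> mem w (tr (code p) x v)) \<longleftrightarrow> v = val p x"
  using cert_sound cert_complete by blast

text \<open>The de Bruijn shift for programs: the input becomes a pair of the old input and the new
  variable, so \<open>Unp 2\<close> reads the new variable and the old programs run on the first
  component.\<close>

abbreviation prS :: "(nat \<Rightarrow> prg) \<Rightarrow> nat \<Rightarrow> prg" where
  "prS \<rho> \<equiv> case_nat (Unp 2) (\<lambda>v. Compp (\<rho> v) (Unp 1))"

lemma val_prS: "(\<lambda>v. val (prS \<rho> v) (pr x y)) = case_nat y (\<lambda>v. val (\<rho> v) x)"
  by (rule ext) (simp split: nat.split)

lemma TT_prg: "TT NN t \<Longrightarrow> \<exists>p. \<forall>x. val p x = t (\<lambda>v. val (\<rho> v) x)"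
proof (induction rule: TT.induct)
  case (TT_var v) show ?case by (rule exI[of _ "\<rho> v"]) simp
next
  case (TT_const c) show ?case by (rule exI[of _ "Cst c"]) simp
next
  case (TT_ad s t)
  then obtain p q where "\<forall>x. val p x = s (\<lambda>v. val (\<rho> v) x)" "\<forall>x. val q x = t (\<lambda>v. val (\<rho> v) x)" by blast
  then show ?case by (intro exI[of _ "Bin 0 p q"]) (simp add: bop_def)
next
  case (TT_mu s t)
  then obtain p q where "\<forall>x. val p x = s (\<lambda>v. val (\<rho> v) x)" "\<forall>x. val q x = t (\<lambda>v. val (\<rho> v) x)" by blast
  then show ?case by (intro exI[of _ "Bin 1 p q"]) (simp add: bop_def)
qed

text \<open>The programs \<rho> compute the free variables from a single input; the parameters
  hidden in the predicate become constants of the program.\<close>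

lemma DD_prg: "DD NN R \<Longrightarrow> \<exists>p. \<forall>x. val p x \<noteq> 0 \<longleftrightarrow> R (\<lambda>v. val (\<rho> v) x)"
proof (induction arbitrary: \<rho> rule: DD.induct)
  case (DD_eq s t)
  obtain p q where "\<forall>x. val p x = s (\<lambda>v. val (\<rho> v) x)" "\<forall>x. val q x = t (\<lambda>v. val (\<rho> v) x)" using DD_eq TT_prg by meson
  then show ?case by (intro exI[of _ "Bin 2 p q"]) (simp add: bop_def)
next
  case (DD_ls s t)
  obtain p q where "\<forall>x. val p x = s (\<lambda>v. val (\<rho> v) x)" "\<forall>x. val q x = t (\<lambda>v. val (\<rho> v) x)" using DD_ls TT_prg by meson
  then show ?case by (intro exI[of _ "Bin 3 p q"]) (simp add: bop_def)
next
  case (DD_not R)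
  obtain p where p: "\<forall>x. val p x \<noteq> 0 \<longleftrightarrow> R (\<lambda>v. val (\<rho> v) x)" using DD_not.IH[of \<rho>] ..
  have "val p x = 0 \<longleftrightarrow> \<not> R (\<lambda>v. val (\<rho> v) x)" for x using spec[OF p, of x] by blast
  then show ?case by (intro exI[of _ "Bin 2 p (Cst 0)"]) (simp add: bop_def)
next
  case (DD_conj R S)
  obtain p q where "\<forall>x. val p x \<noteq> 0 \<longleftrightarrow> R (\<lambda>v. val (\<rho> v) x)" "\<forall>x. val q x \<noteq> 0 \<longleftrightarrow> S (\<lambda>v. val (\<rho> v) x)"
    using DD_conj.IH by metis
  then show ?case by (intro exI[of _ "Bin 2 (Bin 4 p q) (Cst 0)"]) (simp add: bop_def)
next
  case (DD_bex t R)
  obtain p where p: "\<forall>x. val p x = t (\<lambda>v. val (\<rho> v) x)" using DD_bex TT_prg by meson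
  obtain q where q: "\<forall>x. val q x \<noteq> 0 \<longleftrightarrow> R (\<lambda>v. val (prS \<rho> v) x)" using DD_bex.IH by blast
  have "val q (pr x y) \<noteq> 0 \<longleftrightarrow> R (case_nat y (\<lambda>v. val (\<rho> v) x))" for x y using q unfolding val_prS[symmetric] by blast
  then show ?case using p by (intro exI[of _ "BExp p q"]) simp
qed

text \<open>A universal predicate for Pi_{n+1}. At level 0 a certified value is unique, so it may be
  tested over all certificates, which keeps the formula universal; each further level negates and
  adds one universal quantifier.\<close>

primrec univ :: "nat \<Rightarrow> nat \<Rightarrow> nat \<Rightarrow> bool" where
  "univ 0 k x \<longleftrightarrow> (\<forall>y w c. cert w \<and> mem w (tr k (pr x y) c) \<longrightarrow> c = 0)"
| "univ (Suc n) k x \<longleftrightarrow> (\<forall>y. \<not> univ n k (pr x y))"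

lemma PG_univ: "PG NN (Suc n) (\<lambda>e. univ n (e 0) (e 1))"
proof (induction n)
  case 0
  interpret std 0 by (rule std)
  have "PG NN (Suc 0) (\<lambda>e. \<forall>y. \<forall>w. \<forall>c. cert w \<and> mem w (tr (e 0) (pr (e 1) y) c) \<longrightarrow> c = 0)"
    by (intro PG_allI PG_DD nDD nFF DD_sub1[OF DD_cert] DD_mem FF_pr)
  then show ?case by simp
next
  case (Suc n)
  interpret std 0 by (rule std)
  have "PG NN (Suc n) (\<lambda>e. univ n (e 0) (e (Suc 0)))" using Suc by simp
  from PG_sub2[OF this] have s: "PG NN (Suc n) (\<lambda>e. univ n (s e) (t e))" if "FF s" "FF t" for s t using that by blast
  have "PG NN (Suc (Suc n)) (\<lambda>e. \<forall>y. \<not> univ n (e 0) (pr (e 1) y))"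
    by (intro PG_allI PG_SG SG_not s nFF FF_pr)
  then show ?case by simp
qed

text \<open>Contraction leaves a single leading quantifier, whose variable is paired with the
  input.\<close>

lemma univ_complete: "PG NN (Suc n) R \<Longrightarrow> \<exists>k. \<forall>x. univ n k x \<longleftrightarrow> R (\<lambda>v. val (\<rho> v) x)"
proof (induction n arbitrary: R \<rho>)
  case 0
  interpret std 0 by (rule std)
  obtain P where P: "PG NN 0 P" and e: "\<And>e. \<not> R e \<longleftrightarrow> (\<exists>a. P (case_nat a e))" using contract_n[OF SG_not[OF 0]] by blast
  obtain p where p: "\<forall>x. val p x \<noteq> 0 \<longleftrightarrow> P (\<lambda>v. val (prS \<rho> v) x)" using DD_prg[OF PG0_DD[OF P]] by blast
  have p': "val p (pr x y) \<noteq> 0 \<longleftrightarrow> P (case_nat y (\<lambda>v. val (\<rho> v) x))" for x y using p unfolding val_prS[symmetric] by blast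
  have "univ 0 (code p) x \<longleftrightarrow> (\<forall>y. val p (pr x y) = 0)" for x
  proof -
    have "(\<forall>w c. cert w \<and> mem w (tr (code p) (pr x y) c) \<longrightarrow> c = 0) \<longleftrightarrow> val p (pr x y) = 0" for y
      using cert_iff[of p "pr x y"] by metis
    then show ?thesis unfolding univ.simps by simp
  qed
  moreover have "(\<forall>y. val p (pr x y) = 0) \<longleftrightarrow> R (\<lambda>v. val (\<rho> v) x)" for x
    using p'[of x] e[of "\<lambda>v. val (\<rho> v) x"] by blast
  ultimately have "univ 0 (code p) x \<longleftrightarrow> R (\<lambda>v. val (\<rho> v) x)" for x by (rule trans)
  then show ?case by (intro exI[of _ "code p"] allI)
next
  case (Suc n)
  interpret std "Suc n" by (rule std)
  obtain P where P: "PG NN (Suc n) P" and e: "\<And>e. \<not> R e \<longleftrightarrow> (\<exists>a. P (case_nat a e))" using contract_n[OF SG_not[OF Suc.prems]] by blast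
  obtain k where k: "\<forall>x. univ n k x \<longleftrightarrow> P (\<lambda>v. val (prS \<rho> v) x)" using Suc.IH[OF P] by blast
  have k': "univ n k (pr x y) \<longleftrightarrow> P (case_nat y (\<lambda>v. val (\<rho> v) x))" for x y using k unfolding val_prS[symmetric] by blast
  have "(\<forall>y. \<not> P (case_nat y e')) = R e'" for e' using e[of e'] by blast
  then have "univ (Suc n) k x \<longleftrightarrow> R (\<lambda>v. val (\<rho> v) x)" for x unfolding univ.simps k' .
  then show ?case by (intro exI[of _ k] allI)
qed

definition Dfun :: "nat \<Rightarrow> (nat \<Rightarrow> nat) set" where
  "Dfun n = {f. SG NN (Suc n) (\<lambda>e. e 0 = f (e (Suc 0)))}"

text \<open>A witness \<open>z\<close> for \<open>H k i z\<close> is a pair whose second component is the value at \<open>i\<close> of the function with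
  index \<open>k\<close>.\<close>

lemma enum_Dfun:
  "\<exists>H. PG NN n (\<lambda>e. H (e 0) (e 1) (e 2)) \<and> (\<forall>f\<in>Dfun n. \<exists>k. \<forall>i. (\<exists>z. H k i z) \<and> (\<forall>z. H k i z \<longrightarrow> p2 z = f i))"
proof -
  interpret std n by (rule std)
  \<comment> \<open>The program input is pr i z: variable 0 is the witness \<open>p1 z\<close>,
    variable 1 the value \<open>p2 z\<close>, and all others are the argument i.\<close>
  let ?\<rho> = "\<lambda>v. if v = 0 then Compp (Unp 1) (Unp 2) else if v = 1 then Compp (Unp 2) (Unp 2) else Unp 1"
  let ?env = "\<lambda>i z v. if v = 0 then p1 z else if v = 1 then p2 z else (i :: nat)"
  have \<rho>: "(\<lambda>v. val (?\<rho> v) (pr i z)) = ?env i z" for i z by (rule ext) simp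
  have graph: "\<exists>P. PG NN n P \<and> (\<forall>i. (\<exists>y. P (?env i (pr y (f i)))) \<and> (\<forall>z. P (?env i z) \<longrightarrow> p2 z = f i))" if f: "f \<in> Dfun n" for f
  proof -
    obtain P where P: "PG NN n P" and e: "\<And>e. (e 0 = f (e (Suc 0))) \<longleftrightarrow> (\<exists>a. P (case_nat a e))"
      using contract_n f unfolding Dfun_def by blast
    have c: "?env i z = case_nat (p1 z) (case_nat (p2 z) (\<lambda>_. i))" for i z by (rule ext) (simp split: nat.split)
    have "\<exists>y. P (?env i (pr y (f i)))" for i
      using e[of "case_nat (f i) (\<lambda>_. i)"] unfolding c by simp
    moreover have "p2 z = f i" if "P (?env i z)" for i z
      using e[of "case_nat (p2 z) (\<lambda>_. i)"] that unfolding c by auto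
    ultimately show ?thesis using P by blast
  qed
  show ?thesis
  proof (cases n)
    case 0
    \<comment> \<open>Program evaluation is not a bounded relation, so for n = 0 the witness carries
      a certificate as well: z = pr (pr w (pr y c)) v, where w certifies the nonzero output c on
      input (i, (y, v)).\<close>
    let ?H = "\<lambda>k i z. p2 (p2 (p1 z)) \<noteq> 0 \<and> (cert (p1 (p1 z)) \<and> mem (p1 (p1 z)) (tr k (pr i (pr (p1 (p2 (p1 z))) (p2 z))) (p2 (p2 (p1 z)))))"
    have "PG NN n (\<lambda>e. ?H (e 0) (e 1) (e 2))"
      by (intro PG_DD nDD nFF DD_sub1[OF DD_cert] DD_mem FF_pr FF_p)
    moreover have "\<exists>k. \<forall>i. (\<exists>z. ?H k i z) \<and> (\<forall>z. ?H k i z \<longrightarrow> p2 z = f i)" if f: "f \<in> Dfun n" for f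
    proof -
      obtain P where P: "PG NN n P" and 1: "\<And>i. \<exists>y. P (?env i (pr y (f i)))" and 2: "\<And>i z. P (?env i z) \<Longrightarrow> p2 z = f i" using graph[OF f] by blast
      obtain p where p: "\<forall>x. val p x \<noteq> 0 \<longleftrightarrow> P (\<lambda>v. val (?\<rho> v) x)" using DD_prg[OF PG0_DD[OF P[unfolded 0]], of ?\<rho>] ..
      have p': "val p (pr i z) \<noteq> 0 \<longleftrightarrow> P (?env i z)" for i z using p[rule_format, of "pr i z"] unfolding \<rho> .
      have "\<exists>z. ?H (code p) i z" for i
      proof -
        obtain y where y: "P (?env i (pr y (f i)))" using 1 by blast
        obtain w where w: "cert w" "mem w (tr (code p) (pr i (pr y (f i))) (val p (pr i (pr y (f i)))))" using cert_complete by blast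
        show ?thesis by (rule exI[of _ "pr (pr w (pr y (val p (pr i (pr y (f i)))))) (f i)"]) (use w p'[of i "pr y (f i)"] y in simp)
      qed
      moreover have "p2 z = f i" if h: "?H (code p) i z" for i z
      proof -
        have "p2 (p2 (p1 z)) = val p (pr i (pr (p1 (p2 (p1 z))) (p2 z)))" using h cert_sound by blast
        then have "P (?env i (pr (p1 (p2 (p1 z))) (p2 z)))" using h p' by metis
        then show ?thesis using 2 by fastforce
      qed
      ultimately show ?thesis by blast
    qed
    ultimately show ?thesis by (intro exI[of _ ?H]) blast
  next
    case (Suc m)
    have u: "PG NN n (\<lambda>e. univ m (e 0) (e (Suc 0)))" using PG_univ[of m] Suc by simp
    have "PG NN n (\<lambda>e. univ m (e 0) (pr (e 1) (e 2)))" by (rule PG_sub2[OF u]) (intro nFF FF_pr)+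
    moreover have "\<exists>k. \<forall>i. (\<exists>z. univ m k (pr i z)) \<and> (\<forall>z. univ m k (pr i z) \<longrightarrow> p2 z = f i)" if f: "f \<in> Dfun n" for f
    proof -
      obtain P where P: "PG NN n P" and 1: "\<And>i. \<exists>y. P (?env i (pr y (f i)))" and 2: "\<And>i z. P (?env i z) \<Longrightarrow> p2 z = f i" using graph[OF f] by blast
      obtain k where k: "\<forall>x. univ m k x \<longleftrightarrow> P (\<lambda>v. val (?\<rho> v) x)" using univ_complete[OF P[unfolded Suc], of ?\<rho>] ..
      have "univ m k (pr i z) \<longleftrightarrow> P (?env i z)" for i z using k[rule_format, of "pr i z"] unfolding \<rho> .
      then show ?thesis using 1 2 by (intro exI[of _ k]) metis
    qed
    ultimately show ?thesis by (intro exI[of _ "\<lambda>k i z. univ m k (pr i z)"]) blast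
  qed
qed

section \<open>The diagonal cut\<close>

locale std1 = std "Suc n" for n :: nat

lemma std1: "std1 n" unfolding std1_def by (rule std)

section \<open>Delta_{n+1} predicates and functions of the standard model\<close>

context std1 begin

definition BB :: "((nat \<Rightarrow> nat) \<Rightarrow> bool) \<Rightarrow> bool" where
  "BB R \<longleftrightarrow> SG NN (Suc n) R \<and> PG NN (Suc n) R"

text \<open>For a total function a Sigma_{n+1} graph is already Delta_{n+1}; see
  \<open>BB_graph\<close>.\<close>

definition GG :: "((nat \<Rightarrow> nat) \<Rightarrow> nat) \<Rightarrow> bool" where
  "GG F \<longleftrightarrow> SG NN (Suc n) (\<lambda>e. e 0 = F (\<lambda>v. e (Suc v)))"

lemma SG_ren: "SG NN k R \<Longrightarrow> SG NN k (\<lambda>e. R (\<lambda>v. e (r v)))" and PG_ren: "PG NN k R \<Longrightarrow> PG NN k (\<lambda>e. R (\<lambda>v. e (r v)))"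
  using SG_Fsub[where \<sigma> = "\<lambda>e v. e (r v)"] PG_Fsub[where \<sigma> = "\<lambda>e v. e (r v)"] FF_var by blast+

lemma SG_GG: assumes "GG F" "SG NN (Suc n) (\<lambda>e. P (\<lambda>v. e (Suc v)) (e 0))" shows "SG NN (Suc n) (\<lambda>e. P e (F e))"
proof -
  have "SG NN (Suc n) (\<lambda>e. \<exists>a. a = F e \<and> P e a)" using assms unfolding GG_def by (intro SG_exI SG_conj)
  then show ?thesis by simp
qed

lemma PG_GG: assumes "GG F" "PG NN (Suc n) (\<lambda>e. P (\<lambda>v. e (Suc v)) (e 0))" shows "PG NN (Suc n) (\<lambda>e. P e (F e))"
  by (rule PG_iff[OF PG_not[OF SG_GG[where P = "\<lambda>e a. \<not> P e a", OF assms(1) SG_not[OF assms(2)]]]]) simp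

lemma BB_GG: "GG F \<Longrightarrow> BB (\<lambda>e. P (\<lambda>v. e (Suc v)) (e 0)) \<Longrightarrow> BB (\<lambda>e. P e (F e))"
  unfolding BB_def using SG_GG PG_GG by blast

lemma BB_DD: "DD NN R \<Longrightarrow> BB R" unfolding BB_def by (blast intro: SG_DD PG_DD)
lemma BB_conj: "BB R \<Longrightarrow> BB S \<Longrightarrow> BB (\<lambda>e. R e \<and> S e)" unfolding BB_def by (blast intro: SG_conj PG_conj)
lemma BB_disj: "BB R \<Longrightarrow> BB S \<Longrightarrow> BB (\<lambda>e. R e \<or> S e)" unfolding BB_def by (blast intro: SG_disj PG_disj)
lemma BB_not: "BB R \<Longrightarrow> BB (\<lambda>e. \<not> R e)" unfolding BB_def by (blast intro: SG_not PG_not)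
lemma BB_imp: "BB R \<Longrightarrow> BB S \<Longrightarrow> BB (\<lambda>e. R e \<longrightarrow> S e)"
  unfolding imp_conv_disj by (intro BB_disj BB_not)
lemma BB_low: "SG NN n R \<Longrightarrow> BB R" "PG NN n R \<Longrightarrow> BB R"
  unfolding BB_def by (auto intro: SG_PG PG_SG SG_mono1 PG_mono1)
lemma BB_Fbex: "FF t \<Longrightarrow> BB (\<lambda>e. P (\<lambda>v. e (Suc v)) (e 0)) \<Longrightarrow> BB (\<lambda>e. \<exists>a. a < t e \<and> P e a)"
  unfolding BB_def using SG_bex[unfolded NN_simps, of t "Suc n" P] PG_bex[unfolded NN_simps, of t P] by blast
lemma BB_Fball: "FF t \<Longrightarrow> BB (\<lambda>e. P (\<lambda>v. e (Suc v)) (e 0)) \<Longrightarrow> BB (\<lambda>e. \<forall>a. a < t e \<longrightarrow> P e a)"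
  unfolding BB_def using SG_ball[unfolded NN_simps, of t P] PG_ball[unfolded NN_simps, of t "Suc n" P] by blast

lemma GG_FF: "FF F \<Longrightarrow> GG F"
  unfolding GG_def FF_def by (blast intro: SG_DD)
lemma GG_shift: "GG F \<Longrightarrow> GG (\<lambda>e. F (\<lambda>v. e (Suc v)))"
  unfolding GG_def by (drule SG_ren[where r = "\<lambda>v. if v = 0 then 0 else Suc v"]) simp
lemma GG_I: "SG NN (Suc n) (\<lambda>e. e 0 = F (\<lambda>v. e (Suc v))) \<Longrightarrow> GG F" by (simp add: GG_def)

lemma BB_graph: assumes "GG F" shows "BB (\<lambda>e. e 0 = F (\<lambda>v. e (Suc v)))"
  by (rule BB_GG[where P = "\<lambda>e a. e 0 = a", OF GG_shift[OF assms]]) (intro BB_DD nDD nFF)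

lemma GG_comp: assumes "GG t" "GG (\<lambda>e. f (\<lambda>v. e (Suc v)) (e 0))" shows "GG (\<lambda>e. f e (t e))"
  by (rule GG_I, rule SG_GG[where P = "\<lambda>e a. e 0 = f (\<lambda>v. e (Suc v)) a", OF GG_shift[OF assms(1)]])
     (use SG_ren[where r = "\<lambda>v. if v = 0 then Suc 0 else if v = Suc 0 then 0 else v", OF assms(2)[unfolded GG_def]] in simp)

lemma GG_ad: "GG s \<Longrightarrow> GG t \<Longrightarrow> GG (\<lambda>e. s e + t e)"
  by (rule GG_comp[of s "\<lambda>e a. a + t e"], assumption, rule GG_comp[of "\<lambda>e. t (\<lambda>v. e (Suc v))" "\<lambda>e a. e 0 + a"], erule GG_shift)
     (intro GG_FF nFF)
lemma GG_mu: "GG s \<Longrightarrow> GG t \<Longrightarrow> GG (\<lambda>e. s e * t e)"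
  by (rule GG_comp[of s "\<lambda>e a. a * t e"], assumption, rule GG_comp[of "\<lambda>e. t (\<lambda>v. e (Suc v))" "\<lambda>e a. e 0 * a"], erule GG_shift)
     (intro GG_FF nFF)

lemma GG_least: assumes P: "BB (\<lambda>e. P (\<lambda>v. e (Suc v)) (e 0))" and ex: "\<And>e. \<exists>a. P e a" shows "GG (\<lambda>e. LEAST a. P e a)"
proof (rule GG_I)
  have i: "x = (LEAST a. P e a) \<longleftrightarrow> P e x \<and> (\<forall>a. a < x \<longrightarrow> \<not> P e a)" for e x
    using ex[of e] by (metis LeastI_ex Least_equality not_less not_less_Least)
  have "BB (\<lambda>e. P (\<lambda>v. e (Suc v)) (e 0) \<and> (\<forall>a. a < e 0 \<longrightarrow> \<not> P (\<lambda>v. e (Suc v)) a))"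
  proof (intro BB_conj P BB_Fball nFF BB_not)
    show "BB (\<lambda>e. P (\<lambda>v. e (Suc (Suc v))) (e 0))" 
      using P SG_ren[where r = "\<lambda>v. if v = 0 then 0 else Suc v" and R = "\<lambda>e. P (\<lambda>v. e (Suc v)) (e 0)"]
        PG_ren[where r = "\<lambda>v. if v = 0 then 0 else Suc v" and R = "\<lambda>e. P (\<lambda>v. e (Suc v)) (e 0)"]
      unfolding BB_def by simp
  qed
  then show "SG NN (Suc n) (\<lambda>e. e 0 = (LEAST a. P (\<lambda>v. e (Suc v)) a))" unfolding i BB_def by blast
qed

text \<open>Functions are substituted one variable at a time, j counting the variables already
  replaced. Since a formula has finitely many variables, \<open>fbound\<close> many replacements
  suffice in \<open>BB_sat\<close>.\<close>

lemma SG_GGs: "(\<And>v. GG (G v)) \<Longrightarrow> SG NN (Suc n) R \<Longrightarrow> SG NN (Suc n) (\<lambda>e. R (\<lambda>v. if v < j then G v e else e (v - j)))"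
proof (induction j arbitrary: G)
  case (Suc j)
  have "SG NN (Suc n) (\<lambda>e. R (\<lambda>v. if v < j then G v (\<lambda>w. e (Suc w)) else e (v - j)))"
    by (rule Suc.IH) (rule GG_shift, rule Suc.prems, rule Suc.prems)
  moreover have "(\<lambda>v. if v < j then G v (\<lambda>w. e (Suc w)) else e (v - j)) =
      (\<lambda>v. if v < j then G v (\<lambda>w. e (Suc w)) else if v = j then e 0 else e (Suc (v - Suc j)))" for e :: "nat \<Rightarrow> nat"
    by (rule ext) (auto simp: Suc_diff_Suc)
  ultimately have "SG NN (Suc n) (\<lambda>e. R (\<lambda>v. if v < j then G v (\<lambda>w. e (Suc w)) else if v = j then e 0 else e (Suc (v - Suc j))))" by simp
  from SG_GG[where P = "\<lambda>e a. R (\<lambda>v. if v < j then G v e else if v = j then a else e (v - Suc j))", OF Suc.prems(1)[of j] this]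
  have s: "SG NN (Suc n) (\<lambda>e. R (\<lambda>v. if v < j then G v e else if v = j then G j e else e (v - Suc j)))" .
  have "(\<lambda>v. if v < j then G v e else if v = j then G j e else e (v - Suc j)) = (\<lambda>v. if v < Suc j then G v e else e (v - Suc j))" for e
    by (rule ext) (auto simp: less_Suc_eq)
  then show ?case using s by simp
qed simp

lemma BB_sat: assumes p: "sigma n p \<or> pi n p" and G: "\<And>v. GG (G v)" shows "BB (\<lambda>e. sat NN (\<lambda>v. G v e) p)"
proof -
  have b: "BB (\<lambda>e. sat NN (\<lambda>v. e v) p)"
    using p sigma_fsub[of n p "\<lambda>v e. e v"] pi_fsub[of n p "\<lambda>v e. e v"] FF_var BB_low by blast
  have c: "sat NN (\<lambda>v. if v < fbound p then G v e else e (v - fbound p)) p = sat NN (\<lambda>v. G v e) p" for e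
    by (rule sat_cong) simp
  have "SG NN (Suc n) (\<lambda>e. sat NN (\<lambda>v. G v e) p)"
    using SG_GGs[where R = "\<lambda>e. sat NN (\<lambda>v. e v) p" and j = "fbound p" and G = G, OF G] b unfolding BB_def c by blast
  moreover have "SG NN (Suc n) (\<lambda>e. \<not> sat NN (\<lambda>v. G v e) p)"
    using SG_GGs[where R = "\<lambda>e. \<not> sat NN (\<lambda>v. e v) p" and j = "fbound p" and G = G, OF G] BB_not[OF b] unfolding BB_def c by blast
  ultimately show ?thesis unfolding BB_def using PG_not by fastforce
qed

lemma Dfun_GG: "f \<in> Dfun n \<longleftrightarrow> GG (\<lambda>e. f (e 0))"
  unfolding Dfun_def GG_def by simp

lemma Dfun_GG': "f \<in> Dfun n \<Longrightarrow> GG t \<Longrightarrow> GG (\<lambda>e. f (t e))"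
  by (rule GG_comp[of t "\<lambda>e a. f a"]) (simp_all add: Dfun_GG)

text \<open>A computation is a finite set \<open>w\<close> of pairs (j, value) in which each entry
  is justified by its predecessor. Correctness of \<open>w\<close> is Delta_{n+1}, and one
  quantifier over \<open>w\<close> gives a Sigma_{n+1} graph.\<close>

lemma GG_rec:
  assumes s0: "GG (\<lambda>e. s0 (e 0))" and h: "GG (\<lambda>e. h (e 0) (e 1) (e 2))"
    and S: "\<And>x. S x 0 = s0 x" "\<And>x z. S x (Suc z) = h x z (S x z)"
  shows "GG (\<lambda>e. S (e 0) (e 1))"
proof (rule GG_I)
  let ?J = "\<lambda>x w t. (p1 t = 0 \<and> p2 t = s0 x) \<or> (\<exists>j. j < w \<and> (\<exists>u. u < w \<and> (p1 t = j + 1 \<and> (mem w (pr j u) \<and> p2 t = h x j u))))"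
  let ?C = "\<lambda>x w. \<forall>t. t < w \<longrightarrow> mem w t \<longrightarrow> ?J x w t"
  have sound: "y = S x z" if C: "?C x w" and m: "mem w (pr z y)" for x w z y
    using m
  proof (induction z arbitrary: y)
    case 0
    have "?J x w (pr 0 y)" using C 0 mem_less by blast
    then show ?case by (simp add: S)
  next
    case (Suc z)
    have "?J x w (pr (Suc z) y)" using C Suc.prems mem_less by blast
    then obtain u where "mem w (pr z u)" "y = h x z u" by auto
    then show ?case using Suc.IH[of u] S(2) by simp
  qed
  have complete: "\<exists>w. ?C x w \<and> mem w (pr z (S x z))" for x z
  proof -
    obtain w where w: "\<And>t. mem w t \<longleftrightarrow> t \<in> (\<lambda>j. pr j (S x j)) ` {..z}" using mem_code[of "(\<lambda>j. pr j (S x j)) ` {..z}"] by auto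
    have "?J x w t" if t: "mem w t" for t
    proof -
      obtain j where j: "j \<le> z" "t = pr j (S x j)" using t w by blast
      show ?thesis
      proof (cases j)
        case 0 then show ?thesis using j S by simp
      next
        case (Suc i)
        have m: "mem w (pr i (S x i))" using w j(1) Suc by auto
        then have "i < w" "S x i < w" using mem_less le_pr[where a=i and b="S x i"] by fastforce+
        then show ?thesis using m j Suc S(2) by auto
      qed
    qed
    then have "?C x w" by (intro allI impI)
    moreover have "mem w (pr z (S x z))" unfolding w by (rule imageI) simp
    ultimately show ?thesis by (intro exI[of _ w] conjI)
  qed
  have i: "y = S x z \<longleftrightarrow> (\<exists>w. ?C x w \<and> mem w (pr z y))" for x y z
  proof
    assume "y = S x z" then show "\<exists>w. ?C x w \<and> mem w (pr z y)" using complete[of x z] by (simp only:)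
  next
    assume "\<exists>w. ?C x w \<and> mem w (pr z y)" then show "y = S x z" by (elim exE conjE) (rule sound)
  qed
  have A: "BB (\<lambda>e. p2 (e 0) = s0 (e (Suc (Suc (Suc 0)))))"
    by (rule BB_GG[where P = "\<lambda>e a. p2 (e 0) = a", OF GG_comp[of "\<lambda>e. e (Suc (Suc (Suc 0)))" "\<lambda>e a. s0 a"]])
       (use s0 in \<open>auto intro!: GG_FF BB_DD nDD nFF FF_p\<close>)
  have B: "BB (\<lambda>e. p2 (e 2) = h (e 5) (e 1) (e 0))"
  proof -
    have "GG (\<lambda>e. h (e 5) (e 1) (e 0))"
      using SG_ren[where r = "\<lambda>v. if v = 0 then 0 else if v = 1 then 6 else if v = 2 then 2 else 1", OF h[unfolded GG_def]] 
      by (intro GG_I) (simp add: numeral_eq_Suc)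
    then show ?thesis
      by (rule BB_GG[where P = "\<lambda>e a. p2 (e 2) = a"]) (intro BB_DD nDD nFF FF_p)
  qed
  have A': "BB (\<lambda>e. p2 (e 0) = s0 (e (Suc (Suc 1))))" using A by simp
  have B': "BB (\<lambda>e. p2 (e (Suc (Suc 0))) = h (e (Suc (Suc (Suc (Suc 1))))) (e (Suc 0)) (e 0))" using B by (simp add: numeral_eq_Suc)
  have "SG NN (Suc n) (\<lambda>e. \<exists>w. ?C (e 1) w \<and> mem w (pr (e 2) (e 0)))"
  proof (rule SG_exI, rule SG_conj)
    show "SG NN (Suc n) (\<lambda>e. mem (e 0) (pr (e (Suc 2)) (e (Suc 0))))" by (intro SG_DD DD_mem FF_pr nFF)
    have "BB (\<lambda>e. \<forall>t. t < e 0 \<longrightarrow> mem (e 0) t \<longrightarrow> ?J (e (Suc 1)) (e 0) t)"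
      by (intro BB_Fball BB_Fbex BB_imp BB_disj BB_conj nFF A' B') (intro BB_DD DD_mem nDD nFF FF_pr FF_p)+
    then show "SG NN (Suc n) (\<lambda>e. \<forall>t. t < e 0 \<longrightarrow> mem (e 0) t \<longrightarrow> ?J (e (Suc 1)) (e 0) t)" unfolding BB_def by blast
  qed
  then show "SG NN (Suc n) (\<lambda>e. e 0 = S (e (Suc 0)) (e (Suc 1)))" unfolding i by (simp add: numeral_2_eq_2)
qed

lemma FF_half: assumes "FF s" shows "FF (\<lambda>e. s e div 2)"
proof -
  have i: "y = x div 2 \<longleftrightarrow> 2 * y = x \<or> 2 * y + 1 = x" for x y :: nat by presburger
  show ?thesis
    by (rule FF_I[OF assms]) (simp, unfold i, intro nDD nFF FF_shift[OF assms])
qed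

lemma GG_if: assumes "BB P" "GG s" "GG t" shows "GG (\<lambda>e. if P e then s e else t e)"
proof (rule GG_I)
  let ?sh = "\<lambda>(e :: nat \<Rightarrow> nat) v. e (Suc v)"
  have P: "BB (\<lambda>e. P (?sh e))" using assms(1) SG_ren[where r = Suc] PG_ren[where r = Suc] unfolding BB_def by blast
  have "BB (\<lambda>e. (P (?sh e) \<and> e 0 = s (?sh e)) \<or> (\<not> P (?sh e) \<and> e 0 = t (?sh e)))"
    by (intro BB_disj BB_conj BB_not P BB_graph assms(2,3))
  moreover have "(y = (if Q then a else b)) = ((Q \<and> y = a) \<or> (\<not> Q \<and> y = b))" for Q and y a b :: nat by simp
  ultimately show "SG NN (Suc n) (\<lambda>e. e 0 = (if P (?sh e) then s (?sh e) else t (?sh e)))" unfolding BB_def by simp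
qed

lemma pow_Dfun: "(\<lambda>i. 2 ^ i) \<in> Dfun n"
proof -
  have "GG (\<lambda>e. (\<lambda>x z. 2 ^ z) (e 0) (e 1))"
    by (rule GG_rec[where ?s0.0 = "\<lambda>_. 1" and h = "\<lambda>x z s. 2 * s"]) (auto intro!: GG_FF nFF)
  then have "SG NN (Suc n) (\<lambda>e. e 0 = 2 ^ e 2)" unfolding GG_def by (simp add: numeral_eq_Suc)
  from SG_ren[where r = "\<lambda>v. if v = 2 then 1 else v", OF this] show ?thesis unfolding Dfun_def by simp
qed

end

text \<open>Stage \<open>z\<close> of the diagonal construction, coding an interval \<open>[l, u)\<close>: it is halved whenever
  \<open>z\<close> is the least witness of some index \<open>k < i\<close>, so as to avoid the value of that witness.\<close>

definition hits :: "(nat \<Rightarrow> nat \<Rightarrow> nat \<Rightarrow> bool) \<Rightarrow> nat \<Rightarrow> nat \<Rightarrow> bool" where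
  "hits H i z \<longleftrightarrow> (\<exists>k. k < i \<and> (H k i z \<and> (\<forall>z'. z' < z \<longrightarrow> \<not> H k i z')))"

definition halve :: "(nat \<Rightarrow> nat \<Rightarrow> nat \<Rightarrow> bool) \<Rightarrow> nat \<Rightarrow> nat \<Rightarrow> nat \<Rightarrow> nat" where
  "halve H i z s = (if hits H i z then if p2 z < p1 s + (p2 s - p1 s) div 2 then pr (p1 s + (p2 s - p1 s) div 2) (p2 s)
     else pr (p1 s) (p1 s + (p2 s - p1 s) div 2) else s)"

primrec stage :: "(nat \<Rightarrow> nat \<Rightarrow> nat \<Rightarrow> bool) \<Rightarrow> nat \<Rightarrow> nat \<Rightarrow> nat" where
  "stage H i 0 = pr 0 (2 ^ i)"
| "stage H i (Suc z) = halve H i z (stage H i z)"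

text \<open>Each index k below i is served at its least witness only, hence at most once.\<close>

lemma card_hits: "card {z'. z' < z \<and> hits H i z'} \<le> i"
proof -
  have "{z'. z' < z \<and> hits H i z'} \<subseteq> (\<lambda>k. LEAST z. H k i z) ` {..<i}"
  proof
    fix z' assume "z' \<in> {z'. z' < z \<and> hits H i z'}"
    then obtain k where k: "k < i" "H k i z'" "\<And>z''. z'' < z' \<Longrightarrow> \<not> H k i z''" unfolding hits_def by blast
    have "(LEAST z. H k i z) = z'" by (rule Least_equality) (use k in \<open>auto simp: not_less[symmetric]\<close>)
    then show "z' \<in> (\<lambda>k. LEAST z. H k i z) ` {..<i}" using k(1) by blast
  qed
  from card_mono[OF _ this] have "card {z'. z' < z \<and> hits H i z'} \<le> card ((\<lambda>k. LEAST z. H k i z) ` {..<i})" by simp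
  also have "\<dots> \<le> i" using card_image_le[of "{..<i}" "\<lambda>k. LEAST z. H k i z"] by simp
  finally show ?thesis .
qed

text \<open>The initial length 2^i survives up to i halvings, so the interval never becomes
  empty.\<close>

lemma stage_width: "p2 (stage H i z) = p1 (stage H i z) + 2 ^ (i - card {z'. z' < z \<and> hits H i z'})"
proof (induction z)
  case (Suc z)
  let ?c = "card {z'. z' < z \<and> hits H i z'}"
  show ?case
  proof (cases "hits H i z")
    case True
    have "{z'. z' < Suc z \<and> hits H i z'} = insert z {z'. z' < z \<and> hits H i z'}" using True by auto
    then have c: "card {z'. z' < Suc z \<and> hits H i z'} = Suc ?c" by simp
    have "i - ?c = Suc (i - Suc ?c)" using card_hits[of "Suc z" H i] c by simp
    then have "(2 :: nat) ^ (i - ?c) = 2 * 2 ^ (i - Suc ?c)" by simp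
    then show ?thesis unfolding c using Suc True by (simp add: halve_def)
  next
    case False
    then have "{z'. z' < Suc z \<and> hits H i z'} = {z'. z' < z \<and> hits H i z'}" by (auto simp: less_Suc_eq)
    then show ?thesis using Suc False by (simp add: halve_def)
  qed
qed simp

lemma stage_less: "p1 (stage H i z) < p2 (stage H i z)"
  unfolding stage_width by simp

lemma stage_Suc: "p1 (stage H i z) \<le> p1 (stage H i (Suc z)) \<and> p2 (stage H i (Suc z)) \<le> p2 (stage H i z)"
  using stage_less[of H i z] by (simp add: halve_def) linarith

lemma stage_mono: "z \<le> z' \<Longrightarrow> p1 (stage H i z) \<le> p1 (stage H i z') \<and> p2 (stage H i z') \<le> p2 (stage H i z)"
  by (induction rule: dec_induct) (use stage_Suc[of H i] in \<open>auto intro: order_trans simp del: stage.simps\<close>)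

text \<open>At a common later stage l < u, hence v + 1 \<le> l < u \<le> v'. The distance of more
  than one is what closes the cut under successor.\<close>

lemma stage_gap: "v < p1 (stage H i z) \<Longrightarrow> p2 (stage H i z') \<le> v' \<Longrightarrow> v + 1 < v'"
  using stage_mono[of z "max z z'" H i] stage_mono[of z' "max z z'" H i] stage_less[of H i "max z z'"] by linarith

lemma stage_avoid: "hits H i z \<Longrightarrow> p2 z < p1 (stage H i (Suc z)) \<or> p2 (stage H i (Suc z)) \<le> p2 z"
  by (simp add: halve_def)

text \<open>\<open>R\<close> collects the numbers that fall to the left of the shrinking interval,
  \<open>S\<close> those at or beyond its right end; both are Sigma_{n+1} as the stages are
  Delta_{n+1}. A function with index k has its value driven out of the interval for every i > k, so
  only finitely many i stay undecided for it.\<close>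

lemma diagonal_cut:
  "\<exists>R S t. SG NN (Suc n) (\<lambda>e. R (e 0) (e 1)) \<and> SG NN (Suc n) (\<lambda>e. S (e 0) (e 1)) \<and> t \<in> Dfun n \<and>
     (\<forall>i v v'. R v i \<longrightarrow> S v' i \<longrightarrow> v + 1 < v') \<and> (\<forall>i. \<not> S 0 i) \<and> (\<forall>i. S (t i) i) \<and>
     (\<forall>f\<in>Dfun n. \<exists>k. \<forall>i. k < i \<longrightarrow> R (f i) i \<or> S (f i) i)"
proof -
  interpret std1 n by (rule std1)
  obtain H where H: "PG NN n (\<lambda>e. H (e 0) (e 1) (e 2))"
    and en: "\<forall>f\<in>Dfun n. \<exists>k. \<forall>i. (\<exists>z. H k i z) \<and> (\<forall>z. H k i z \<longrightarrow> p2 z = f i)" using enum_Dfun[of n] by (elim exE conjE)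
  define R where "R v i \<longleftrightarrow> (\<exists>z. v < p1 (stage H i z))" for v i
  define S where "S v i \<longleftrightarrow> (\<exists>z. p2 (stage H i z) \<le> v)" for v i
  have Hb: "BB (\<lambda>e. H (e a) (e b) (e c))" for a b c
    using PG_ren[where r = "\<lambda>v. if v = 0 then a else if v = 1 then b else c", OF H] by (intro BB_low) (simp add: numeral_eq_Suc)
  have hits: "BB (\<lambda>e. hits H (e 0) (e 1))"
    unfolding hits_def by (intro BB_Fbex BB_Fball BB_conj BB_not nFF Hb)
  have mid: "FF (\<lambda>e. p1 (e 2) + (p2 (e 2) - p1 (e 2)) div 2)"
  proof -
    have d: "FF (\<lambda>e. p2 (e 2) - p1 (e 2))"
    proof -
      have i: "y = x - x' \<longleftrightarrow> y + x' = x \<or> (x < x' \<and> y = 0)" for x x' y :: nat by auto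
      have "FF (\<lambda>e. p2 (e 2))" by (intro FF_p nFF)
      then show ?thesis by (rule FF_I) (simp, unfold i, intro nDD nFF FF_p)
    qed
    show ?thesis by (intro nFF FF_p FF_half d)
  qed
  have st: "GG (\<lambda>e. stage H (e 0) (e 1))"
  proof (rule GG_rec)
    show "GG (\<lambda>e. pr 0 (2 ^ e 0))"
      by (rule GG_comp[where f = "\<lambda>e a. pr 0 a"], rule Dfun_GG'[OF pow_Dfun]) (intro GG_FF FF_pr nFF)+
    show "GG (\<lambda>e. halve H (e 0) (e 1) (e 2))"
      unfolding halve_def by (intro GG_if hits GG_FF BB_DD nDD FF_pr mid FF_p nFF)
  qed simp_all
  then have st': "GG (\<lambda>e. stage H (e a) (e b))" for a b
    using SG_ren[where r = "\<lambda>v. if v = 0 then 0 else if v = 1 then Suc a else Suc b", OF st[unfolded GG_def]]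
    unfolding GG_def by (simp add: numeral_eq_Suc)
  have "SG NN (Suc n) (\<lambda>e. R (e 0) (e 1))" unfolding R_def
    by (rule SG_exI, rule SG_GG[where P = "\<lambda>e a. e (Suc 0) < p1 a", OF st']) (intro SG_DD nDD FF_p nFF)
  moreover have "SG NN (Suc n) (\<lambda>e. S (e 0) (e 1))" unfolding S_def
    by (rule SG_exI, rule SG_GG[where P = "\<lambda>e a. p2 a \<le> e (Suc 0)", OF st']) (intro SG_DD nDD FF_p nFF)
  moreover have "v + 1 < v'" if "R v i" "S v' i" for i v v'
    using that unfolding R_def S_def by (elim exE) (rule stage_gap)
  moreover have "\<not> S 0 i" for i
  proof
    assume "S 0 i"
    then obtain z where "p2 (stage H i z) = 0" unfolding S_def by auto
    then show False using stage_less[of H i z] by simp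
  qed
  moreover have "S (2 ^ i) i" for i unfolding S_def by (rule exI[of _ 0]) simp
  moreover have "\<exists>k. \<forall>i. k < i \<longrightarrow> R (f i) i \<or> S (f i) i" if f: "f \<in> Dfun n" for f
  proof -
    obtain k where k0: "\<forall>i. (\<exists>z. H k i z) \<and> (\<forall>z. H k i z \<longrightarrow> p2 z = f i)" using bspec[OF en f] ..
    have k: "\<exists>z. H k i z" "\<And>z. H k i z \<Longrightarrow> p2 z = f i" for i using spec[OF k0, of i] by simp_all
    have "R (f i) i \<or> S (f i) i" if i: "k < i" for i
    proof -
      let ?z = "LEAST z. H k i z"
      have z: "H k i ?z" using k(1) by (rule LeastI_ex)
      have "hits H i ?z" unfolding hits_def using i z not_less_Least by (intro exI[of _ k] conjI allI impI)
      from stage_avoid[OF this] show ?thesis unfolding k(2)[OF z] R_def S_def by (elim disjE) (rule disjI1, erule exI, rule disjI2, erule exI)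
    qed
    then show ?thesis by blast
  qed
  ultimately show ?thesis using pow_Dfun by (intro exI[of _ R] exI[of _ S] exI[of _ "\<lambda>i. 2 ^ i"] conjI allI impI ballI)
qed

section \<open>A model with a definable cut\<close>

lemma countable_Dfun: "countable (Dfun n)"
proof -
  let ?\<phi> = "\<lambda>f (e :: nat \<Rightarrow> nat). e 0 = (f (e (Suc 0)) :: nat)"
  have "?\<phi> ` Dfun n \<subseteq> {R. repr NN (sigma (Suc n)) R}"
    by (rule image_subsetI, rule CollectI, rule SG_PG_repr(1)[OF NN_simps(1)]) (simp add: Dfun_def)
  then have "countable (?\<phi> ` Dfun n)" by (rule countable_subset) (rule countable_repr, simp)
  moreover have "inj_on ?\<phi> (Dfun n)"
  proof (rule inj_onI, rule ext)
    fix f g :: "nat \<Rightarrow> nat" and i assume "?\<phi> f = ?\<phi> g"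
    from fun_cong[OF this, of "case_nat (f i) (\<lambda>_. i)"] show "f i = g i" by simp
  qed
  ultimately show ?thesis by (rule countable_image_inj_on)
qed

context std1 begin

lemma Dfun_upd: assumes "\<And>v. e v \<in> Dfun n" shows "GG (((\<lambda>v E. e v (E (Suc 0)))(x := (\<lambda>E. E 0))) v)"
proof (cases "v = x")
  case False then show ?thesis using Dfun_GG'[OF assms[of v], of "\<lambda>E. E (Suc 0)"] GG_FF[OF FF_var] by simp
qed (simp add: GG_FF[OF FF_var])

lemma BB_sat_upd: assumes "sigma n p \<or> pi n p" "\<And>v. e v \<in> Dfun n"
  shows "BB (\<lambda>E. sat NN ((\<lambda>v. e v (E (Suc 0)))(x := E 0)) p)"
proof -
  have "(\<lambda>v. ((\<lambda>v E. e v (E (Suc 0)))(x := (\<lambda>E. E 0))) v E) = (\<lambda>v. e v (E (Suc 0)))(x := E 0)" for E by auto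
  then show ?thesis using BB_sat[where G = "(\<lambda>v E. e v (E (Suc 0)))(x := (\<lambda>E. E 0))", OF assms(1) Dfun_upd[of e, OF assms(2)]] by (simp only:)
qed

lemma BB_sat_Dfun: assumes "sigma n p \<or> pi n p" "\<And>v. e v \<in> Dfun n"
  shows "BB (\<lambda>E. sat NN (\<lambda>v. e v (E (Suc 0))) p)"
  by (rule BB_sat[OF assms(1)]) (rule Dfun_GG'[OF assms(2) GG_FF[OF FF_var]])

lemma Dfun_Least: assumes "BB (\<lambda>E. P (E (Suc 0)) (E 0))" "\<And>i. \<exists>a. P i a" shows "(\<lambda>i. LEAST a. P i a) \<in> Dfun n"
  unfolding Dfun_GG by (rule GG_least[where P = "\<lambda>e a. P (e 0) a"]) (use assms in simp_all)

text \<open>The disjunct \<open>g i < a\<close> stops an unsuccessful search, which makes the least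
  number operator total.\<close>

lemma Dfun_bounded_least:
  assumes p: "sigma n p \<or> pi n p" and e: "\<And>v. e v \<in> Dfun n" and g: "g \<in> Dfun n"
  shows "\<exists>h\<in>Dfun n. \<forall>i\<in>UNIV. (\<exists>a. a \<le> g i \<and> sat NN ((\<lambda>v. e v i)(x := a)) p = b) \<longrightarrow>
     sat NN ((\<lambda>v. e v i)(x := h i)) p = b \<and> (\<forall>a. a < h i \<longrightarrow> sat NN ((\<lambda>v. e v i)(x := a)) p \<noteq> b)"
proof -
  let ?X = "\<lambda>i a. sat NN ((\<lambda>v. e v i)(x := a)) p"
  have X: "BB (\<lambda>E. ?X (E (Suc 0)) (E 0))" by (rule BB_sat_upd[OF p e])
  have "BB (\<lambda>E. ?X (E (Suc 0)) (E 0) = b)" using X BB_not[OF X] by (cases b) simp_all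
  moreover have "BB (\<lambda>E. g (E (Suc 0)) < E 0)"
    by (rule BB_GG[where P = "\<lambda>e a. a < e 0", OF Dfun_GG'[OF g GG_FF[OF FF_var]]]) (intro BB_DD nDD nFF)
  ultimately have "BB (\<lambda>E. g (E (Suc 0)) < E 0 \<or> ?X (E (Suc 0)) (E 0) = b)" by (intro BB_disj)
  then have h: "(\<lambda>i. LEAST a. g i < a \<or> ?X i a = b) \<in> Dfun n" by (rule Dfun_Least[where P = "\<lambda>i a. g i < a \<or> ?X i a = b"]) (rule exI, rule disjI1, rule lessI)
  have "?X i (LEAST a. g i < a \<or> ?X i a = b) = b \<and> (\<forall>a. a < (LEAST a. g i < a \<or> ?X i a = b) \<longrightarrow> ?X i a \<noteq> b)"
    if ex: "\<exists>a. a \<le> g i \<and> ?X i a = b" for i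
  proof -
    obtain a where a: "a \<le> g i" "?X i a = b" using ex by (elim exE conjE)
    let ?P = "\<lambda>a. g i < a \<or> ?X i a = b"
    have Pa: "?P a" using a(2) by (rule disjI2)
    have "\<not> g i < (LEAST a. ?P a)" using Least_le[of ?P a, OF Pa] a(1) by linarith
    then have "?X i (LEAST a. ?P a) = b" using LeastI[of ?P a, OF Pa] by (simp only: simp_thms)
    moreover have "?X i a' \<noteq> b" if "a' < (LEAST a. ?P a)" for a' using not_less_Least[OF that] by (simp only: simp_thms de_Morgan_disj)
    ultimately show ?thesis by (intro conjI allI impI)
  qed
  then show ?thesis using h by (intro bexI[OF _ h] ballI impI)
qed

text \<open>Where no witness exists the search stops at zero. This remains in \<open>Dfun n\<close>
  because solvability is itself assumed Delta_{n+1}.\<close>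

lemma Dfun_witness:
  assumes P: "BB (\<lambda>E. P (E (Suc 0)) (E 0))" and Q: "BB (\<lambda>E. \<exists>a. P (E (Suc 0)) a)"
  shows "\<exists>g\<in>Dfun n. \<forall>i\<in>UNIV. (\<exists>a. P i a) \<longrightarrow> (\<exists>a. a \<le> g i \<and> P i a)"
proof -
  have h: "(\<lambda>i. LEAST a. P i a \<or> \<not> (\<exists>a. P i a)) \<in> Dfun n"
  proof (rule Dfun_Least[where P = "\<lambda>i a. P i a \<or> \<not> (\<exists>a. P i a)"])
    show "BB (\<lambda>E. P (E (Suc 0)) (E 0) \<or> \<not> (\<exists>a. P (E (Suc 0)) a))" by (intro BB_disj BB_not P Q)
    show "\<exists>a. P i a \<or> \<not> (\<exists>a. P i a)" for i by (cases "\<exists>a. P i a") simp_all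
  qed
  have "\<exists>a. a \<le> (LEAST a. P i a \<or> \<not> (\<exists>a. P i a)) \<and> P i a" if "\<exists>a. P i a" for i
  proof (rule exI, rule conjI[OF order_refl])
    have "P i (LEAST a. P i a)" using that by (rule LeastI_ex)
    then show "P i (LEAST a. P i a \<or> \<not> (\<exists>a. P i a))" using that by simp
  qed
  then show ?thesis by (intro bexI[OF _ h] ballI impI)
qed

lemma Dfun_bound_ex:
  assumes p: "sigma n p" and n: "0 < n" and e: "\<And>v. e v \<in> Dfun n"
  shows "\<exists>g\<in>Dfun n. \<forall>i\<in>UNIV. (\<exists>a. sat NN ((\<lambda>v. e v i)(x := a)) p) \<longrightarrow> (\<exists>a. a \<le> g i \<and> sat NN ((\<lambda>v. e v i)(x := a)) p)"
proof (rule Dfun_witness)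
  show "BB (\<lambda>E. sat NN ((\<lambda>v. e v (E (Suc 0)))(x := E 0)) p)" using p e by (intro BB_sat_upd) auto
  \<comment> \<open>For n > 0 the quantifier is absorbed into level n, so solvability is
    Delta_{n+1}.\<close>
  have "sigma n (Ex x p)" using sigma_pi.intros(4) p n by (metis gr0_conv_Suc)
  then have "BB (\<lambda>E. sat NN (\<lambda>v. e v (E (Suc 0))) (Ex x p))" using e by (intro BB_sat_Dfun) auto
  then show "BB (\<lambda>E. \<exists>a. sat NN ((\<lambda>v. e v (E (Suc 0)))(x := a)) p)" by simp
qed

lemma Dfun_bound_all:
  assumes p: "pi n p" and n: "0 < n" and e: "\<And>v. e v \<in> Dfun n"
  shows "\<exists>g\<in>Dfun n. \<forall>i\<in>UNIV. (\<exists>a. \<not> sat NN ((\<lambda>v. e v i)(x := a)) p) \<longrightarrow> (\<exists>a. a \<le> g i \<and> \<not> sat NN ((\<lambda>v. e v i)(x := a)) p)"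
proof (rule Dfun_witness)
  show "BB (\<lambda>E. \<not> sat NN ((\<lambda>v. e v (E (Suc 0)))(x := E 0)) p)" using p e by (intro BB_not BB_sat_upd) auto
  have "pi n (Al x p)" using sigma_pi.intros(6) p n by (metis gr0_conv_Suc)
  then have "BB (\<lambda>E. \<not> sat NN (\<lambda>v. e v (E (Suc 0))) (Al x p))" using e by (intro BB_not BB_sat_Dfun) auto
  then show "BB (\<lambda>E. \<exists>a. \<not> sat NN ((\<lambda>v. e v (E (Suc 0)))(x := a)) p)" by simp
qed

lemma rup_NN:
  assumes u: "ultra U"
    and cl: "\<And>f g. f \<in> Dfun n \<Longrightarrow> g \<in> Dfun n \<Longrightarrow> cl f = cl g \<longleftrightarrow> {i. f i = g i} \<in> U" and surj: "cl ` Dfun n = UNIV"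
  shows "rup NN n (Dfun n) UNIV U UNIV cl"
proof -
  have 1: "UNIV \<in> U" by (rule ultra_D(5)[OF u])
  have 2: "(\<lambda>_. c) \<in> Dfun n" for c unfolding Dfun_GG by (intro GG_FF nFF)
  have 3: "(\<lambda>i. f i + g i) \<in> Dfun n" if "f \<in> Dfun n" "g \<in> Dfun n" for f g using that unfolding Dfun_GG by (rule GG_ad)
  have 4: "(\<lambda>i. f i * g i) \<in> Dfun n" if "f \<in> Dfun n" "g \<in> Dfun n" for f g using that unfolding Dfun_GG by (rule GG_mu)
  show ?thesis
    by (rule rup.intro; (unfold NN_simps)?; (fact 1 2 3 4 PAminus_NN u cl surj refl Dfun_bounded_least Dfun_bound_ex Dfun_bound_all | rule UNIV_I))
qed

end

section \<open>Exponentiation in an ultrapower that is not cofinal\<close>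

lemma fbound_exp: "fbound exp_matrix = 7"
  by (simp add: exp_matrix_def rem_is_def bmod_def)

lemma exp_vars:
  "e 0 = e' 0 \<Longrightarrow> e 7 = e' 7 \<Longrightarrow>
    sat M e (BEx 1 (V 7) (BEx 2 (V 7) (BEx 3 (V 7) exp_matrix))) = sat M e' (BEx 1 (V 7) (BEx 2 (V 7) (BEx 3 (V 7) exp_matrix)))"
  unfolding exp_matrix_def rem_is_def bmod_def by simp

text \<open>One bound for the power and its code turns the statement into a bounded formula; 7 is
  the first variable outside \<open>exp_matrix\<close>.\<close>

lemma exp_bounded:
  "\<exists>t. sat NN (e(7 := t)) (BEx 1 (V 7) (BEx 2 (V 7) (BEx 3 (V 7) exp_matrix)))"
proof -
  have "sat NN e exp_sentence" using Exp_NN unfolding Exp_def env_in_def by simp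
  then obtain y c d where s: "sat NN (e(0 := e 0, 1 := y, 2 := c, 3 := d)) exp_matrix"
    unfolding exp_sentence_def sat.simps NN_simps bex_UNIV ball_UNIV by blast
  let ?t = "Suc (y + c + d)"
  have m: "sat NN (e(7 := ?t, 1 := y, 2 := c, 3 := d)) exp_matrix"
    using s by (rule sat_cong[THEN iffD1, rotated]) (simp add: fbound_exp)
  show ?thesis
    by (rule exI[of _ ?t], unfold sat.simps NN_simps bex_UNIV,
        rule exI[of _ y], rule conjI, simp, rule exI[of _ c], rule conjI, simp, rule exI[of _ d], rule conjI, simp, rule m)
qed

text \<open>In the ultrapower of the standard model the class of the identity exceeds all standard
  numbers, so \<open>Exp_cofinal\<close> does not apply. Instead a bound function \<open>t\<close>
  in \<open>Fn\<close> makes exponentiation a bounded formula, to which Los applies at every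
  n.\<close>

lemma (in rup) Exp_N:
  assumes s: "\<And>f. f \<in> Fn \<Longrightarrow> \<exists>t\<in>Fn. \<forall>i. \<forall>e. e 0 = f i \<longrightarrow> e 7 = t i \<longrightarrow> sat M e (BEx 1 (V 7) (BEx 2 (V 7) (BEx 3 (V 7) exp_matrix)))"
  shows "Exp N"
  unfolding Exp_def
proof (intro allI impI)
  let ?q = "BEx 1 (V 7) (BEx 2 (V 7) (BEx 3 (V 7) exp_matrix))"
  have d: "delta0 ?q" unfolding exp_matrix_def rem_is_def by (intro delta0.intros)
  fix e
  have "\<exists>y c d. sat N (e(0 := X, 1 := y, 2 := c, 3 := d)) exp_matrix" for X
  proof -
    obtain e' where e': "\<forall>v. e' v \<in> Fn" "e = (\<lambda>v. cl (e' v))" using env_ex[of e] by (elim exE conjE)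
    obtain f where f: "f \<in> Fn" "cl f = X" using rp by blast
    obtain t where t: "t \<in> Fn" "\<forall>i. \<forall>e. e 0 = f i \<longrightarrow> e 7 = t i \<longrightarrow> sat M e ?q" using s[OF f(1)] by blast
    let ?E = "e'(0 := f, 7 := t)"
    have E: "\<forall>v. ?E v \<in> Fn" using e'(1) f(1) t(1) by simp
    have "{i. sat M (\<lambda>v. ?E v i) ?q} = UNIV" using t(2) by (simp del: sat.simps)
    then have "sat N (\<lambda>v. cl (?E v)) ?q" using los_delta0[OF d] E U_UNIV unfolding los_def by (simp del: sat.simps)
    moreover have "(\<lambda>v. cl (?E v)) = e(0 := X, 7 := cl t)" using e'(2) f(2) by auto
    ultimately obtain y c d where "sat N (e(0 := X, 7 := cl t, 1 := y, 2 := c, 3 := d)) exp_matrix" by auto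
    then have "sat N (e(0 := X, 1 := y, 2 := c, 3 := d)) exp_matrix"
      by (rule sat_cong[THEN iffD1, rotated]) (simp add: fbound_exp)
    then show ?thesis by blast
  qed
  then show "sat N e exp_sentence" unfolding exp_sentence_def sat.simps N_carr by blast
qed

lemma contract_NN: "SG NN (Suc n) R \<Longrightarrow> \<exists>P. PG NN n P \<and> (\<forall>e. R e \<longleftrightarrow> (\<exists>a. P (case_nat a e)))"
proof -
  interpret std n by (rule std)
  show "SG NN (Suc n) R \<Longrightarrow> ?thesis" by (rule contract_n)
qed

text \<open>The ultrafilter contains all final segments of the index set, so the finitely many
  indices that \<open>diagonal_cut\<close> leaves undecided for a function disappear. The relations
  R and S thus become complementary sets of classes.\<close>

lemma base_model:
  "\<exists>(M :: nat arith_struct) I p q e e'. model n M \<and> is_cut M I \<and> I \<noteq> UNIV \<and> sigma (Suc n) p \<and> sigma (Suc n) q \<and>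
     (\<forall>v. v \<in> I \<longleftrightarrow> sat M (e(2 := v)) p) \<and> (\<forall>v. v \<notin> I \<longleftrightarrow> sat M (e'(2 := v)) q)"
proof -
  interpret std1 n by (rule std1)
  obtain R S t where R: "SG NN (Suc n) (\<lambda>e. R (e 0) (e 1))" and S: "SG NN (Suc n) (\<lambda>e. S (e 0) (e 1))" and t: "t \<in> Dfun n"
     and gap': "\<forall>i v v'. R v i \<longrightarrow> S v' i \<longrightarrow> v + 1 < v'" and S0: "\<forall>i. \<not> S 0 i" and St: "\<forall>i. S (t i) i"
     and tot: "\<forall>f\<in>Dfun n. \<exists>k. \<forall>i. k < i \<longrightarrow> R (f i) i \<or> S (f i) i" using diagonal_cut[of n] by (elim exE conjE)
  have gap: "R v i \<Longrightarrow> S v' i \<Longrightarrow> v + 1 < v'" for i v v' using gap' by simp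
  have "\<exists>U :: nat set set. ultra U \<and> range (\<lambda>k. {k<..}) \<subseteq> U"
  proof (rule ultra_ex)
    fix G :: "nat set set" assume G: "finite G" "G \<subseteq> range (\<lambda>k. {k<..})"
    then obtain K where K: "finite K" "G = (\<lambda>k. {k<..}) ` K" using finite_subset_image[OF G] by blast
    have "k < Suc (Max (insert 0 K))" if "k \<in> K" for k using K(1) that by (simp add: less_Suc_eq_le)
    then have "Suc (Max (insert 0 K)) \<in> \<Inter>G" unfolding K(2) by simp
    then show "\<Inter>G \<noteq> {}" by blast
  qed
  then obtain U :: "nat set set" where u: "ultra U" and rU: "range (\<lambda>k. {k<..}) \<subseteq> U" by (elim exE conjE)
  have cof: "{k<..} \<in> U" for k using rU by blast
  have idD: "(\<lambda>i. i) \<in> Dfun n" and constD: "(\<lambda>i. c) \<in> Dfun n" for c unfolding Dfun_GG by (intro GG_FF nFF)+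
  note U = ultra_D[OF u]
  have "infinite (UNIV :: nat set)" by simp
  from class_numbering[OF u countable_Dfun[of n] constD this] obtain cl :: "(nat \<Rightarrow> nat) \<Rightarrow> nat" where
    cl: "\<forall>f\<in>Dfun n. \<forall>g\<in>Dfun n. cl f = cl g \<longleftrightarrow> {i. f i = g i} \<in> U" "cl ` Dfun n = UNIV"
    by (elim exE conjE)
  interpret X: rup NN n "Dfun n" UNIV U UNIV cl by (rule rup_NN) (use u cl in simp_all)
  let ?M = X.N
  have EM: "Exp ?M"
  proof (rule X.Exp_N)
    fix f assume f: "f \<in> Dfun n"
    let ?q = "BEx 1 (V 7) (BEx 2 (V 7) (BEx 3 (V 7) exp_matrix))"
    let ?e = "\<lambda>v :: nat. f"
    have d: "sigma n ?q \<or> pi n ?q"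
      unfolding exp_matrix_def rem_is_def by (intro disjI1 sigma_pi.intros(1) delta0.intros)
    have ex: "\<exists>a. sat NN ((\<lambda>v. f i)(7 := a)) ?q" for i by (rule exp_bounded)
    have B: "BB (\<lambda>E. sat NN ((\<lambda>v. f (E (Suc 0)))(7 := E 0)) ?q)" by (rule BB_sat_upd[where e = ?e and x = 7, OF d f])
    let ?t = "\<lambda>i. LEAST a. sat NN ((\<lambda>v. f i)(7 := a)) ?q"
    have t: "?t \<in> Dfun n" by (rule Dfun_Least[OF B ex])
    have "sat NN e ?q" if "e 0 = f i" "e 7 = ?t i" for e i
    proof -
      have "sat NN ((\<lambda>v. f i)(7 := ?t i)) ?q" using ex by (rule LeastI_ex)
      moreover have "sat NN ((\<lambda>v. f i)(7 := ?t i)) ?q = sat NN e ?q"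
        by (rule exp_vars) (use that in simp_all)
      ultimately show ?thesis by blast
    qed
    then show "\<exists>t\<in>Dfun n. \<forall>i e. e 0 = f i \<longrightarrow> e 7 = t i \<longrightarrow> sat NN e ?q" using t by (intro bexI[of _ ?t] allI impI)
  qed
  have M: "model n ?M" unfolding model_def using EM X.ISigma_N by simp
  have formula: "\<exists>P p e. pi n p \<and> BB (\<lambda>E. P (E 0) (E 1) (E 2)) \<and> (\<forall>v i. T v i \<longleftrightarrow> (\<exists>a. P a v i)) \<and>
      (\<forall>f\<in>Dfun n. \<forall>g\<in>Dfun n. sat ?M (e(2 := cl f, 0 := cl g)) p \<longleftrightarrow> {i. P (g i) (f i) i} \<in> U)"
    if T: "SG NN (Suc n) (\<lambda>e. T (e 0) (e 1))" for T
  proof -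
    have "\<exists>Q. PG NN n Q \<and> (\<forall>e. T (e 0) (e 1) \<longleftrightarrow> (\<exists>a. Q (case_nat a e)))"
      by (rule contract_NN[OF T])
    then obtain Q where Q: "PG NN n Q" and TQ: "\<forall>e. T (e 0) (e 1) \<longleftrightarrow> (\<exists>a. Q (case_nat a e))" by (elim exE conjE)
    obtain p c where p: "pi n p" and Qp': "\<forall>e. Q e = sat NN (mix e c) p"
      using SG_PG_repr(2)[OF NN_simps(1) Q] unfolding repr_def by (elim exE conjE)
    have Qp: "Q e = sat NN (mix e c) p" for e using Qp' ..
    \<comment> \<open>\<open>mix\<close> doubles positions: the witness a becomes formula variable 0
      and v becomes variable 2, the one named in the conclusion.\<close>
    let ?env = "\<lambda>a v i :: nat. case_nat a (case_nat v (\<lambda>_. i))"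
    let ?P = "\<lambda>a v i. Q (?env a v i)"
    let ?E = "\<lambda>w i. mix (?env 0 0 i) c w"
    have mixE: "mix (?env a v i) c = (\<lambda>w. ?E w i)(2 := v, 0 := a)" for a v i
      by (rule ext) (auto simp: mix_def split: nat.split elim!: evenE)
    have envD: "(\<lambda>i. ?env 0 0 i m) \<in> Dfun n" for m
    proof (cases m)
      case (Suc k) then show ?thesis using idD constD by (cases k) simp_all
    qed (simp add: constD)
    have ED: "?E w \<in> Dfun n" for w
      unfolding mix_def using envD constD by (cases "even w") simp_all
    have los: "X.los p" by (rule X.los_sigma_pi(2)[OF p])
    have "sat ?M ((\<lambda>w. cl (?E w))(2 := cl f, 0 := cl g)) p \<longleftrightarrow> {i. ?P (g i) (f i) i} \<in> U" if f: "f \<in> Dfun n" and g: "g \<in> Dfun n" for f g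
    proof -
      let ?E' = "?E(2 := f, 0 := g)"
      have "\<forall>v. ?E' v \<in> Dfun n" using ED f g by simp
      then have "sat ?M (\<lambda>v. cl (?E' v)) p \<longleftrightarrow> {i. sat NN (\<lambda>v. ?E' v i) p} \<in> U"
        by (rule mp[OF spec[OF los[unfolded X.los_def]]])
      moreover have "(\<lambda>v. cl (?E' v)) = (\<lambda>w. cl (?E w))(2 := cl f, 0 := cl g)" by auto
      moreover have "(\<lambda>v. ?E' v i) = mix (?env (g i) (f i) i) c" for i
        by (rule trans[OF _ mixE[symmetric]], rule ext) simp
      ultimately show ?thesis unfolding Qp by simp
    qed
    moreover have "BB (\<lambda>E. ?P (E 0) (E 1) (E 2))"
      using PG_ren[where r = "\<lambda>v. if v = 0 then 0 else if v = 1 then 1 else 2", OF Q]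
      by (intro BB_low) (rule PG_iff, assumption, rule arg_cong[where f = Q], auto split: nat.split)
    moreover have "T v i \<longleftrightarrow> (\<exists>a. ?P a v i)" for v i using spec[OF TQ, of "case_nat v (\<lambda>_. i)"] by simp
    ultimately show ?thesis using p by (intro exI[of _ ?P] exI[of _ p] exI[of _ "\<lambda>w. cl (?E w)"] conjI allI ballI)
  qed
  obtain P p e where p: "pi n p" and BP: "BB (\<lambda>E. P (E 0) (E 1) (E 2))" and RP: "\<forall>v i. R v i \<longleftrightarrow> (\<exists>a. P a v i)"
    and Pp: "\<forall>f\<in>Dfun n. \<forall>g\<in>Dfun n. sat ?M (e(2 := cl f, 0 := cl g)) p \<longleftrightarrow> {i. P (g i) (f i) i} \<in> U" 
    using formula[OF R] by (elim exE conjE)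
  obtain Q q e' where q: "pi n q" and BQ: "BB (\<lambda>E. Q (E 0) (E 1) (E 2))" and SQ: "\<forall>v i. S v i \<longleftrightarrow> (\<exists>a. Q a v i)"
    and Qq: "\<forall>f\<in>Dfun n. \<forall>g\<in>Dfun n. sat ?M (e'(2 := cl f, 0 := cl g)) q \<longleftrightarrow> {i. Q (g i) (f i) i} \<in> U" 
    using formula[OF S] by (elim exE conjE)
  define I where "I = {v. sat ?M (e(2 := v)) (Ex 0 p)}"
  define J where "J = {v. sat ?M (e'(2 := v)) (Ex 0 q)}"
  have I: "cl f \<in> I \<longleftrightarrow> (\<exists>g\<in>Dfun n. {i. P (g i) (f i) i} \<in> U)" if "f \<in> Dfun n" for f
    unfolding I_def mem_Collect_eq sat.simps X.N_carr bex_UNIV X.ex_cl(1) using Pp that by simp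
  have J: "cl f \<in> J \<longleftrightarrow> (\<exists>g\<in>Dfun n. {i. Q (g i) (f i) i} \<in> U)" if "f \<in> Dfun n" for f
    unfolding J_def mem_Collect_eq sat.simps X.N_carr bex_UNIV X.ex_cl(1) using Qq that by simp
  have IR: "{i. R (f i) i} \<in> U" if f: "f \<in> Dfun n" and v: "cl f \<in> I" for f
  proof -
    obtain g where g: "{i. P (g i) (f i) i} \<in> U" using v unfolding I[OF f] ..
    show ?thesis by (rule U(1)[OF g]) (auto simp: RP)
  qed
  have JS: "{i. S (f i) i} \<in> U" if f: "f \<in> Dfun n" and v: "cl f \<in> J" for f
  proof -
    obtain g where g: "{i. Q (g i) (f i) i} \<in> U" using v unfolding J[OF f] ..
    show ?thesis by (rule U(1)[OF g]) (auto simp: SQ)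
  qed
  have IJ: "cl f \<in> I \<or> cl f \<in> J" if f: "f \<in> Dfun n" for f
  proof -
    obtain k where k: "\<forall>i. k < i \<longrightarrow> R (f i) i \<or> S (f i) i" using bspec[OF tot f] ..
    \<comment> \<open>Truth of an existential formula in the ultrapower needs a witness function in
      \<open>Dfun n\<close>. One search looks for witnesses of R and S together, and the clause
      \<open>i \<le> k\<close> ends it at undecided indices.\<close>
    let ?W = "\<lambda>i a. P a (f i) i \<or> (Q a (f i) i \<or> i \<le> k)"
    let ?g = "\<lambda>i. LEAST a. ?W i a"
    have ex: "\<exists>a. ?W i a" for i
    proof (cases "k < i")
      case True
      then have "(\<exists>a. P a (f i) i) \<or> (\<exists>a. Q a (f i) i)" using k RP SQ by simp
      then show ?thesis by (elim disjE exE) (rule exI, erule disjI1, rule exI, rule disjI2, erule disjI1)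
    qed simp
    have fG: "GG (\<lambda>E. f (E (Suc 0)))" by (rule Dfun_GG'[OF f GG_FF[OF FF_var]])
    have sub: "BB (\<lambda>E. H (E 0) (f (E (Suc 0))) (E (Suc 0)))" if H: "BB (\<lambda>E. H (E 0) (E 1) (E 2))" for H
    proof (rule BB_GG[where P = "\<lambda>E a. H (E 0) a (E (Suc 0))", OF fG])
      show "BB (\<lambda>E. H (E (Suc 0)) (E 0) (E (Suc (Suc 0))))"
        using H SG_ren[where r = "\<lambda>v. if v = 0 then 1 else if v = 1 then 0 else v" and R = "\<lambda>E. H (E 0) (E 1) (E 2)"]
          PG_ren[where r = "\<lambda>v. if v = 0 then 1 else if v = 1 then 0 else v" and R = "\<lambda>E. H (E 0) (E 1) (E 2)"]
        unfolding BB_def by (simp add: numeral_eq_Suc)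
    qed
    have g: "?g \<in> Dfun n"
      by (rule Dfun_Least[where P = ?W, OF _ ex]) (intro BB_disj sub[OF BP] sub[OF BQ] BB_DD nDD nFF)
    have W: "?W i (?g i)" for i using ex by (rule LeastI_ex)
    have "{k<..} \<subseteq> {i. P (?g i) (f i) i} \<union> {i. Q (?g i) (f i) i}" 
    proof
      fix i assume "i \<in> {k<..}"
      then show "i \<in> {i. P (?g i) (f i) i} \<union> {i. Q (?g i) (f i) i}" using W[of i] by simp
    qed
    then have un: "{i. P (?g i) (f i) i} \<union> {i. Q (?g i) (f i) i} \<in> U" by (rule U(1)[OF cof])
    show ?thesis
    proof (cases "{i. P (?g i) (f i) i} \<in> U")
      case True then show ?thesis unfolding I[OF f] by (intro disjI1 bexI[OF _ g])
    next
      case False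
      then have "- {i. P (?g i) (f i) i} \<in> U" unfolding U(4) .
      from U(2)[OF this un] have "{i. Q (?g i) (f i) i} \<in> U" by (rule U(1)) auto
      then show ?thesis unfolding J[OF f] by (intro disjI2 bexI[OF _ g])
    qed
  qed
  have far: "{i. f i + 1 < g i} \<in> U" if "f \<in> Dfun n" "g \<in> Dfun n" "cl f \<in> I" "cl g \<in> J" for f g
    by (rule U(1)[OF U(2)[OF IR[OF that(1,3)] JS[OF that(2,4)]]]) (use gap in auto)
  have clash: "\<not> {i. Y i} \<in> U" if "\<And>i. \<not> Y i" for Y using that U(3) by simp
  have disj: "v \<notin> I \<or> v \<notin> J" for v
  proof (rule ccontr)
    assume a: "\<not> (v \<notin> I \<or> v \<notin> J)"
    obtain f where f: "f \<in> Dfun n" "v = cl f" using X.rp by metis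
    have "{i. f i + 1 < f i} \<in> U" using far[OF f(1) f(1)] a f(2) by simp
    then show False using U(3) by simp
  qed
  have comp: "v \<notin> I \<longleftrightarrow> v \<in> J" for v
  proof -
    obtain f where f: "f \<in> Dfun n" "v = cl f" using X.rp by metis
    show ?thesis using IJ[OF f(1)] disj[of v] f(2) by blast
  qed
  have "is_cut ?M I" unfolding is_cut_def X.N_carr
  proof (intro conjI ballI impI)
    have "cl (\<lambda>_. 0) \<notin> J" using JS[OF constD, of 0] clash[of "\<lambda>i. S 0 i"] S0 by blast
    then show "I \<noteq> {}" using comp by blast
  next
    fix a b assume a: "a \<in> I" and l: "ls ?M b a"
    obtain f where f: "f \<in> Dfun n" "a = cl f" using X.rp by metis
    obtain g where g: "g \<in> Dfun n" "b = cl g" using X.rp by metis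
    have l': "{i. g i < f i} \<in> U" using l X.N_op(3)[OF g(1) f(1)] f(2) g(2) by simp
    show "b \<in> I"
    proof (rule ccontr)
      assume "b \<notin> I"
      then have "cl g \<in> J" using comp g(2) by blast
      from U(2)[OF l' far[OF f(1) g(1) _ this]] have "{i. g i < f i \<and> f i + 1 < g i} \<in> U" using a f(2) by (simp add: Collect_conj_eq)
      then show False using clash[of "\<lambda>i. g i < f i \<and> f i + 1 < g i"] by simp
    qed
  next
    fix a assume a: "a \<in> I"
    obtain f where f: "f \<in> Dfun n" "a = cl f" using X.rp by metis
    have s: "(\<lambda>i. f i + 1) \<in> Dfun n" using X.F_ad[OF f(1) constD[of 1]] by simp
    have e: "ad ?M a (un ?M) = cl (\<lambda>i. f i + 1)" unfolding X.N_un f(2) using X.N_op(1)[OF f(1) constD[of 1]] by simp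
    show "ad ?M a (un ?M) \<in> I" unfolding e
    proof (rule ccontr)
      assume "cl (\<lambda>i. f i + 1) \<notin> I"
      then have "cl (\<lambda>i. f i + 1) \<in> J" using comp by blast
      from far[OF f(1) s _ this] have "{i. f i + 1 < f i + 1} \<in> U" using a f(2) by simp
      then show False using clash[of "\<lambda>i. f i + 1 < f i + 1"] by simp
    qed
  qed simp
  moreover have "cl t \<notin> I" 
  proof
    assume "cl t \<in> I"
    from IR[OF t this] have "{i. R (t i) i} \<in> U" .
    moreover have "\<not> R (t i) i" for i using gap[of "t i" i "t i"] St by auto
    ultimately show False using clash[of "\<lambda>i. R (t i) i"] by blast
  qed
  then have "I \<noteq> UNIV" by blast
  moreover have "sigma (Suc n) (Ex 0 p)" "sigma (Suc n) (Ex 0 q)" using p q by (auto intro: sigma_pi.intros)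
  moreover have "\<forall>v. v \<in> I \<longleftrightarrow> sat ?M (e(2 := v)) (Ex 0 p)" unfolding I_def by simp
  moreover have "\<forall>v. v \<notin> I \<longleftrightarrow> sat ?M (e'(2 := v)) (Ex 0 q)" unfolding comp unfolding J_def by simp
  ultimately show ?thesis using M
    by (intro exI[of _ ?M] exI[of _ I] exI[of _ "Ex 0 p"] exI[of _ "Ex 0 q"] exI[of _ e] exI[of _ e'] conjI)
qed

section \<open>Failure of collection\<close>

text \<open>In an extension \<open>p\<close> need not define a segment any more; passing to the
  downward closure (for \<open>up\<close>) or the upward closure forces monotonicity while staying
  Sigma_{n+1}. The two new variables lie beyond those of \<open>p\<close> and beyond 2.\<close>

lemma cone_formula:
  assumes p: "sigma (Suc n) p"
  shows "\<exists>A z. sigma (Suc n) A \<and> (\<forall>(M :: nat arith_struct) e j. carr M = UNIV \<longrightarrow>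
      sat M (e(z := j)) A = (\<exists>b. (if up then \<not> ls M b j else \<not> ls M j b) \<and> sat M (e(2 := b)) p))"
proof -
  let ?w = "fbound p + 3" and ?z = "fbound p + 4"
  let ?d = "if up then Nt (Ltf (V ?w) (V ?z)) else Nt (Ltf (V ?z) (V ?w))"
  have "delta0 ?d" by (simp add: delta0.intros)
  then obtain A where A: "sigma (Suc n) A" and sA: "\<forall>(M :: nat arith_struct) e. carr M \<noteq> {} \<longrightarrow>
           sat M e A = (\<exists>b\<in>carr M. sat M (e(?w := b)) ?d \<and> sat M (e(2 := b)) p)"
    using sigma_ex_conj[of n p ?d ?z ?w 2, where 'a = nat] p by (auto split: if_splits)
  have "sat M (e(?z := j)) A = (\<exists>b. (if up then \<not> ls M b j else \<not> ls M j b) \<and> sat M (e(2 := b)) p)"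
    if U: "carr M = UNIV" for M :: "nat arith_struct" and e j
  proof -
    have c: "sat M (e(?z := j, 2 := b)) p = sat M (e(2 := b)) p" for b by (rule sat_cong) simp
    show ?thesis using spec[OF spec[OF sA, of M], of "e(?z := j)"] unfolding U c by simp
  qed
  then show ?thesis using A by (intro exI[of _ A] exI[of _ ?z] conjI allI impI)
qed

text \<open>Every b witnesses S or T, and collection bounds these witnesses for all b below
  \<open>u\<close> by one \<open>v\<close>. Membership in S then means b < u with an S-witness below
  \<open>v\<close>, a Pi_n condition; it is inductive but fails at \<open>u\<close>, against Pi_n
  induction.\<close>

lemma not_BSigma:
  fixes N :: "nat arith_struct"
  assumes N: "model n N" and S: "SG N (Suc n) (\<lambda>e. S (e 0))" and T: "SG N (Suc n) (\<lambda>e. T (e 0))"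
    and part: "\<And>y. S y \<longleftrightarrow> \<not> T y" and S0: "S (zr N)" and SS: "\<And>y. S y \<Longrightarrow> S (ad N y (un N))"
    and down: "\<And>y y'. S y \<Longrightarrow> ls N y' y \<Longrightarrow> S y'" and u: "T u"
  shows "\<not> BSigma (Suc n) N"
proof
  assume B: "BSigma (Suc n) N"
  interpret isige N n by (rule model_isige[OF N])
  have UN: "carr N = UNIV" using N unfolding model_def by simp
  obtain P' where P': "PG N n P'" and SP: "\<forall>e. S (e 0) \<longleftrightarrow> (\<exists>a. P' (case_nat a e))" using contract_n[OF S] by (elim exE conjE)
  obtain Q' where Q': "PG N n Q'" and TQ: "\<forall>e. T (e 0) \<longleftrightarrow> (\<exists>a. Q' (case_nat a e))" using contract_n[OF T] by (elim exE conjE)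
  define P where "P b x \<longleftrightarrow> P' (case_nat x (\<lambda>_. b))" for b x
  define Q where "Q b x \<longleftrightarrow> Q' (case_nat x (\<lambda>_. b))" for b x
  have sP: "S b \<longleftrightarrow> (\<exists>x. P b x)" and tQ: "T b \<longleftrightarrow> (\<exists>x. Q b x)" for b
    using spec[OF SP, of "\<lambda>_. b"] spec[OF TQ, of "\<lambda>_. b"] unfolding P_def Q_def by simp_all
  have PP: "PG N n (\<lambda>e. P (e a) (e b))" and PQ: "PG N n (\<lambda>e. Q (e a) (e b))" for a b
    unfolding P_def Q_def by (rule PG_Fsub[OF P'], rule FF_case, rule FF_var, rule FF_var,
      rule PG_Fsub[OF Q'], rule FF_case, rule FF_var, rule FF_var)
  have "SG N (Suc n) (\<lambda>e. P (e 0) (e (Suc 0)) \<or> Q (e 0) (e (Suc 0)))" by (intro SG_disj SG_PG PP PQ)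
  from SG_PG_repr(1)[OF UN this] obtain r c where r: "sigma (Suc n) r"
    and W: "\<forall>e. (P (e 0) (e (Suc 0)) \<or> Q (e 0) (e (Suc 0))) = sat N (mix e c) r" unfolding repr_def by (elim exE conjE)
  let ?e = "mix (\<lambda>_. zr N) c"
  have eq: "?e(0 := b, 2 := x) = mix (\<lambda>v. if v = 0 then b else if v = Suc 0 then x else zr N) c" for b x
    by (rule ext) (auto simp: mix_def elim!: evenE)
  have W': "sat N (?e(0 := b, 2 := x)) r \<longleftrightarrow> P b x \<or> Q b x" for b x
    unfolding eq using spec[OF W, of "\<lambda>v. if v = 0 then b else if v = Suc 0 then x else zr N"] by simp
  have tot: "\<exists>x. P b x \<or> Q b x" for b using part[of b] sP[of b] tQ[of b] by blast
  have "\<exists>v. \<forall>b. ls N b u \<longrightarrow> (\<exists>x. ls N x v \<and> (P b x \<or> Q b x))"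
  proof -
    have "\<forall>b\<in>carr N. ls N b u \<longrightarrow> (\<exists>x\<in>carr N. sat N (?e(0 := b, 2 := x)) r)" unfolding W' UN using tot by blast
    moreover have "env_in N ?e" "u \<in> carr N" "0 \<noteq> (2 :: nat)" unfolding env_in_def UN by simp_all
    ultimately have "\<exists>v\<in>carr N. \<forall>b\<in>carr N. ls N b u \<longrightarrow> (\<exists>x\<in>carr N. ls N x v \<and> sat N (?e(0 := b, 2 := x)) r)"
      using B[unfolded BSigma_def, rule_format, of r 0 2 ?e u] r by blast
    then show ?thesis unfolding W' UN by simp
  qed
  then obtain v where v: "\<forall>b. ls N b u \<longrightarrow> (\<exists>x. ls N x v \<and> (P b x \<or> Q b x))" ..
  \<comment> \<open>An S-witness below \<open>v\<close> must exist for b in S, since a T-witness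
    would put b outside S.\<close>
  let ?Y = "\<lambda>b. ls N b u \<and> (\<exists>x. ls N x v \<and> P b x)"
  have SY: "?Y b" if s: "S b" for b
  proof -
    have l: "ls N b u"
    proof (rule ccontr)
      assume "\<not> ls N b u"
      then have "ls N u b \<or> u = b" by (simp add: A.not_less A.le_less)
      then have "S u" using s down by blast
      then show False using part u by blast
    qed
    obtain x where x: "ls N x v" "P b x \<or> Q b x" using v l by blast
    have "\<not> Q b x" using s part tQ by blast
    then show ?thesis using l x by blast
  qed
  have YS: "S b" if "?Y b" for b using that sP by blast
  have "PG N n (\<lambda>e. ?Y (e 0))"
    by (intro PG_conj PG_DD[OF DD_Fls] PG_bex PP FF_var FF_const)
  then have "?Y u" by (rule ind_PG) (rule SY[OF S0], rule SY[OF SS[OF YS]])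
  then show False by simp
qed

text \<open>The closures of the two definitions are read in the extension. Every element there is
  below some member of the cut or above some non-member, and elementarity decides S and T at those
  elements, so S and T still cover the model and stay disjoint.\<close>

lemma ex_not_BSigma: "\<exists>N :: nat arith_struct. ISigma n N \<and> Exp N \<and> WPHP (Suc n) N \<and> \<not> BSigma (Suc n) N"
proof -
  obtain M :: "nat arith_struct" and I p q e e' where M: "model n M" and cut: "is_cut M I" and ne: "I \<noteq> UNIV"
    and p: "sigma (Suc n) p" and q: "sigma (Suc n) q"
    and Ip: "\<forall>v. v \<in> I \<longleftrightarrow> sat M (e(2 := v)) p" and Iq: "\<forall>v. v \<notin> I \<longleftrightarrow> sat M (e'(2 := v)) q"
    using base_model[of n] by (elim exE conjE)
  obtain N :: "nat arith_struct" and h where g: "good_ext n (\<lambda>_. I) M N h" and W: "WPHP (Suc n) N" using main_nat[OF M, of "\<lambda>_. I", OF cut] by (elim exE conjE)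
  have N: "model n N" and el: "el (Suc n) M N h" 
    and gap: "\<forall>y. (\<exists>i\<in>I. ple N y (h i)) \<or> (\<exists>j. j \<notin> I \<and> ple N (h j) y)" using g unfolding good_ext_def by simp_all
  interpret MM: isige M n by (rule model_isige[OF M])
  interpret NN: isige N n by (rule model_isige[OF N])
  have UM: "carr M = UNIV" and UN: "carr N = UNIV" using M N unfolding model_def by simp_all
  obtain A z where A: "sigma (Suc n) A" and sA: "\<forall>(M :: nat arith_struct) e j. carr M = UNIV \<longrightarrow>
      sat M (e(z := j)) A = (\<exists>b. (if True then \<not> ls M b j else \<not> ls M j b) \<and> sat M (e(2 := b)) p)"
    using cone_formula[OF p, of True] by (elim exE conjE)
  obtain B y where B: "sigma (Suc n) B" and sB: "\<forall>(M :: nat arith_struct) e j. carr M = UNIV \<longrightarrow>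
      sat M (e(y := j)) B = (\<exists>b. (if False then \<not> ls M b j else \<not> ls M j b) \<and> sat M (e(2 := b)) q)"
    using cone_formula[OF q, of False] by (elim exE conjE)
  have A': "sat K (f(z := j)) A \<longleftrightarrow> (\<exists>b. \<not> ls K b j \<and> sat K (f(2 := b)) p)" if "carr K = UNIV" for K :: "nat arith_struct" and f j
    using sA that by simp
  have B': "sat K (f(y := j)) B \<longleftrightarrow> (\<exists>b. \<not> ls K j b \<and> sat K (f(2 := b)) q)" if "carr K = UNIV" for K :: "nat arith_struct" and f j
    using sB that by simp
  have down: "b \<in> I" if "a \<in> I" "ls M b a" for a b using cut that unfolding is_cut_def UM by blast
  define S where "S v \<longleftrightarrow> sat N ((\<lambda>w. h (e w))(z := v)) A" for v
  define T where "T v \<longleftrightarrow> sat N ((\<lambda>w. h (e' w))(y := v)) B" for v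
  have IA: "sat M (e(z := j)) A \<longleftrightarrow> j \<in> I" for j
  proof -
    have "(\<exists>b. \<not> ls M b j \<and> b \<in> I) \<longleftrightarrow> j \<in> I" using down MM.A.not_less MM.A.le_less by metis
    then show ?thesis unfolding A'[OF UM] using Ip by simp
  qed
  have IB: "sat M (e'(y := j)) B \<longleftrightarrow> j \<notin> I" for j
  proof -
    have "(\<exists>b. \<not> ls M j b \<and> b \<notin> I) \<longleftrightarrow> j \<notin> I" using down MM.A.not_less MM.A.le_less by metis
    then show ?thesis unfolding B'[OF UM] using Iq by simp
  qed
  have upd: "(\<lambda>w. h (f w))(x := h a) = (\<lambda>w. h ((f(x := a)) w))" for f :: "nat \<Rightarrow> nat" and x :: nat and a by auto
  have ele: "sigma (Suc n) r \<Longrightarrow> sat N (\<lambda>v. h (f v)) r = sat M f r" for r f using el unfolding el_def by blast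
  have SI: "S (h j) \<longleftrightarrow> j \<in> I" and TI: "T (h j) \<longleftrightarrow> j \<notin> I" for j
    unfolding S_def T_def upd ele[OF A] ele[OF B] IA IB by (rule refl)+
  have Sd: "S b" if "S a" "ple N b a" for a b
    using that unfolding S_def A'[OF UN] by (meson NN.A.less_le_trans)
  have Tu: "T b" if "T a" "ple N a b" for a b
    using that unfolding T_def B'[OF UN] by (meson NN.A.le_less_trans)
  have cov: "S v \<or> T v" for v using gap Sd Tu SI TI by meson
  have dis: "\<not> (S v \<and> T v)" for v using gap Sd Tu SI TI by meson
  have F: "NN.FF (((\<lambda>v f. h (g v))(x := (\<lambda>f. f 0))) w)" for g :: "nat \<Rightarrow> nat" and x w :: nat
    by (cases "w = x") (simp_all add: NN.FF_var NN.FF_const)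
  have env: "(\<lambda>w. ((\<lambda>v f. h (g v))(x := (\<lambda>f. f 0))) w f) = (\<lambda>w. h (g w))(x := f 0)" for f g :: "nat \<Rightarrow> nat" and x :: nat
    by auto
  have SGS: "SG N (Suc n) (\<lambda>f. S (f 0))" unfolding S_def
    using NN.sigma_fsub[where F = "(\<lambda>v f. h (e v))(z := (\<lambda>f. f 0))", OF A F] unfolding env .
  have SGT: "SG N (Suc n) (\<lambda>f. T (f 0))" unfolding T_def
    using NN.sigma_fsub[where F = "(\<lambda>v f. h (e' v))(y := (\<lambda>f. f 0))", OF B F] unfolding env .
  obtain j0 where j0: "j0 \<notin> I" using ne by blast
  obtain i0 where i0: "i0 \<in> I" using cut unfolding is_cut_def by blast
  have "\<not> BSigma (Suc n) N"
  proof (rule not_BSigma[OF N SGS SGT])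
    show "S v \<longleftrightarrow> \<not> T v" for v using cov[of v] dis[of v] by blast
    show "S (zr N)" using Sd[of "h i0" "zr N"] SI i0 by simp
    show "S b" if "S a" "ls N b a" for a b using Sd[OF that(1)] that(2) by (simp add: NN.A.less_imp_le)
    show "T (h j0)" using TI j0 by simp
    show "S (ad N v (un N))" if v: "S v" for v
    proof -
      obtain i where i: "i \<in> I" "ple N v (h i)" using gap v Tu TI dis by meson
      have "ad M i (un M) \<in> I" using cut i(1) unfolding is_cut_def by blast
      then have "S (ad N (h i) (un N))" using SI[of "ad M i (un M)"] el_ops[OF el] by simp
      then show ?thesis by (rule Sd) (rule NN.A.add_right_mono[OF i(2)])
    qed
  qed
  then show ?thesis using N W unfolding model_def by blast
qed

theorem theorem5p10:
  fixes n :: nat and M :: "'a arith_struct" and I :: "nat \<Rightarrow> 'a set"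
  assumes "countable (carr M)"
    and "ISigma n M" and "Exp M"
    and "\<forall>k. is_cut M (I k)"
  shows "(\<exists>(N :: nat arith_struct) h.
            ISigma n N \<and> Exp N \<and> WPHP (Suc n) N \<and>
            sigma_elementary (Suc n) M N h \<and> cofinal M N h \<and>
            (\<forall>k. supN N h (I k) = infN N h (carr M - I k)))
       \<and> (\<exists>N :: nat arith_struct.
            ISigma n N \<and> Exp N \<and> WPHP (Suc n) N \<and> \<not> BSigma (Suc n) N)"
  by (rule conjI[OF main_ext[OF assms] ex_not_BSigma])

end
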